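(* Let $s\in\widehat{\mathcal S}$ and let $\mathscr P$ be a projective sheaf on $\widehat{\mathcal G}$ such that the full subgraph $\widehat{\mathcal G}_{\operatorname{supp}\mathscr P\cup(\operatorname{supp}\mathscr P)s}$ satisfies the GKM-property. Then the sheaf $\vartheta^s\mathscr P$ is well defined (that is, $\vartheta^s_{on}\mathscr P$ is projective, so that $\vartheta^s_{out}$ may be applied to it), and $\vartheta^s\mathscr P$ is a projective sheaf on $\widehat{\mathcal G}$ with support contained in $\operatorname{supp}\mathscr P\cup(\operatorname{supp}\mathscr P)s$.
   Context: Affine setting. $R$ is an irreducible reduced finite root system in a finite-dimensional $\mathbb Q$-vector space $V$, with weight lattice $X=\{\lambda\in V:\langle\lambda,\alpha^\vee\rangle\in\mathbb Z\ \forall\alpha\in R\}$, positive roots $R^+$, simple roots $\Pi$, highest root $\tilde\alpha$. The affine Weyl group $\widehat{\mathcal W}$ is the group of transformations of $V^*$ generated by $s_{\alpha,n}(v)=v-(\langle\alpha,v\rangle-n)\alpha^\vee$ ($\alpha\in R,n\in\mathbb Z$). Affine roots: $\widehat R=R\times\mathbb Z\subset\widehat X:=X\oplus\mathbb Z\subset\widehat V:=V\oplus\mathbb Q$, with $s_{(\alpha,-n)}:=s_{\alpha,n}$; $\widehat R^+=\{(\alpha,n):n>0\}\cup\{(\alpha,0):\alpha\in R^+\}$; $\widehat\Pi=\{(\alpha,0):\alpha\in\Pi\}\cup\{(-\tilde\alpha,1)\}$; $\widehat{\mathcal S}=\{s_\gamma:\gamma\in\widehat\Pi\}$. $(\widehat{\mathcal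 W},\widehat{\mathcal S})$ is a Coxeter system with length $\ell$, Bruhat order $\le$, unit $e$. $\widehat{\mathcal W}$ acts linearly on $\widehat V$ by $s_\alpha(\beta)=\beta-\langle\{\beta\},\{\alpha\}^\vee\rangle\alpha$, where $\{(\lambda,n)\}=\lambda$. $\mathbb F$ is a field of characteristic $\neq2$, $\mathsf V=\widehat X\otimes_{\mathbb Z}\mathbb F$, $S$ is the symmetric algebra of $\mathsf V$, $\mathbb Z$-graded with $\mathsf V$ in degree $2$; $\bar\lambda:=\lambda\otimes1$ for $\lambda\in\widehat X$. The moment graph $\widehat{\mathcal G}$ has vertex poset $(\widehat{\mathcal W},\le)$ and an edge $x\to y$ labelled $\bar\alpha$ iff $x<y$ and $y=s_\alpha x$, $\alpha\in\widehat R^+$. If $E$ is an edge between $x$ and $y$ then $Es$ denotes the edge (same label) between $xs$ and $ys$. For $s\in\widehat{\mathcal S}$, $\widehat{\mathcal G}^s$ has vertices $\bar x=\{x,xs\}$ ($x\in\widehat{\mathcal W}$), order: $\bar x<\bar y$ iff $\bar x\ne\bar y$ and $u<v$ for some $u\in\bar x,v\in\bar y$; an edge $\bar x\to\bar y$ labelled $\bar\alpha$ iff $\bar x<\bar y$ and $s_\alpha\bar x=\bar y$, $\alpha\in\widehat R^+$; $\bar E:\bar x\to\bar y$ denotes the edge induced by $E:x\to y$. For a set $\Omega$ of vertices, the full subgraph has vertex set $\Omega$ and all edges between elements of $\Omega$. GKM-property: labels of any two distinct edges with a common vertex are not proportional over $\mathbb F$. Sheaves. Graded means $\mathbb Z$-graded;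 homomorphisms of graded modules have degree $0$; $M\langle n\rangle_i=M_{i+n}$. $\mathcal C$ is the category of finitely generated graded $S$-modules; its free objects are the finite sums $\bigoplus S\langle r_i\rangle$. A sheaf $\mathscr M$ on a moment graph consists of graded $S$-modules $\mathscr M^x$ (vertices $x$), graded $S$-modules $\mathscr M^E$ with $l(E)\mathscr M^E=0$ (edges $E$ with label $l(E)$), and homomorphisms of graded $S$-modules $\rho_{x,E}:\mathscr M^x\to\mathscr M^E$ for $x$ on $E$. $\operatorname{supp}\mathscr M=\{x:\mathscr M^x\ne0\}$. For a set $\mathcal I$ of vertices, $\Gamma(\mathcal I,\mathscr M)=\{m\in\prod_{x\in\mathcal I}\mathscr M^x:\rho_{x,E}(m_x)=\rho_{y,E}(m_y)$ for all edges $E$ joining $x,y\in\mathcal I\}$, and $\Gamma(\mathscr M)$ is the case of all vertices. A set $U$ of vertices is open if $x\in U,y\ge x$ imply $y\in U$. $\mathscr P$ is projective if: (P1) $\operatorname{supp}\mathscr P$ is finite; (P2) each $\mathscr P^x$ is a free object of $\mathcal C$; (P3) for each edge $E:x\to y$ with label $\alpha$, $\rho_{y,E}$ is surjective with kernel $\alpha\mathscr P^y$; (P4) every element of every $\mathscr P^x$ is the value at $x$ of some global section, and $\Gamma(\mathcal I,\mathscr P)\to\Gamma(\mathcal I',\mathscr P)$ is surjective for all open $\mathcal I'\subset\mathcal I$. Functors. For a projective sheaf $\mathscr P$ on $\widehat{\mathcal G}$, $\mathscr N=\vartheta^s_{on}\mathscr P$ is the sheaf on $\widehat{\mathcal G}^s$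 with $\mathscr N^{\bar x}=\Gamma(\{x,xs\},\mathscr P)$; for an edge $\bar E:\bar x\to\bar y$ induced by $E:x\to y$, $\mathscr N^{\bar E}$ is the image of $\mathscr N^{\bar y}$ under $\rho_{y,E}\oplus\rho_{ys,Es}:\mathscr P^y\oplus\mathscr P^{ys}\to\mathscr P^E\oplus\mathscr P^{Es}$, and $\rho_{\bar y,\bar E}$, $\rho_{\bar x,\bar E}$ are the restrictions of $\rho_{y,E}\oplus\rho_{ys,Es}$ and $\rho_{x,E}\oplus\rho_{xs,Es}$ (the latter also has image $\mathscr N^{\bar E}$). For a projective sheaf $\mathscr Q$ on $\widehat{\mathcal G}^s$, $\mathscr M=\vartheta^s_{out}\mathscr Q$ is the sheaf on $\widehat{\mathcal G}$ with $\mathscr M^x=\mathscr Q^{\bar x}$; if $E$ joins $x$ and $xs$, $\mathscr M^E=\mathscr Q^{\bar x}/l(E)\mathscr Q^{\bar x}$ with $\rho_{x,E},\rho_{xs,E}$ the natural projections; otherwise, if $E$ joins $x,y$, $\mathscr M^E=\mathscr Q^{\bar E}$, $\rho_{x,E}=\rho_{\bar x,\bar E}$, $\rho_{y,E}=\rho_{\bar y,\bar E}$. $\vartheta^s:=\vartheta^s_{out}\circ\vartheta^s_{on}$, applicable to projective $\mathscr P$ such that $\vartheta^s_{on}\mathscr P$ is projective. *)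

theory Defs
  imports Complex_Main "HOL-Algebra.Bij" "HOL-Algebra.Generated_Groups"
    "HOL-Algebra.QuotRing" "HOL-Algebra.Module"
    "HOL-Library.Poly_Mapping" "HOL-Library.Product_Plus"
begin

section \<open>Graded modules over a graded ring\<close>

record 'a graded_ring = "'a ring" +
  rgrade :: "int \<Rightarrow> 'a set"

record ('a, 'b) gmodule = "('a, 'b) module" +
  grade :: "int \<Rightarrow> 'b set"

definition graded_module :: "('a, 'c) graded_ring_scheme \<Rightarrow> ('a, 'b, 'd) gmodule_scheme \<Rightarrow> bool" where
  "graded_module R M \<longleftrightarrow>
     module R M \<and>
     (\<forall>i. additive_subgroup (grade M i) M) \<and>
     (\<forall>m\<in>carrier M. \<exists>!c. (\<forall>i. c i \<in> grade M i) \<and> finite {i. c i \<noteq> \<zero>\<^bsub>M\<^esub>} \<and>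
        m = finsum M c {i. c i \<noteq> \<zero>\<^bsub>M\<^esub>}) \<and>
     (\<forall>i j. \<forall>a\<in>rgrade R i. \<forall>m\<in>grade M j. a \<odot>\<^bsub>M\<^esub> m \<in> grade M (i + j))"

definition graded_hom ::
  "('a, 'c) graded_ring_scheme \<Rightarrow> ('a, 'm, 'd) gmodule_scheme \<Rightarrow> ('a, 'n, 'e) gmodule_scheme \<Rightarrow> ('m \<Rightarrow> 'n) set"
where
  "graded_hom R M N = {f \<in> carrier M \<rightarrow> carrier N.
     (\<forall>x\<in>carrier M. \<forall>y\<in>carrier M. f (x \<oplus>\<^bsub>M\<^esub> y) = f x \<oplus>\<^bsub>N\<^esub> f y) \<and>
     (\<forall>a\<in>carrier R. \<forall>x\<in>carrier M. f (a \<odot>\<^bsub>M\<^esub> x) = a \<odot>\<^bsub>N\<^esub> f x) \<and>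
     (\<forall>i. f ` grade M i \<subseteq> grade N i)}"

definition graded_iso ::
  "('a, 'c) graded_ring_scheme \<Rightarrow> ('a, 'm, 'd) gmodule_scheme \<Rightarrow> ('a, 'n, 'e) gmodule_scheme \<Rightarrow> bool"
where
  "graded_iso R M N \<longleftrightarrow> (\<exists>f\<in>graded_hom R M N. bij_betw f (carrier M) (carrier N))"

text \<open>The fields \<open>mult\<close> and \<open>one\<close> that a module record inherits from rings carry no meaning and are left unspecified.\<close>

definition regular_gmodule :: "('a, 'c) graded_ring_scheme \<Rightarrow> ('a, 'a) gmodule" where
  "regular_gmodule R = \<lparr>carrier = carrier R, mult = undefined, one = undefined,
     zero = \<zero>\<^bsub>R\<^esub>, add = add R, smult = mult R, grade = rgrade R\<rparr>"

definition gshift :: "int \<Rightarrow> ('a, 'b) gmodule \<Rightarrow> ('a, 'b) gmodule" where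
  "gshift n M = M\<lparr>grade := (\<lambda>i. grade M (i + n))\<rparr>"

text \<open>The direct sum of finitely many graded modules; only used for finite \<open>I\<close>.\<close>

definition gsum :: "'i set \<Rightarrow> ('i \<Rightarrow> ('a, 'b) gmodule) \<Rightarrow> ('a, 'i \<Rightarrow> 'b) gmodule" where
  "gsum I N = \<lparr>carrier = (\<Pi>\<^sub>E i\<in>I. carrier (N i)), mult = undefined, one = undefined,
     zero = (\<lambda>i\<in>I. \<zero>\<^bsub>N i\<^esub>),
     add = (\<lambda>f g. \<lambda>i\<in>I. f i \<oplus>\<^bsub>N i\<^esub> g i),
     smult = (\<lambda>a f. \<lambda>i\<in>I. a \<odot>\<^bsub>N i\<^esub> f i),
     grade = (\<lambda>d. \<Pi>\<^sub>E i\<in>I. grade (N i) d)\<rparr>"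

definition graded_free :: "('a, 'c) graded_ring_scheme \<Rightarrow> ('a, 'b) gmodule \<Rightarrow> bool" where
  "graded_free R M \<longleftrightarrow>
     (\<exists>rs. graded_iso R M (gsum {..<length rs} (\<lambda>i. gshift (rs ! i) (regular_gmodule R))))"

definition gsubmodule :: "('a, 'b) gmodule \<Rightarrow> 'b set \<Rightarrow> ('a, 'b) gmodule" where
  "gsubmodule M C = M\<lparr>carrier := C, grade := (\<lambda>i. grade M i \<inter> C)\<rparr>"

definition quot_module :: "('a, 'b, 'c) module_scheme \<Rightarrow> 'b set \<Rightarrow> ('a, 'b set) module" where
  "quot_module M N = \<lparr>carrier = a_rcosets\<^bsub>M\<^esub> N, mult = undefined, one = undefined,
     zero = N, add = set_add M, smult = (\<lambda>a A. \<Union>m\<in>A. N +>\<^bsub>M\<^esub> (a \<odot>\<^bsub>M\<^esub> m))\<rparr>"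

definition quot_gmodule :: "('a, 'b) gmodule \<Rightarrow> 'b set \<Rightarrow> ('a, 'b set) gmodule" where
  "quot_gmodule M N = module.extend (quot_module M N)
     (gmodule.fields (\<lambda>i. (\<lambda>m. N +>\<^bsub>M\<^esub> m) ` grade M i))"

text \<open>Transport of structure along an injection.\<close>

definition transport_gmodule :: "('b \<Rightarrow> 'c) \<Rightarrow> ('a, 'b) gmodule \<Rightarrow> ('a, 'c) gmodule" where
  "transport_gmodule f M = \<lparr>carrier = f ` carrier M, mult = undefined, one = undefined,
     zero = f \<zero>\<^bsub>M\<^esub>,
     add = (\<lambda>x y. f (the_inv f x \<oplus>\<^bsub>M\<^esub> the_inv f y)),
     smult = (\<lambda>a x. f (a \<odot>\<^bsub>M\<^esub> the_inv f x)),
     grade = (\<lambda>i. f ` grade M i)\<rparr>"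


section \<open>Base change of a lattice and symmetric algebras\<close>

text \<open>
  For a subgroup \<open>X\<close> of an abelian group, the vector space \<open>X \<otimes> F\<close> is presented as the free
  \<open>F\<close>-vector space on the symbols \<open>\<lambda> \<otimes> 1\<close> modulo the relations
  \<open>(\<lambda> + \<mu>) \<otimes> 1 = \<lambda> \<otimes> 1 + \<mu> \<otimes> 1\<close>.
\<close>

definition fscale :: "'f::field \<Rightarrow> ('x, 'f) poly_mapping \<Rightarrow> ('x, 'f) poly_mapping" where
  "fscale c = Poly_Mapping.map ((*) c)"

definition free_vector_space :: "'x set \<Rightarrow> ('f::field, ('x, 'f) poly_mapping) module" where
  "free_vector_space X = \<lparr>carrier = {p. Poly_Mapping.keys p \<subseteq> X}, mult = undefined, one = undefined,
     zero = 0, add = (+), smult = fscale\<rparr>"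

definition additivity_relations :: "'x::ab_group_add set \<Rightarrow> ('x, 'f::field) poly_mapping set" where
  "additivity_relations X = Modules.module.span fscale
     {Poly_Mapping.single (x + y) 1 - Poly_Mapping.single x 1 - Poly_Mapping.single y 1 | x y.
        x \<in> X \<and> y \<in> X}"

definition base_change :: "'x::ab_group_add set \<Rightarrow> ('f::field, ('x, 'f) poly_mapping set) module" where
  "base_change X = quot_module (free_vector_space X) (additivity_relations X)"

definition base_change_of :: "'x::ab_group_add set \<Rightarrow> 'x \<Rightarrow> ('x, 'f::field) poly_mapping set" where
  "base_change_of X x =
     additivity_relations X +>\<^bsub>free_vector_space X :: ('f, ('x, 'f) poly_mapping) module\<^esub>
       Poly_Mapping.single x 1"

definition proportional :: "('f::field, 'l) module \<Rightarrow> 'l \<Rightarrow> 'l \<Rightarrow> bool" where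
  "proportional V u v \<longleftrightarrow> (\<exists>a b. (a, b) \<noteq> (0, 0) \<and> a \<odot>\<^bsub>V\<^esub> u = b \<odot>\<^bsub>V\<^esub> v)"

text \<open>
  The symmetric algebra of a vector space \<open>V\<close>: polynomials in variables indexed by the elements
  of \<open>V\<close>, modulo the relations making the map from \<open>V\<close> to the variables linear.
\<close>

type_synonym ('l, 'f) polys = "(('l, nat) poly_mapping, 'f) poly_mapping"

definition poly_var :: "'l \<Rightarrow> ('l, 'f::field) polys" where
  "poly_var v = Poly_Mapping.single (Poly_Mapping.single v 1) 1"

definition poly_const :: "'f::field \<Rightarrow> ('l, 'f) polys" where
  "poly_const c = Poly_Mapping.single 0 c"

definition total_degree :: "('l, nat) poly_mapping \<Rightarrow> nat" where
  "total_degree m = (\<Sum>v\<in>Poly_Mapping.keys m. Poly_Mapping.lookup m v)"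

definition poly_ring :: "'l set \<Rightarrow> ('l, 'f::field) polys ring" where
  "poly_ring A = \<lparr>carrier = {p. \<forall>m\<in>Poly_Mapping.keys p. Poly_Mapping.keys m \<subseteq> A},
     mult = (*), one = 1, zero = 0, add = (+)\<rparr>"

definition sym_ideal :: "('f::field, 'l) module \<Rightarrow> ('l, 'f) polys set" where
  "sym_ideal V = Idl\<^bsub>poly_ring (carrier V)\<^esub>
     ({poly_var (u \<oplus>\<^bsub>V\<^esub> v) - poly_var u - poly_var v | u v. u \<in> carrier V \<and> v \<in> carrier V} \<union>
      {poly_var (c \<odot>\<^bsub>V\<^esub> v) - poly_const c * poly_var v | c v. v \<in> carrier V})"

definition sym_class :: "('f::field, 'l) module \<Rightarrow> ('l, 'f) polys \<Rightarrow> ('l, 'f) polys set" where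
  "sym_class V p = sym_ideal V +>\<^bsub>poly_ring (carrier V) :: ('l, 'f) polys ring\<^esub> p"

definition Sym :: "('f::field, 'l) module \<Rightarrow> ('l, 'f) polys set graded_ring" where
  "Sym V = ring.extend (poly_ring (carrier V) Quot sym_ideal V)
     (graded_ring.fields (\<lambda>i. sym_class V `
        {p \<in> carrier (poly_ring (carrier V)). \<forall>m\<in>Poly_Mapping.keys p. 2 * int (total_degree m) = i}))"

definition sym_of :: "('f::field, 'l) module \<Rightarrow> 'l \<Rightarrow> ('l, 'f) polys set" where
  "sym_of V v = sym_class V (poly_var v)"


section \<open>Moment graphs and sheaves on them\<close>

record ('v, 'e, 'l) moment_graph =
  verts :: "'v set"
  less :: "'v \<Rightarrow> 'v \<Rightarrow> bool"
  edges :: "'e set"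
  ends :: "'e \<Rightarrow> 'v set"
  label :: "'e \<Rightarrow> 'l"

definition joins :: "('v, 'e, 'l) moment_graph \<Rightarrow> 'e \<Rightarrow> 'v \<Rightarrow> 'v \<Rightarrow> bool" where
  "joins G E x y \<longleftrightarrow> E \<in> edges G \<and> ends G E = {x, y}"

definition directed_edge :: "('v, 'e, 'l) moment_graph \<Rightarrow> 'e \<Rightarrow> 'v \<Rightarrow> 'v \<Rightarrow> bool" where
  "directed_edge G E x y \<longleftrightarrow> joins G E x y \<and> less G x y"

definition full_subgraph :: "('v, 'e, 'l) moment_graph \<Rightarrow> 'v set \<Rightarrow> ('v, 'e, 'l) moment_graph" where
  "full_subgraph G \<Omega> = G\<lparr>verts := \<Omega>, edges := {E \<in> edges G. ends G E \<subseteq> \<Omega>}\<rparr>"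

definition GKM :: "('f::field, 'l) module \<Rightarrow> ('v, 'e, 'l) moment_graph \<Rightarrow> bool" where
  "GKM V G \<longleftrightarrow> (\<forall>E\<in>edges G. \<forall>F\<in>edges G. E \<noteq> F \<and> ends G E \<inter> ends G F \<noteq> {} \<longrightarrow>
     \<not> proportional V (label G E) (label G F))"

definition open_verts :: "('v, 'e, 'l) moment_graph \<Rightarrow> 'v set \<Rightarrow> bool" where
  "open_verts G U \<longleftrightarrow> U \<subseteq> verts G \<and> (\<forall>x\<in>U. \<forall>y\<in>verts G. less G x y \<longrightarrow> y \<in> U)"

record ('v, 'e, 's, 'm, 'n) msheaf =
  vstalk :: "'v \<Rightarrow> ('s, 'm) gmodule"
  estalk :: "'e \<Rightarrow> ('s, 'n) gmodule"
  rho :: "'v \<Rightarrow> 'e \<Rightarrow> 'm \<Rightarrow> 'n"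

definition is_sheaf ::
  "('f::field, 'l) module \<Rightarrow> ('v, 'e, 'l) moment_graph \<Rightarrow> ('v, 'e, ('l, 'f) polys set, 'm, 'n) msheaf \<Rightarrow> bool"
where
  "is_sheaf V G M \<longleftrightarrow>
     (\<forall>x\<in>verts G. graded_module (Sym V) (vstalk M x)) \<and>
     (\<forall>E\<in>edges G. graded_module (Sym V) (estalk M E) \<and>
        (\<forall>m\<in>carrier (estalk M E). sym_of V (label G E) \<odot>\<^bsub>estalk M E\<^esub> m = \<zero>\<^bsub>estalk M E\<^esub>)) \<and>
     (\<forall>E\<in>edges G. \<forall>x\<in>ends G E. rho M x E \<in> graded_hom (Sym V) (vstalk M x) (estalk M E))"

definition msupp :: "('v, 'e, 'l) moment_graph \<Rightarrow> ('v, 'e, 's, 'm, 'n) msheaf \<Rightarrow> 'v set" where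
  "msupp G M = {x \<in> verts G. carrier (vstalk M x) \<noteq> {\<zero>\<^bsub>vstalk M x\<^esub>}}"

definition sections ::
  "('v, 'e, 'l) moment_graph \<Rightarrow> 'v set \<Rightarrow> ('v, 'e, 's, 'm, 'n) msheaf \<Rightarrow> ('v \<Rightarrow> 'm) set" where
  "sections G I M = {m \<in> (\<Pi>\<^sub>E x\<in>I. carrier (vstalk M x)).
     \<forall>E. \<forall>x\<in>I. \<forall>y\<in>I. joins G E x y \<longrightarrow> rho M x E (m x) = rho M y E (m y)}"

definition smult_image :: "('f::field, 'l) module \<Rightarrow> 'l \<Rightarrow> (('l, 'f) polys set, 'm) gmodule \<Rightarrow> 'm set" where
  "smult_image V v M = (\<lambda>m. sym_of V v \<odot>\<^bsub>M\<^esub> m) ` carrier M"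

definition projective_sheaf ::
  "('f::field, 'l) module \<Rightarrow> ('v, 'e, 'l) moment_graph \<Rightarrow> ('v, 'e, ('l, 'f) polys set, 'm, 'n) msheaf \<Rightarrow> bool"
where
  "projective_sheaf V G P \<longleftrightarrow>
     is_sheaf V G P \<and>
     finite (msupp G P) \<and>
     (\<forall>x\<in>verts G. graded_free (Sym V) (vstalk P x)) \<and>
     (\<forall>E x y. directed_edge G E x y \<longrightarrow>
        rho P y E ` carrier (vstalk P y) = carrier (estalk P E) \<and>
        a_kernel (vstalk P y) (estalk P E) (rho P y E) = smult_image V (label G E) (vstalk P y)) \<and>
     (\<forall>x\<in>verts G. \<forall>p\<in>carrier (vstalk P x). \<exists>m\<in>sections G (verts G) P. m x = p) \<and>
     (\<forall>I I'. open_verts G I \<and> open_verts G I' \<and> I' \<subseteq> I \<longrightarrow>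
        (\<lambda>m. restrict m I') ` sections G I P = sections G I' P)"


section \<open>Word length and Bruhat order\<close>

definition word_length :: "('w, 'x) monoid_scheme \<Rightarrow> 'w set \<Rightarrow> 'w \<Rightarrow> nat" where
  "word_length W S w =
     (LEAST n. \<exists>ws. set ws \<subseteq> S \<and> length ws = n \<and> foldr (\<lambda>a b. a \<otimes>\<^bsub>W\<^esub> b) ws \<one>\<^bsub>W\<^esub> = w)"

definition bruhat_step :: "('w, 'x) monoid_scheme \<Rightarrow> 'w set \<Rightarrow> 'w \<Rightarrow> 'w \<Rightarrow> bool" where
  "bruhat_step W S x y \<longleftrightarrow> x \<in> carrier W \<and>
     (\<exists>w\<in>carrier W. \<exists>s\<in>S. y = (w \<otimes>\<^bsub>W\<^esub> s \<otimes>\<^bsub>W\<^esub> inv\<^bsub>W\<^esub> w) \<otimes>\<^bsub>W\<^esub> x) \<and>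
     word_length W S x < word_length W S y"

definition bruhat_less :: "('w, 'x) monoid_scheme \<Rightarrow> 'w set \<Rightarrow> 'w \<Rightarrow> 'w \<Rightarrow> bool" where
  "bruhat_less W S = (bruhat_step W S)\<^sup>+\<^sup>+"


section \<open>Root systems and the affine Weyl group\<close>

text \<open>
  \<open>coroot \<Delta> \<alpha> \<lambda>\<close> is the pairing of \<open>\<lambda>\<close> with the coroot of \<open>\<alpha>\<close>. The axioms below determine it for
  \<open>\<alpha>\<close> in \<open>roots \<Delta>\<close>; no other values are used.
\<close>

record 'v root_data =
  qscale :: "rat \<Rightarrow> 'v \<Rightarrow> 'v"
  roots :: "'v set"
  coroot :: "'v \<Rightarrow> 'v \<Rightarrow> rat"
  simples :: "'v set"

definition vdual :: "'v::ab_group_add root_data \<Rightarrow> ('v \<Rightarrow> rat) set" where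
  "vdual \<Delta> = {f. Vector_Spaces.linear (qscale \<Delta>) (*) f}"

definition root_system :: "'v::ab_group_add root_data \<Rightarrow> bool" where
  "root_system \<Delta> \<longleftrightarrow>
     vector_space (qscale \<Delta>) \<and>
     finite (roots \<Delta>) \<and> 0 \<notin> roots \<Delta> \<and>
     Modules.module.span (qscale \<Delta>) (roots \<Delta>) = UNIV \<and>
     (\<forall>\<alpha>\<in>roots \<Delta>. coroot \<Delta> \<alpha> \<in> vdual \<Delta> \<and> coroot \<Delta> \<alpha> \<alpha> = 2 \<and>
        (\<forall>\<beta>\<in>roots \<Delta>. coroot \<Delta> \<alpha> \<beta> \<in> \<int> \<and> \<beta> - qscale \<Delta> (coroot \<Delta> \<alpha> \<beta>) \<alpha> \<in> roots \<Delta>))"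

definition reduced_roots :: "'v::ab_group_add root_data \<Rightarrow> bool" where
  "reduced_roots \<Delta> \<longleftrightarrow>
     (\<forall>\<alpha>\<in>roots \<Delta>. \<forall>c. qscale \<Delta> c \<alpha> \<in> roots \<Delta> \<longrightarrow> c = 1 \<or> c = -1)"

definition irreducible_roots :: "'v::ab_group_add root_data \<Rightarrow> bool" where
  "irreducible_roots \<Delta> \<longleftrightarrow> roots \<Delta> \<noteq> {} \<and>
     \<not> (\<exists>A B. A \<noteq> {} \<and> B \<noteq> {} \<and> A \<inter> B = {} \<and> A \<union> B = roots \<Delta> \<and>
          (\<forall>\<alpha>\<in>A. \<forall>\<beta>\<in>B. coroot \<Delta> \<beta> \<alpha> = 0 \<and> coroot \<Delta> \<alpha> \<beta> = 0))"

definition simple_cone :: "'v::ab_group_add root_data \<Rightarrow> 'v set" where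
  "simple_cone \<Delta> = {\<Sum>\<alpha>\<in>simples \<Delta>. qscale \<Delta> (of_nat (c \<alpha>)) \<alpha> | c. True}"

definition simple_system :: "'v::ab_group_add root_data \<Rightarrow> bool" where
  "simple_system \<Delta> \<longleftrightarrow> simples \<Delta> \<subseteq> roots \<Delta> \<and>
     \<not> Modules.module.dependent (qscale \<Delta>) (simples \<Delta>) \<and>
     (\<forall>\<beta>\<in>roots \<Delta>. \<beta> \<in> simple_cone \<Delta> \<or> - \<beta> \<in> simple_cone \<Delta>)"

definition pos_roots :: "'v::ab_group_add root_data \<Rightarrow> 'v set" where
  "pos_roots \<Delta> = roots \<Delta> \<inter> simple_cone \<Delta>"

definition highest_root :: "'v::ab_group_add root_data \<Rightarrow> 'v" where
  "highest_root \<Delta> = (THE \<theta>. \<theta> \<in> roots \<Delta> \<and> (\<forall>\<beta>\<in>roots \<Delta>. \<theta> - \<beta> \<in> simple_cone \<Delta>))"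

definition affine_weights :: "'v::ab_group_add root_data \<Rightarrow> ('v \<times> int) set" where
  "affine_weights \<Delta> = {\<mu>. \<forall>\<alpha>\<in>roots \<Delta>. coroot \<Delta> \<alpha> \<mu> \<in> \<int>} \<times> UNIV"

definition pos_affine_roots :: "'v::ab_group_add root_data \<Rightarrow> ('v \<times> int) set" where
  "pos_affine_roots \<Delta> = {(\<alpha>, n). \<alpha> \<in> roots \<Delta> \<and> 0 < n} \<union> {(\<alpha>, 0) | \<alpha>. \<alpha> \<in> pos_roots \<Delta>}"

definition simple_affine_roots :: "'v::ab_group_add root_data \<Rightarrow> ('v \<times> int) set" where
  "simple_affine_roots \<Delta> = {(\<alpha>, 0) | \<alpha>. \<alpha> \<in> simples \<Delta>} \<union> {(- highest_root \<Delta>, 1)}"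

type_synonym 'v affine_trans = "('v \<Rightarrow> rat) \<Rightarrow> ('v \<Rightarrow> rat)"

definition affine_refl :: "'v::ab_group_add root_data \<Rightarrow> 'v \<Rightarrow> int \<Rightarrow> 'v affine_trans" where
  "affine_refl \<Delta> \<alpha> n = (\<lambda>f\<in>vdual \<Delta>. (\<lambda>\<mu>. f \<mu> - (f \<alpha> - of_int n) * coroot \<Delta> \<alpha> \<mu>))"

definition affine_weyl :: "'v::ab_group_add root_data \<Rightarrow> 'v affine_trans monoid" where
  "affine_weyl \<Delta> = (BijGroup (vdual \<Delta>))
     \<lparr>carrier := generate (BijGroup (vdual \<Delta>)) {affine_refl \<Delta> \<alpha> n | \<alpha> n. \<alpha> \<in> roots \<Delta>}\<rparr>"

definition root_refl :: "'v::ab_group_add root_data \<Rightarrow> 'v \<times> int \<Rightarrow> 'v affine_trans" where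
  "root_refl \<Delta> \<gamma> = affine_refl \<Delta> (fst \<gamma>) (- snd \<gamma>)"

definition simple_refls :: "'v::ab_group_add root_data \<Rightarrow> 'v affine_trans set" where
  "simple_refls \<Delta> = root_refl \<Delta> ` simple_affine_roots \<Delta>"


section \<open>The affine moment graphs\<close>

text \<open>
  An edge is given by the set of its two end points together with the positive affine root.
\<close>

type_synonym 'v affine_edge = "'v affine_trans set \<times> ('v \<times> int)"
type_synonym 'v affine_coset_edge = "'v affine_trans set set \<times> ('v \<times> int)"
type_synonym ('v, 'f) weight_space = "('v \<times> int, 'f) poly_mapping set"
type_synonym ('v, 'f) weight_sym = "(('v, 'f) weight_space, 'f) polys set"

definition label_space :: "'v::ab_group_add root_data \<Rightarrow> ('f::field, ('v, 'f) weight_space) module" where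
  "label_space \<Delta> = base_change (affine_weights \<Delta>)"

definition root_label :: "'v::ab_group_add root_data \<Rightarrow> 'v \<times> int \<Rightarrow> ('v, 'f::field) weight_space" where
  "root_label \<Delta> \<alpha> = base_change_of (affine_weights \<Delta>) \<alpha>"

abbreviation weyl_less :: "'v::ab_group_add root_data \<Rightarrow> 'v affine_trans \<Rightarrow> 'v affine_trans \<Rightarrow> bool" where
  "weyl_less \<Delta> \<equiv> bruhat_less (affine_weyl \<Delta>) (simple_refls \<Delta>)"

definition affine_edges :: "'v::ab_group_add root_data \<Rightarrow> 'v affine_edge set" where
  "affine_edges \<Delta> = {({x, y}, \<alpha>) | x y \<alpha>.
     x \<in> carrier (affine_weyl \<Delta>) \<and> y \<in> carrier (affine_weyl \<Delta>) \<and> \<alpha> \<in> pos_affine_roots \<Delta> \<and>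
     weyl_less \<Delta> x y \<and> y = root_refl \<Delta> \<alpha> \<otimes>\<^bsub>affine_weyl \<Delta>\<^esub> x}"

definition affine_graph :: "'v::ab_group_add root_data \<Rightarrow>
    ('v affine_trans, 'v affine_edge, ('v, 'f::field) weight_space) moment_graph" where
  "affine_graph \<Delta> = \<lparr>verts = carrier (affine_weyl \<Delta>), less = weyl_less \<Delta>,
     edges = affine_edges \<Delta>, ends = fst, label = (\<lambda>E. root_label \<Delta> (snd E))\<rparr>"

definition coset :: "'v::ab_group_add root_data \<Rightarrow> 'v affine_trans \<Rightarrow> 'v affine_trans \<Rightarrow> 'v affine_trans set" where
  "coset \<Delta> s x = {x, x \<otimes>\<^bsub>affine_weyl \<Delta>\<^esub> s}"

definition cosets :: "'v::ab_group_add root_data \<Rightarrow> 'v affine_trans \<Rightarrow> 'v affine_trans set set" where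
  "cosets \<Delta> s = coset \<Delta> s ` carrier (affine_weyl \<Delta>)"

definition coset_less ::
  "'v::ab_group_add root_data \<Rightarrow> 'v affine_trans set \<Rightarrow> 'v affine_trans set \<Rightarrow> bool" where
  "coset_less \<Delta> X Y \<longleftrightarrow> X \<noteq> Y \<and> (\<exists>u\<in>X. \<exists>v\<in>Y. weyl_less \<Delta> u v)"

definition coset_edges ::
  "'v::ab_group_add root_data \<Rightarrow> 'v affine_trans \<Rightarrow> 'v affine_coset_edge set" where
  "coset_edges \<Delta> s = {({X, Y}, \<alpha>) | X Y \<alpha>.
     X \<in> cosets \<Delta> s \<and> Y \<in> cosets \<Delta> s \<and> \<alpha> \<in> pos_affine_roots \<Delta> \<and>
     coset_less \<Delta> X Y \<and> (\<lambda>u. root_refl \<Delta> \<alpha> \<otimes>\<^bsub>affine_weyl \<Delta>\<^esub> u) ` X = Y}"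

definition coset_graph :: "'v::ab_group_add root_data \<Rightarrow> 'v affine_trans \<Rightarrow>
    ('v affine_trans set, 'v affine_coset_edge, ('v, 'f::field) weight_space) moment_graph" where
  "coset_graph \<Delta> s = \<lparr>verts = cosets \<Delta> s, less = coset_less \<Delta>,
     edges = coset_edges \<Delta> s, ends = fst, label = (\<lambda>B. root_label \<Delta> (snd B))\<rparr>"

definition coset_edge ::
  "'v::ab_group_add root_data \<Rightarrow> 'v affine_trans \<Rightarrow> 'v affine_edge \<Rightarrow> 'v affine_coset_edge" where
  "coset_edge \<Delta> s E = (coset \<Delta> s ` fst E, snd E)"


section \<open>The functors between sheaves on the two graphs\<close>

text \<open>
  If \<open>B\<close> is induced by the edge \<open>E\<close> between \<open>x\<close> and \<open>y\<close>, then the edges inducing \<open>B\<close> are exactly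
  \<open>E\<close> and \<open>Es\<close>. So \<open>gsum (inducing_edges \<Delta> s B) (estalk P)\<close> is the direct sum of the stalks at \<open>E\<close>
  and \<open>Es\<close>, and \<open>coset_rho\<close> is the sum of the maps into them, with no choice of \<open>E\<close> involved. Each
  of the two edges has exactly one end point in the coset \<open>X\<close>, if \<open>X\<close> is an end point of \<open>B\<close>.
\<close>

definition inducing_edges ::
  "'v::ab_group_add root_data \<Rightarrow> 'v affine_trans \<Rightarrow> 'v affine_coset_edge \<Rightarrow> 'v affine_edge set" where
  "inducing_edges \<Delta> s B = {E \<in> affine_edges \<Delta>. coset_edge \<Delta> s E = B}"

definition coset_rho :: "'v::ab_group_add root_data \<Rightarrow> 'v affine_trans \<Rightarrow>
    ('v affine_trans, 'v affine_edge, 's, 'm, 'n) msheaf \<Rightarrow>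
    'v affine_trans set \<Rightarrow> 'v affine_coset_edge \<Rightarrow> ('v affine_trans \<Rightarrow> 'm) \<Rightarrow> ('v affine_edge \<Rightarrow> 'n)" where
  "coset_rho \<Delta> s P X B m =
     (\<lambda>E\<in>inducing_edges \<Delta> s B. let u = (THE u. u \<in> fst E \<and> u \<in> X) in rho P u E (m u))"

definition upper_coset :: "'v::ab_group_add root_data \<Rightarrow> 'v affine_coset_edge \<Rightarrow> 'v affine_trans set" where
  "upper_coset \<Delta> B = (THE Y. \<exists>X. fst B = {X, Y} \<and> coset_less \<Delta> X Y)"

definition theta_on :: "'v::ab_group_add root_data \<Rightarrow> 'v affine_trans \<Rightarrow>
    ('v affine_trans, 'v affine_edge, ('v, 'f::field) weight_sym, 'm, 'n) msheaf \<Rightarrow>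
    ('v affine_trans set, 'v affine_coset_edge, ('v, 'f) weight_sym,
      'v affine_trans \<Rightarrow> 'm, 'v affine_edge \<Rightarrow> 'n) msheaf" where
  "theta_on \<Delta> s P =
     (let G = (affine_graph \<Delta> :: ('v affine_trans, 'v affine_edge, ('v, 'f) weight_space) moment_graph);
          N = (\<lambda>X. gsubmodule (gsum X (vstalk P)) (sections G X P))
      in \<lparr>vstalk = N,
          estalk = (\<lambda>B. gsubmodule (gsum (inducing_edges \<Delta> s B) (estalk P))
            (coset_rho \<Delta> s P (upper_coset \<Delta> B) B ` carrier (N (upper_coset \<Delta> B)))),
          rho = coset_rho \<Delta> s P\<rparr>)"

text \<open>
  The stalks of \<open>theta_out\<close> on the edges \<open>{x, xs}\<close> and on the other edges have different types and
  are embedded into a sum type. If an edge joins \<open>x\<close> and \<open>xs\<close>, then the set \<open>fst E\<close> of its end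
  points is the coset of \<open>x\<close>.
\<close>

definition theta_out :: "'v::ab_group_add root_data \<Rightarrow> 'v affine_trans \<Rightarrow>
    ('v affine_trans set, 'v affine_coset_edge, ('v, 'f::field) weight_sym, 'm, 'n) msheaf \<Rightarrow>
    ('v affine_trans, 'v affine_edge, ('v, 'f) weight_sym, 'm, 'm set + 'n) msheaf" where
  "theta_out \<Delta> s Q =
     (let K = (\<lambda>E. smult_image (label_space \<Delta>) (root_label \<Delta> (snd E)) (vstalk Q (fst E)))
      in \<lparr>vstalk = (\<lambda>x. vstalk Q (coset \<Delta> s x)),
          estalk = (\<lambda>E. if fst E \<in> cosets \<Delta> s
            then transport_gmodule Inl (quot_gmodule (vstalk Q (fst E)) (K E))
            else transport_gmodule Inr (estalk Q (coset_edge \<Delta> s E))),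
          rho = (\<lambda>x E m. if fst E \<in> cosets \<Delta> s
            then Inl (K E +>\<^bsub>vstalk Q (fst E)\<^esub> m)
            else Inr (rho Q (coset \<Delta> s x) (coset_edge \<Delta> s E) m))\<rparr>)"

definition theta :: "'v::ab_group_add root_data \<Rightarrow> 'v affine_trans \<Rightarrow>
    ('v affine_trans, 'v affine_edge, ('v, 'f::field) weight_sym, 'm, 'n) msheaf \<Rightarrow>
    ('v affine_trans, 'v affine_edge, ('v, 'f) weight_sym,
      'v affine_trans \<Rightarrow> 'm, ('v affine_trans \<Rightarrow> 'm) set + ('v affine_edge \<Rightarrow> 'n)) msheaf" where
  "theta \<Delta> s P = theta_out \<Delta> s (theta_on \<Delta> s P)"

end

theory Submission
  imports Defs
begin


text \<open>Write N for \<open>theta_on \<Delta> s P\<close>, let \<gamma> be the simple affine root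
  of s, and let l be the label of the inner edge u -> us of a coset {u, us} with u < us.

  Vertex stalks of N. A section of P on {u, us} is a pair (a, b) in P^u x P^us whose images on the
  inner edge agree. Since P^us maps onto that edge stalk with kernel l P^us, the projection to P^u
  is onto and its kernel is a copy of P^us shifted by the degree 2 of l. Freeness of P^u splits the
  projection, so the stalk is graded free (\<open>nv_free\<close>).

  Dividing by 2. A function d from vertices to S with d(s_\<alpha> x) congruent to d(x) modulo
  \<alpha> multiplies sections of any sheaf, because edge stalks are killed by their labels
  (\<open>sections_scale\<close>). One such function is c(x), the class of the affine root x\<gamma>
  (\<open>cf\<close>, \<open>admissible_cf\<close>): it is the label of the edge {x, xs} up to sign,
  and c(xs) = -c(x). As 2 is invertible, (c(u) - c)/2 vanishes at u and equals c(u) at us.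
  Correcting with this function, every section of P on a coset extends to a global section
  (\<open>section_extends\<close>). Hence the stalks of N are generated by global sections, and the
  map from a lower coset lands in the edge stalk, which is defined through the upper coset.

  Coprimality. Consider an edge between two cosets with label \<alpha>. If the stalks of P on the
  upper coset are zero, what has to be shown is trivial. Otherwise \<open>supp_down\<close> puts an
  element of the lower coset into the support too, so both cosets lie in the set to which the
  GKM-property applies, and \<alpha> is not proportional to an inner label
  (\<open>gkm_cases\<close>). Non-proportional labels are part of one basis, hence distinct
  variables of a polynomial ring, and one acts injectively modulo the other on free modules
  (\<open>lb_coprime\<close>, \<open>free_coprime\<close>). This is used twice: to see that the
  kernel on the upper coset is \<alpha> times the stalk (\<open>NN_ker\<close>), and to cancel an
  inner label on an edge stalk of N (\<open>ne_coprime\<close>).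

  Sections of N over a set J of cosets are the same as sections of P over the union of J
  (\<open>flatten\<close>, \<open>unflatten\<close>), and unions of open sets of cosets are open. So
  the extension property passes from P to N, and N is projective (\<open>NN_projective\<close>).

  For \<open>theta \<Delta> s P\<close> the edge conditions are built in on inner edges and
  inherited from N on the others (\<open>TH_P3\<close>). The point is extension from an open set I.
  On a coset inside I a section m satisfies m(x) - m(xs) = c(x) n, and the n form a section of N
  over the cosets inside I (\<open>TH_difference\<close>, \<open>TH_difference_edge\<close>); extend
  it to all cosets. Then m - c n/2 is constant on cosets, so it comes from a section of N over the
  cosets that meet I, which extends to some b. Now b + c n/2 extends m (\<open>TH_extend\<close>).
  Both sets of cosets are open because right multiplication by s preserves the direction of edges
  between different cosets (\<open>weyl_less_s\<close>, \<open>weyl_less_cosets\<close>).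

  The combinatorial input is that x < s_\<alpha> x holds exactly if x^{-1} \<alpha> is positive
  (\<open>weyl_less_refl_iff\<close>). It rests on strong exchange, on the expansion of affine roots
  in the simple affine roots, and thus on the existence of the highest root.\<close>

section \<open>Coroots and the invariant form of a finite root system\<close>

locale based_root_system =
  fixes \<Delta> :: "'v::ab_group_add root_data"
  assumes root_system: "root_system \<Delta>" and reduced: "reduced_roots \<Delta>"
    and irreducible: "irreducible_roots \<Delta>" and simple_system: "simple_system \<Delta>"
begin

sublocale VS: vector_space "qscale \<Delta>"
  using root_system by (simp add: root_system_def)

abbreviation Rt :: "'v set" where "Rt \<equiv> roots \<Delta>"
abbreviation scl :: "rat \<Rightarrow> 'v \<Rightarrow> 'v" (infixr "*q" 75) where "c *q v \<equiv> qscale \<Delta> c v"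
abbreviation cr :: "'v \<Rightarrow> 'v \<Rightarrow> rat" where "cr \<equiv> coroot \<Delta>"

lemma finite_roots: "finite Rt" and zero_not_root: "0 \<notin> Rt"
  and span_roots: "VS.span Rt = UNIV"
  and coroot_vdual: "\<alpha> \<in> Rt \<Longrightarrow> cr \<alpha> \<in> vdual \<Delta>"
  and coroot_self: "\<alpha> \<in> Rt \<Longrightarrow> cr \<alpha> \<alpha> = 2"
  and coroot_Ints: "\<alpha> \<in> Rt \<Longrightarrow> \<beta> \<in> Rt \<Longrightarrow> cr \<alpha> \<beta> \<in> \<int>"
  and refl_root': "\<alpha> \<in> Rt \<Longrightarrow> \<beta> \<in> Rt \<Longrightarrow> \<beta> - cr \<alpha> \<beta> *q \<alpha> \<in> Rt"
  using root_system unfolding root_system_def by auto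

lemma vdual_iff: "f \<in> vdual \<Delta> \<longleftrightarrow> (\<forall>x y. f (x + y) = f x + f y) \<and> (\<forall>c x. f (c *q x) = c * f x)"
  unfolding vdual_def Vector_Spaces.linear_iff using VS.vector_space_axioms
  by (auto simp: vector_space_def algebra_simps)

lemma vdual_add: "f \<in> vdual \<Delta> \<Longrightarrow> f (x + y) = f x + f y"
  and vdual_scale: "f \<in> vdual \<Delta> \<Longrightarrow> f (c *q x) = c * f x"
  by (auto simp: vdual_iff)
lemma vdual_zero: "f \<in> vdual \<Delta> \<Longrightarrow> f 0 = 0"
  using vdual_scale[of f 0 0] by simp
lemma vdual_minus: "f \<in> vdual \<Delta> \<Longrightarrow> f (- x) = - f x"
  using vdual_scale[of f "-1" x] by simp
lemma vdual_diff: "f \<in> vdual \<Delta> \<Longrightarrow> f (x - y) = f x - f y"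
  using vdual_add[of f x "-y"] vdual_minus[of f y] by simp
lemma vdual_sum: "f \<in> vdual \<Delta> \<Longrightarrow> f (\<Sum>i\<in>A. g i) = (\<Sum>i\<in>A. f (g i))"
  by (induction A rule: infinite_finite_induct) (auto simp: vdual_zero vdual_add)

lemmas vdual_simps = vdual_add vdual_scale vdual_zero vdual_minus vdual_diff vdual_sum

lemma coroot_add: "\<alpha> \<in> Rt \<Longrightarrow> cr \<alpha> (x + y) = cr \<alpha> x + cr \<alpha> y"
  and coroot_scale: "\<alpha> \<in> Rt \<Longrightarrow> cr \<alpha> (c *q x) = c * cr \<alpha> x"
  and coroot_zero: "\<alpha> \<in> Rt \<Longrightarrow> cr \<alpha> 0 = 0"
  and coroot_minus: "\<alpha> \<in> Rt \<Longrightarrow> cr \<alpha> (- x) = - cr \<alpha> x"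
  and coroot_diff: "\<alpha> \<in> Rt \<Longrightarrow> cr \<alpha> (x - y) = cr \<alpha> x - cr \<alpha> y"
  and coroot_sum: "\<alpha> \<in> Rt \<Longrightarrow> cr \<alpha> (\<Sum>i\<in>A. g i) = (\<Sum>i\<in>A. cr \<alpha> (g i))"
  using coroot_vdual vdual_simps by blast+
lemmas coroot_simps = coroot_add coroot_scale coroot_zero coroot_minus coroot_diff coroot_sum coroot_self

lemma vdual_eq_on_roots:
  assumes "f \<in> vdual \<Delta>" "g \<in> vdual \<Delta>" "\<And>\<beta>. \<beta> \<in> Rt \<Longrightarrow> f \<beta> = g \<beta>"
  shows "f = g"
proof
  fix x
  have "x \<in> VS.span Rt" using span_roots by simp
  then show "f x = g x"
    by (induction rule: VS.span_induct_alt) (use assms in \<open>auto simp: vdual_simps[OF assms(1)] vdual_simps[OF assms(2)]\<close>)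
qed

text \<open>If two candidates for the coroot differ on \<open>v\<close>, the product of the two reflections
  translates \<open>v\<close> infinitely often along \<open>\<alpha>\<close>.\<close>

lemma finite_orbit:
  assumes "\<And>k::nat. v + rat_of_nat k *q u \<in> Rt" "u \<noteq> 0"
  shows False
proof -
  have "inj (\<lambda>k::nat. v + rat_of_nat k *q u)"
    using assms(2) by (auto intro!: injI)
  moreover have "finite (range (\<lambda>k::nat. v + rat_of_nat k *q u))"
    using assms(1) finite_roots by (meson finite_subset image_subsetI)
  ultimately show False using finite_imageD by blast
qed

text \<open>Makes the coroot accessible: any functional that satisfies the axioms, such as the
  transported one in \<open>coroot_rfl\<close>, has to be it.\<close>

lemma coroot_unique:
  assumes a: "\<alpha> \<in> Rt" and f: "f \<in> vdual \<Delta>" "f \<alpha> = 2" "\<And>\<beta>. \<beta> \<in> Rt \<Longrightarrow> \<beta> - f \<beta> *q \<alpha> \<in> Rt"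
  shows "f = cr \<alpha>"
proof (rule vdual_eq_on_roots[OF f(1) coroot_vdual[OF a]])
  fix v assume v: "v \<in> Rt"
  define d where "d = f v - cr \<alpha> v"
  have a0: "\<alpha> \<noteq> 0" using a zero_not_root by auto
  have "v + rat_of_nat k *q (d *q \<alpha>) \<in> Rt" for k
  proof (induction k)
    case (Suc k)
    let ?w = "v + rat_of_nat k *q (d *q \<alpha>)"
    let ?w1 = "?w - f ?w *q \<alpha>"
    have w1: "?w1 \<in> Rt" by (rule f(3)[OF Suc])
    have shift: "v + c *q \<alpha> - e *q \<alpha> = v + (c - e) *q \<alpha>" for c e
      by (simp add: VS.scale_left_diff_distrib)
    have w1': "?w1 = v + (rat_of_nat k * d - (f v + rat_of_nat k * d * 2)) *q \<alpha>"
      by (simp only: VS.scale_scale shift vdual_add[OF f(1)] vdual_scale[OF f(1)] f(2))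
    have "?w1 - cr \<alpha> ?w1 *q \<alpha> = v + (rat_of_nat (Suc k) * d) *q \<alpha>"
      unfolding w1' coroot_add[OF a] coroot_scale[OF a] coroot_self[OF a] shift
      by (rule arg_cong[where f="\<lambda>c. v + c *q \<alpha>"]) (simp add: d_def algebra_simps)
    with refl_root'[OF a w1] show ?case by (simp only: VS.scale_scale)
  qed (simp add: v)
  then have "d *q \<alpha> = 0" using finite_orbit by blast
  then show "f v = cr \<alpha> v" using a0 by (simp add: d_def)
qed

definition rfl :: "'v \<Rightarrow> 'v \<Rightarrow> 'v" where "rfl \<alpha> x = x - cr \<alpha> x *q \<alpha>"

lemma rfl_root: "\<alpha> \<in> Rt \<Longrightarrow> \<beta> \<in> Rt \<Longrightarrow> rfl \<alpha> \<beta> \<in> Rt"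
  by (simp add: rfl_def refl_root')
lemma rfl_rfl: "\<alpha> \<in> Rt \<Longrightarrow> rfl \<alpha> (rfl \<alpha> x) = x"
  by (simp add: rfl_def coroot_simps algebra_simps)
lemma rfl_self: "\<alpha> \<in> Rt \<Longrightarrow> rfl \<alpha> \<alpha> = - \<alpha>"
  using VS.scale_left_distrib[of 1 1 \<alpha>] by (simp add: rfl_def coroot_simps)
lemma rfl_simps: 
  assumes "\<alpha> \<in> Rt"
  shows "rfl \<alpha> (x + y) = rfl \<alpha> x + rfl \<alpha> y" "rfl \<alpha> (x - y) = rfl \<alpha> x - rfl \<alpha> y" "rfl \<alpha> (c *q x) = c *q rfl \<alpha> x"
    "rfl \<alpha> (- x) = - rfl \<alpha> x"
  using assms by (simp_all add: rfl_def coroot_simps algebra_simps)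
lemma neg_root: "\<alpha> \<in> Rt \<Longrightarrow> - \<alpha> \<in> Rt"
  using rfl_root[of \<alpha> \<alpha>] rfl_self by simp

text \<open>The conjugate of the reflection in \<beta> by the reflection in \<alpha> preserves the
  roots and is the reflection attached to \<open>rfl \<alpha> \<beta>\<close> and the functional on
  the right; \<open>coroot_unique\<close> identifies that functional.\<close>

lemma coroot_rfl:
  assumes "\<alpha> \<in> Rt" "\<beta> \<in> Rt"
  shows "cr (rfl \<alpha> \<beta>) x = cr \<beta> (rfl \<alpha> x)"
proof -
  have "(\<lambda>x. cr \<beta> (rfl \<alpha> x)) = cr (rfl \<alpha> \<beta>)"
  proof (rule coroot_unique)
    show "rfl \<alpha> \<beta> \<in> Rt" using assms rfl_root by simp
    show "(\<lambda>x. cr \<beta> (rfl \<alpha> x)) \<in> vdual \<Delta>"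
      using assms by (auto simp: vdual_iff rfl_simps coroot_simps)
    show "cr \<beta> (rfl \<alpha> (rfl \<alpha> \<beta>)) = 2" using assms by (simp add: rfl_rfl coroot_simps)
    fix \<gamma> assume g: "\<gamma> \<in> Rt"
    have "rfl \<alpha> (rfl \<beta> (rfl \<alpha> \<gamma>)) \<in> Rt" using g assms rfl_root by simp
    also have "rfl \<alpha> (rfl \<beta> (rfl \<alpha> \<gamma>)) = \<gamma> - cr \<beta> (rfl \<alpha> \<gamma>) *q rfl \<alpha> \<beta>"
      unfolding rfl_def[of \<beta>] using assms by (simp add: rfl_simps rfl_rfl)
    finally show "\<gamma> - cr \<beta> (rfl \<alpha> \<gamma>) *q rfl \<alpha> \<beta> \<in> Rt" .
  qed
  then show ?thesis by (metis (no_types))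
qed

lemma coroot_neg: "\<alpha> \<in> Rt \<Longrightarrow> cr (- \<alpha>) x = - cr \<alpha> x"
  using coroot_rfl[of \<alpha> \<alpha> x] by (simp add: rfl_self, simp add: rfl_def coroot_simps)

text \<open>A Weyl-invariant form that needs no averaging over the Weyl group: reflections permute
  the roots, hence the coroots. It is positive semidefinite by construction, and on a root \<alpha>
  it is positive since the summand of \<alpha> itself is 4.\<close>

definition form :: "'v \<Rightarrow> 'v \<Rightarrow> rat" where "form x y = (\<Sum>\<gamma>\<in>Rt. cr \<gamma> x * cr \<gamma> y)"

lemma form_sym: "form x y = form y x"
  by (simp add: form_def mult.commute)
lemma form_add: "form (x + y) z = form x z + form y z" 
  by (simp add: form_def coroot_simps algebra_simps sum.distrib)
lemma form_scale: "form (c *q x) z = c * form x z"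
  by (simp add: form_def coroot_simps algebra_simps sum_distrib_left)
lemma form_vdual: "(\<lambda>x. form x z) \<in> vdual \<Delta>"
  by (simp add: vdual_iff form_add form_scale)
lemmas form_simps = vdual_simps[OF form_vdual]

lemma form_rfl: assumes "\<alpha> \<in> Rt" shows "form (rfl \<alpha> x) (rfl \<alpha> y) = form x y"
proof -
  have "bij_betw (rfl \<alpha>) Rt Rt"
    by (rule bij_betw_byWitness[where f'="rfl \<alpha>"]) (use assms rfl_rfl rfl_root in auto)
  then have "form x y = (\<Sum>\<gamma>\<in>Rt. cr (rfl \<alpha> \<gamma>) x * cr (rfl \<alpha> \<gamma>) y)"
    unfolding form_def by (rule sum.reindex_bij_betw[symmetric])
  also have "\<dots> = form (rfl \<alpha> x) (rfl \<alpha> y)" unfolding form_def using assms by (simp add: coroot_rfl)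
  finally show ?thesis by simp
qed

lemma form_root_pos: assumes "\<alpha> \<in> Rt" shows "form \<alpha> \<alpha> > 0"
proof -
  have "cr \<alpha> \<alpha> * cr \<alpha> \<alpha> \<le> form \<alpha> \<alpha>" unfolding form_def
    by (rule member_le_sum) (use assms finite_roots in auto)
  then show ?thesis using assms by (simp add: coroot_self)
qed

text \<open>Invariance under \<open>rfl \<alpha>\<close>, which negates \<alpha>, forces this
  proportionality. In particular \<open>cr\<close> and \<open>form\<close> have the same sign, so
  the sign of a Cartan integer is symmetric in the two roots.\<close>

lemma form_coroot: assumes "\<alpha> \<in> Rt" shows "2 * form x \<alpha> = cr \<alpha> x * form \<alpha> \<alpha>"
proof -
  have "form x \<alpha> = form (rfl \<alpha> x) (- \<alpha>)" using form_rfl[of \<alpha> x \<alpha>] assms by (simp add: rfl_self)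
  also have "\<dots> = - form (rfl \<alpha> x) \<alpha>" using form_sym form_simps(4) by metis
  also have "\<dots> = - form x \<alpha> + cr \<alpha> x * form \<alpha> \<alpha>" by (simp add: rfl_def form_simps)
  finally show ?thesis by simp
qed

lemma form_pos_iff: assumes "\<alpha> \<in> Rt" shows "form x \<alpha> > 0 \<longleftrightarrow> cr \<alpha> x > 0"
proof -
  have "form x \<alpha> > 0 \<longleftrightarrow> cr \<alpha> x * form \<alpha> \<alpha> > 0" using form_coroot[OF assms, of x] by linarith
  then show ?thesis using form_root_pos[OF assms] by (simp add: zero_less_mult_iff)
qed

lemma coroot_pos_sym: "\<alpha> \<in> Rt \<Longrightarrow> \<beta> \<in> Rt \<Longrightarrow> cr \<alpha> \<beta> > 0 \<longleftrightarrow> cr \<beta> \<alpha> > 0"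
  using form_pos_iff form_sym by metis

text \<open>Let m and n be the two Cartan integers, both positive. If one of them is 1, a reflection
  produces the difference up to sign. If both are at least 2, then v, twice the component of
  \<alpha> orthogonal to \<beta>, has norm (4 - m n) times that of \<alpha>, which is at most 0. So
  every coroot vanishes on v, and this leaves m = n = 2. Then the product of the two reflections
  moves \<beta> by 2(\<alpha> - \<beta>) again and again, which a finite set of roots does not allow
  unless \<alpha> = \<beta>.\<close>

lemma diff_root:
  assumes a: "\<alpha> \<in> Rt" and b: "\<beta> \<in> Rt" and p: "cr \<beta> \<alpha> > 0" and ne: "\<alpha> \<noteq> \<beta>"
  shows "\<alpha> - \<beta> \<in> Rt"
proof -
  define m n where "m = cr \<beta> \<alpha>" and "n = cr \<alpha> \<beta>"
  have mn: "m > 0" "n > 0" "m \<in> \<int>" "n \<in> \<int>" using p a b coroot_pos_sym coroot_Ints by (auto simp: m_def n_def)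
  consider "m = 1" | "n = 1" | "m \<ge> 2" "n \<ge> 2"
  proof -
    obtain i j where "m = of_int i" "n = of_int j" using mn(3,4) by (elim Ints_cases) 
    with mn have "m = 1 \<or> n = 1 \<or> (m \<ge> 2 \<and> n \<ge> 2)" by auto
    then show ?thesis using that by blast
  qed
  then show ?thesis
  proof cases
    case 1 then show ?thesis using refl_root'[OF b a] by (simp add: m_def)
  next
    case 2 then have "\<beta> - \<alpha> \<in> Rt" using refl_root'[OF a b] by (simp add: n_def)
    then show ?thesis using neg_root by fastforce
  next
    case 3
    define v where "v = 2 *q \<alpha> - m *q \<beta>"
    have e1: "m * form \<beta> \<beta> = 2 * form \<alpha> \<beta>" and e2: "n * form \<alpha> \<alpha> = 2 * form \<alpha> \<beta>"
      using form_coroot[OF b, of \<alpha>] form_coroot[OF a, of \<beta>] form_sym[of \<alpha> \<beta>] by (simp_all add: m_def n_def)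
    have ex: "form v w = 2 * form \<alpha> w - m * form \<beta> w" for w by (simp add: v_def form_simps)
    have "form v v = 2 * form v \<alpha> - m * form v \<beta>"
      using ex[of v] form_sym by metis
    also have "\<dots> = 4 * form \<alpha> \<alpha> - 4 * m * form \<alpha> \<beta> + m * (m * form \<beta> \<beta>)"
      using form_sym[of \<alpha> \<beta>] by (simp add: ex algebra_simps)
    also have "\<dots> = (4 - m * n) * form \<alpha> \<alpha>" unfolding e1 using e2 by (simp add: algebra_simps)
    finally have "form v v = (4 - m * n) * form \<alpha> \<alpha>" .
    moreover have "m * n \<ge> 2 * 2" using 3 by (intro mult_mono) auto
    ultimately have "form v v \<le> 0" using form_root_pos[OF a] by (simp add: mult_nonpos_nonneg)
    moreover have "form v v \<ge> 0" unfolding form_def by (rule sum_nonneg) simp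
    ultimately have "form v v = 0" by simp
    then have "\<forall>\<gamma>\<in>Rt. cr \<gamma> v * cr \<gamma> v = 0"
      unfolding form_def by (subst (asm) sum_nonneg_eq_0_iff) (use finite_roots in auto)
    then have z: "cr \<gamma> v = 0" if "\<gamma> \<in> Rt" for \<gamma> using that by auto
    have "cr \<alpha> v = 0" "cr \<beta> v = 0" using z a b by auto
    then have mn4: "m * n = 4" by (simp add: v_def coroot_simps a b n_def)
    have "m = 2" "n = 2"
    proof -
      have "(m - 2) * (n - 2) \<ge> 0" using 3 by simp
      then show "m = 2" "n = 2" using mn4 3 by (simp_all add: algebra_simps)
    qed
    then have c: "cr \<beta> \<alpha> = 2" "cr \<alpha> \<beta> = 2" by (simp_all add: m_def n_def)
    have "\<beta> + rat_of_nat k *q (2 *q (\<alpha> - \<beta>)) \<in> Rt" for k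
    proof (induction k)
      case (Suc k)
      let ?w = "\<beta> + rat_of_nat k *q (2 *q (\<alpha> - \<beta>))"
      have "rfl \<alpha> (rfl \<beta> ?w) \<in> Rt" by (intro rfl_root a b Suc)
      also have "rfl \<alpha> (rfl \<beta> ?w) = \<beta> + rat_of_nat (Suc k) *q (2 *q (\<alpha> - \<beta>))"
        using a b c by (simp add: rfl_def coroot_simps algebra_simps)
      finally show ?case .
    qed (simp add: b)
    then show ?thesis using finite_orbit[of \<beta> "2 *q (\<alpha> - \<beta>)"] ne by simp
  qed
qed

section \<open>Simple roots, heights and the highest root\<close>

abbreviation "Sm \<equiv> simples \<Delta>"

lemma simples_roots: "Sm \<subseteq> Rt" and indep_simples: "VS.independent Sm"
  and root_cone: "\<beta> \<in> Rt \<Longrightarrow> \<beta> \<in> simple_cone \<Delta> \<or> - \<beta> \<in> simple_cone \<Delta>"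
  using simple_system unfolding simple_system_def by auto

lemma finite_simples: "finite Sm"
  using finite_subset[OF simples_roots finite_roots] .

lemma cone_span: "\<beta> \<in> simple_cone \<Delta> \<Longrightarrow> \<beta> \<in> VS.span Sm"
  unfolding simple_cone_def
  by (elim CollectE exE conjE) (simp only:, intro VS.span_sum VS.span_scale VS.span_base)

lemma span_simples: "x \<in> VS.span Sm"
proof -
  have "Rt \<subseteq> VS.span Sm"
  proof
    fix \<beta> assume "\<beta> \<in> Rt"
    then consider "\<beta> \<in> VS.span Sm" | "- \<beta> \<in> VS.span Sm" using root_cone cone_span by blast
    then show "\<beta> \<in> VS.span Sm" using VS.span_neg[of "- \<beta>"] by cases auto
  qed
  then have "VS.span Rt \<subseteq> VS.span Sm" by (simp add: VS.span_minimal)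
  then show ?thesis using span_roots by auto
qed

definition co :: "'v \<Rightarrow> 'v \<Rightarrow> rat" where "co a x = VS.representation Sm x a"

lemma co_vdual: "co a \<in> vdual \<Delta>"
  unfolding vdual_iff co_def
  by (simp add: VS.representation_add VS.representation_scale indep_simples span_simples)
lemmas co_simps = vdual_simps[OF co_vdual]

lemma co_basis: "b \<in> Sm \<Longrightarrow> co a b = (if a = b then 1 else 0)"
  by (simp add: co_def VS.representation_basis indep_simples)

lemma co_expand: "(\<Sum>a\<in>Sm. co a x *q a) = x"
  unfolding co_def by (rule VS.sum_representation_eq) (use indep_simples span_simples finite_simples in auto)

lemma co_eqI: "(\<And>a. a \<in> Sm \<Longrightarrow> co a x = co a y) \<Longrightarrow> x = y"
  using co_expand[of x] co_expand[of y] by (metis (no_types, lifting) sum.cong)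

lemma vdual_co: assumes "f \<in> vdual \<Delta>" shows "f x = (\<Sum>a\<in>Sm. co a x * f a)"
proof -
  have "f x = f (\<Sum>a\<in>Sm. co a x *q a)" by (simp add: co_expand)
  then show ?thesis by (simp add: vdual_simps[OF assms])
qed

lemma cone_iff: "x \<in> simple_cone \<Delta> \<longleftrightarrow> (\<forall>a\<in>Sm. co a x \<in> \<nat>)"
proof
  assume "x \<in> simple_cone \<Delta>"
  then obtain c where x: "x = (\<Sum>\<alpha>\<in>Sm. rat_of_nat (c \<alpha>) *q \<alpha>)" unfolding simple_cone_def by auto
  show "\<forall>a\<in>Sm. co a x \<in> \<nat>"
  proof
    fix a assume a: "a \<in> Sm"
    have "co a x = (\<Sum>\<alpha>\<in>Sm. if a = \<alpha> then rat_of_nat (c \<alpha>) else 0)"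
      unfolding x by (simp add: co_simps co_basis cong: sum.cong) (rule sum.cong, auto)
    then show "co a x \<in> \<nat>" using a finite_simples by simp
  qed
next
  assume h: "\<forall>a\<in>Sm. co a x \<in> \<nat>"
  have "x = (\<Sum>\<alpha>\<in>Sm. rat_of_nat (nat \<lfloor>co \<alpha> x\<rfloor>) *q \<alpha>)"
    by (subst co_expand[symmetric]) (rule sum.cong, use h in \<open>auto elim!: Nats_cases\<close>)
  then show "x \<in> simple_cone \<Delta>" unfolding simple_cone_def by auto
qed

lemma cone_co: "x \<in> simple_cone \<Delta> \<Longrightarrow> a \<in> Sm \<Longrightarrow> co a x \<ge> 0"
  using cone_iff Nats_altdef1 by (metis Nats_cases of_nat_0_le_iff)

lemma root_co:
  assumes "\<beta> \<in> Rt" "a \<in> Sm" "co a \<beta> > 0" shows "\<beta> \<in> simple_cone \<Delta>"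
  using root_cone[OF assms(1)] cone_co[of "-\<beta>" a] assms by (auto simp: co_simps)

lemma root_co_nz: assumes "\<beta> \<in> Rt" obtains a where "a \<in> Sm" "co a \<beta> \<noteq> 0"
  using assms zero_not_root co_eqI[of \<beta> 0] by (auto simp: co_simps)

lemma simple_cone_mem: "a \<in> Sm \<Longrightarrow> a \<in> simple_cone \<Delta>"
  by (auto simp: cone_iff co_basis)

lemma cone_add: "x \<in> simple_cone \<Delta> \<Longrightarrow> y \<in> simple_cone \<Delta> \<Longrightarrow> x + y \<in> simple_cone \<Delta>"
  by (auto simp: cone_iff co_simps)

lemma cone_antisym: "x \<in> simple_cone \<Delta> \<Longrightarrow> - x \<in> simple_cone \<Delta> \<Longrightarrow> x = 0"
  using cone_co[of x] cone_co[of "-x"] by (intro co_eqI) (force simp: co_simps)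

text \<open>The height with respect to the simple roots; it is the measure for inductions and for
  the choice of maximal roots.\<close>

definition hf :: "'v \<Rightarrow> rat" where "hf x = (\<Sum>a\<in>Sm. co a x)"
lemma hf_vdual: "hf \<in> vdual \<Delta>"
  by (simp add: vdual_iff hf_def co_simps sum.distrib sum_distrib_left)
lemmas hf_simps = vdual_simps[OF hf_vdual]
lemma hf_simple: "a \<in> Sm \<Longrightarrow> hf a = 1"
  using finite_simples by (simp add: hf_def co_basis)

lemma hf_pos: assumes "x \<in> simple_cone \<Delta>" "x \<noteq> 0" shows "hf x > 0"
proof -
  obtain a where "a \<in> Sm" "co a x \<noteq> 0" using co_eqI[of x 0] assms(2) by (auto simp: co_simps)
  then have "co a x > 0" using cone_co[OF assms(1)] by force
  then show ?thesis unfolding hf_def using \<open>a \<in> Sm\<close> cone_co[OF assms(1)] finite_simples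
    by (intro sum_pos2) auto
qed

text \<open>Otherwise \<open>diff_root\<close> makes a - b a root, with one positive and one
  negative simple coordinate.\<close>

lemma simple_obtuse: assumes "a \<in> Sm" "b \<in> Sm" "a \<noteq> b" shows "cr b a \<le> 0"
proof (rule ccontr)
  assume "\<not> cr b a \<le> 0"
  then have "a - b \<in> Rt" using diff_root[of a b] assms simples_roots by auto
  then have "a - b \<in> simple_cone \<Delta> \<or> - (a - b) \<in> simple_cone \<Delta>" by (rule root_cone)
  moreover have "co a (- (a - b)) = -1" "co b (a - b) = -1" using assms by (simp_all add: co_simps co_basis)
  ultimately show False using cone_co[of "a - b" b] cone_co[of "- (a - b)" a] assms by fastforce
qed

lemma form_co: "form x y = (\<Sum>a\<in>Sm. co a x * form a y)"
  using vdual_co[OF form_vdual] .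

lemma coroot_zero_iff: "\<alpha> \<in> Rt \<Longrightarrow> cr \<alpha> x = 0 \<longleftrightarrow> form x \<alpha> = 0"
  using form_coroot[of \<alpha> x] form_root_pos[of \<alpha>] by auto

lemma coroot_nonneg_iff: "\<alpha> \<in> Rt \<Longrightarrow> cr \<alpha> x \<ge> 0 \<longleftrightarrow> form x \<alpha> \<ge> 0"
  using form_pos_iff[of \<alpha> x] coroot_zero_iff[of \<alpha> x] by (auto simp: order_le_less)

text \<open>Expand \<open>form \<beta> \<beta>\<close>, which is positive, along the given
  combination: some summand is positive.\<close>

lemma pos_root_simple:
  assumes "\<beta> \<in> Rt" "\<beta> = (\<Sum>a\<in>A. k a *q g a)" "\<And>a. a \<in> A \<Longrightarrow> k a \<ge> 0" "\<And>a. a \<in> A \<Longrightarrow> g a \<in> Rt"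
  obtains a where "a \<in> A" "cr (g a) \<beta> > 0" "k a > 0"
proof -
  have "form \<beta> \<beta> = (\<Sum>a\<in>A. k a * form (g a) \<beta>)"
    by (subst (1) assms(2)) (simp add: form_simps)
  moreover have "form \<beta> \<beta> > 0" using assms(1) form_root_pos by blast
  ultimately obtain a where a: "a \<in> A" "k a * form (g a) \<beta> > 0"
    by (metis (no_types, lifting) not_less sum_nonpos)
  then have "form \<beta> (g a) > 0" "k a > 0" using assms(3)[of a] form_sym[of "g a" \<beta>] by (auto simp: zero_less_mult_iff)
  then show ?thesis using that a form_pos_iff assms(4) by blast
qed

text \<open>Supports of roots are connected. Induct on the height, subtracting a simple root g that
  pairs positively with \<beta>; let K be the one of J and its complement that contains g. If
  \<beta> - g were supported off K, it would be orthogonal to g, so reflecting \<beta> in g would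
  give the root \<beta> - 2g, which has coordinates of both signs.\<close>

lemma pos_root_decomposition:
  assumes J: "J \<subseteq> Sm" and orth: "\<And>a b. a \<in> J \<Longrightarrow> b \<in> Sm - J \<Longrightarrow> form a b = 0"
    and b: "\<beta> \<in> Rt" "\<beta> \<in> simple_cone \<Delta>"
  shows "(\<forall>a\<in>Sm-J. co a \<beta> = 0) \<or> (\<forall>a\<in>J. co a \<beta> = 0)"
  using b
proof (induction "nat \<lfloor>hf \<beta>\<rfloor>" arbitrary: \<beta> rule: less_induct)
  case less
  have "\<exists>a\<in>Sm. cr a \<beta> > 0"
    by (rule pos_root_simple[OF less(2), where k = "\<lambda>a. co a \<beta>" and A = Sm and g = "\<lambda>a. a"])
      (use cone_co[OF less(3)] simples_roots co_expand[of \<beta>] in auto)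
  then obtain g where g: "g \<in> Sm" "cr g \<beta> > 0" by blast
  have gR: "g \<in> Rt" using g simples_roots by auto
  show ?case
  proof (cases "\<beta> = g")
    case True then show ?thesis using g by (auto simp: co_basis)
  next
    case False
    define \<beta>' where "\<beta>' = \<beta> - g"
    have r: "\<beta>' \<in> Rt" unfolding \<beta>'_def using diff_root[OF less(2) gR g(2) False] .
    have cob: "co a \<beta>' = co a \<beta> - (if a = g then 1 else 0)" for a
      using g by (simp add: \<beta>'_def co_simps co_basis)
    \<comment> \<open>If g were the only simple root occurring in \<beta>, then \<beta> would be a
      positive multiple of g, hence g itself by reducedness. So another coordinate is positive and
      survives the subtraction of g.\<close>
    have pos: "\<beta>' \<in> simple_cone \<Delta>"
    proof -
      have "\<exists>a\<in>Sm. a \<noteq> g \<and> co a \<beta> > 0"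
      proof (rule ccontr)
        assume "\<not> ?thesis"
        then have "co a \<beta> = 0" if "a \<in> Sm" "a \<noteq> g" for a using cone_co[OF less(3)] that by force
        then have "\<beta> = co g \<beta> *q g" by (intro co_eqI) (auto simp: co_simps co_basis g)
        moreover have "co g \<beta> \<noteq> -1" using cone_co[OF less(3) g(1)] by linarith
        ultimately have "co g \<beta> = 1" using reduced gR less(2) unfolding reduced_roots_def by metis
        then show False using \<open>\<beta> = co g \<beta> *q g\<close> False by simp
      qed
      then show ?thesis using root_co[OF r] cob by auto
    qed
    have "hf \<beta>' = hf \<beta> - 1" using g by (simp add: \<beta>'_def hf_simps hf_simple)
    moreover have "hf \<beta>' > 0" using hf_pos[OF pos] r zero_not_root by auto
    ultimately have "nat \<lfloor>hf \<beta>'\<rfloor> < nat \<lfloor>hf \<beta>\<rfloor>" by linarith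
    then have IH: "(\<forall>a\<in>Sm-J. co a \<beta>' = 0) \<or> (\<forall>a\<in>J. co a \<beta>' = 0)" using less(1) r pos by blast
    define K where "K = (if g \<in> J then J else Sm - J)"
    have K: "K \<subseteq> Sm" "g \<in> K" using J g by (auto simp: K_def)
    have oK: "form a b = 0" if "a \<in> K" "b \<in> Sm - K" for a b
      using that orth[of a b] orth[of b a] form_sym[of a b] J by (auto simp: K_def split: if_splits)
    have IHK: "(\<forall>a\<in>Sm-K. co a \<beta>' = 0) \<or> (\<forall>a\<in>K. co a \<beta>' = 0)"
      using IH J by (auto simp: K_def)
    have "\<forall>a\<in>Sm-K. co a \<beta>' = 0"
    proof (rule ccontr)
      assume n: "\<not> ?thesis"
      then have z: "\<forall>a\<in>K. co a \<beta>' = 0" using IHK by blast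
      have "form \<beta>' g = (\<Sum>a\<in>Sm. co a \<beta>' * form a g)" by (rule form_co)
      also have "\<dots> = 0"
        using z oK[OF K(2)] form_sym by (intro sum.neutral) (metis DiffI mult_eq_0_iff)
      finally have "cr g \<beta>' = 0" using coroot_zero_iff gR by blast
      then have "cr g \<beta> = 2" by (simp add: \<beta>'_def coroot_simps gR)
      then have "rfl g \<beta> = \<beta>' - g" using VS.scale_left_distrib[of 1 1 g] by (simp add: rfl_def \<beta>'_def)
      then have r2: "\<beta>' - g \<in> Rt" using rfl_root[OF gR less(2)] by simp
      obtain a where a: "a \<in> Sm - K" "co a \<beta>' \<noteq> 0" using n by blast
      then have "co a \<beta>' > 0" using cone_co[OF pos, of a] by force
      then have "co a (\<beta>' - g) > 0" using a g K by (auto simp: co_simps co_basis)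
      then have "\<beta>' - g \<in> simple_cone \<Delta>" using root_co[OF r2] a by blast
      then have "co g (\<beta>' - g) \<ge> 0" using cone_co g by blast
      then show False using z K g by (simp add: co_simps co_basis)
    qed
    then have "\<forall>a\<in>Sm-K. co a \<beta> = 0" using cob K by (metis DiffD2 diff_zero)
    then show ?thesis using J by (auto simp: K_def split: if_splits)
  qed
qed

definition dominant :: "'v \<Rightarrow> bool" where "dominant x \<longleftrightarrow> (\<forall>a\<in>Sm. cr a x \<ge> 0)"

text \<open>Take a root of greatest height among those above \<beta>. A simple reflection with
  negative pairing would raise the height and stay above \<beta>.\<close>

lemma dominant_above:
  assumes "\<beta> \<in> Rt"
  obtains \<theta> where "\<theta> \<in> Rt" "\<theta> - \<beta> \<in> simple_cone \<Delta>" "dominant \<theta>"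
    "\<And>\<gamma>. \<gamma> \<in> Rt \<Longrightarrow> \<gamma> - \<beta> \<in> simple_cone \<Delta> \<Longrightarrow> hf \<gamma> \<le> hf \<theta>"
proof -
  let ?A = "{\<gamma> \<in> Rt. \<gamma> - \<beta> \<in> simple_cone \<Delta>}"
  have fin: "finite ?A" using finite_roots by auto
  have "0 \<in> simple_cone \<Delta>" by (simp add: cone_iff co_simps)
  then have ne: "?A \<noteq> {}" using assms by auto
  have "Max (hf ` ?A) \<in> hf ` ?A" using fin ne by (intro Max_in) auto
  then obtain \<theta> where t: "\<theta> \<in> ?A" "hf \<theta> = Max (hf ` ?A)" by (metis (no_types, lifting) imageE)
  have mx: "hf \<gamma> \<le> hf \<theta>" if "\<gamma> \<in> ?A" for \<gamma> using t(2) fin that by simp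
  have "dominant \<theta>" unfolding dominant_def
  proof (intro ballI, rule ccontr)
    fix a assume a: "a \<in> Sm" "\<not> cr a \<theta> \<ge> 0"
    have aR: "a \<in> Rt" using a simples_roots by auto
    obtain k where k: "cr a \<theta> = of_int k" using coroot_Ints[OF aR, of \<theta>] t by (auto elim: Ints_cases)
    have e: "rfl a \<theta> - \<beta> = (\<theta> - \<beta>) + rat_of_nat (nat (- k)) *q a" using a k by (simp add: rfl_def)
    have "rat_of_nat (nat (- k)) *q a \<in> simple_cone \<Delta>" using a by (auto simp: cone_iff co_simps co_basis)
    then have "rfl a \<theta> - \<beta> \<in> simple_cone \<Delta>" unfolding e using cone_add t by blast
    then have "rfl a \<theta> \<in> ?A" using t rfl_root[OF aR] by blast
    moreover have "hf (rfl a \<theta>) = hf \<theta> - cr a \<theta>" using a by (simp add: rfl_def hf_simps hf_simple)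
    ultimately show False using mx a by fastforce
  qed
  then show ?thesis using that[of \<theta>] t mx by auto
qed

text \<open>For b outside the support J of \<theta>, all terms in the expansion of
  \<open>form \<theta> b\<close> are at most 0 because simple roots meet at obtuse angles, while the
  sum is at least 0 by dominance. So J is orthogonal to the other simple roots, the roots split into
  the two orthogonal sets A and B by \<open>pos_root_decomposition\<close>, and irreducibility makes
  B empty.\<close>

lemma dominant_full_support:
  assumes t: "\<theta> \<in> Rt" "\<theta> \<in> simple_cone \<Delta>" "dominant \<theta>" and a: "a \<in> Sm"
  shows "co a \<theta> > 0"
proof -
  define J where "J = {a \<in> Sm. co a \<theta> \<noteq> 0}"
  have J: "J \<subseteq> Sm" by (auto simp: J_def)
  have pos: "co a \<theta> > 0" if "a \<in> J" for a using that cone_co[OF t(2), of a] by (auto simp: J_def order_le_less)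
  have orth: "form a b = 0" if "a \<in> J" "b \<in> Sm - J" for a b
  proof -
    have b: "b \<in> Sm" "b \<in> Rt" using that simples_roots by auto
    have fle: "co c \<theta> * form c b \<le> 0" if "c \<in> Sm" for c
    proof (cases "c = b")
      case False
      then have "form c b \<le> 0" using simple_obtuse[OF that b(1)] form_pos_iff[OF b(2), of c] by force
      then show ?thesis using cone_co[OF t(2) that] by (simp add: mult_nonneg_nonpos)
    next
      case True then show ?thesis using \<open>b \<in> Sm - J\<close> by (simp add: J_def)
    qed
    have "form \<theta> b \<ge> 0" using t(3) b coroot_nonneg_iff by (auto simp: dominant_def)
    then have "(\<Sum>c\<in>Sm. co c \<theta> * form c b) = 0"
      using form_co[of \<theta> b] sum_nonpos[of Sm "\<lambda>c. co c \<theta> * form c b"] fle by fastforce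
    then have "\<forall>c\<in>Sm. - (co c \<theta> * form c b) = 0"
      using fle finite_simples by (subst sum_nonneg_eq_0_iff[symmetric]) (auto simp: sum_negf)
    then have "co a \<theta> * form a b = 0" using that J by auto
    then show ?thesis using pos[OF that(1)] by simp
  qed
  have dec: "(\<forall>a\<in>Sm-J. co a \<beta> = 0) \<or> (\<forall>a\<in>J. co a \<beta> = 0)" if "\<beta> \<in> Rt" for \<beta>
    using root_cone[OF that] pos_root_decomposition[OF J orth that] pos_root_decomposition[OF J orth neg_root[OF that]]
    by (auto simp: co_simps)
  define A where "A = {\<beta> \<in> Rt. \<forall>a\<in>Sm-J. co a \<beta> = 0}"
  define B where "B = {\<beta> \<in> Rt. \<forall>a\<in>J. co a \<beta> = 0}"
  have fo: "form \<alpha> \<beta> = 0" if "\<alpha> \<in> A" "\<beta> \<in> B" for \<alpha> \<beta>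
  proof -
    have z: "co a \<alpha> * (co b \<beta> * form b a) = 0" if "a \<in> Sm" "b \<in> Sm" for a b
      using that \<open>\<alpha> \<in> A\<close> \<open>\<beta> \<in> B\<close> orth[of a b] form_sym[of a b] by (cases "a \<in> J"; cases "b \<in> J") (auto simp: A_def B_def)
    have "form \<alpha> \<beta> = (\<Sum>a\<in>Sm. \<Sum>b\<in>Sm. co a \<alpha> * (co b \<beta> * form b a))"
    proof -
      have "co a \<alpha> * form a \<beta> = (\<Sum>b\<in>Sm. co a \<alpha> * (co b \<beta> * form b a))" for a
        by (subst form_sym, subst form_co) (simp only: sum_distrib_left)
      then show ?thesis by (simp only: form_co[of \<alpha> \<beta>])
    qed
    also have "\<dots> = 0" by (intro sum.neutral ballI z)
    finally show ?thesis .
  qed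
  have "A \<union> B = Rt" using dec by (auto simp: A_def B_def)
  moreover have "A \<inter> B = {}"
  proof -
    have False if "\<beta> \<in> A" "\<beta> \<in> B" for \<beta>
    proof -
      obtain a where "a \<in> Sm" "co a \<beta> \<noteq> 0" using \<open>\<beta> \<in> A\<close> root_co_nz[of \<beta>] by (auto simp: A_def)
      then show False using that by (cases "a \<in> J") (auto simp: A_def B_def)
    qed
    then show ?thesis by blast
  qed
  moreover have "\<theta> \<in> A" using t by (auto simp: A_def J_def)
  moreover have "\<forall>\<alpha>\<in>A. \<forall>\<beta>\<in>B. cr \<beta> \<alpha> = 0 \<and> cr \<alpha> \<beta> = 0"
  proof (intro ballI conjI)
    fix \<alpha> \<beta> assume ab: "\<alpha> \<in> A" "\<beta> \<in> B"
    then have "\<alpha> \<in> Rt" "\<beta> \<in> Rt" by (auto simp: A_def B_def)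
    then show "cr \<beta> \<alpha> = 0" "cr \<alpha> \<beta> = 0" using fo[OF ab] coroot_zero_iff form_sym[of \<alpha> \<beta>] by auto
  qed
  ultimately have "B = {}" using irreducible unfolding irreducible_roots_def by blast
  moreover have "a \<in> B" if "a \<notin> J" using a that simples_roots by (auto simp: B_def co_basis)
  ultimately show ?thesis using pos by blast
qed

text \<open>A root \<theta> of greatest height is dominant with all coordinates positive. A dominant
  root \<theta>' of greatest height above a given root therefore pairs positively with \<theta>. If
  the two differed, \<theta> - \<theta>' would be a root of one sign, and either sign contradicts
  the maximality of one of them. So \<theta>' is \<theta>, and every root lies below
  \<theta>.\<close>

lemma highest_root_exists: "\<exists>\<theta>\<in>Rt. \<forall>\<beta>\<in>Rt. \<theta> - \<beta> \<in> simple_cone \<Delta>"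
proof -
  have "Rt \<noteq> {}" using irreducible by (simp add: irreducible_roots_def)
  then have "Max (hf ` Rt) \<in> hf ` Rt" using finite_roots by (intro Max_in) auto
  then obtain \<theta> where t: "\<theta> \<in> Rt" "hf \<theta> = Max (hf ` Rt)" by (metis (no_types, lifting) imageE)
  have mx: "hf \<gamma> \<le> hf \<theta>" if "\<gamma> \<in> Rt" for \<gamma> using t(2) finite_roots that by simp
  have tc: "\<theta> \<in> simple_cone \<Delta>"
  proof (rule ccontr)
    assume "\<not> ?thesis"
    then have "- \<theta> \<in> simple_cone \<Delta>" using root_cone t by blast
    then have "hf (- \<theta>) > 0" using hf_pos[of "- \<theta>"] t zero_not_root by auto
    then show False using mx[OF neg_root[OF t(1)]] by (simp add: hf_simps)
  qed
  have above: "\<theta>' = \<theta>" if "\<theta>' \<in> Rt" "dominant \<theta>'" "\<And>\<gamma>. \<gamma> \<in> Rt \<Longrightarrow> \<gamma> - \<theta>' \<in> simple_cone \<Delta> \<Longrightarrow> hf \<gamma> \<le> hf \<theta>'"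
    and pos: "\<And>a. a \<in> Sm \<Longrightarrow> co a \<theta> > 0" for \<theta>'
  proof (rule ccontr)
    assume ne: "\<theta>' \<noteq> \<theta>"
    have nn: "form a \<theta>' \<ge> 0" if "a \<in> Sm" for a
      using \<open>dominant \<theta>'\<close> that simples_roots coroot_nonneg_iff form_sym by (metis dominant_def subsetD)
    have "\<exists>a\<in>Sm. form a \<theta>' \<noteq> 0"
    proof (rule ccontr)
      assume "\<not> ?thesis"
      then have "form \<theta>' \<theta>' = 0" by (subst form_co) simp
      then show False using form_root_pos[OF \<open>\<theta>' \<in> Rt\<close>] by simp
    qed
    then obtain a where a: "a \<in> Sm" "form a \<theta>' > 0" using nn by force
    have "form \<theta> \<theta>' > 0" unfolding form_co[of \<theta>]
      by (rule sum_pos2[OF finite_simples a(1)]) (use a pos nn in \<open>auto intro!: mult_nonneg_nonneg simp: less_imp_le\<close>)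
    then have "cr \<theta>' \<theta> > 0" using form_pos_iff that(1) by blast
    then have d: "\<theta> - \<theta>' \<in> Rt" using diff_root[OF t(1) that(1)] ne by blast
    then consider "\<theta> - \<theta>' \<in> simple_cone \<Delta>" | "- (\<theta> - \<theta>') \<in> simple_cone \<Delta>" using root_cone by blast
    then show False
    proof cases
      case 1
      then have "hf (\<theta> - \<theta>') > 0" using hf_pos ne by auto
      moreover have "hf \<theta> \<le> hf \<theta>'" using that(3) t 1 by blast
      ultimately show False by (simp add: hf_simps)
    next
      case 2
      then have "hf (- (\<theta> - \<theta>')) > 0" using hf_pos ne by auto
      then show False using mx[OF that(1)] by (simp add: hf_simps)
    qed
  qed
  have td: "dominant \<theta>"
  proof -
    obtain \<theta>1 where 1: "\<theta>1 \<in> Rt" "\<theta>1 - \<theta> \<in> simple_cone \<Delta>" "dominant \<theta>1" using dominant_above[OF t(1)] by blast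
    have "\<theta>1 = \<theta>" using hf_pos[OF 1(2)] mx[OF 1(1)] by (force simp: hf_simps)
    then show ?thesis using 1 by simp
  qed
  have "\<theta> - \<beta> \<in> simple_cone \<Delta>" if b: "\<beta> \<in> Rt" for \<beta>
  proof -
    obtain \<theta>' where 1: "\<theta>' \<in> Rt" "\<theta>' - \<beta> \<in> simple_cone \<Delta>" "dominant \<theta>'"
      "\<And>\<gamma>. \<gamma> \<in> Rt \<Longrightarrow> \<gamma> - \<beta> \<in> simple_cone \<Delta> \<Longrightarrow> hf \<gamma> \<le> hf \<theta>'" using dominant_above[OF b] by blast
    have "\<theta>' = \<theta>"
    proof (rule above[OF 1(1,3)])
      fix \<gamma> assume "\<gamma> \<in> Rt" "\<gamma> - \<theta>' \<in> simple_cone \<Delta>"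
      then show "hf \<gamma> \<le> hf \<theta>'" using 1(4)[of \<gamma>] cone_add[OF _ 1(2), of "\<gamma> - \<theta>'"] by simp
    qed (use dominant_full_support[OF t(1) tc td] in blast)
    then show ?thesis using 1 by simp
  qed
  then show ?thesis using t by blast
qed

abbreviation "hr \<equiv> highest_root \<Delta>"

lemma highest_root: "hr \<in> Rt" "\<beta> \<in> Rt \<Longrightarrow> hr - \<beta> \<in> simple_cone \<Delta>"
proof -
  have "\<exists>!\<theta>. \<theta> \<in> Rt \<and> (\<forall>\<beta>\<in>Rt. \<theta> - \<beta> \<in> simple_cone \<Delta>)"
  proof (rule ex_ex1I)
    fix x y assume "x \<in> Rt \<and> (\<forall>\<beta>\<in>Rt. x - \<beta> \<in> simple_cone \<Delta>)" "y \<in> Rt \<and> (\<forall>\<beta>\<in>Rt. y - \<beta> \<in> simple_cone \<Delta>)"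
    then have "x - y \<in> simple_cone \<Delta>" "- (x - y) \<in> simple_cone \<Delta>" by auto
    then show "x = y" using cone_antisym by fastforce
  qed (use highest_root_exists in blast)
  then have "hr \<in> Rt \<and> (\<forall>\<beta>\<in>Rt. hr - \<beta> \<in> simple_cone \<Delta>)"
    unfolding highest_root_def by (rule theI')
  then show "hr \<in> Rt" "\<beta> \<in> Rt \<Longrightarrow> hr - \<beta> \<in> simple_cone \<Delta>" by auto
qed
end


section \<open>The affine Weyl group and its action on affine roots\<close>

context based_root_system begin

definition AR :: "('v \<times> int) set" where "AR = Rt \<times> UNIV"
lemma AR_iff: "\<beta> \<in> AR \<longleftrightarrow> fst \<beta> \<in> Rt" by (auto simp: AR_def mem_Times_iff)
abbreviation PR :: "('v \<times> int) set" where "PR \<equiv> pos_affine_roots \<Delta>"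
abbreviation SA :: "('v \<times> int) set" where "SA \<equiv> simple_affine_roots \<Delta>"

definition ci :: "'v \<Rightarrow> 'v \<Rightarrow> int" where "ci \<alpha> \<beta> = \<lfloor>cr \<alpha> \<beta>\<rfloor>"
lemma of_int_ci: "\<alpha> \<in> Rt \<Longrightarrow> \<beta> \<in> Rt \<Longrightarrow> rat_of_int (ci \<alpha> \<beta>) = cr \<alpha> \<beta>"
  unfolding ci_def using coroot_Ints[of \<alpha> \<beta>] by (auto elim: Ints_cases)

text \<open>The linear reflection formula on affine roots. The integer component requires an
  integral Cartan number, hence \<open>ci\<close>, whose floor is exact on roots.\<close>

definition arfl :: "'v \<times> int \<Rightarrow> 'v \<times> int \<Rightarrow> 'v \<times> int" where
  "arfl \<gamma> \<beta> = (rfl (fst \<gamma>) (fst \<beta>), snd \<beta> - ci (fst \<gamma>) (fst \<beta>) * snd \<gamma>)"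

text \<open>An affine root is regarded as an affine function on the dual space. The group consists
  of transformations of that space, so this is how it reaches the affine roots.\<close>

definition ev :: "'v \<times> int \<Rightarrow> ('v \<Rightarrow> rat) \<Rightarrow> rat" where "ev \<beta> f = f (fst \<beta>) + rat_of_int (snd \<beta>)"

lemma zero_vdual: "(\<lambda>x. 0) \<in> vdual \<Delta>"
  by (simp add: vdual_iff)

lemma ev_inject: assumes "\<And>f. f \<in> vdual \<Delta> \<Longrightarrow> ev \<beta> f = ev \<beta>' f" shows "\<beta> = \<beta>'"
proof -
  have s: "snd \<beta> = snd \<beta>'" using assms[OF zero_vdual] by (simp add: ev_def)
  have "fst \<beta> = fst \<beta>'" using assms[OF co_vdual] s by (intro co_eqI) (simp add: ev_def)
  with s show ?thesis by (simp add: prod_eq_iff)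
qed

lemma arfl_AR: "\<gamma> \<in> AR \<Longrightarrow> \<beta> \<in> AR \<Longrightarrow> arfl \<gamma> \<beta> \<in> AR"
  by (auto simp: AR_iff arfl_def rfl_root)

lemma neg_AR: "\<beta> \<in> AR \<Longrightarrow> - \<beta> \<in> AR"
  by (auto simp: AR_iff neg_root)

lemma root_refl_apply: "f \<in> vdual \<Delta> \<Longrightarrow> root_refl \<Delta> \<gamma> f = (\<lambda>\<mu>. f \<mu> - ev \<gamma> f * cr (fst \<gamma>) \<mu>)"
  by (simp add: root_refl_def affine_refl_def ev_def)

lemma root_refl_vdual: 
  assumes "\<gamma> \<in> AR" "f \<in> vdual \<Delta>" shows "root_refl \<Delta> \<gamma> f \<in> vdual \<Delta>"
proof -
  have "fst \<gamma> \<in> Rt" using assms by (simp add: AR_iff)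
  then show ?thesis unfolding root_refl_apply[OF assms(2)] vdual_iff
    by (simp add: vdual_add[OF assms(2)] vdual_scale[OF assms(2)] coroot_simps algebra_simps)
qed

lemma ev_root_refl:
  assumes "\<gamma> \<in> AR" "\<beta> \<in> AR" "f \<in> vdual \<Delta>"
  shows "ev \<beta> (root_refl \<Delta> \<gamma> f) = ev (arfl \<gamma> \<beta>) f"
proof -
  have "rat_of_int (ci (fst \<gamma>) (fst \<beta>)) = cr (fst \<gamma>) (fst \<beta>)" using assms of_int_ci by (simp add: AR_iff)
  moreover have "f (rfl (fst \<gamma>) (fst \<beta>)) = f (fst \<beta>) - cr (fst \<gamma>) (fst \<beta>) * f (fst \<gamma>)"
    by (simp add: rfl_def vdual_diff[OF assms(3)] vdual_scale[OF assms(3)])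
  ultimately show ?thesis unfolding root_refl_apply[OF assms(3)]
    by (simp add: ev_def arfl_def algebra_simps)
qed

lemma root_refl_invol:
  assumes "\<gamma> \<in> AR" "f \<in> vdual \<Delta>" shows "root_refl \<Delta> \<gamma> (root_refl \<Delta> \<gamma> f) = f"
proof -
  have g: "fst \<gamma> \<in> Rt" using assms by (simp add: AR_iff)
  have "ev \<gamma> (root_refl \<Delta> \<gamma> f) = - ev \<gamma> f"
    unfolding root_refl_apply[OF assms(2)] by (simp add: ev_def coroot_simps g)
  then show ?thesis
    unfolding root_refl_apply[OF root_refl_vdual[OF assms]] unfolding root_refl_apply[OF assms(2)] by simp
qed

lemma root_refl_extensional: "root_refl \<Delta> \<gamma> \<in> extensional (vdual \<Delta>)"
  by (simp add: root_refl_def affine_refl_def)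

lemma root_refl_Bij: "\<gamma> \<in> AR \<Longrightarrow> root_refl \<Delta> \<gamma> \<in> Bij (vdual \<Delta>)"
  unfolding Bij_def using root_refl_extensional
  by (auto intro!: bij_betw_byWitness[where f'="root_refl \<Delta> \<gamma>"] simp: root_refl_invol root_refl_vdual)

abbreviation W :: "'v affine_trans monoid" where "W \<equiv> affine_weyl \<Delta>"

lemma reflections_eq: "{affine_refl \<Delta> \<alpha> n | \<alpha> n. \<alpha> \<in> Rt} = root_refl \<Delta> ` AR"
proof -
  have "affine_refl \<Delta> \<alpha> n \<in> root_refl \<Delta> ` AR" if "\<alpha> \<in> Rt" for \<alpha> n
    by (rule image_eqI[of _ _ "(\<alpha>, - n)"]) (use that in \<open>auto simp: root_refl_def AR_iff\<close>)
  moreover have "root_refl \<Delta> \<gamma> \<in> {affine_refl \<Delta> \<alpha> n | \<alpha> n. \<alpha> \<in> Rt}" if "\<gamma> \<in> AR" for \<gamma>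
    unfolding root_refl_def using that by (auto simp: AR_iff)
  ultimately show ?thesis by blast
qed

lemma carrier_W: "carrier W = generate (BijGroup (vdual \<Delta>)) (root_refl \<Delta> ` AR)"
  unfolding affine_weyl_def reflections_eq by simp

lemma reflections_Bij: "root_refl \<Delta> ` AR \<subseteq> carrier (BijGroup (vdual \<Delta>))"
  using root_refl_Bij by (auto simp: BijGroup_def)

lemma subgroup_W: "subgroup (carrier W) (BijGroup (vdual \<Delta>))"
  unfolding carrier_W by (rule group.generate_is_subgroup[OF group_BijGroup reflections_Bij])

sublocale W: group W
proof -
  have "W = (BijGroup (vdual \<Delta>))\<lparr>carrier := carrier W\<rparr>" by (simp add: affine_weyl_def)
  then show "group W" using subgroup.subgroup_is_group[OF subgroup_W group_BijGroup] by simp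
qed

lemma W_Bij: "x \<in> carrier W \<Longrightarrow> x \<in> Bij (vdual \<Delta>)"
  using subgroup.mem_carrier[OF subgroup_W] by (simp add: BijGroup_def)

lemma W_vdual: "x \<in> carrier W \<Longrightarrow> f \<in> vdual \<Delta> \<Longrightarrow> x f \<in> vdual \<Delta>"
  using W_Bij by (auto simp: Bij_def bij_betw_def)

lemma W_mult:
  assumes "x \<in> carrier W" "y \<in> carrier W" "f \<in> vdual \<Delta>"
  shows "(x \<otimes>\<^bsub>W\<^esub> y) f = x (y f)"
proof -
  have "mult W = mult (BijGroup (vdual \<Delta>))" by (simp add: affine_weyl_def)
  then show ?thesis using W_Bij[OF assms(1)] W_Bij[OF assms(2)] assms(3) by (simp add: BijGroup_def compose_def)
qed

lemma W_one: "f \<in> vdual \<Delta> \<Longrightarrow> \<one>\<^bsub>W\<^esub> f = f"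
  by (simp add: affine_weyl_def BijGroup_def)

lemma W_eqI: assumes "x \<in> carrier W" "y \<in> carrier W" "\<And>f. f \<in> vdual \<Delta> \<Longrightarrow> x f = y f" shows "x = y"
  using assms(3) W_Bij[OF assms(1)] W_Bij[OF assms(2)]
  by (intro extensionalityI[of x "vdual \<Delta>" y]) (auto simp: Bij_def)

lemma root_refl_W: "\<gamma> \<in> AR \<Longrightarrow> root_refl \<Delta> \<gamma> \<in> carrier W"
  unfolding carrier_W by (auto intro: generate.incl)

lemma root_refl_square: "\<gamma> \<in> AR \<Longrightarrow> root_refl \<Delta> \<gamma> \<otimes>\<^bsub>W\<^esub> root_refl \<Delta> \<gamma> = \<one>\<^bsub>W\<^esub>"
  by (rule W_eqI) (simp_all add: root_refl_W W_mult W_one root_refl_invol)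

lemma root_refl_inv: "\<gamma> \<in> AR \<Longrightarrow> inv\<^bsub>W\<^esub> (root_refl \<Delta> \<gamma>) = root_refl \<Delta> \<gamma>"
  by (rule W.inv_equality) (simp_all add: root_refl_square root_refl_W)

text \<open>The generators are involutions, so inverses contribute nothing new and every element is
  reached from the unit by left multiplications with reflections.\<close>

lemma W_induct [consumes 1, case_names one refl]:
  assumes "x \<in> carrier W" and "P \<one>\<^bsub>W\<^esub>"
    and step: "\<And>\<gamma> y. \<gamma> \<in> AR \<Longrightarrow> y \<in> carrier W \<Longrightarrow> P y \<Longrightarrow> P (root_refl \<Delta> \<gamma> \<otimes>\<^bsub>W\<^esub> y)"
  shows "P x"
proof -
  let ?B = "BijGroup (vdual \<Delta>)"
  have inv: "inv\<^bsub>?B\<^esub> h = h" if "h \<in> root_refl \<Delta> ` AR" for h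
  proof -
    obtain \<gamma> where g: "\<gamma> \<in> AR" "h = root_refl \<Delta> \<gamma>" using \<open>h \<in> _\<close> by blast
    have "inv\<^bsub>?B\<^esub> h = inv\<^bsub>W\<^esub> h"
      using group.m_inv_consistent[OF group_BijGroup subgroup_W root_refl_W[OF g(1)]] g(2)
      by (simp add: affine_weyl_def)
    then show ?thesis using root_refl_inv g by simp
  qed
  have "x \<in> generate ?B (root_refl \<Delta> ` AR)" using assms(1) carrier_W by simp
  then have "\<forall>y\<in>carrier W. P y \<longrightarrow> P (x \<otimes>\<^bsub>W\<^esub> y)"
  proof (induction rule: generate.induct)
    case one
    have "\<one>\<^bsub>?B\<^esub> = \<one>\<^bsub>W\<^esub>" by (simp add: affine_weyl_def)
    then show ?case by simp
  next
    case (incl h) then show ?case using step by auto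
  next
    case (inv h) then show ?case using step \<open>\<And>h. h \<in> root_refl \<Delta> ` AR \<Longrightarrow> inv\<^bsub>?B\<^esub> h = h\<close> by auto
  next
    case (eng a b)
    have "a \<in> carrier W" "b \<in> carrier W" using eng carrier_W by auto
    moreover have "a \<otimes>\<^bsub>?B\<^esub> b = a \<otimes>\<^bsub>W\<^esub> b" by (simp add: affine_weyl_def)
    ultimately show ?case using eng by (simp add: W.m_assoc)
  qed
  then show ?thesis using assms(1,2) by force
qed

text \<open>Transport of affine functions: \<open>ev (act x \<beta>)\<close> is
  \<open>ev \<beta>\<close> composed with the inverse of x. Uniqueness comes from
  \<open>ev_inject\<close> and surjectivity of x, existence from induction over reflections.\<close>

definition act :: "'v affine_trans \<Rightarrow> 'v \<times> int \<Rightarrow> 'v \<times> int" where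
  "act x \<beta> = (THE \<beta>'. \<beta>' \<in> AR \<and> (\<forall>f\<in>vdual \<Delta>. ev \<beta>' (x f) = ev \<beta> f))"

lemma W_surj: assumes "x \<in> carrier W" "f \<in> vdual \<Delta>" obtains g where "g \<in> vdual \<Delta>" "f = x g"
  using assms W_Bij[OF assms(1)] by (auto simp: Bij_def bij_betw_def)

lemma act_eqI:
  assumes "x \<in> carrier W" "\<beta>' \<in> AR" "\<And>f. f \<in> vdual \<Delta> \<Longrightarrow> ev \<beta>' (x f) = ev \<beta> f"
  shows "act x \<beta> = \<beta>'"
  unfolding act_def
proof (rule the_equality)
  fix \<gamma> assume g: "\<gamma> \<in> AR \<and> (\<forall>f\<in>vdual \<Delta>. ev \<gamma> (x f) = ev \<beta> f)"
  show "\<gamma> = \<beta>'"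
  proof (rule ev_inject)
    fix f assume "f \<in> vdual \<Delta>"
    then obtain h where "h \<in> vdual \<Delta>" "f = x h" using W_surj assms(1) by blast
    then show "ev \<gamma> f = ev \<beta>' f" using g assms(3) by auto
  qed
qed (use assms in blast)

lemma act_exists:
  assumes "x \<in> carrier W" "\<beta> \<in> AR"
  shows "\<exists>\<beta>'\<in>AR. \<forall>f\<in>vdual \<Delta>. ev \<beta>' (x f) = ev \<beta> f"
  using assms(1)
proof (induction rule: W_induct)
  case one then show ?case using assms(2) by (auto simp: W_one)
next
  case (refl \<gamma> y)
  then obtain \<beta>' where b: "\<beta>' \<in> AR" "\<forall>f\<in>vdual \<Delta>. ev \<beta>' (y f) = ev \<beta> f" by blast
  have "ev (arfl \<gamma> \<beta>') ((root_refl \<Delta> \<gamma> \<otimes>\<^bsub>W\<^esub> y) f) = ev \<beta> f" if "f \<in> vdual \<Delta>" for f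
  proof -
    have yf: "y f \<in> vdual \<Delta>" using refl that W_vdual by blast
    have "ev (arfl \<gamma> \<beta>') (root_refl \<Delta> \<gamma> (y f)) = ev \<beta>' (root_refl \<Delta> \<gamma> (root_refl \<Delta> \<gamma> (y f)))"
      using ev_root_refl[OF refl(1) b(1)] root_refl_vdual[OF refl(1) yf] by simp
    then show ?thesis using b that refl yf root_refl_invol[OF refl(1) yf] by (simp add: W_mult root_refl_W)
  qed
  then show ?case using arfl_AR[OF refl(1) b(1)] by blast
qed

lemma assumes "x \<in> carrier W" "\<beta> \<in> AR" shows act_AR: "act x \<beta> \<in> AR"
  and ev_act: "f \<in> vdual \<Delta> \<Longrightarrow> ev (act x \<beta>) (x f) = ev \<beta> f"
proof -
  obtain \<beta>' where b: "\<beta>'\<in>AR" "\<forall>f\<in>vdual \<Delta>. ev \<beta>' (x f) = ev \<beta> f" using act_exists[OF assms] by blast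
  then have "act x \<beta> = \<beta>'" using act_eqI[OF assms(1)] by blast
  with b show "act x \<beta> \<in> AR" "f \<in> vdual \<Delta> \<Longrightarrow> ev (act x \<beta>) (x f) = ev \<beta> f" by simp_all
qed

lemma act_mult:
  assumes "x \<in> carrier W" "y \<in> carrier W" "\<beta> \<in> AR"
  shows "act (x \<otimes>\<^bsub>W\<^esub> y) \<beta> = act x (act y \<beta>)"
  using assms by (intro act_eqI) (auto simp: W_mult W_vdual ev_act act_AR)

lemma act_one: "\<beta> \<in> AR \<Longrightarrow> act \<one>\<^bsub>W\<^esub> \<beta> = \<beta>"
  by (intro act_eqI) (auto simp: W_one)

lemma act_inv: assumes "x \<in> carrier W" "\<beta> \<in> AR" 
  shows "act (inv\<^bsub>W\<^esub> x) (act x \<beta>) = \<beta>" "act x (act (inv\<^bsub>W\<^esub> x) \<beta>) = \<beta>"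
  using assms act_mult[of "inv\<^bsub>W\<^esub> x" x \<beta>] act_mult[of x "inv\<^bsub>W\<^esub> x" \<beta>] by (simp_all add: act_one)

lemma act_root_refl: assumes "\<gamma> \<in> AR" "\<beta> \<in> AR" shows "act (root_refl \<Delta> \<gamma>) \<beta> = arfl \<gamma> \<beta>"
  using assms by (intro act_eqI)
    (auto simp: root_refl_W arfl_AR ev_root_refl[symmetric] root_refl_vdual root_refl_invol)

lemma ev_neg: "f \<in> vdual \<Delta> \<Longrightarrow> ev (- \<beta>) f = - ev \<beta> f"
  by (simp add: ev_def vdual_minus[of f])

lemma act_neg: assumes "x \<in> carrier W" "\<beta> \<in> AR" shows "act x (- \<beta>) = - act x \<beta>"
  using assms neg_AR[OF act_AR[OF assms]] 
  by (intro act_eqI) (auto simp: ev_neg W_vdual ev_act)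

lemma arfl_self: "\<gamma> \<in> AR \<Longrightarrow> arfl \<gamma> \<gamma> = - \<gamma>"
  by (auto simp: AR_iff prod_eq_iff arfl_def rfl_self ci_def coroot_self)

lemma ci_rfl: assumes "\<gamma> \<in> Rt" "\<alpha> \<in> Rt" "\<beta> \<in> Rt" shows "ci (rfl \<gamma> \<alpha>) (rfl \<gamma> \<beta>) = ci \<alpha> \<beta>"
  unfolding ci_def using assms by (simp add: coroot_rfl rfl_rfl)

lemma ci_rfl2: assumes "\<gamma> \<in> Rt" "\<alpha> \<in> Rt" "\<beta> \<in> Rt" shows "ci \<gamma> (rfl \<alpha> \<beta>) = ci \<gamma> \<beta> - ci \<alpha> \<beta> * ci \<gamma> \<alpha>"
proof -
  have "rat_of_int (ci \<gamma> (rfl \<alpha> \<beta>)) = rat_of_int (ci \<gamma> \<beta> - ci \<alpha> \<beta> * ci \<gamma> \<alpha>)"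
    using assms by (simp add: of_int_ci rfl_root) (simp add: rfl_def coroot_simps)
  then show ?thesis by linarith
qed

lemma arfl_arfl:
  assumes "\<gamma> \<in> AR" "\<alpha> \<in> AR" "\<beta> \<in> AR"
  shows "arfl \<gamma> (arfl \<alpha> \<beta>) = arfl (arfl \<gamma> \<alpha>) (arfl \<gamma> \<beta>)"
proof -
  have "rfl (fst \<gamma>) (rfl (fst \<alpha>) (fst \<beta>)) = rfl (rfl (fst \<gamma>) (fst \<alpha>)) (rfl (fst \<gamma>) (fst \<beta>))"
    unfolding rfl_def[of "rfl _ _"] unfolding rfl_def[of "fst \<alpha>"] using assms by (auto simp: AR_iff coroot_rfl rfl_rfl rfl_simps)
  then show ?thesis using assms by (auto simp: AR_iff arfl_def ci_rfl ci_rfl2 algebra_simps)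
qed

text \<open>The action on affine roots is faithful: every (\<beta>, 0) is the image under x of some
  affine root, so the values of x f on roots can be read off from the action, and a functional is
  determined on roots.\<close>

lemma root_refl_eqI:
  assumes "x \<in> carrier W" "y \<in> carrier W" "\<And>\<beta>. \<beta> \<in> AR \<Longrightarrow> act x \<beta> = act y \<beta>"
  shows "x = y"
proof (rule W_eqI[OF assms(1,2)])
  fix f assume f: "f \<in> vdual \<Delta>"
  show "x f = y f"
  proof (rule vdual_eq_on_roots)
    fix \<beta> assume "\<beta> \<in> Rt"
    define \<gamma> where "\<gamma> = act (inv\<^bsub>W\<^esub> x) (\<beta>, 0)"
    have b: "(\<beta>, 0) \<in> AR" using \<open>\<beta> \<in> Rt\<close> by (simp add: AR_iff)
    have g: "\<gamma> \<in> AR" unfolding \<gamma>_def using assms(1) b by (intro act_AR) auto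
    have ag: "act x \<gamma> = (\<beta>, 0)" unfolding \<gamma>_def using act_inv(2)[OF assms(1) b] .
    have "ev (\<beta>, 0) (x f) = ev (\<beta>, 0) (y f)"
      using ev_act[OF assms(1) g f] ev_act[OF assms(2) g f] assms(3)[OF g] ag by simp
    then show "x f \<beta> = y f \<beta>" by (simp add: ev_def)
  qed (rule W_vdual[OF assms(1) f], rule W_vdual[OF assms(2) f])
qed

lemma act_arfl:
  assumes "x \<in> carrier W" "\<alpha> \<in> AR" "\<beta> \<in> AR"
  shows "act x (arfl \<alpha> \<beta>) = arfl (act x \<alpha>) (act x \<beta>)"
  using assms(1)
proof (induction rule: W_induct)
  case (refl \<gamma> y)
  then show ?case using assms
    by (simp add: act_mult act_root_refl arfl_arfl[OF refl(1) act_AR[OF refl(2) assms(2)] act_AR[OF refl(2) assms(3)]]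
        act_AR root_refl_W arfl_AR)
qed (use assms act_one arfl_AR in \<open>simp\<close>)

text \<open>By faithfulness it suffices to compare both sides on affine roots, where the claim is
  the equivariance \<open>act_arfl\<close>.\<close>

lemma root_refl_conj:
  assumes "x \<in> carrier W" "\<alpha> \<in> AR"
  shows "root_refl \<Delta> (act x \<alpha>) \<otimes>\<^bsub>W\<^esub> x = x \<otimes>\<^bsub>W\<^esub> root_refl \<Delta> \<alpha>"
  using assms
  by (intro root_refl_eqI) (simp_all add: act_mult act_root_refl act_arfl act_AR root_refl_W)

lemma root_refl_conj':
  assumes "x \<in> carrier W" "\<alpha> \<in> AR"
  shows "root_refl \<Delta> (act x \<alpha>) = x \<otimes>\<^bsub>W\<^esub> root_refl \<Delta> \<alpha> \<otimes>\<^bsub>W\<^esub> inv\<^bsub>W\<^esub> x"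
  using root_refl_conj[OF assms] assms act_AR[OF assms] root_refl_W
  by (subst W.inv_solve_right) simp_all

lemma root_refl_neg: "\<gamma> \<in> AR \<Longrightarrow> root_refl \<Delta> (- \<gamma>) = root_refl \<Delta> \<gamma>"
proof (rule W_eqI)
  fix f assume "\<gamma> \<in> AR" "f \<in> vdual \<Delta>"
  then show "root_refl \<Delta> (- \<gamma>) f = root_refl \<Delta> \<gamma> f"
    by (auto simp: AR_iff root_refl_apply ev_neg coroot_neg)
qed (use neg_AR root_refl_W in \<open>auto\<close>)

end


section \<open>Positive affine roots, length and Bruhat order\<close>

context based_root_system begin

text \<open>The coordinate at (a, 0) in the basis of simple affine roots. The coordinate at
  (-\<open>hr\<close>, 1) is \<open>snd \<beta>\<close>, so the term with \<open>hr\<close>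
  compensates for what that basis vector contributes to the finite part.\<close>

definition Ka :: "'v \<Rightarrow> 'v \<times> int \<Rightarrow> rat" where "Ka a \<beta> = co a (fst \<beta>) + rat_of_int (snd \<beta>) * co a hr"

lemma Ka_arfl: "\<gamma> \<in> AR \<Longrightarrow> \<beta> \<in> AR \<Longrightarrow> Ka a (arfl \<gamma> \<beta>) = Ka a \<beta> - cr (fst \<gamma>) (fst \<beta>) * Ka a \<gamma>"
  using of_int_ci[of "fst \<gamma>" "fst \<beta>"] by (simp add: AR_iff Ka_def arfl_def rfl_def co_simps algebra_simps)

lemma Ka_neg: "Ka a (- \<beta>) = - Ka a \<beta>"
  by (simp add: Ka_def co_simps)

lemma PR_AR: "\<beta> \<in> PR \<Longrightarrow> \<beta> \<in> AR"
  by (auto simp: pos_affine_roots_def AR_iff pos_roots_def)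

lemma PR_cases: "\<beta> \<in> PR \<longleftrightarrow> \<beta> \<in> AR \<and> (snd \<beta> > 0 \<or> snd \<beta> = 0 \<and> fst \<beta> \<in> simple_cone \<Delta>)"
  by (cases \<beta>) (auto simp: pos_affine_roots_def AR_iff pos_roots_def)

lemma highest_root_co: assumes "a \<in> Sm" shows "co a hr \<ge> 0"
proof -
  have "hr - (- hr) \<in> simple_cone \<Delta>" using highest_root neg_root by blast
  then have "co a (hr - (- hr)) \<ge> 0" using cone_co assms by blast
  then show ?thesis by (simp add: co_simps)
qed

text \<open>If the integer part n is at least 1, the coordinates dominate those of \<open>hr\<close>
  + \<open>fst \<beta>\<close>, which are nonnegative because \<open>hr\<close> lies above the root
  -\<open>fst \<beta>\<close>. If n = 0, the claim is about finite roots.\<close>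

lemma PR_iff:
  assumes "\<beta> \<in> AR"
  shows "\<beta> \<in> PR \<longleftrightarrow> (\<forall>a\<in>Sm. Ka a \<beta> \<ge> 0) \<and> snd \<beta> \<ge> 0"
proof
  assume b: "\<beta> \<in> PR"
  show "(\<forall>a\<in>Sm. Ka a \<beta> \<ge> 0) \<and> snd \<beta> \<ge> 0"
  proof (intro conjI ballI)
    fix a assume a: "a \<in> Sm"
    show "Ka a \<beta> \<ge> 0"
    proof (cases "snd \<beta> = 0")
      case True then show ?thesis using b cone_co a by (simp add: PR_cases Ka_def)
    next
      case False
      then have "rat_of_int (snd \<beta>) \<ge> 1" using b by (auto simp: PR_cases)
      then have "co a hr \<le> rat_of_int (snd \<beta>) * co a hr" using highest_root_co[OF a] by (simp add: mult_le_cancel_right1)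
      moreover have "hr - (- fst \<beta>) \<in> simple_cone \<Delta>" using assms highest_root neg_root by (simp only: AR_iff)
      then have "co a (hr - (- fst \<beta>)) \<ge> 0" using cone_co a by blast
      ultimately show ?thesis by (simp add: Ka_def co_simps)
    qed
  qed (use b in \<open>auto simp: PR_cases\<close>)
next
  assume h: "(\<forall>a\<in>Sm. Ka a \<beta> \<ge> 0) \<and> snd \<beta> \<ge> 0"
  have "fst \<beta> \<in> simple_cone \<Delta>" if "snd \<beta> = 0"
  proof -
    have r: "fst \<beta> \<in> Rt" using assms by (simp add: AR_iff)
    obtain a where "a \<in> Sm" "co a (fst \<beta>) \<noteq> 0" using root_co_nz[OF r] .
    then have "co a (fst \<beta>) > 0" using h \<open>snd \<beta> = 0\<close> by (force simp: Ka_def)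
    then show ?thesis using root_co[OF r \<open>a \<in> Sm\<close>] by simp
  qed
  then show "\<beta> \<in> PR" using h assms by (auto simp: PR_cases)
qed

lemma PR_total: "\<beta> \<in> AR \<Longrightarrow> \<beta> \<in> PR \<or> - \<beta> \<in> PR"
  using neg_AR[of \<beta>] root_cone[of "fst \<beta>"] by (auto simp: PR_cases AR_iff)

lemma PR_neg: "\<beta> \<in> PR \<Longrightarrow> - \<beta> \<notin> PR"
  using cone_antisym[of "fst \<beta>"] zero_not_root by (auto simp: PR_cases AR_iff)

lemma PR_witness: "\<beta> \<in> AR \<Longrightarrow> (\<exists>a\<in>Sm. Ka a \<beta> > 0) \<or> snd \<beta> > 0 \<Longrightarrow> \<beta> \<in> PR"
  using PR_total[of \<beta>] PR_iff[OF neg_AR, of \<beta>] by (force simp: Ka_neg)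

lemma SA_cases: assumes "\<gamma> \<in> SA" obtains (fin) a where "a \<in> Sm" "\<gamma> = (a, 0)" | (aff) "\<gamma> = (- hr, 1)"
  using assms by (auto simp: simple_affine_roots_def)

lemma SA_PR: "\<gamma> \<in> SA \<Longrightarrow> \<gamma> \<in> PR"
  by (erule SA_cases) (use simples_roots simple_cone_mem highest_root(1) neg_root in \<open>auto simp: PR_cases AR_iff\<close>)

lemma SA_AR: "\<gamma> \<in> SA \<Longrightarrow> \<gamma> \<in> AR"
  using SA_PR PR_AR by blast

text \<open>The reflection changes only the coordinate at \<gamma>. By reducedness a positive root
  other than \<gamma> has some other positive coordinate, and one positive coordinate decides the
  sign of a root.\<close>

lemma simple_refl_pos:
  assumes g: "\<gamma> \<in> SA" and b: "\<beta> \<in> PR" and ne: "\<beta> \<noteq> \<gamma>"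
  shows "arfl \<gamma> \<beta> \<in> PR"
proof -
  have bA: "\<beta> \<in> AR" and gA: "\<gamma> \<in> AR" using b g PR_AR SA_AR by auto
  have bR: "fst \<beta> \<in> Rt" using bA AR_iff by simp
  have pos: "\<forall>a\<in>Sm. Ka a \<beta> \<ge> 0" "snd \<beta> \<ge> 0" using PR_iff[OF bA] b by auto
  from g show ?thesis
  proof (cases rule: SA_cases)
    case (fin a)
    have "(\<exists>c\<in>Sm. c \<noteq> a \<and> Ka c \<beta> > 0) \<or> snd \<beta> > 0"
    proof (rule ccontr)
      assume "\<not> ?thesis"
      then have n: "snd \<beta> = 0" and z: "\<And>c. c \<in> Sm \<Longrightarrow> c \<noteq> a \<Longrightarrow> co c (fst \<beta>) = 0"
        using pos by (force simp: Ka_def)+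
      have e: "fst \<beta> = co a (fst \<beta>) *q a" by (rule co_eqI) (use z fin in \<open>auto simp: co_simps co_basis\<close>)
      have "a \<in> Rt" using fin simples_roots by auto
      then have "co a (fst \<beta>) = 1 \<or> co a (fst \<beta>) = -1" using reduced bR e unfolding reduced_roots_def by metis
      moreover have "co a (fst \<beta>) \<ge> 0" using pos fin n by (auto simp: Ka_def)
      ultimately have "fst \<beta> = a" using e by auto
      then show False using ne n fin by (auto simp: prod_eq_iff)
    qed
    moreover have "Ka c (arfl \<gamma> \<beta>) = Ka c \<beta>" if "c \<noteq> a" for c
      using Ka_arfl[OF gA bA] that fin by (simp add: Ka_def co_basis)
    moreover have "snd (arfl \<gamma> \<beta>) = snd \<beta>" using fin by (simp add: arfl_def)
    ultimately show ?thesis using PR_witness[OF arfl_AR[OF gA bA]] by metis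
  next
    case aff
    have "\<exists>c\<in>Sm. Ka c \<beta> > 0"
    proof (rule ccontr)
      assume "\<not> ?thesis"
      then have z: "\<And>c. c \<in> Sm \<Longrightarrow> Ka c \<beta> = 0" using pos by force
      have e: "fst \<beta> = rat_of_int (snd \<beta>) *q (- hr)"
        by (rule co_eqI) (use z in \<open>simp add: co_simps Ka_def eq_neg_iff_add_eq_0\<close>)
      have "- hr \<in> Rt" using highest_root(1) neg_root by blast
      then have "rat_of_int (snd \<beta>) = 1 \<or> rat_of_int (snd \<beta>) = -1" using reduced bR e unfolding reduced_roots_def by metis
      then have "snd \<beta> = 1" using pos by linarith
      then show False using ne e aff by (auto simp: prod_eq_iff)
    qed
    moreover have "Ka c (arfl \<gamma> \<beta>) = Ka c \<beta>" for c
      using Ka_arfl[OF gA bA] aff by (simp add: Ka_def co_simps)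
    ultimately show ?thesis using PR_witness[OF arfl_AR[OF gA bA]] by metis
  qed
qed

definition ht :: "'v \<times> int \<Rightarrow> rat" where "ht \<beta> = (\<Sum>a\<in>Sm. Ka a \<beta>) + rat_of_int (snd \<beta>)"

lemma ht_arfl: "\<gamma> \<in> AR \<Longrightarrow> \<beta> \<in> AR \<Longrightarrow> ht (arfl \<gamma> \<beta>) = ht \<beta> - cr (fst \<gamma>) (fst \<beta>) * ht \<gamma>"
  using of_int_ci[of "fst \<gamma>" "fst \<beta>"]
  by (simp add: ht_def Ka_arfl sum_subtractf sum_distrib_left algebra_simps) (simp add: arfl_def AR_iff)

lemma ht_SA: "\<gamma> \<in> SA \<Longrightarrow> ht \<gamma> = 1"
  by (erule SA_cases) (auto simp: ht_def Ka_def co_basis co_simps finite_simples)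

lemma ht_nonneg: "\<beta> \<in> PR \<Longrightarrow> ht \<beta> \<ge> 0"
  using PR_iff[OF PR_AR, of \<beta>] by (auto simp: ht_def intro!: add_nonneg_nonneg sum_nonneg)

text \<open>Expand \<open>fst \<beta>\<close> in the finite parts of the simple affine roots with
  the nonnegative coordinates of \<beta>. If all pairings were at most 0, so would be
  \<open>form\<close> of \<open>fst \<beta>\<close> with itself.\<close>

lemma exists_descent: assumes "\<beta> \<in> PR" shows "\<exists>\<gamma>\<in>SA. cr (fst \<gamma>) (fst \<beta>) > 0"
proof (rule ccontr)
  assume n: "\<not> ?thesis"
  have bR: "fst \<beta> \<in> Rt" using assms PR_AR AR_iff by blast
  let ?b = "fst \<beta>"
  have le: "form x ?b \<le> 0" if "(x, m) \<in> SA" for x m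
  proof -
    have "x \<in> Rt" using SA_AR[OF that] by (simp add: AR_iff)
    then show ?thesis using n that form_pos_iff[of x ?b] form_sym[of x ?b] by force
  qed
  have 1: "Ka a \<beta> * form a ?b \<le> 0" if "a \<in> Sm" for a
    using le[of a 0] that assms PR_iff[OF PR_AR[OF assms]]
    by (intro mult_nonneg_nonpos) (auto simp: simple_affine_roots_def)
  have "form (- hr) ?b \<le> 0" by (rule le[of "- hr" 1]) (simp add: simple_affine_roots_def)
  then have "form hr ?b \<ge> 0" by (simp add: form_simps)
  moreover have "snd \<beta> \<ge> 0" using assms by (auto simp: PR_cases)
  ultimately have 2: "rat_of_int (snd \<beta>) * form hr ?b \<ge> 0" by simp
  have "(\<Sum>a\<in>Sm. Ka a \<beta> * form a ?b) = form ?b ?b + rat_of_int (snd \<beta>) * form hr ?b"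
    unfolding form_co[of ?b ?b] form_co[of hr ?b]
    by (simp add: Ka_def algebra_simps sum.distrib sum_distrib_left)
  moreover have "(\<Sum>a\<in>Sm. Ka a \<beta> * form a ?b) \<le> 0" using 1 by (simp add: sum_nonpos)
  ultimately show False using 2 form_root_pos[OF bR] by linarith
qed

abbreviation S :: "'v affine_trans set" where "S \<equiv> simple_refls \<Delta>"

definition wd :: "'v affine_trans list \<Rightarrow> 'v affine_trans" where "wd ws = foldr (\<lambda>a b. a \<otimes>\<^bsub>W\<^esub> b) ws \<one>\<^bsub>W\<^esub>"

lemma S_W: "t \<in> S \<Longrightarrow> t \<in> carrier W"
  using SA_AR root_refl_W by (auto simp: simple_refls_def)

lemma wd_Nil [simp]: "wd [] = \<one>\<^bsub>W\<^esub>" and wd_Cons [simp]: "wd (t # ws) = t \<otimes>\<^bsub>W\<^esub> wd ws"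
  by (simp_all add: wd_def)

lemma wd_W: "set ws \<subseteq> S \<Longrightarrow> wd ws \<in> carrier W"
  by (induction ws) (auto simp: S_W)

lemma wd_append: "set ws \<subseteq> S \<Longrightarrow> set vs \<subseteq> S \<Longrightarrow> wd (ws @ vs) = wd ws \<otimes>\<^bsub>W\<^esub> wd vs"
  by (induction ws) (auto simp: S_W wd_W W.m_assoc)

lemma S_inv: "t \<in> S \<Longrightarrow> inv\<^bsub>W\<^esub> t = t"
  using SA_AR root_refl_inv by (auto simp: simple_refls_def)

lemma wd_rev: "set ws \<subseteq> S \<Longrightarrow> wd (rev ws) = inv\<^bsub>W\<^esub> (wd ws)"
  by (induction ws) (auto simp: wd_append S_W wd_W W.inv_mult_group S_inv)

text \<open>Induction on the affine height \<open>ht\<close>: a simple reflection with positive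
  pairing lowers it by an integer that is at least 1, and keeps the root positive unless the root
  already is that simple root.\<close>

lemma pos_root_conjugate: 
  assumes "\<beta> \<in> PR" shows "\<exists>ws \<gamma>. set ws \<subseteq> S \<and> \<gamma> \<in> SA \<and> \<beta> = act (wd ws) \<gamma>"
  using assms
proof (induction "nat \<lfloor>ht \<beta>\<rfloor>" arbitrary: \<beta> rule: less_induct)
  case less
  obtain \<gamma> where g: "\<gamma> \<in> SA" "cr (fst \<gamma>) (fst \<beta>) > 0" using exists_descent[OF less(2)] by blast
  have gA: "\<gamma> \<in> AR" and bA: "\<beta> \<in> AR" using g less(2) SA_AR PR_AR by auto
  show ?case
  proof (cases "\<beta> = \<gamma>")
    case True then show ?thesis using g act_one[OF bA] by (intro exI[of _ "[]"] exI[of _ \<gamma>]) auto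
  next
    case False
    define \<beta>' where "\<beta>' = arfl \<gamma> \<beta>"
    have b': "\<beta>' \<in> PR" unfolding \<beta>'_def by (rule simple_refl_pos[OF g(1) less(2) False])
    have "ht \<beta>' = ht \<beta> - rat_of_int (ci (fst \<gamma>) (fst \<beta>))"
      using ht_arfl[OF gA bA] ht_SA[OF g(1)] of_int_ci[of "fst \<gamma>" "fst \<beta>"] gA bA by (simp add: \<beta>'_def AR_iff)
    moreover have "ci (fst \<gamma>) (fst \<beta>) \<ge> 1"
      using g(2) of_int_ci[of "fst \<gamma>" "fst \<beta>"] gA bA by (simp add: AR_iff)
    ultimately have "nat \<lfloor>ht \<beta>'\<rfloor> < nat \<lfloor>ht \<beta>\<rfloor>" using ht_nonneg[OF b'] by linarith
    then obtain ws \<delta> where w: "set ws \<subseteq> S" "\<delta> \<in> SA" "\<beta>' = act (wd ws) \<delta>" using less(1) b' by blast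
    let ?t = "root_refl \<Delta> \<gamma>"
    have tS: "?t \<in> S" using g by (simp add: simple_refls_def)
    have "act (wd (?t # ws)) \<delta> = act ?t \<beta>'"
      using w tS by (simp add: act_mult S_W wd_W SA_AR)
    also have "\<dots> = \<beta>"
    proof -
      have "act ?t \<beta>' = act ?t (act ?t \<beta>)" using \<beta>'_def act_root_refl[OF gA bA] by simp
      also have "\<dots> = \<beta>" using act_inv(1)[OF root_refl_W[OF gA] bA] root_refl_inv[OF gA] by simp
      finally show ?thesis .
    qed
    finally show ?thesis using w tS by (intro exI[of _ "?t # ws"] exI[of _ \<delta>]) auto
  qed
qed

lemma refl_conj_simple:
  assumes "\<alpha> \<in> PR"
  obtains ws t where "set ws \<subseteq> S" "t \<in> S" "root_refl \<Delta> \<alpha> = wd ws \<otimes>\<^bsub>W\<^esub> t \<otimes>\<^bsub>W\<^esub> inv\<^bsub>W\<^esub> (wd ws)"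
proof -
  obtain ws \<gamma> where w: "set ws \<subseteq> S" "\<gamma> \<in> SA" "\<alpha> = act (wd ws) \<gamma>" using pos_root_conjugate[OF assms] by blast
  then show ?thesis using that[of ws "root_refl \<Delta> \<gamma>"] root_refl_conj'[OF wd_W[OF w(1)] SA_AR[OF w(2)]]
    by (simp add: simple_refls_def)
qed

lemma pos_AR: assumes "\<gamma> \<in> AR" obtains \<alpha> where "\<alpha> \<in> PR" "root_refl \<Delta> \<gamma> = root_refl \<Delta> \<alpha>" "\<alpha> = \<gamma> \<or> \<alpha> = - \<gamma>"
  using PR_total[OF assms] root_refl_neg[OF assms] by (metis)

text \<open>A conjugate of a simple reflection is spelled by the palindrome
  \<open>ws @ [t] @ rev ws\<close>.\<close>

lemma refl_word: assumes "\<gamma> \<in> AR" shows "\<exists>ws. set ws \<subseteq> S \<and> wd ws = root_refl \<Delta> \<gamma>"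
proof -
  obtain \<alpha> where a: "\<alpha> \<in> PR" "root_refl \<Delta> \<gamma> = root_refl \<Delta> \<alpha>" using pos_AR[OF assms] by blast
  obtain ws t where w: "set ws \<subseteq> S" "t \<in> S" "root_refl \<Delta> \<alpha> = wd ws \<otimes>\<^bsub>W\<^esub> t \<otimes>\<^bsub>W\<^esub> inv\<^bsub>W\<^esub> (wd ws)"
    using refl_conj_simple[OF a(1)] .
  have "wd (ws @ [t] @ rev ws) = root_refl \<Delta> \<gamma>"
    using w a by (simp add: wd_append wd_rev wd_W S_W W.m_assoc)
  then show ?thesis using w by (intro exI[of _ "ws @ [t] @ rev ws"]) auto
qed

lemma W_word: assumes "x \<in> carrier W" shows "\<exists>ws. set ws \<subseteq> S \<and> wd ws = x"
  using assms
proof (induction rule: W_induct)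
  case one then show ?case by (intro exI[of _ "[]"]) auto
next
  case (refl \<gamma> y)
  obtain ws vs where "set ws \<subseteq> S" "wd ws = root_refl \<Delta> \<gamma>" "set vs \<subseteq> S" "wd vs = y"
    using refl_word[OF refl(1)] refl(3) by blast
  then show ?case by (intro exI[of _ "ws @ vs"]) (auto simp: wd_append)
qed

abbreviation wl :: "'v affine_trans \<Rightarrow> nat" where "wl \<equiv> word_length W S"

lemma wl_word: assumes "x \<in> carrier W" obtains ws where "set ws \<subseteq> S" "wd ws = x" "length ws = wl x"
proof -
  have "\<exists>n ws. set ws \<subseteq> S \<and> length ws = n \<and> wd ws = x" using W_word[OF assms] by blast
  then have "\<exists>ws. set ws \<subseteq> S \<and> length ws = wl x \<and> wd ws = x"
    unfolding word_length_def wd_def by (rule LeastI_ex)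
  then show ?thesis using that by blast
qed

lemma wl_le: "set ws \<subseteq> S \<Longrightarrow> wl (wd ws) \<le> length ws"
  unfolding word_length_def wd_def by (rule Least_le) blast

text \<open>Follow \<alpha> through the word from the left. As it ends up negative, at some letter
  it equals the simple root of that letter, and deleting this letter realizes the multiplication by
  the reflection. Only the drop in length is recorded.\<close>

lemma strong_exchange:
  assumes "set ws \<subseteq> S" "\<alpha> \<in> PR" "act (inv\<^bsub>W\<^esub> (wd ws)) \<alpha> \<notin> PR"
  shows "\<exists>vs. set vs \<subseteq> S \<and> length vs < length ws \<and> wd vs = root_refl \<Delta> \<alpha> \<otimes>\<^bsub>W\<^esub> wd ws"
  using assms
proof (induction ws arbitrary: \<alpha>)
  case Nil then show ?case using act_one[OF PR_AR] by simp
next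
  case (Cons t ws)
  have aA: "\<alpha> \<in> AR" using Cons PR_AR by blast
  obtain \<gamma> where g: "\<gamma> \<in> SA" "t = root_refl \<Delta> \<gamma>" using Cons by (auto simp: simple_refls_def)
  have gA: "\<gamma> \<in> AR" using g SA_AR by blast
  have t: "t \<in> S" "t \<in> carrier W" and ws: "set ws \<subseteq> S" "wd ws \<in> carrier W" using Cons S_W wd_W by auto
  have tt: "t \<otimes>\<^bsub>W\<^esub> t = \<one>\<^bsub>W\<^esub>" using g root_refl_square[OF gA] by simp
  show ?case
  proof (cases "\<alpha> = \<gamma>")
    case True
    have "wd ws = root_refl \<Delta> \<alpha> \<otimes>\<^bsub>W\<^esub> wd (t # ws)"
      using True g tt t ws by (simp add: W.m_assoc[symmetric])
    then show ?thesis using ws by (intro exI[of _ ws]) auto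
  next
    case False
    have p: "arfl \<gamma> \<alpha> \<in> PR" using simple_refl_pos[OF g(1) Cons(3) False] .
    have "act (inv\<^bsub>W\<^esub> (wd (t # ws))) \<alpha> = act (inv\<^bsub>W\<^esub> (wd ws)) (act t \<alpha>)"
      using t ws aA by (simp add: W.inv_mult_group S_inv act_mult)
    also have "act t \<alpha> = arfl \<gamma> \<alpha>" using g act_root_refl[OF gA aA] by simp
    finally obtain vs where v: "set vs \<subseteq> S" "length vs < length ws" "wd vs = root_refl \<Delta> (arfl \<gamma> \<alpha>) \<otimes>\<^bsub>W\<^esub> wd ws"
      using Cons.IH[OF ws(1) p] Cons(4) by auto
    have "t \<otimes>\<^bsub>W\<^esub> root_refl \<Delta> (arfl \<gamma> \<alpha>) = t \<otimes>\<^bsub>W\<^esub> (t \<otimes>\<^bsub>W\<^esub> root_refl \<Delta> \<alpha> \<otimes>\<^bsub>W\<^esub> t)"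
      using root_refl_conj'[OF t(2) aA] \<open>act t \<alpha> = arfl \<gamma> \<alpha>\<close> S_inv[OF t(1)] by simp
    also have "\<dots> = root_refl \<Delta> \<alpha> \<otimes>\<^bsub>W\<^esub> t"
      using tt t root_refl_W[OF aA] by (simp add: W.m_assoc[symmetric])
    finally have "wd (t # vs) = root_refl \<Delta> \<alpha> \<otimes>\<^bsub>W\<^esub> wd (t # ws)"
      using v(3) t ws root_refl_W[OF aA] root_refl_W[OF PR_AR[OF p]] by (simp add: W.m_assoc[symmetric])
    then show ?thesis using v t by (intro exI[of _ "t # vs"]) auto
  qed
qed

lemma wl_refl_less:
  assumes "x \<in> carrier W" "\<alpha> \<in> PR" "act (inv\<^bsub>W\<^esub> x) \<alpha> \<notin> PR"
  shows "wl (root_refl \<Delta> \<alpha> \<otimes>\<^bsub>W\<^esub> x) < wl x"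
proof -
  obtain ws where w: "set ws \<subseteq> S" "wd ws = x" "length ws = wl x" using wl_word[OF assms(1)] .
  then obtain vs where "set vs \<subseteq> S" "length vs < length ws" "wd vs = root_refl \<Delta> \<alpha> \<otimes>\<^bsub>W\<^esub> x"
    using strong_exchange[of ws \<alpha>] assms by auto
  then show ?thesis using wl_le[of vs] w by auto
qed

lemma refl_refl: "\<alpha> \<in> AR \<Longrightarrow> x \<in> carrier W \<Longrightarrow> root_refl \<Delta> \<alpha> \<otimes>\<^bsub>W\<^esub> (root_refl \<Delta> \<alpha> \<otimes>\<^bsub>W\<^esub> x) = x"
  by (simp add: root_refl_W root_refl_square W.m_assoc[symmetric])

text \<open>The reflection in \<alpha> negates \<alpha>, so passing to the reflected element flips
  the sign of the transported root, and \<open>wl_refl_less\<close> applies there.\<close>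

lemma wl_less_refl:
  assumes "x \<in> carrier W" "\<alpha> \<in> PR" "act (inv\<^bsub>W\<^esub> x) \<alpha> \<in> PR"
  shows "wl x < wl (root_refl \<Delta> \<alpha> \<otimes>\<^bsub>W\<^esub> x)"
proof -
  let ?t = "root_refl \<Delta> \<alpha>"
  have a: "\<alpha> \<in> AR" "?t \<in> carrier W" "?t \<otimes>\<^bsub>W\<^esub> x \<in> carrier W" using assms PR_AR root_refl_W by auto
  have "act (inv\<^bsub>W\<^esub> (?t \<otimes>\<^bsub>W\<^esub> x)) \<alpha> = - act (inv\<^bsub>W\<^esub> x) \<alpha>"
    using assms a by (simp add: W.inv_mult_group root_refl_inv act_mult act_root_refl arfl_self act_neg)
  then have "act (inv\<^bsub>W\<^esub> (?t \<otimes>\<^bsub>W\<^esub> x)) \<alpha> \<notin> PR" using PR_neg assms(3) by simp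
  then show ?thesis using wl_refl_less[OF a(3) assms(2)] refl_refl[OF a(1) assms(1)] by simp
qed

text \<open>The conjugates of simple reflections are exactly the reflections in positive affine
  roots; this connects the order with the edges of the graph.\<close>

lemma bruhat_step_iff: "bruhat_step W S x y \<longleftrightarrow> x \<in> carrier W \<and> (\<exists>\<alpha>\<in>PR. y = root_refl \<Delta> \<alpha> \<otimes>\<^bsub>W\<^esub> x) \<and> wl x < wl y"
proof -
  have "(\<exists>w\<in>carrier W. \<exists>t\<in>S. z = w \<otimes>\<^bsub>W\<^esub> t \<otimes>\<^bsub>W\<^esub> inv\<^bsub>W\<^esub> w) \<longleftrightarrow> (\<exists>\<alpha>\<in>PR. z = root_refl \<Delta> \<alpha>)" for z
  proof
    assume "\<exists>w\<in>carrier W. \<exists>t\<in>S. z = w \<otimes>\<^bsub>W\<^esub> t \<otimes>\<^bsub>W\<^esub> inv\<^bsub>W\<^esub> w"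
    then obtain w \<gamma> where w: "w \<in> carrier W" "\<gamma> \<in> SA" "z = w \<otimes>\<^bsub>W\<^esub> root_refl \<Delta> \<gamma> \<otimes>\<^bsub>W\<^esub> inv\<^bsub>W\<^esub> w"
      by (auto simp: simple_refls_def)
    then have "z = root_refl \<Delta> (act w \<gamma>)" using root_refl_conj' SA_AR by simp
    then show "\<exists>\<alpha>\<in>PR. z = root_refl \<Delta> \<alpha>" using pos_AR[OF act_AR[OF w(1) SA_AR[OF w(2)]]] by metis
  next
    assume "\<exists>\<alpha>\<in>PR. z = root_refl \<Delta> \<alpha>"
    then show "\<exists>w\<in>carrier W. \<exists>t\<in>S. z = w \<otimes>\<^bsub>W\<^esub> t \<otimes>\<^bsub>W\<^esub> inv\<^bsub>W\<^esub> w" using refl_conj_simple wd_W by metis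
  qed
  then have "(\<exists>w\<in>carrier W. \<exists>t\<in>S. y = w \<otimes>\<^bsub>W\<^esub> t \<otimes>\<^bsub>W\<^esub> inv\<^bsub>W\<^esub> w \<otimes>\<^bsub>W\<^esub> x) \<longleftrightarrow> (\<exists>\<alpha>\<in>PR. y = root_refl \<Delta> \<alpha> \<otimes>\<^bsub>W\<^esub> x)"
    by metis
  then show ?thesis unfolding bruhat_step_def by blast
qed

lemma weyl_less_wl: "weyl_less \<Delta> x y \<Longrightarrow> wl x < wl y"
  unfolding bruhat_less_def by (induction rule: tranclp_induct) (auto simp: bruhat_step_iff)

lemma weyl_less_W: "weyl_less \<Delta> x y \<Longrightarrow> x \<in> carrier W \<and> y \<in> carrier W"
  unfolding bruhat_less_def by (induction rule: tranclp_induct) (auto simp: bruhat_step_iff PR_AR root_refl_W)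

lemma weyl_less_trans: "weyl_less \<Delta> x y \<Longrightarrow> weyl_less \<Delta> y z \<Longrightarrow> weyl_less \<Delta> x z"
  unfolding bruhat_less_def by (rule tranclp_trans)

text \<open>The order refines the order by length, and the sign of the transported root decides
  whether the reflection lengthens or shortens x. Directions of edges thereby become sign
  conditions.\<close>

lemma weyl_less_refl_iff:
  assumes "x \<in> carrier W" "\<alpha> \<in> PR"
  shows "weyl_less \<Delta> x (root_refl \<Delta> \<alpha> \<otimes>\<^bsub>W\<^esub> x) \<longleftrightarrow> act (inv\<^bsub>W\<^esub> x) \<alpha> \<in> PR"
proof
  assume "act (inv\<^bsub>W\<^esub> x) \<alpha> \<in> PR"
  then have "bruhat_step W S x (root_refl \<Delta> \<alpha> \<otimes>\<^bsub>W\<^esub> x)" using assms wl_less_refl by (auto simp: bruhat_step_iff)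
  then show "weyl_less \<Delta> x (root_refl \<Delta> \<alpha> \<otimes>\<^bsub>W\<^esub> x)" unfolding bruhat_less_def by blast
next
  assume "weyl_less \<Delta> x (root_refl \<Delta> \<alpha> \<otimes>\<^bsub>W\<^esub> x)"
  then show "act (inv\<^bsub>W\<^esub> x) \<alpha> \<in> PR" using weyl_less_wl wl_refl_less[OF assms] by fastforce
qed

lemma weyl_less_refl_total:
  assumes "x \<in> carrier W" "\<alpha> \<in> PR"
  shows "weyl_less \<Delta> x (root_refl \<Delta> \<alpha> \<otimes>\<^bsub>W\<^esub> x) \<or> weyl_less \<Delta> (root_refl \<Delta> \<alpha> \<otimes>\<^bsub>W\<^esub> x) x"
proof (rule disjCI)
  assume n: "\<not> weyl_less \<Delta> (root_refl \<Delta> \<alpha> \<otimes>\<^bsub>W\<^esub> x) x"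
  let ?y = "root_refl \<Delta> \<alpha> \<otimes>\<^bsub>W\<^esub> x"
  have a: "\<alpha> \<in> AR" "?y \<in> carrier W" using assms PR_AR root_refl_W by auto
  have "act (inv\<^bsub>W\<^esub> ?y) \<alpha> \<notin> PR" using n weyl_less_refl_iff[OF a(2) assms(2)] refl_refl[OF a(1) assms(1)] by simp
  then have "wl x < wl ?y" using wl_refl_less[OF a(2) assms(2)] refl_refl[OF a(1) assms(1)] by simp
  then have "bruhat_step W S x ?y" using assms by (auto simp: bruhat_step_iff)
  then show "weyl_less \<Delta> x ?y" unfolding bruhat_less_def by blast
qed

text \<open>Equal reflections give s_\<beta> \<alpha> = -\<alpha>, so 2\<alpha> is an integral
  multiple c\<beta>. Reducedness leaves c = 2 or c = -2, and positivity excludes the latter.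
  Consequently the label of an edge is determined by its ends.\<close>

lemma root_refl_inj:
  assumes "\<alpha> \<in> PR" "\<beta> \<in> PR" "root_refl \<Delta> \<alpha> = root_refl \<Delta> \<beta>" shows "\<alpha> = \<beta>"
proof -
  have A: "\<alpha> \<in> AR" "\<beta> \<in> AR" using assms PR_AR by auto
  then have R: "fst \<alpha> \<in> Rt" "fst \<beta> \<in> Rt" by (auto simp: AR_iff)
  define c where "c = ci (fst \<beta>) (fst \<alpha>)"
  have c: "cr (fst \<beta>) (fst \<alpha>) = rat_of_int c" using of_int_ci[OF R(2,1)] by (simp add: c_def)
  have "arfl \<beta> \<alpha> = - \<alpha>" using arfl_self[OF A(1)] act_root_refl[OF A(1) A(1)] act_root_refl[OF A(2,1)] assms(3) by simp
  then have 1: "fst \<alpha> - rat_of_int c *q fst \<beta> = - fst \<alpha>" and 2: "snd \<alpha> - c * snd \<beta> = - snd \<alpha>"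
    by (auto simp: arfl_def rfl_def c c_def prod_eq_iff)
  have "2 *q fst \<alpha> = rat_of_int c *q fst \<beta>"
    using 1 VS.scale_left_distrib[of 1 1 "fst \<alpha>"] by (simp add: algebra_simps)
  then have "(1/2) *q (2 *q fst \<alpha>) = (1/2) *q (rat_of_int c *q fst \<beta>)" by simp
  then have e: "fst \<alpha> = (rat_of_int c / 2) *q fst \<beta>" by simp
  then have "rat_of_int c / 2 = 1 \<or> rat_of_int c / 2 = -1" using reduced R unfolding reduced_roots_def by metis
  then have "c = 2 \<or> c = -2" by linarith
  then have "\<alpha> = \<beta> \<or> \<alpha> = - \<beta>" using e 2 by (auto simp: prod_eq_iff)
  then show ?thesis using PR_neg[OF assms(2)] assms(1) by metis
qed

end


section \<open>Cosets of a simple reflection and the edges between them\<close>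

locale affine_wall = based_root_system \<Delta> for \<Delta> :: "'v::ab_group_add root_data" +
  fixes s :: "'v affine_trans"
  assumes s_simple: "s \<in> simple_refls \<Delta>"
begin

abbreviation wm (infixl "\<cdot>" 70) where "x \<cdot> y \<equiv> x \<otimes>\<^bsub>W\<^esub> y"
abbreviation rr :: "'v \<times> int \<Rightarrow> 'v affine_trans" where "rr \<equiv> root_refl \<Delta>"

definition \<gamma>s :: "'v \<times> int" where "\<gamma>s = (SOME \<gamma>. \<gamma> \<in> SA \<and> s = rr \<gamma>)"

lemma \<gamma>s: "\<gamma>s \<in> SA" "s = rr \<gamma>s"
proof -
  have "\<exists>\<gamma>. \<gamma> \<in> SA \<and> s = rr \<gamma>" using s_simple by (auto simp: simple_refls_def)
  then have "\<gamma>s \<in> SA \<and> s = rr \<gamma>s" unfolding \<gamma>s_def by (rule someI_ex)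
  then show "\<gamma>s \<in> SA" "s = rr \<gamma>s" by auto
qed

lemma \<gamma>s_AR [simp]: "\<gamma>s \<in> AR" using \<gamma>s SA_AR by blast
lemma s_W [simp]: "s \<in> carrier W" using root_refl_W[OF \<gamma>s_AR] \<gamma>s(2)[symmetric] by simp
lemma s_s: "s \<cdot> s = \<one>\<^bsub>W\<^esub>" using root_refl_square[OF \<gamma>s_AR] \<gamma>s(2)[symmetric] by simp

lemma xss [simp]: "x \<in> carrier W \<Longrightarrow> x \<cdot> s \<cdot> s = x"
  by (simp add: W.m_assoc s_s)

lemma rr_W [simp]: "\<alpha> \<in> PR \<Longrightarrow> rr \<alpha> \<in> carrier W"
  using root_refl_W PR_AR by blast

lemma rr_s: "\<alpha> \<in> PR \<Longrightarrow> x \<in> carrier W \<Longrightarrow> rr \<alpha> \<cdot> (x \<cdot> s) = rr \<alpha> \<cdot> x \<cdot> s"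
  by (simp add: W.m_assoc)

lemma rr_rr [simp]: "\<alpha> \<in> PR \<Longrightarrow> x \<in> carrier W \<Longrightarrow> rr \<alpha> \<cdot> (rr \<alpha> \<cdot> x) = x"
  using refl_refl PR_AR by blast

text \<open>The affine root whose reflection carries x to xs by left multiplication. It is kept with
  its sign, since \<open>wall (x \<cdot> s) = - wall x\<close> is the antisymmetry that later
  separates x from xs; \<open>lab\<close> is the positive one of the pair and labels the
  edge.\<close>

definition wall :: "'v affine_trans \<Rightarrow> 'v \<times> int" where "wall x = act x \<gamma>s"

lemma wall_AR: "x \<in> carrier W \<Longrightarrow> wall x \<in> AR"
  by (simp add: wall_def act_AR)

lemma wall_s: assumes "x \<in> carrier W" shows "wall (x \<cdot> s) = - wall x"
proof -
  have "act s \<gamma>s = - \<gamma>s" using \<gamma>s(2)[symmetric] act_root_refl[OF \<gamma>s_AR \<gamma>s_AR] arfl_self[OF \<gamma>s_AR] by simp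
  then show ?thesis using assms by (simp add: wall_def act_mult act_neg)
qed

lemma wall_rr:
  assumes "x \<in> carrier W" "\<alpha> \<in> PR" shows "wall (rr \<alpha> \<cdot> x) = arfl \<alpha> (wall x)"
  using assms act_root_refl[OF PR_AR[OF assms(2)] wall_AR[OF assms(1)]] by (simp add: wall_def act_mult)

definition lab :: "'v affine_trans \<Rightarrow> 'v \<times> int" where "lab x = (if wall x \<in> PR then wall x else - wall x)"

lemma lab: assumes "x \<in> carrier W" shows "lab x \<in> PR" "rr (lab x) \<cdot> x = x \<cdot> s" "lab x = wall x \<or> lab x = - wall x"
proof -
  show "lab x \<in> PR" using PR_total[OF wall_AR[OF assms]] by (auto simp: lab_def)
  have "rr (lab x) = rr (wall x)" using root_refl_neg[OF wall_AR[OF assms]] by (simp add: lab_def)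
  then show "rr (lab x) \<cdot> x = x \<cdot> s" using root_refl_conj[OF assms \<gamma>s_AR] \<gamma>s(2)[symmetric] by (simp add: wall_def)
  show "lab x = wall x \<or> lab x = - wall x" by (simp add: lab_def)
qed

lemma rr_cancel: assumes "x \<in> carrier W" "\<alpha> \<in> PR" "\<beta> \<in> PR" "rr \<alpha> \<cdot> x = rr \<beta> \<cdot> x" shows "\<alpha> = \<beta>"
  using root_refl_inj[OF assms(2,3)] assms W.right_cancel[of x "rr \<alpha>" "rr \<beta>"] by simp

lemma rr_ne: assumes "x \<in> carrier W" "\<alpha> \<in> PR" shows "rr \<alpha> \<cdot> x \<noteq> x"
  using weyl_less_refl_total[OF assms] weyl_less_wl by force

lemma xs_ne: "x \<in> carrier W \<Longrightarrow> x \<cdot> s \<noteq> x"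
  using rr_ne[of x "lab x"] lab[of x] by simp

lemma lab_unique: assumes "x \<in> carrier W" "\<alpha> \<in> PR" "rr \<alpha> \<cdot> x = x \<cdot> s" shows "\<alpha> = lab x"
  using rr_cancel[OF assms(1,2) lab(1)[OF assms(1)]] lab(2)[OF assms(1)] assms(3) by simp

lemma lab_s: assumes "x \<in> carrier W" shows "lab (x \<cdot> s) = lab x"
  using lab_unique[of "x \<cdot> s" "lab x"] assms lab[OF assms] rr_s[of "lab x" x] rr_rr[of "lab x" x] by auto

abbreviation cs :: "'v affine_trans \<Rightarrow> 'v affine_trans set" where "cs \<equiv> coset \<Delta> s"

lemma cs_def': "cs x = {x, x \<cdot> s}" by (simp add: coset_def)

lemma cs_s [simp]: "x \<in> carrier W \<Longrightarrow> cs (x \<cdot> s) = cs x" by (auto simp: cs_def')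
lemma cs_self [simp]: "x \<in> cs x" by (simp add: cs_def')
lemma cs_W: "x \<in> carrier W \<Longrightarrow> u \<in> cs x \<Longrightarrow> u \<in> carrier W" by (auto simp: cs_def')
lemma cs_eq: "x \<in> carrier W \<Longrightarrow> u \<in> cs x \<Longrightarrow> cs u = cs x" by (auto simp: cs_def')
lemma cs_eq_iff: "x \<in> carrier W \<Longrightarrow> u \<in> carrier W \<Longrightarrow> cs u = cs x \<longleftrightarrow> u = x \<or> u = x \<cdot> s"
  using cs_eq[of x u] cs_self[of u] by (auto simp: cs_def')
lemma cosets_cs: "x \<in> carrier W \<Longrightarrow> cs x \<in> cosets \<Delta> s" by (simp add: cosets_def)
lemma cosets_W: "X \<in> cosets \<Delta> s \<Longrightarrow> u \<in> X \<Longrightarrow> u \<in> carrier W" by (auto simp: cosets_def intro: cs_W)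
lemma cosets_eq: "X \<in> cosets \<Delta> s \<Longrightarrow> u \<in> X \<Longrightarrow> X = cs u" by (auto simp: cosets_def dest: cs_eq)
lemma cosets_ne: "X \<in> cosets \<Delta> s \<Longrightarrow> \<exists>u. u \<in> X" by (auto simp: cosets_def cs_def')
lemma finite_coset: "X \<in> cosets \<Delta> s \<Longrightarrow> finite X" by (auto simp: cosets_def cs_def')

lemma rr_cs: "\<alpha> \<in> PR \<Longrightarrow> x \<in> carrier W \<Longrightarrow> (\<lambda>u. rr \<alpha> \<cdot> u) ` cs x = cs (rr \<alpha> \<cdot> x)"
  by (simp add: cs_def' rr_s)

lemma rr_not_s: "\<alpha> \<in> PR \<Longrightarrow> x \<in> carrier W \<Longrightarrow> cs (rr \<alpha> \<cdot> x) = cs x \<longleftrightarrow> rr \<alpha> \<cdot> x = x \<cdot> s"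
  using cs_eq_iff[of x "rr \<alpha> \<cdot> x"] rr_ne[of x \<alpha>] by auto

lemma rr_not_s': 
  assumes "\<alpha> \<in> PR" "x \<in> carrier W" "cs (rr \<alpha> \<cdot> x) \<noteq> cs x"
  shows "rr \<alpha> \<cdot> x \<noteq> x \<cdot> s" "\<alpha> \<noteq> lab x"
  using assms rr_not_s lab by auto

text \<open>\<open>s\<close> permutes the positive affine roots other than its own, so right multiplication by \<open>s\<close>
  preserves the direction of an edge.\<close>

lemma weyl_less_s:
  assumes x: "x \<in> carrier W" and a: "\<alpha> \<in> PR" and l: "weyl_less \<Delta> x (rr \<alpha> \<cdot> x)" and ne: "cs (rr \<alpha> \<cdot> x) \<noteq> cs x"
  shows "weyl_less \<Delta> (x \<cdot> s) (rr \<alpha> \<cdot> x \<cdot> s)"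
proof -
  define \<beta> where "\<beta> = act (inv\<^bsub>W\<^esub> x) \<alpha>"
  have aA: "\<alpha> \<in> AR" using a PR_AR by blast
  have b: "\<beta> \<in> PR" using weyl_less_refl_iff[OF x a] l by (simp add: \<beta>_def)
  have bA: "\<beta> \<in> AR" using b PR_AR by blast
  have "act x \<beta> = \<alpha>" unfolding \<beta>_def by (rule act_inv(2)[OF x aA])
  have "\<beta> \<noteq> \<gamma>s"
  proof
    assume "\<beta> = \<gamma>s"
    then have "rr \<alpha> \<cdot> x = x \<cdot> s" using root_refl_conj[OF x bA] \<open>act x \<beta> = \<alpha>\<close> \<gamma>s(2)[symmetric] by simp
    then show False using ne rr_not_s[OF a x] by simp
  qed
  then have "arfl \<gamma>s \<beta> \<in> PR" using simple_refl_pos[OF \<gamma>s(1) b] by simp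
  moreover have "act (inv\<^bsub>W\<^esub> (x \<cdot> s)) \<alpha> = arfl \<gamma>s \<beta>"
    using x aA bA \<gamma>s(2)[symmetric] root_refl_inv[OF \<gamma>s_AR] act_root_refl[OF \<gamma>s_AR bA]
    by (simp add: W.inv_mult_group act_mult \<beta>_def)
  ultimately show ?thesis using weyl_less_refl_iff[of "x \<cdot> s" \<alpha>] x a by (simp add: rr_s)
qed

definition wle :: "'v affine_trans \<Rightarrow> 'v affine_trans \<Rightarrow> bool" where "wle x y \<longleftrightarrow> x = y \<or> weyl_less \<Delta> x y"

lemma wle_trans: "wle x y \<Longrightarrow> wle y z \<Longrightarrow> wle x z"
  using weyl_less_trans by (auto simp: wle_def)

text \<open>For a single reflection step, either both ends lie in one coset or multiplication by s
  gives a second, parallel step by \<open>weyl_less_s\<close>. Chains of steps compose; the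
  reflexive \<open>wle\<close> accounts for steps inside a coset.\<close>

lemma weyl_less_cosets:
  assumes "weyl_less \<Delta> u v"
  shows "(\<forall>u'\<in>cs u. \<exists>v'\<in>cs v. wle u' v') \<and> (\<forall>v'\<in>cs v. \<exists>u'\<in>cs u. wle u' v')"
proof -
  have step: "(\<forall>u'\<in>cs u. \<exists>v'\<in>cs v. wle u' v') \<and> (\<forall>v'\<in>cs v. \<exists>u'\<in>cs u. wle u' v')"
    if st: "bruhat_step W S u v" for u v
  proof -
    obtain \<alpha> where a: "u \<in> carrier W" "\<alpha> \<in> PR" "v = rr \<alpha> \<cdot> u" using st bruhat_step_iff by blast
    have l: "weyl_less \<Delta> u v" using st unfolding bruhat_less_def by blast
    show ?thesis
    proof (cases "cs v = cs u")
      case True then show ?thesis by (auto simp: wle_def)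
    next
      case False
      then have "weyl_less \<Delta> (u \<cdot> s) (v \<cdot> s)" using weyl_less_s[OF a(1,2)] l a by simp
      with l show ?thesis by (auto simp: wle_def cs_def')
    qed
  qed
  from assms show ?thesis unfolding bruhat_less_def
  proof (induction rule: tranclp_induct)
    case (base y) then show ?case using step by blast
  next
    case (step y z)
    with \<open>\<And>v u. bruhat_step W S u v \<Longrightarrow> _ u v\<close> have "(\<forall>u'\<in>cs y. \<exists>v'\<in>cs z. wle u' v') \<and> (\<forall>v'\<in>cs z. \<exists>u'\<in>cs y. wle u' v')" by blast
    then show ?case using step.IH wle_trans by meson
  qed
qed

lemma coset_less_wle:
  assumes "X \<in> cosets \<Delta> s" "Y \<in> cosets \<Delta> s" "coset_less \<Delta> X Y"
  shows "\<forall>u'\<in>X. \<exists>v'\<in>Y. wle u' v'" "\<forall>v'\<in>Y. \<exists>u'\<in>X. wle u' v'"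
proof -
  obtain u v where "u \<in> X" "v \<in> Y" "weyl_less \<Delta> u v" using assms(3) by (auto simp: coset_less_def)
  then show "\<forall>u'\<in>X. \<exists>v'\<in>Y. wle u' v'" "\<forall>v'\<in>Y. \<exists>u'\<in>X. wle u' v'"
    using weyl_less_cosets[of u v] cosets_eq assms by metis+
qed

lemma coset_less_asym:
  assumes X: "X \<in> cosets \<Delta> s" and Y: "Y \<in> cosets \<Delta> s" and l: "coset_less \<Delta> X Y"
  shows "\<not> coset_less \<Delta> Y X"
proof
  assume l2: "coset_less \<Delta> Y X"
  have dis: "X \<inter> Y = {}" using cosets_eq[OF X] cosets_eq[OF Y] l by (auto simp: coset_less_def)
  \<comment> \<open>An element of greatest length in X: climbing to Y and back, strictly since X and
    Y are disjoint, leads to a longer element of X.\<close>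
  obtain u where u: "u \<in> X" "wl u = Max (wl ` X)"
    using Max_in[of "wl ` X"] finite_coset[OF X] cosets_ne[OF X] by (metis (no_types, lifting) empty_iff finite_imageI imageE image_is_empty)
  obtain v where v: "v \<in> Y" "wle u v" using coset_less_wle(1)[OF X Y l] u by blast
  obtain w where w: "w \<in> X" "wle v w" using coset_less_wle(1)[OF Y X l2] v by blast
  have "weyl_less \<Delta> u v" "weyl_less \<Delta> v w" using u v w dis by (auto simp: wle_def)
  then have "wl u < wl w" using weyl_less_wl by (meson less_trans)
  moreover have "wl w \<le> wl u" using w u finite_coset[OF X] by simp
  ultimately show False by simp
qed

text \<open>All edges over one coset edge point the same way, because a reversed edge would
  contradict \<open>coset_less_asym\<close>. So the axioms for upper ends apply to both of the edges
  that induce it.\<close>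

lemma coset_less_edge:
  assumes x: "x \<in> carrier W" and a: "\<alpha> \<in> PR" and l: "coset_less \<Delta> (cs x) (cs (rr \<alpha> \<cdot> x))"
  shows "weyl_less \<Delta> x (rr \<alpha> \<cdot> x)"
proof (rule ccontr)
  assume "\<not> ?thesis"
  then have "weyl_less \<Delta> (rr \<alpha> \<cdot> x) x" using weyl_less_refl_total[OF x a] by blast
  then have "coset_less \<Delta> (cs (rr \<alpha> \<cdot> x)) (cs x)" using l cs_self[of x] cs_self[of "rr \<alpha> \<cdot> x"] unfolding coset_less_def by metis
  then show False using coset_less_asym[OF _ _ l] x a cosets_cs by simp
qed

lemma edge_coset_less:
  assumes "weyl_less \<Delta> x y" "cs x \<noteq> cs y" shows "coset_less \<Delta> (cs x) (cs y)"
  using assms by (auto simp: coset_less_def intro: bexI[of _ x] bexI[of _ y])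

lemma coset_less_total:
  assumes "x \<in> carrier W" "\<alpha> \<in> PR" "cs (rr \<alpha> \<cdot> x) \<noteq> cs x"
  shows "coset_less \<Delta> (cs x) (cs (rr \<alpha> \<cdot> x)) \<or> coset_less \<Delta> (cs (rr \<alpha> \<cdot> x)) (cs x)"
  using weyl_less_refl_total[OF assms(1,2)] edge_coset_less assms(3) by metis

definition edg :: "'v affine_trans \<Rightarrow> 'v \<times> int \<Rightarrow> 'v affine_edge" where "edg x \<alpha> = ({x, rr \<alpha> \<cdot> x}, \<alpha>)"
definition cedg :: "'v affine_trans \<Rightarrow> 'v \<times> int \<Rightarrow> 'v affine_coset_edge" where
  "cedg x \<alpha> = ({cs x, cs (rr \<alpha> \<cdot> x)}, \<alpha>)"

lemma edg_rr: "x \<in> carrier W \<Longrightarrow> \<alpha> \<in> PR \<Longrightarrow> edg (rr \<alpha> \<cdot> x) \<alpha> = edg x \<alpha>"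
  by (auto simp: edg_def)

lemma affine_edges_iff: "E \<in> affine_edges \<Delta> \<longleftrightarrow> (\<exists>x\<in>carrier W. \<exists>\<alpha>\<in>PR. E = edg x \<alpha> \<and> weyl_less \<Delta> x (rr \<alpha> \<cdot> x))"
proof
  assume "E \<in> affine_edges \<Delta>" 
  then show "\<exists>x\<in>carrier W. \<exists>\<alpha>\<in>PR. E = edg x \<alpha> \<and> weyl_less \<Delta> x (rr \<alpha> \<cdot> x)"
    by (auto simp: affine_edges_def edg_def)
next
  assume "\<exists>x\<in>carrier W. \<exists>\<alpha>\<in>PR. E = edg x \<alpha> \<and> weyl_less \<Delta> x (rr \<alpha> \<cdot> x)"
  then show "E \<in> affine_edges \<Delta>" unfolding affine_edges_def edg_def
    by (auto simp: insert_commute) (metis W.m_closed rr_W)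
qed

lemma edg_edge: assumes "x \<in> carrier W" "\<alpha> \<in> PR" shows "edg x \<alpha> \<in> affine_edges \<Delta>"
  using weyl_less_refl_total[OF assms]
proof
  assume "weyl_less \<Delta> x (rr \<alpha> \<cdot> x)" then show ?thesis using assms affine_edges_iff by blast
next
  assume "weyl_less \<Delta> (rr \<alpha> \<cdot> x) x" 
  then have "weyl_less \<Delta> (rr \<alpha> \<cdot> x) (rr \<alpha> \<cdot> (rr \<alpha> \<cdot> x))" using assms by simp
  moreover have "rr \<alpha> \<cdot> x \<in> carrier W" using assms by simp
  ultimately show ?thesis using assms affine_edges_iff edg_rr[OF assms] by metis
qed

lemma edge_end: assumes "E \<in> affine_edges \<Delta>" "x \<in> fst E" 
  shows "x \<in> carrier W" "snd E \<in> PR" "E = edg x (snd E)"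
proof -
  obtain z \<alpha> where z: "z \<in> carrier W" "\<alpha> \<in> PR" "E = edg z \<alpha>" using assms(1) affine_edges_iff by blast
  then have "x = z \<or> x = rr \<alpha> \<cdot> z" "snd E = \<alpha>" using assms(2) by (auto simp: edg_def)
  then show "x \<in> carrier W" "snd E \<in> PR" "E = edg x (snd E)" using z edg_rr[of z \<alpha>] by auto
qed

lemma fst_edg [simp]: "fst (edg x \<alpha>) = {x, rr \<alpha> \<cdot> x}" and snd_edg [simp]: "snd (edg x \<alpha>) = \<alpha>"
  by (simp_all add: edg_def)
lemma fst_cedg [simp]: "fst (cedg x \<alpha>) = {cs x, cs (rr \<alpha> \<cdot> x)}" and snd_cedg [simp]: "snd (cedg x \<alpha>) = \<alpha>"
  by (simp_all add: cedg_def)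

lemma joins_iff:
  "fst E = {x, y} \<and> E \<in> affine_edges \<Delta> \<longleftrightarrow> x \<in> carrier W \<and> snd E \<in> PR \<and> y = rr (snd E) \<cdot> x \<and> E = edg x (snd E)"
proof
  assume h: "fst E = {x, y} \<and> E \<in> affine_edges \<Delta>"
  then have e: "x \<in> carrier W" "snd E \<in> PR" "E = edg x (snd E)" using edge_end[of E x] by auto
  then have "{x, y} = {x, rr (snd E) \<cdot> x}" using h fst_edg by metis
  then have "y = rr (snd E) \<cdot> x" using rr_ne[OF e(1,2)] by (auto simp: doubleton_eq_iff)
  then show "x \<in> carrier W \<and> snd E \<in> PR \<and> y = rr (snd E) \<cdot> x \<and> E = edg x (snd E)" using e by simp
next
  assume "x \<in> carrier W \<and> snd E \<in> PR \<and> y = rr (snd E) \<cdot> x \<and> E = edg x (snd E)"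
  then show "fst E = {x, y} \<and> E \<in> affine_edges \<Delta>" using edg_edge fst_edg by metis
qed

lemma cedg_rr: "x \<in> carrier W \<Longrightarrow> \<alpha> \<in> PR \<Longrightarrow> cedg (rr \<alpha> \<cdot> x) \<alpha> = cedg x \<alpha>"
  by (auto simp: cedg_def)
lemma cedg_s: "x \<in> carrier W \<Longrightarrow> \<alpha> \<in> PR \<Longrightarrow> cedg (x \<cdot> s) \<alpha> = cedg x \<alpha>"
  by (auto simp: cedg_def rr_s)

lemma coset_edge_edg [simp]: "coset_edge \<Delta> s (edg x \<alpha>) = cedg x \<alpha>"
  by (simp add: coset_edge_def edg_def cedg_def)

lemma cedg_edge: assumes "x \<in> carrier W" "\<alpha> \<in> PR" "cs (rr \<alpha> \<cdot> x) \<noteq> cs x" shows "cedg x \<alpha> \<in> coset_edges \<Delta> s"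
proof -
  have y: "rr \<alpha> \<cdot> x \<in> carrier W" using assms by simp
  show ?thesis using coset_less_total[OF assms]
  proof
    assume "coset_less \<Delta> (cs x) (cs (rr \<alpha> \<cdot> x))"
    then show ?thesis unfolding coset_edges_def cedg_def
      using assms y cosets_cs rr_cs[OF assms(2,1)] by blast
  next
    assume l: "coset_less \<Delta> (cs (rr \<alpha> \<cdot> x)) (cs x)"
    have "(\<lambda>u. rr \<alpha> \<cdot> u) ` cs (rr \<alpha> \<cdot> x) = cs x" using rr_cs[OF assms(2) y] assms by simp
    moreover have "cedg x \<alpha> = ({cs (rr \<alpha> \<cdot> x), cs x}, \<alpha>)" by (simp add: cedg_def insert_commute)
    ultimately show ?thesis unfolding coset_edges_def
      using assms y cosets_cs l by blast
  qed
qed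

lemma coset_edge_end: assumes "B \<in> coset_edges \<Delta> s" "X \<in> fst B" "x \<in> X"
  shows "x \<in> carrier W" "snd B \<in> PR" "X = cs x" "cs (rr (snd B) \<cdot> x) \<noteq> cs x" "B = cedg x (snd B)"
proof -
  obtain Y Z \<alpha> where b: "Y \<in> cosets \<Delta> s" "Z \<in> cosets \<Delta> s" "\<alpha> \<in> PR" "coset_less \<Delta> Y Z"
    "(\<lambda>u. rr \<alpha> \<cdot> u) ` Y = Z" "B = ({Y, Z}, \<alpha>)" using assms(1) unfolding coset_edges_def by blast
  obtain y where y: "y \<in> carrier W" "Y = cs y" using b(1) by (auto simp: cosets_def)
  have Z: "Z = cs (rr \<alpha> \<cdot> y)" using b y rr_cs by simp
  have B: "B = cedg y \<alpha>" using b y Z by (simp add: cedg_def)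
  have ne: "cs (rr \<alpha> \<cdot> y) \<noteq> cs y" using b(4) y Z by (auto simp: coset_less_def)
  have "X \<in> cosets \<Delta> s" using assms(2) b by auto
  then show 1: "x \<in> carrier W" "X = cs x" using cosets_W cosets_eq assms(3) by blast+
  show 2: "snd B \<in> PR" using b by simp
  have "X = cs y \<or> X = cs (rr \<alpha> \<cdot> y)" using assms(2) b y Z by auto
  then have "x = y \<or> x = y \<cdot> s \<or> x = rr \<alpha> \<cdot> y \<or> x = rr \<alpha> \<cdot> y \<cdot> s" using assms(3) by (auto simp: cs_def')
  then have "cs (rr \<alpha> \<cdot> x) \<noteq> cs x \<and> cedg x \<alpha> = cedg y \<alpha>"
    by (elim disjE) (simp_all add: y(1) b(3) ne ne[symmetric] cedg_s cedg_rr rr_s)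
  then show "cs (rr (snd B) \<cdot> x) \<noteq> cs x" "B = cedg x (snd B)" using B by simp_all
qed

lemma coset_joins_iff:
  "fst B = {X, Y} \<and> B \<in> coset_edges \<Delta> s \<longleftrightarrow>
    (\<exists>x\<in>carrier W. snd B \<in> PR \<and> cs (rr (snd B) \<cdot> x) \<noteq> cs x \<and> X = cs x \<and> Y = cs (rr (snd B) \<cdot> x) \<and> B = cedg x (snd B))"
proof
  assume h: "fst B = {X, Y} \<and> B \<in> coset_edges \<Delta> s"
  then have "X \<in> cosets \<Delta> s" by (auto simp: coset_edges_def doubleton_eq_iff)
  then obtain x where "x \<in> X" using cosets_ne by blast
  then have e: "x \<in> carrier W" "snd B \<in> PR" "X = cs x" "cs (rr (snd B) \<cdot> x) \<noteq> cs x" "B = cedg x (snd B)"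
    using coset_edge_end[of B X x] h by auto
  have "{X, Y} = {cs x, cs (rr (snd B) \<cdot> x)}" using h e fst_cedg by metis
  then have "Y = cs (rr (snd B) \<cdot> x)" using e by (auto simp: doubleton_eq_iff)
  then show "\<exists>x\<in>carrier W. snd B \<in> PR \<and> cs (rr (snd B) \<cdot> x) \<noteq> cs x \<and> X = cs x \<and> Y = cs (rr (snd B) \<cdot> x) \<and> B = cedg x (snd B)"
    using e by blast
next
  assume "\<exists>x\<in>carrier W. snd B \<in> PR \<and> cs (rr (snd B) \<cdot> x) \<noteq> cs x \<and> X = cs x \<and> Y = cs (rr (snd B) \<cdot> x) \<and> B = cedg x (snd B)"
  then show "fst B = {X, Y} \<and> B \<in> coset_edges \<Delta> s" using cedg_edge fst_cedg by metis
qed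

text \<open>The two inducing edges are indexed by the elements u of the coset \<open>cs x\<close>,
  so that identities in the direct sum of edge stalks can be checked for each u.\<close>

lemma inducing_edges_cedg:
  assumes "x \<in> carrier W" "\<alpha> \<in> PR" "cs (rr \<alpha> \<cdot> x) \<noteq> cs x"
  shows "inducing_edges \<Delta> s (cedg x \<alpha>) = (\<lambda>u. edg u \<alpha>) ` cs x"
proof (intro equalityI subsetI)
  fix E assume "E \<in> inducing_edges \<Delta> s (cedg x \<alpha>)"
  then have E: "E \<in> affine_edges \<Delta>" "coset_edge \<Delta> s E = cedg x \<alpha>" by (auto simp: inducing_edges_def)
  then have sE: "snd E = \<alpha>" by (auto simp: coset_edge_def cedg_def)
  have "cs x \<in> cs ` fst E" using E by (auto simp: coset_edge_def cedg_def)
  then obtain u where u: "u \<in> fst E" "cs x = cs u" by blast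
  then have "u \<in> carrier W" "E = edg u \<alpha>" using edge_end[OF E(1) u(1)] sE by auto
  then show "E \<in> (\<lambda>u. edg u \<alpha>) ` cs x" using u cs_self by blast
next
  fix E assume "E \<in> (\<lambda>u. edg u \<alpha>) ` cs x"
  then obtain u where u: "u \<in> cs x" "E = edg u \<alpha>" by blast
  then have "u = x \<or> u = x \<cdot> s" by (simp add: cs_def')
  then have "cedg u \<alpha> = cedg x \<alpha> \<and> u \<in> carrier W"
    by (elim disjE) (simp_all add: cedg_s[OF assms(1,2)] assms(1))
  then show "E \<in> inducing_edges \<Delta> s (cedg x \<alpha>)"
    unfolding u(2) inducing_edges_def using edg_edge[of u \<alpha>] assms(2) by simp
qed

lemma the_end: 
  assumes "x \<in> carrier W" "\<alpha> \<in> PR" "cs (rr \<alpha> \<cdot> x) \<noteq> cs x" "u \<in> cs x"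
  shows "(THE v. v \<in> fst (edg u \<alpha>) \<and> v \<in> cs x) = u"
proof (rule the_equality)
  fix v assume v: "v \<in> fst (edg u \<alpha>) \<and> v \<in> cs x"
  have u: "u \<in> carrier W" "cs u = cs x" using cs_W[OF assms(1,4)] cs_eq[OF assms(1,4)] by simp_all
  have "rr \<alpha> \<cdot> u \<notin> cs x"
  proof
    assume "rr \<alpha> \<cdot> u \<in> cs x"
    then have "cs (rr \<alpha> \<cdot> u) = cs x" using cs_eq assms by blast
    moreover have "u = x \<or> u = x \<cdot> s" using assms(4) by (simp add: cs_def')
    then have "cs (rr \<alpha> \<cdot> u) = cs (rr \<alpha> \<cdot> x)" by (elim disjE) (simp_all add: assms(1,2) rr_s)
    ultimately show False using assms(3) by metis
  qed
  then show "v = u" using v by auto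
qed (use assms(4) in simp)

lemma upper_coset_cedg:
  assumes "x \<in> carrier W" "\<alpha> \<in> PR" "coset_less \<Delta> (cs x) (cs (rr \<alpha> \<cdot> x))"
  shows "upper_coset \<Delta> (cedg x \<alpha>) = cs (rr \<alpha> \<cdot> x)"
  unfolding upper_coset_def
proof (rule the_equality)
  fix Y assume "\<exists>X. fst (cedg x \<alpha>) = {X, Y} \<and> coset_less \<Delta> X Y"
  then obtain X where X: "{cs x, cs (rr \<alpha> \<cdot> x)} = {X, Y}" "coset_less \<Delta> X Y" by auto
  have "\<not> coset_less \<Delta> (cs (rr \<alpha> \<cdot> x)) (cs x)" using coset_less_asym[OF _ _ assms(3)] assms cosets_cs by simp
  then show "Y = cs (rr \<alpha> \<cdot> x)" using X by (auto simp: doubleton_eq_iff)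
qed (use assms(3) in auto)

lemma edge_in_coset: assumes "x \<in> carrier W" "\<alpha> \<in> PR"
  shows "fst (edg x \<alpha>) \<in> cosets \<Delta> s \<longleftrightarrow> cs (rr \<alpha> \<cdot> x) = cs x"
proof
  assume "fst (edg x \<alpha>) \<in> cosets \<Delta> s"
  then have "{x, rr \<alpha> \<cdot> x} = cs x" using cosets_eq[of "fst (edg x \<alpha>)" x] by simp
  then have "rr \<alpha> \<cdot> x \<in> cs x" by blast
  then show "cs (rr \<alpha> \<cdot> x) = cs x" using cs_eq assms by blast
next
  assume "cs (rr \<alpha> \<cdot> x) = cs x"
  then have "rr \<alpha> \<cdot> x = x \<cdot> s" using rr_not_s assms by blast
  then show "fst (edg x \<alpha>) \<in> cosets \<Delta> s" using cosets_cs[OF assms(1)] by (simp add: cs_def')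
qed

end


section \<open>Graded modules and homogeneous components\<close>

lemma (in abelian_monoid) finsum_superset:
  assumes "finite B" "A \<subseteq> B" "\<And>i. i \<in> B - A \<Longrightarrow> f i = \<zero>" "f \<in> B \<rightarrow> carrier G"
  shows "finsum G f A = finsum G f B"
  unfolding finsum_def by (rule comm_monoid.finprod_mono_neutral_cong_left[OF a_comm_monoid]) (use assms in auto)

lemma finsum_additive_map:
  assumes G: "abelian_monoid G" and H: "abelian_monoid H"
    and f: "f \<in> A \<rightarrow> carrier G" and h: "h \<in> carrier G \<rightarrow> carrier H" "h \<zero>\<^bsub>G\<^esub> = \<zero>\<^bsub>H\<^esub>"
    "\<And>x y. x \<in> carrier G \<Longrightarrow> y \<in> carrier G \<Longrightarrow> h (x \<oplus>\<^bsub>G\<^esub> y) = h x \<oplus>\<^bsub>H\<^esub> h y"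
  shows "h (finsum G f A) = finsum H (\<lambda>i. h (f i)) A"
  using f
proof (induction A rule: infinite_finite_induct)
  case (infinite A)
  then show ?case using h(2) abelian_monoid.finsum_infinite[OF G infinite(1)] abelian_monoid.finsum_infinite[OF H infinite(1)]
    by simp
next
  case empty
  then show ?case by (simp add: h(2) abelian_monoid.finsum_empty[OF G] abelian_monoid.finsum_empty[OF H])
next
  case (insert a A)
  then have "f \<in> A \<rightarrow> carrier G" "f a \<in> carrier G" by auto
  moreover have "(\<lambda>i. h (f i)) \<in> A \<rightarrow> carrier H" "h (f a) \<in> carrier H" using insert.prems h(1) by auto
  ultimately show ?case
    using insert.hyps insert.IH by (simp add: h(3) abelian_monoid.finsum_insert[OF G] abelian_monoid.finsum_insert[OF H]
      abelian_monoid.finsum_closed[OF G])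
qed

lemma graded_module_module: "graded_module R M \<Longrightarrow> module R M"
  and graded_module_sub: "graded_module R M \<Longrightarrow> additive_subgroup (grade M i) M"
  and graded_module_smult: "graded_module R M \<Longrightarrow> a \<in> rgrade R i \<Longrightarrow> m \<in> grade M j \<Longrightarrow> a \<odot>\<^bsub>M\<^esub> m \<in> grade M (i + j)"
  by (auto simp: graded_module_def)

lemma grade_carrier: "graded_module R M \<Longrightarrow> m \<in> grade M i \<Longrightarrow> m \<in> carrier M"
  by (rule additive_subgroup.a_Hcarr[OF graded_module_sub])
lemma grade_zero: "graded_module R M \<Longrightarrow> \<zero>\<^bsub>M\<^esub> \<in> grade M i"
  by (rule additive_subgroup.zero_closed[OF graded_module_sub])
lemma grade_add: "graded_module R M \<Longrightarrow> m \<in> grade M i \<Longrightarrow> n \<in> grade M i \<Longrightarrow> m \<oplus>\<^bsub>M\<^esub> n \<in> grade M i"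
  by (rule additive_subgroup.a_closed[OF graded_module_sub])
lemma grade_neg: "graded_module R M \<Longrightarrow> m \<in> grade M i \<Longrightarrow> \<ominus>\<^bsub>M\<^esub> m \<in> grade M i"
  by (rule additive_subgroup.a_inv_closed[OF graded_module_sub])

lemma module_abelian_monoid: "module R M \<Longrightarrow> abelian_monoid M"
  using module.axioms(2) abelian_group.axioms(1) by blast

definition gcomp :: "('a, 'b) gmodule \<Rightarrow> 'b \<Rightarrow> int \<Rightarrow> 'b" where
  "gcomp M m = (THE c. (\<forall>i. c i \<in> grade M i) \<and> finite {i. c i \<noteq> \<zero>\<^bsub>M\<^esub>} \<and>
     m = finsum M c {i. c i \<noteq> \<zero>\<^bsub>M\<^esub>})"

lemma gcomp:
  assumes "graded_module R M" "m \<in> carrier M"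
  shows "gcomp M m i \<in> grade M i" "finite {i. gcomp M m i \<noteq> \<zero>\<^bsub>M\<^esub>}"
    "m = finsum M (gcomp M m) {i. gcomp M m i \<noteq> \<zero>\<^bsub>M\<^esub>}"
proof -
  have "\<exists>!c. (\<forall>i. c i \<in> grade M i) \<and> finite {i. c i \<noteq> \<zero>\<^bsub>M\<^esub>} \<and> m = finsum M c {i. c i \<noteq> \<zero>\<^bsub>M\<^esub>}"
    using assms unfolding graded_module_def by blast
  from theI'[OF this] show "gcomp M m i \<in> grade M i" "finite {i. gcomp M m i \<noteq> \<zero>\<^bsub>M\<^esub>}"
    "m = finsum M (gcomp M m) {i. gcomp M m i \<noteq> \<zero>\<^bsub>M\<^esub>}"
    unfolding gcomp_def by auto
qed

lemma gcomp_carrier: "graded_module R M \<Longrightarrow> m \<in> carrier M \<Longrightarrow> gcomp M m i \<in> carrier M"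
  by (rule grade_carrier[OF _ gcomp(1)])

lemma gcomp_eqI:
  assumes gM: "graded_module R M" and fA: "finite A" and c: "\<And>i. c i \<in> grade M i" "\<And>i. i \<notin> A \<Longrightarrow> c i = \<zero>\<^bsub>M\<^esub>"
    and m: "m = finsum M c A"
  shows "gcomp M m = c"
proof -
  interpret M: module R M using graded_module_module[OF gM] .
  have cc: "c i \<in> carrier M" for i using grade_carrier[OF gM] c by blast
  let ?B = "{i. c i \<noteq> \<zero>\<^bsub>M\<^esub>}"
  have fB: "finite ?B" using fA c(2) by (auto intro: finite_subset)
  have "finsum M c ?B = finsum M c A" using c(2) fA cc by (intro M.finsum_superset) auto
  then have "(\<forall>i. c i \<in> grade M i) \<and> finite ?B \<and> m = finsum M c ?B" using c fB m by auto
  moreover have "m \<in> carrier M" using m cc by auto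
  then have "\<exists>!c. (\<forall>i. c i \<in> grade M i) \<and> finite {i. c i \<noteq> \<zero>\<^bsub>M\<^esub>} \<and> m = finsum M c {i. c i \<noteq> \<zero>\<^bsub>M\<^esub>}"
    using gM unfolding graded_module_def by blast
  ultimately show ?thesis unfolding gcomp_def by (rule the1_equality[rotated])
qed

lemma gcomp_sum:
  assumes gM: "graded_module R M" "m \<in> carrier M" and "finite A" "{i. gcomp M m i \<noteq> \<zero>\<^bsub>M\<^esub>} \<subseteq> A"
  shows "m = finsum M (gcomp M m) A"
proof -
  interpret M: module R M using graded_module_module[OF gM(1)] .
  have "finsum M (gcomp M m) {i. gcomp M m i \<noteq> \<zero>\<^bsub>M\<^esub>} = finsum M (gcomp M m) A"
    using assms gcomp_carrier[OF gM] by (intro M.finsum_superset) auto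
  then show ?thesis using gcomp(3)[OF gM] by simp
qed

lemma gcomp_grade:
  assumes gM: "graded_module R M" and "m \<in> grade M i"
  shows "gcomp M m = (\<lambda>j. if j = i then m else \<zero>\<^bsub>M\<^esub>)"
proof (rule gcomp_eqI[OF gM, of "{i}"])
  interpret M: module R M using graded_module_module[OF gM(1)] .
  show "m = finsum M (\<lambda>j. if j = i then m else \<zero>\<^bsub>M\<^esub>) {i}"
    using grade_carrier[OF assms] by simp
qed (use assms grade_zero[OF gM] in auto)

lemma gcomp_add:
  assumes gM: "graded_module R M" and m: "m \<in> carrier M" and n: "n \<in> carrier M"
  shows "gcomp M (m \<oplus>\<^bsub>M\<^esub> n) i = gcomp M m i \<oplus>\<^bsub>M\<^esub> gcomp M n i"
proof -
  interpret M: module R M using graded_module_module[OF gM] .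
  let ?A = "{i. gcomp M m i \<noteq> \<zero>\<^bsub>M\<^esub>} \<union> {i. gcomp M n i \<noteq> \<zero>\<^bsub>M\<^esub>}"
  have "gcomp M (m \<oplus>\<^bsub>M\<^esub> n) = (\<lambda>i. gcomp M m i \<oplus>\<^bsub>M\<^esub> gcomp M n i)"
  proof (rule gcomp_eqI[OF gM, of ?A])
    show fA: "finite ?A" using gcomp(2)[OF gM m] gcomp(2)[OF gM n] by auto
    show "gcomp M m i \<oplus>\<^bsub>M\<^esub> gcomp M n i \<in> grade M i" for i using gcomp(1)[OF gM] m n grade_add[OF gM] by blast
    show "m \<oplus>\<^bsub>M\<^esub> n = finsum M (\<lambda>i. gcomp M m i \<oplus>\<^bsub>M\<^esub> gcomp M n i) ?A"
      using gcomp_sum[OF gM m fA] gcomp_sum[OF gM n fA] gcomp_carrier[OF gM m] gcomp_carrier[OF gM n]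
      by (subst M.finsum_addf) auto
  qed auto
  then show ?thesis by simp
qed

text \<open>The uniqueness of decompositions follows from additive projections that act on
  homogeneous elements like a Kronecker delta: applying \<open>\<pi> j\<close> to any decomposition
  returns its component of degree j.\<close>

lemma graded_moduleI:
  fixes \<pi> :: "int \<Rightarrow> 'b \<Rightarrow> 'b" and M :: "('a, 'b) gmodule"
  assumes M: "module R M" and sub: "\<And>i. additive_subgroup (grade M i) M"
    and smult: "\<And>i j a m. a \<in> rgrade R i \<Longrightarrow> m \<in> grade M j \<Longrightarrow> a \<odot>\<^bsub>M\<^esub> m \<in> grade M (i + j)"
    and pg: "\<And>i m. m \<in> carrier M \<Longrightarrow> \<pi> i m \<in> grade M i"
    and padd: "\<And>i m n. m \<in> carrier M \<Longrightarrow> n \<in> carrier M \<Longrightarrow> \<pi> i (m \<oplus>\<^bsub>M\<^esub> n) = \<pi> i m \<oplus>\<^bsub>M\<^esub> \<pi> i n"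
    and pid: "\<And>i j m. m \<in> grade M i \<Longrightarrow> \<pi> j m = (if j = i then m else \<zero>\<^bsub>M\<^esub>)"
    and pfin: "\<And>m. m \<in> carrier M \<Longrightarrow> finite {i. \<pi> i m \<noteq> \<zero>\<^bsub>M\<^esub>}"
    and psum: "\<And>m. m \<in> carrier M \<Longrightarrow> m = finsum M (\<lambda>i. \<pi> i m) {i. \<pi> i m \<noteq> \<zero>\<^bsub>M\<^esub>}"
  shows "graded_module R M"
  unfolding graded_module_def
proof (intro conjI allI ballI ex1I[of _ "\<lambda>i. \<pi> i m" for m])
  interpret M: module R M using M .
  fix m c assume m: "m \<in> carrier M" and c: "(\<forall>i. c i \<in> grade M i) \<and> finite {i. c i \<noteq> \<zero>\<^bsub>M\<^esub>} \<and> m = finsum M c {i. c i \<noteq> \<zero>\<^bsub>M\<^esub>}"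
  have gc: "grade M i \<subseteq> carrier M" for i using additive_subgroup.a_subset[OF sub] .
  have z: "\<zero>\<^bsub>M\<^esub> \<in> grade M i" for i using additive_subgroup.zero_closed[OF sub] .
  let ?A = "{i. c i \<noteq> \<zero>\<^bsub>M\<^esub>}"
  show "c = (\<lambda>i. \<pi> i m)"
  proof
    fix j
    have "\<pi> j m = \<pi> j (finsum M c ?A)" using c by simp
    also have "\<dots> = finsum M (\<lambda>i. \<pi> j (c i)) ?A"
    proof (rule finsum_additive_map)
      show "\<pi> j \<in> carrier M \<rightarrow> carrier M" using pg gc by blast
      show "\<pi> j \<zero>\<^bsub>M\<^esub> = \<zero>\<^bsub>M\<^esub>" using pid[OF z] by (metis (full_types))
      show "c \<in> ?A \<rightarrow> carrier M" using c gc by blast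
    qed (use padd M.abelian_monoid_axioms in auto)
    also have "\<dots> = finsum M (\<lambda>i. if j = i then c i else \<zero>\<^bsub>M\<^esub>) ?A"
    proof (rule M.finsum_cong')
      show "(\<lambda>i. if j = i then c i else \<zero>\<^bsub>M\<^esub>) \<in> ?A \<rightarrow> carrier M" using c gc by (intro Pi_I) (auto simp: subset_iff)
      show "\<pi> j (c i) = (if j = i then c i else \<zero>\<^bsub>M\<^esub>)" for i using pid c by blast
    qed simp
    also have "\<dots> = c j"
    proof (cases "j \<in> ?A")
      case True
      have "c \<in> ?A \<rightarrow> carrier M" using c gc by blast
      then show ?thesis using True c by (intro M.finsum_singleton) blast+
    next
      case False
      then have "finsum M (\<lambda>i. if j = i then c i else \<zero>\<^bsub>M\<^esub>) ?A = finsum M (\<lambda>i. \<zero>\<^bsub>M\<^esub>) ?A"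
        by (intro M.finsum_cong') auto
      then show ?thesis using False by simp
    qed
    finally show "c j = \<pi> j m" by simp
  qed
qed (use assms in auto)

lemma graded_homD:
  assumes "f \<in> graded_hom R M N"
  shows "x \<in> carrier M \<Longrightarrow> f x \<in> carrier N"
    "x \<in> carrier M \<Longrightarrow> y \<in> carrier M \<Longrightarrow> f (x \<oplus>\<^bsub>M\<^esub> y) = f x \<oplus>\<^bsub>N\<^esub> f y"
    "a \<in> carrier R \<Longrightarrow> x \<in> carrier M \<Longrightarrow> f (a \<odot>\<^bsub>M\<^esub> x) = a \<odot>\<^bsub>N\<^esub> f x"
    "x \<in> grade M i \<Longrightarrow> f x \<in> grade N i"
  using assms unfolding graded_hom_def by (auto simp: image_subset_iff)

lemma graded_homI:
  assumes "\<And>x. x \<in> carrier M \<Longrightarrow> f x \<in> carrier N"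
    "\<And>x y. x \<in> carrier M \<Longrightarrow> y \<in> carrier M \<Longrightarrow> f (x \<oplus>\<^bsub>M\<^esub> y) = f x \<oplus>\<^bsub>N\<^esub> f y"
    "\<And>a x. a \<in> carrier R \<Longrightarrow> x \<in> carrier M \<Longrightarrow> f (a \<odot>\<^bsub>M\<^esub> x) = a \<odot>\<^bsub>N\<^esub> f x"
    "\<And>x i. x \<in> grade M i \<Longrightarrow> f x \<in> grade N i"
  shows "f \<in> graded_hom R M N"
  using assms unfolding graded_hom_def by auto

lemma additive_zero:
  assumes "abelian_group M" "abelian_group N" "f \<in> carrier M \<rightarrow> carrier N"
    "\<And>x y. x \<in> carrier M \<Longrightarrow> y \<in> carrier M \<Longrightarrow> f (x \<oplus>\<^bsub>M\<^esub> y) = f x \<oplus>\<^bsub>N\<^esub> f y"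
  shows "f \<zero>\<^bsub>M\<^esub> = \<zero>\<^bsub>N\<^esub>"
proof -
  interpret M: abelian_group M by fact
  interpret N: abelian_group N by fact
  have "f \<zero>\<^bsub>M\<^esub> \<in> carrier N" using assms(3) by auto
  moreover have "f \<zero>\<^bsub>M\<^esub> \<oplus>\<^bsub>N\<^esub> f \<zero>\<^bsub>M\<^esub> = f \<zero>\<^bsub>M\<^esub>" using assms(4)[of "\<zero>\<^bsub>M\<^esub>" "\<zero>\<^bsub>M\<^esub>"] by simp
  ultimately show ?thesis using N.add.r_cancel_one by auto
qed

lemma graded_hom_zero:
  assumes "f \<in> graded_hom R M N" "module R M" "module R N" shows "f \<zero>\<^bsub>M\<^esub> = \<zero>\<^bsub>N\<^esub>"
  using assms by (intro additive_zero) (auto dest: module.axioms(2) graded_homD)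

lemma graded_hom_neg:
  assumes "f \<in> graded_hom R M N" "module R M" "module R N" "x \<in> carrier M"
  shows "f (\<ominus>\<^bsub>M\<^esub> x) = \<ominus>\<^bsub>N\<^esub> f x"
proof -
  interpret M: module R M by fact
  interpret N: module R N by fact
  have "f (\<ominus>\<^bsub>M\<^esub> x) \<oplus>\<^bsub>N\<^esub> f x = \<zero>\<^bsub>N\<^esub>"
    using graded_homD(2)[OF assms(1), of "\<ominus>\<^bsub>M\<^esub> x" x] assms graded_hom_zero[OF assms(1-3)] by (simp add: M.l_neg)
  then show ?thesis using assms graded_homD(1)[OF assms(1)] by (simp add: N.minus_equality)
qed

lemma graded_hom_minus:
  assumes "f \<in> graded_hom R M N" "module R M" "module R N" "x \<in> carrier M" "y \<in> carrier M"
  shows "f (x \<ominus>\<^bsub>M\<^esub> y) = f x \<ominus>\<^bsub>N\<^esub> f y"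
proof -
  interpret M: module R M by fact
  show ?thesis using assms by (simp add: a_minus_def graded_hom_neg[OF assms(1-3)] graded_homD(2)[OF assms(1)])
qed

text \<open>The images of the components form a homogeneous decomposition of the image, and there is
  only one.\<close>

lemma gcomp_hom:
  assumes f: "f \<in> graded_hom R M N" and gM: "graded_module R M" and gN: "graded_module R N" and m: "m \<in> carrier M"
  shows "gcomp N (f m) i = f (gcomp M m i)"
proof -
  interpret M: module R M using graded_module_module[OF gM] .
  interpret N: module R N using graded_module_module[OF gN] .
  note f0 = graded_hom_zero[OF f M.module_axioms N.module_axioms]
  let ?A = "{i. gcomp M m i \<noteq> \<zero>\<^bsub>M\<^esub>}"
  have "gcomp N (f m) = (\<lambda>i. f (gcomp M m i))"
  proof (rule gcomp_eqI[OF gN gcomp(2)[OF gM m]])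
    show "f (gcomp M m i) \<in> grade N i" for i using graded_homD(4)[OF f] gcomp(1)[OF gM m] .
    show "i \<notin> ?A \<Longrightarrow> f (gcomp M m i) = \<zero>\<^bsub>N\<^esub>" for i using f0 by simp
    have "f (finsum M (gcomp M m) ?A) = finsum N (\<lambda>i. f (gcomp M m i)) ?A"
      by (rule finsum_additive_map)
        (use f0 graded_homD[OF f] gcomp_carrier[OF gM m] M.abelian_monoid_axioms N.abelian_monoid_axioms in auto)
    then show "f m = finsum N (\<lambda>i. f (gcomp M m i)) ?A" using gcomp(3)[OF gM m] by simp
  qed
  then show ?thesis by simp
qed

lemma gcomp_smult:
  assumes gM: "graded_module R M" and m: "m \<in> carrier M" and a: "a \<in> rgrade R d" "a \<in> carrier R"
  shows "gcomp M (a \<odot>\<^bsub>M\<^esub> m) (d + i) = a \<odot>\<^bsub>M\<^esub> gcomp M m i"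
proof -
  interpret M: module R M using graded_module_module[OF gM] .
  let ?A = "{i. gcomp M m i \<noteq> \<zero>\<^bsub>M\<^esub>}"
  have fA: "finite ?A" using gcomp(2)[OF gM m] .
  have "gcomp M (a \<odot>\<^bsub>M\<^esub> m) = (\<lambda>j. a \<odot>\<^bsub>M\<^esub> gcomp M m (j - d))"
  proof (rule gcomp_eqI[OF gM, of "(\<lambda>i. d + i) ` ?A"])
    show "a \<odot>\<^bsub>M\<^esub> gcomp M m (i - d) \<in> grade M i" for i
      using graded_module_smult[OF gM a(1) gcomp(1)[OF gM m, of "i - d"]] by simp
    show "i \<notin> (\<lambda>i. d + i) ` ?A \<Longrightarrow> a \<odot>\<^bsub>M\<^esub> gcomp M m (i - d) = \<zero>\<^bsub>M\<^esub>" for i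
      using a by (cases "i - d \<in> ?A") (auto simp: image_iff)
    have "a \<odot>\<^bsub>M\<^esub> m = a \<odot>\<^bsub>M\<^esub> finsum M (gcomp M m) ?A" using gcomp(3)[OF gM m] by simp
    also have "\<dots> = finsum M (\<lambda>i. a \<odot>\<^bsub>M\<^esub> gcomp M m i) ?A"
      using M.finsum_smult_ldistr[OF fA a(2)] gcomp_carrier[OF gM m] by auto
    also have "\<dots> = finsum M (\<lambda>j. a \<odot>\<^bsub>M\<^esub> gcomp M m (j - d)) ((\<lambda>i. d + i) ` ?A)"
      using gcomp_carrier[OF gM m] a by (subst M.finsum_reindex) (auto simp: inj_on_def)
    finally show "a \<odot>\<^bsub>M\<^esub> m = finsum M (\<lambda>j. a \<odot>\<^bsub>M\<^esub> gcomp M m (j - d)) ((\<lambda>i. d + i) ` ?A)" .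
  qed (use fA in auto)
  then show ?thesis by simp
qed

text \<open>Transfers module structure and grading along a surjection with homogeneous kernel.
  Transported modules, quotients and images are the instances needed.\<close>

lemma graded_module_surj:
  fixes M :: "('a, 'b) gmodule" and Q :: "('a, 'c) gmodule"
  assumes gM: "graded_module R M" and surj: "f ` carrier M = carrier Q" and f0: "f \<zero>\<^bsub>M\<^esub> = \<zero>\<^bsub>Q\<^esub>"
    and fadd: "\<And>x y. x \<in> carrier M \<Longrightarrow> y \<in> carrier M \<Longrightarrow> f (x \<oplus>\<^bsub>M\<^esub> y) = f x \<oplus>\<^bsub>Q\<^esub> f y"
    and fsm: "\<And>a x. a \<in> carrier R \<Longrightarrow> x \<in> carrier M \<Longrightarrow> f (a \<odot>\<^bsub>M\<^esub> x) = a \<odot>\<^bsub>Q\<^esub> f x"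
    and fgr: "\<And>i. grade Q i = f ` grade M i"
    and ker: "\<And>x i. x \<in> carrier M \<Longrightarrow> f x = \<zero>\<^bsub>Q\<^esub> \<Longrightarrow> f (gcomp M x i) = \<zero>\<^bsub>Q\<^esub>"
    and rg: "\<And>i. rgrade R i \<subseteq> carrier R"
  shows "graded_module R Q" "f \<in> graded_hom R M Q"
proof -
  interpret M: module R M using graded_module_module[OF gM] .
  have ex: "\<exists>x\<in>carrier M. q = f x" if "q \<in> carrier Q" for q using that surj by auto
  have fc: "f x \<in> carrier Q" if "x \<in> carrier M" for x using that surj by auto
  have Q: "module R Q"
  proof (rule moduleI)
    show "abelian_group Q"
    proof (rule abelian_groupI)
      fix x y z assume "x \<in> carrier Q" "y \<in> carrier Q" "z \<in> carrier Q"
      then obtain a b c where "a \<in> carrier M" "b \<in> carrier M" "c \<in> carrier M" "x = f a" "y = f b" "z = f c"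
        using ex by metis
      then show "x \<oplus>\<^bsub>Q\<^esub> y \<oplus>\<^bsub>Q\<^esub> z = x \<oplus>\<^bsub>Q\<^esub> (y \<oplus>\<^bsub>Q\<^esub> z)" by (simp add: fadd[symmetric] M.a_assoc)
    next
      fix x y assume "x \<in> carrier Q" "y \<in> carrier Q"
      then obtain a b where ab: "a \<in> carrier M" "b \<in> carrier M" "x = f a" "y = f b" using ex by metis
      then show "x \<oplus>\<^bsub>Q\<^esub> y = y \<oplus>\<^bsub>Q\<^esub> x" by (simp add: fadd[symmetric] M.a_comm)
      show "x \<oplus>\<^bsub>Q\<^esub> y \<in> carrier Q" using ab fc[of "a \<oplus>\<^bsub>M\<^esub> b"] by (simp add: fadd)
    next
      fix x assume "x \<in> carrier Q"
      then obtain a where a: "a \<in> carrier M" "x = f a" using ex by metis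
      then show "\<zero>\<^bsub>Q\<^esub> \<oplus>\<^bsub>Q\<^esub> x = x" by (simp add: f0[symmetric] fadd[symmetric])
      have "f (\<ominus>\<^bsub>M\<^esub> a) \<oplus>\<^bsub>Q\<^esub> x = \<zero>\<^bsub>Q\<^esub>" using a by (simp add: f0[symmetric] fadd[symmetric] M.l_neg)
      then show "\<exists>y\<in>carrier Q. y \<oplus>\<^bsub>Q\<^esub> x = \<zero>\<^bsub>Q\<^esub>" using fc[of "\<ominus>\<^bsub>M\<^esub> a"] a by blast
    next
      show "\<zero>\<^bsub>Q\<^esub> \<in> carrier Q" using fc[of "\<zero>\<^bsub>M\<^esub>"] f0 by simp
    qed
  next
    fix a x assume "a \<in> carrier R" "x \<in> carrier Q"
    then show "a \<odot>\<^bsub>Q\<^esub> x \<in> carrier Q" using ex[of x] fc fsm by (metis M.smult_closed)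
  next
    fix a b x assume "a \<in> carrier R" "b \<in> carrier R" "x \<in> carrier Q"
    then obtain m where "m \<in> carrier M" "x = f m" using ex by metis
    with \<open>a \<in> _\<close> \<open>b \<in> _\<close> show "(a \<oplus>\<^bsub>R\<^esub> b) \<odot>\<^bsub>Q\<^esub> x = a \<odot>\<^bsub>Q\<^esub> x \<oplus>\<^bsub>Q\<^esub> b \<odot>\<^bsub>Q\<^esub> x"
      "(a \<otimes>\<^bsub>R\<^esub> b) \<odot>\<^bsub>Q\<^esub> x = a \<odot>\<^bsub>Q\<^esub> (b \<odot>\<^bsub>Q\<^esub> x)"
      by (simp_all add: fsm[symmetric] fadd[symmetric] M.smult_l_distr M.smult_assoc1)
  next
    fix a x y assume "a \<in> carrier R" "x \<in> carrier Q" "y \<in> carrier Q"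
    then obtain m n where "m \<in> carrier M" "x = f m" "n \<in> carrier M" "y = f n" using ex by metis
    with \<open>a \<in> _\<close> show "a \<odot>\<^bsub>Q\<^esub> (x \<oplus>\<^bsub>Q\<^esub> y) = a \<odot>\<^bsub>Q\<^esub> x \<oplus>\<^bsub>Q\<^esub> a \<odot>\<^bsub>Q\<^esub> y"
      by (simp add: fsm[symmetric] fadd[symmetric] M.smult_r_distr)
  next
    fix x assume "x \<in> carrier Q"
    then obtain m where "m \<in> carrier M" "x = f m" using ex by metis
    then show "\<one>\<^bsub>R\<^esub> \<odot>\<^bsub>Q\<^esub> x = x" by (simp add: fsm[symmetric])
  qed (rule M.R.is_cring)
  interpret Q: module R Q by (rule Q)
  note gc = gcomp_carrier[OF gM]
  have fneg: "f (\<ominus>\<^bsub>M\<^esub> x) = \<ominus>\<^bsub>Q\<^esub> f x" if "x \<in> carrier M" for x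
  proof -
    have "f (\<ominus>\<^bsub>M\<^esub> x) \<oplus>\<^bsub>Q\<^esub> f x = \<zero>\<^bsub>Q\<^esub>" using that by (simp add: f0[symmetric] fadd[symmetric] M.l_neg)
    then show ?thesis using that fc by (simp add: Q.minus_equality)
  qed
  \<comment> \<open>Components downstairs are computed from a lift; homogeneity of the kernel makes
    the result independent of the lift.\<close>
  have wd: "f (gcomp M x i) = f (gcomp M y i)" if xy: "x \<in> carrier M" "y \<in> carrier M" "f x = f y" for x y i
  proof -
    have "f (x \<oplus>\<^bsub>M\<^esub> \<ominus>\<^bsub>M\<^esub> y) = \<zero>\<^bsub>Q\<^esub>" using xy fc by (simp add: fadd fneg Q.r_neg)
    then have "f (gcomp M (x \<oplus>\<^bsub>M\<^esub> \<ominus>\<^bsub>M\<^esub> y) i) = \<zero>\<^bsub>Q\<^esub>" using ker xy by simp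
    then have "f (gcomp M (x \<oplus>\<^bsub>M\<^esub> \<ominus>\<^bsub>M\<^esub> y) i) \<oplus>\<^bsub>Q\<^esub> f (gcomp M y i) = f (gcomp M y i)"
      using fc gc[OF xy(2)] by simp
    moreover have "gcomp M x i = gcomp M (x \<oplus>\<^bsub>M\<^esub> \<ominus>\<^bsub>M\<^esub> y) i \<oplus>\<^bsub>M\<^esub> gcomp M y i"
      using gcomp_add[OF gM, of "x \<oplus>\<^bsub>M\<^esub> \<ominus>\<^bsub>M\<^esub> y" y i] xy by (simp add: M.a_assoc M.l_neg)
    ultimately show ?thesis using gc xy by (simp add: fadd)
  qed
  define g where "g q = (SOME x. x \<in> carrier M \<and> f x = q)" for q
  have g: "g q \<in> carrier M" "f (g q) = q" if "q \<in> carrier Q" for q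
    using someI_ex[of "\<lambda>x. x \<in> carrier M \<and> f x = q"] ex[OF that] unfolding g_def by auto
  have \<pi>: "f (gcomp M (g (f x)) i) = f (gcomp M x i)" if "x \<in> carrier M" for x i
    using wd[OF g(1) that g(2)] fc that by blast
  show "graded_module R Q"
  proof (rule graded_moduleI[where \<pi> = "\<lambda>i q. f (gcomp M (g q) i)", OF Q])
    fix i
    show "additive_subgroup (grade Q i) Q"
    proof (rule additive_subgroupI, rule group.subgroupI)
      show "group (add_monoid Q)" by (rule Q.a_group)
      show "grade Q i \<subseteq> carrier (add_monoid Q)" using fgr grade_carrier[OF gM] fc by auto
      show "grade Q i \<noteq> {}" using fgr grade_zero[OF gM] by auto
    next
      fix a assume "a \<in> grade Q i"
      then obtain x where x: "x \<in> grade M i" "a = f x" using fgr by auto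
      then have "\<ominus>\<^bsub>Q\<^esub> a = f (\<ominus>\<^bsub>M\<^esub> x)" using fneg grade_carrier[OF gM] by simp
      then show "inv\<^bsub>add_monoid Q\<^esub> a \<in> grade Q i" using fgr x grade_neg[OF gM x(1)] by (simp add: a_inv_def)
    next
      fix a b assume "a \<in> grade Q i" "b \<in> grade Q i"
      then obtain x y where x: "x \<in> grade M i" "a = f x" "y \<in> grade M i" "b = f y" using fgr by auto
      then have "a \<oplus>\<^bsub>Q\<^esub> b = f (x \<oplus>\<^bsub>M\<^esub> y)" using fadd grade_carrier[OF gM] by simp
      then show "a \<otimes>\<^bsub>add_monoid Q\<^esub> b \<in> grade Q i" using fgr x grade_add[OF gM x(1,3)] by simp
    qed
  next
    fix i j a m assume a: "a \<in> rgrade R i" "m \<in> grade Q j"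
    then obtain x where x: "x \<in> grade M j" "m = f x" using fgr by auto
    have "a \<in> carrier R" using a rg by blast
    then have "a \<odot>\<^bsub>Q\<^esub> m = f (a \<odot>\<^bsub>M\<^esub> x)" using fsm grade_carrier[OF gM x(1)] x by simp
    then show "a \<odot>\<^bsub>Q\<^esub> m \<in> grade Q (i + j)" using fgr graded_module_smult[OF gM a(1) x(1)] by simp
  next
    fix i m assume "m \<in> carrier Q"
    then show "f (gcomp M (g m) i) \<in> grade Q i" using fgr gcomp(1)[OF gM] g by blast
  next
    fix i m n assume "m \<in> carrier Q" "n \<in> carrier Q"
    then obtain x y where x: "x \<in> carrier M" "m = f x" "y \<in> carrier M" "n = f y" using ex by metis
    then have "m \<oplus>\<^bsub>Q\<^esub> n = f (x \<oplus>\<^bsub>M\<^esub> y)" using fadd by simp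
    then show "f (gcomp M (g (m \<oplus>\<^bsub>Q\<^esub> n)) i) = f (gcomp M (g m) i) \<oplus>\<^bsub>Q\<^esub> f (gcomp M (g n) i)"
      using x \<pi>[of "x \<oplus>\<^bsub>M\<^esub> y"] \<pi>[of x] \<pi>[of y] gcomp_add[OF gM x(1,3)] fadd[OF gc gc, OF x(1,3)] by simp
  next
    fix i j m assume "m \<in> grade Q i"
    then obtain x where x: "x \<in> grade M i" "m = f x" using fgr by auto
    then show "f (gcomp M (g m) j) = (if j = i then m else \<zero>\<^bsub>Q\<^esub>)"
      using \<pi> grade_carrier[OF gM x(1)] gcomp_grade[OF gM x(1)] f0 by simp
  next
    fix m assume "m \<in> carrier Q"
    then obtain x where x: "x \<in> carrier M" "m = f x" using ex by metis
    let ?B = "{i. gcomp M x i \<noteq> \<zero>\<^bsub>M\<^esub>}"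
    have e: "f (gcomp M (g m) i) = f (gcomp M x i)" for i using \<pi> x by simp
    let ?A = "{i. f (gcomp M (g m) i) \<noteq> \<zero>\<^bsub>Q\<^esub>}"
    have AB: "?A \<subseteq> ?B" using e f0 by auto
    show fin: "finite ?A" using AB gcomp(2)[OF gM x(1)] finite_subset by blast
    have "m = f (finsum M (gcomp M x) ?B)" using x gcomp(3)[OF gM x(1)] by simp
    also have "\<dots> = finsum Q (\<lambda>i. f (gcomp M x i)) ?B"
      by (rule finsum_additive_map) (use gc[OF x(1)] fc f0 fadd M.abelian_monoid_axioms Q.abelian_monoid_axioms in auto)
    also have "\<dots> = finsum Q (\<lambda>i. f (gcomp M (g m) i)) ?B" using e by simp
    also have "\<dots> = finsum Q (\<lambda>i. f (gcomp M (g m) i)) ?A"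
      by (rule Q.finsum_superset[symmetric]) (use AB gcomp(2)[OF gM x(1)] e fc gc[OF x(1)] in auto)
    finally show "m = finsum Q (\<lambda>i. f (gcomp M (g m) i)) ?A" .
  qed
  show "f \<in> graded_hom R M Q" using fc fadd fsm fgr by (intro graded_homI) auto
qed

text \<open>Closure under homogeneous components ensures that the traces of the grades on C still
  decompose C. Negatives come from the scalar -1.\<close>

lemma graded_module_gsubmodule:
  fixes M :: "('a, 'b) gmodule"
  assumes gM: "graded_module R M" and sub: "C \<subseteq> carrier M" and z: "\<zero>\<^bsub>M\<^esub> \<in> C"
    and add: "\<And>x y. x \<in> C \<Longrightarrow> y \<in> C \<Longrightarrow> x \<oplus>\<^bsub>M\<^esub> y \<in> C"
    and sm: "\<And>a x. a \<in> carrier R \<Longrightarrow> x \<in> C \<Longrightarrow> a \<odot>\<^bsub>M\<^esub> x \<in> C"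
    and gc: "\<And>x i. x \<in> C \<Longrightarrow> gcomp M x i \<in> C" and rg: "\<And>i. rgrade R i \<subseteq> carrier R"
  shows "graded_module R (gsubmodule M C)"
proof -
  interpret M: module R M using graded_module_module[OF gM] .
  let ?C = "gsubmodule M C"
  have [simp]: "carrier ?C = C" "zero ?C = \<zero>\<^bsub>M\<^esub>" "add ?C = add M" "smult ?C = smult M" "grade ?C i = grade M i \<inter> C" for i
    by (simp_all add: gsubmodule_def)
  have c: "x \<in> C \<Longrightarrow> x \<in> carrier M" for x using sub by auto
  have neg: "\<ominus>\<^bsub>M\<^esub> x \<in> C" if "x \<in> C" for x
  proof -
    have "(\<ominus>\<^bsub>R\<^esub> \<one>\<^bsub>R\<^esub>) \<odot>\<^bsub>M\<^esub> x = \<ominus>\<^bsub>M\<^esub> x" using c[OF that] by (simp add: M.smult_l_minus)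
    then show ?thesis using sm[of "\<ominus>\<^bsub>R\<^esub> \<one>\<^bsub>R\<^esub>" x] that by simp
  qed
  have C: "module R ?C"
  proof (rule moduleI)
    show "abelian_group ?C"
    proof (rule abelian_groupI)
      fix x assume "x \<in> carrier ?C"
      then show "\<exists>y\<in>carrier ?C. y \<oplus>\<^bsub>?C\<^esub> x = \<zero>\<^bsub>?C\<^esub>" using neg M.l_neg c by auto
    qed (use add c z in \<open>auto simp: M.a_ac\<close>)
  qed (use M.R.is_cring sm c in \<open>auto simp: M.smult_l_distr M.smult_r_distr M.smult_assoc1\<close>)
  interpret C: module R ?C by (rule C)
  have fs: "finsum ?C h A = finsum M h A" if "h \<in> A \<rightarrow> C" for h :: "int \<Rightarrow> 'b" and A
    using finsum_additive_map[OF C.abelian_monoid_axioms M.abelian_monoid_axioms, of h A "\<lambda>x. x"] that c by auto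
  show ?thesis
  proof (rule graded_moduleI[where \<pi> = "\<lambda>i x. gcomp M x i", OF C])
    fix i
    show "additive_subgroup (grade ?C i) ?C"
    proof (rule additive_subgroupI, rule group.subgroupI)
      show "group (add_monoid ?C)" by (rule C.a_group)
      show "grade ?C i \<noteq> {}" using z grade_zero[OF gM, of i] by auto
    next
      fix a assume a: "a \<in> grade ?C i"
      then have "\<ominus>\<^bsub>M\<^esub> a \<oplus>\<^bsub>M\<^esub> a = \<zero>\<^bsub>M\<^esub>" using c by (simp add: M.l_neg)
      then have "\<ominus>\<^bsub>?C\<^esub> a = \<ominus>\<^bsub>M\<^esub> a" using a neg by (intro C.minus_equality) auto
      then show "inv\<^bsub>add_monoid ?C\<^esub> a \<in> grade ?C i" using a neg grade_neg[OF gM] by (simp add: a_inv_def)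
    qed (use add grade_add[OF gM] in auto)
  next
    fix m assume m: "m \<in> carrier ?C"
    show "finite {i. gcomp M m i \<noteq> \<zero>\<^bsub>?C\<^esub>}" using gcomp(2)[OF gM] m c by simp
    show "m = finsum ?C (\<lambda>i. gcomp M m i) {i. gcomp M m i \<noteq> \<zero>\<^bsub>?C\<^esub>}"
      using gcomp(3)[OF gM, of m] m c gc by (subst fs) auto
  qed (use gc gcomp[OF gM] c gcomp_add[OF gM] gcomp_grade[OF gM] graded_module_smult[OF gM] sm subsetD[OF rg] in auto)
qed


section \<open>Direct sums, shifts, transports and quotients\<close>

lemma gsum_simps [simp]:
  "carrier (gsum I N) = (\<Pi>\<^sub>E i\<in>I. carrier (N i))" "zero (gsum I N) = (\<lambda>i\<in>I. \<zero>\<^bsub>N i\<^esub>)"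
  "f \<oplus>\<^bsub>gsum I N\<^esub> g = (\<lambda>i\<in>I. f i \<oplus>\<^bsub>N i\<^esub> g i)" "a \<odot>\<^bsub>gsum I N\<^esub> f = (\<lambda>i\<in>I. a \<odot>\<^bsub>N i\<^esub> f i)"
  "grade (gsum I N) d = (\<Pi>\<^sub>E i\<in>I. grade (N i) d)"
  by (simp_all add: gsum_def)

lemma gsum_module:
  assumes R: "cring R" and N: "\<And>i. i \<in> I \<Longrightarrow> module R (N i)"
  shows "module R (gsum I N)"
proof (rule moduleI[OF R])
  note ag = module.axioms(2)[OF N]
  note a = abelian_group.axioms(1)[OF ag]
  have mem: "f i \<in> carrier (N i)" if "f \<in> (\<Pi>\<^sub>E i\<in>I. carrier (N i))" "i \<in> I" for f i using that by auto
  have ext: "(\<lambda>i\<in>I. F i) = f" if "f \<in> (\<Pi>\<^sub>E i\<in>I. C i)" "\<And>i. i \<in> I \<Longrightarrow> F i = f i" for F f and C :: "_ \<Rightarrow> _ set"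
    using that by (auto simp: PiE_def extensional_def restrict_def fun_eq_iff)
  show "abelian_group (gsum I N)"
  proof (rule abelian_groupI)
    fix x y z assume x: "x \<in> carrier (gsum I N)" "y \<in> carrier (gsum I N)" "z \<in> carrier (gsum I N)"
    show "x \<oplus>\<^bsub>gsum I N\<^esub> y \<oplus>\<^bsub>gsum I N\<^esub> z = x \<oplus>\<^bsub>gsum I N\<^esub> (y \<oplus>\<^bsub>gsum I N\<^esub> z)"
    proof -
      have "x i \<oplus>\<^bsub>N i\<^esub> y i \<oplus>\<^bsub>N i\<^esub> z i = x i \<oplus>\<^bsub>N i\<^esub> (y i \<oplus>\<^bsub>N i\<^esub> z i)" if "i \<in> I" for i
        using x that by (intro abelian_monoid.a_assoc[OF a]) auto
      then show ?thesis by (auto intro!: restrict_ext)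
    qed
  next
    fix x y assume x: "x \<in> carrier (gsum I N)" "y \<in> carrier (gsum I N)"
    show "x \<oplus>\<^bsub>gsum I N\<^esub> y = y \<oplus>\<^bsub>gsum I N\<^esub> x"
      using x by (auto intro!: restrict_ext simp: abelian_monoid.a_comm[OF a] mem)
    show "x \<oplus>\<^bsub>gsum I N\<^esub> y \<in> carrier (gsum I N)"
      using x by (auto simp: abelian_monoid.a_closed[OF a] mem)
  next
    fix x assume x: "x \<in> carrier (gsum I N)"
    show "\<zero>\<^bsub>gsum I N\<^esub> \<oplus>\<^bsub>gsum I N\<^esub> x = x"
      unfolding gsum_simps by (rule ext) (use x in \<open>auto simp: abelian_monoid.l_zero[OF a] mem\<close>)
    have "(\<lambda>i\<in>I. \<ominus>\<^bsub>N i\<^esub> x i) \<in> carrier (gsum I N)"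
      using x by (auto simp: abelian_group.a_inv_closed[OF ag] mem)
    moreover have "(\<lambda>i\<in>I. \<ominus>\<^bsub>N i\<^esub> x i) \<oplus>\<^bsub>gsum I N\<^esub> x = \<zero>\<^bsub>gsum I N\<^esub>"
      using x by (auto intro!: restrict_ext simp: abelian_group.l_neg[OF ag] mem)
    ultimately show "\<exists>y\<in>carrier (gsum I N). y \<oplus>\<^bsub>gsum I N\<^esub> x = \<zero>\<^bsub>gsum I N\<^esub>" by blast
  qed (auto simp: abelian_monoid.zero_closed[OF a])
  let ?G = "gsum I N"
  show "r \<odot>\<^bsub>?G\<^esub> x \<in> carrier ?G" if "r \<in> carrier R" "x \<in> carrier ?G" for r x
    using that by (auto simp: module.smult_closed[OF N] mem)
  show "(r \<oplus>\<^bsub>R\<^esub> b) \<odot>\<^bsub>?G\<^esub> x = r \<odot>\<^bsub>?G\<^esub> x \<oplus>\<^bsub>?G\<^esub> b \<odot>\<^bsub>?G\<^esub> x"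
    if "r \<in> carrier R" "b \<in> carrier R" "x \<in> carrier ?G" for r b x
    using that by (auto intro!: restrict_ext simp: module.smult_l_distr[OF N] mem)
  show "r \<odot>\<^bsub>?G\<^esub> (x \<oplus>\<^bsub>?G\<^esub> y) = r \<odot>\<^bsub>?G\<^esub> x \<oplus>\<^bsub>?G\<^esub> r \<odot>\<^bsub>?G\<^esub> y"
    if "r \<in> carrier R" "x \<in> carrier ?G" "y \<in> carrier ?G" for r x y
    using that by (auto intro!: restrict_ext simp: module.smult_r_distr[OF N] mem)
  show "(r \<otimes>\<^bsub>R\<^esub> b) \<odot>\<^bsub>?G\<^esub> x = r \<odot>\<^bsub>?G\<^esub> (b \<odot>\<^bsub>?G\<^esub> x)"
    if "r \<in> carrier R" "b \<in> carrier R" "x \<in> carrier ?G" for r b x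
    using that by (auto intro!: restrict_ext simp: module.smult_assoc1[OF N] mem)
  show "\<one>\<^bsub>R\<^esub> \<odot>\<^bsub>?G\<^esub> x = x" if "x \<in> carrier ?G" for x
    unfolding gsum_simps by (rule ext) (use that in \<open>auto simp: module.smult_one[OF N] mem\<close>)
qed

lemma gsum_eqI:
  assumes "f \<in> carrier (gsum I N)" "g \<in> carrier (gsum I N)" "\<And>i. i \<in> I \<Longrightarrow> f i = g i" shows "f = g"
  using assms by (auto intro: PiE_ext)

text \<open>Components are taken in each coordinate; finiteness of I keeps the set of degrees that
  occur finite.\<close>

lemma gsum_graded_module:
  assumes R: "cring R" and I: "finite I" and N: "\<And>i. i \<in> I \<Longrightarrow> graded_module R (N i)"
  shows "graded_module R (gsum I N)"
proof -
  have N': "module R (N i)" if "i \<in> I" for i using graded_module_module[OF N[OF that]] .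
  note ag = module.axioms(2)[OF N'] and am = module_abelian_monoid[OF N']
  have G: "module R (gsum I N)" by (rule gsum_module[OF R N'])
  interpret G: module R "gsum I N" by (rule G)
  show ?thesis
  proof (rule graded_moduleI[where \<pi> = "\<lambda>d f. \<lambda>i\<in>I. gcomp (N i) (f i) d", OF G])
    fix d
    show "additive_subgroup (grade (gsum I N) d) (gsum I N)"
    proof (rule additive_subgroupI, rule group.subgroupI)
      show "group (add_monoid (gsum I N))" by (rule G.a_group)
      show "grade (gsum I N) d \<subseteq> carrier (add_monoid (gsum I N))"
        using grade_carrier[OF N] by (auto intro!: PiE_mono)
      show "grade (gsum I N) d \<noteq> {}" using grade_zero[OF N] by (auto simp: PiE_eq_empty_iff)
    next
      fix f assume f: "f \<in> grade (gsum I N) d"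
      then have fc: "f \<in> carrier (gsum I N)" using grade_carrier[OF N] by (auto simp: PiE_iff)
      have "\<ominus>\<^bsub>N i\<^esub> f i \<in> carrier (N i) \<and> \<ominus>\<^bsub>N i\<^esub> f i \<oplus>\<^bsub>N i\<^esub> f i = \<zero>\<^bsub>N i\<^esub>" if "i \<in> I" for i
        using abelian_group.l_neg[OF ag[OF that], of "f i"] abelian_group.a_inv_closed[OF ag[OF that], of "f i"] fc that
        by auto
      then have "\<ominus>\<^bsub>gsum I N\<^esub> f = (\<lambda>i\<in>I. \<ominus>\<^bsub>N i\<^esub> f i)"
        by (intro G.minus_equality) (use fc in \<open>auto intro!: restrict_ext\<close>)
      then have "\<ominus>\<^bsub>gsum I N\<^esub> f \<in> grade (gsum I N) d" using f grade_neg[OF N] by auto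
      then show "inv\<^bsub>add_monoid (gsum I N)\<^esub> f \<in> grade (gsum I N) d" by (simp only: a_inv_def)
    next
      fix f g assume "f \<in> grade (gsum I N) d" "g \<in> grade (gsum I N) d"
      then show "f \<otimes>\<^bsub>add_monoid (gsum I N)\<^esub> g \<in> grade (gsum I N) d"
        by (auto intro!: grade_add[OF N])
    qed
  next
    fix i j a m assume "a \<in> rgrade R i" "m \<in> grade (gsum I N) j"
    then show "a \<odot>\<^bsub>gsum I N\<^esub> m \<in> grade (gsum I N) (i + j)"
      by (auto intro!: graded_module_smult[OF N])
  next
    fix d f assume "f \<in> carrier (gsum I N)"
    then show "(\<lambda>i\<in>I. gcomp (N i) (f i) d) \<in> grade (gsum I N) d" by (auto intro!: gcomp(1)[OF N])
  next
    fix d f g assume fg: "f \<in> carrier (gsum I N)" "g \<in> carrier (gsum I N)"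
    have "gcomp (N i) (f i \<oplus>\<^bsub>N i\<^esub> g i) d = gcomp (N i) (f i) d \<oplus>\<^bsub>N i\<^esub> gcomp (N i) (g i) d" if "i \<in> I" for i
      using fg that by (intro gcomp_add[OF N[OF that]]) auto
    then show "(\<lambda>i\<in>I. gcomp (N i) ((f \<oplus>\<^bsub>gsum I N\<^esub> g) i) d) =
       (\<lambda>i\<in>I. gcomp (N i) (f i) d) \<oplus>\<^bsub>gsum I N\<^esub> (\<lambda>i\<in>I. gcomp (N i) (g i) d)"
      by (auto intro!: restrict_ext)
  next
    fix d e f assume f: "f \<in> grade (gsum I N) d"
    have e: "gcomp (N i) (f i) k = (if k = d then f i else \<zero>\<^bsub>N i\<^esub>)" if "i \<in> I" for i k
      using gcomp_grade[OF N[OF that] PiE_mem[OF f[unfolded gsum_simps] that]] by simp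
    have fr: "restrict f I = f" using f by (auto simp: PiE_iff extensional_restrict)
    have "(\<lambda>i\<in>I. gcomp (N i) (f i) e) = (if e = d then restrict f I else \<zero>\<^bsub>gsum I N\<^esub>)"
      by (cases "e = d") (simp_all add: e cong: restrict_cong)
    then show "(\<lambda>i\<in>I. gcomp (N i) (f i) e) = (if e = d then f else \<zero>\<^bsub>gsum I N\<^esub>)" unfolding fr .
  next
    fix f assume f: "f \<in> carrier (gsum I N)"
    let ?c = "\<lambda>d. \<lambda>i\<in>I. gcomp (N i) (f i) d"
    let ?A = "{d. ?c d \<noteq> \<zero>\<^bsub>gsum I N\<^esub>}"
    have fi: "f i \<in> carrier (N i)" if "i \<in> I" for i using f that by auto
    have cc: "?c d \<in> carrier (gsum I N)" for d using gcomp_carrier[OF N fi] by auto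
    have "?A \<subseteq> (\<Union>i\<in>I. {d. gcomp (N i) (f i) d \<noteq> \<zero>\<^bsub>N i\<^esub>})" by (auto simp: restrict_def fun_eq_iff)
    moreover have "finite (\<Union>i\<in>I. {d. gcomp (N i) (f i) d \<noteq> \<zero>\<^bsub>N i\<^esub>})" using I gcomp(2)[OF N fi] by auto
    ultimately show fin: "finite ?A" by (rule finite_subset)
    show "f = finsum (gsum I N) ?c ?A"
    proof (rule gsum_eqI[OF f])
      show "finsum (gsum I N) ?c ?A \<in> carrier (gsum I N)" using cc by (intro G.finsum_closed) auto
      fix i assume i: "i \<in> I"
      have "(finsum (gsum I N) ?c ?A) i = finsum (N i) (\<lambda>d. ?c d i) ?A"
        by (rule finsum_additive_map[where h = "\<lambda>f. f i", OF G.abelian_monoid_axioms am[OF i]])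
          (use cc i in auto)
      also have "\<dots> = finsum (N i) (gcomp (N i) (f i)) ?A" using i by simp
      also have "\<dots> = f i"
        by (rule gcomp_sum[OF N[OF i] fi[OF i] fin, symmetric]) (use i in \<open>auto simp: restrict_def fun_eq_iff\<close>)
      finally show "f i = (finsum (gsum I N) ?c ?A) i" by simp
    qed
  qed
qed

lemma gsum_proj_hom: "i \<in> I \<Longrightarrow> (\<lambda>f. f i) \<in> graded_hom R (gsum I N) (N i)"
  by (intro graded_homI) auto

lemma gcomp_gsum:
  assumes "cring R" "finite I" "\<And>i. i \<in> I \<Longrightarrow> graded_module R (N i)" "f \<in> carrier (gsum I N)" "i \<in> I"
  shows "gcomp (gsum I N) f d i = gcomp (N i) (f i) d"
  using gcomp_hom[OF gsum_proj_hom[OF assms(5)] gsum_graded_module[OF assms(1-3)] assms(3)[OF assms(5)] assms(4)] by simp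

lemma gshift_simps [simp]:
  "carrier (gshift n M) = carrier M" "zero (gshift n M) = zero M" "add (gshift n M) = add M"
  "smult (gshift n M) = smult M" "grade (gshift n M) i = grade M (i + n)"
  by (simp_all add: gshift_def)

lemma gshift_graded:
  assumes gM: "graded_module R M"
  shows "graded_module R (gshift n M)"
proof -
  interpret M: module R M using graded_module_module[OF gM] .
  have c: "carrier (add_monoid (gshift n M)) = carrier (add_monoid M)" by simp
  have am: "add_monoid (gshift n M) = add_monoid M" by simp
  have fs: "finsum (gshift n M) h A = finsum M h A" for h and A :: "int set" unfolding finsum_def am ..
  have S: "module R (gshift n M)"
  proof (rule moduleI)
    show "abelian_group (gshift n M)"
      by (rule abelian_groupI) (use M.l_neg in \<open>auto simp: M.a_ac\<close>)
  qed (auto simp: M.R.is_cring M.smult_l_distr M.smult_r_distr M.smult_assoc1)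
  show ?thesis
  proof (rule graded_moduleI[where \<pi> = "\<lambda>i m. gcomp M m (i + n)", OF S])
    fix i show "additive_subgroup (grade (gshift n M) i) (gshift n M)"
      using graded_module_sub[OF gM, of "i + n"] by (simp add: additive_subgroup_def am)
  next
    fix i j a m assume "a \<in> rgrade R i" "m \<in> grade (gshift n M) j"
    then show "a \<odot>\<^bsub>gshift n M\<^esub> m \<in> grade (gshift n M) (i + j)"
      using graded_module_smult[OF gM, of a i m "j + n"] by (simp add: add.assoc)
  next
    fix m assume m: "m \<in> carrier (gshift n M)"
    then have m': "m \<in> carrier M" by simp
    let ?A = "{i. gcomp M m (i + n) \<noteq> \<zero>\<^bsub>gshift n M\<^esub>}" and ?B = "{i. gcomp M m i \<noteq> \<zero>\<^bsub>M\<^esub>}"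
    have e: "?B = (\<lambda>i. i + n) ` ?A"
      by (auto simp: image_iff) (metis diff_add_cancel)
    have inj: "inj_on (\<lambda>i. i + n) ?A" by (auto simp: inj_on_def)
    show "finite ?A" using gcomp(2)[OF gM m'] inj by (simp only: e finite_image_iff)
    have "m = finsum M (gcomp M m) ((\<lambda>i. i + n) ` ?A)" using gcomp(3)[OF gM m'] e by simp
    also have "\<dots> = finsum M (\<lambda>i. gcomp M m (i + n)) ?A"
      using gcomp_carrier[OF gM m'] inj by (intro M.finsum_reindex) auto
    finally show "m = finsum (gshift n M) (\<lambda>i. gcomp M m (i + n)) ?A" unfolding fs .
  qed (use gcomp[OF gM] gcomp_add[OF gM] gcomp_grade[OF gM] in auto)
qed

lemma quot_simps:
  "carrier (quot_gmodule M K) = a_rcosets\<^bsub>M\<^esub> K" "zero (quot_gmodule M K) = K"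
  "add (quot_gmodule M K) = set_add M" "a \<odot>\<^bsub>quot_gmodule M K\<^esub> A = (\<Union>m\<in>A. K +>\<^bsub>M\<^esub> (a \<odot>\<^bsub>M\<^esub> m))"
  "grade (quot_gmodule M K) i = (\<lambda>m. K +>\<^bsub>M\<^esub> m) ` grade M i"
  by (simp_all add: quot_gmodule_def module.defs gmodule.defs quot_module_def)

lemma transport_simps:
  assumes "inj h"
  shows "carrier (transport_gmodule h M) = h ` carrier M" "zero (transport_gmodule h M) = h \<zero>\<^bsub>M\<^esub>"
  "h x \<oplus>\<^bsub>transport_gmodule h M\<^esub> h y = h (x \<oplus>\<^bsub>M\<^esub> y)" "a \<odot>\<^bsub>transport_gmodule h M\<^esub> h x = h (a \<odot>\<^bsub>M\<^esub> x)"
  "grade (transport_gmodule h M) i = h ` grade M i"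
  using assms by (simp_all add: transport_gmodule_def the_inv_f_f)

lemma transport_graded:
  assumes gM: "graded_module R M" and h: "inj h" and rg: "\<And>i. rgrade R i \<subseteq> carrier R"
  shows "graded_module R (transport_gmodule h M)" "h \<in> graded_hom R M (transport_gmodule h M)"
proof -
  interpret M: module R M using graded_module_module[OF gM] .
  have ker: "h (gcomp M x i) = \<zero>\<^bsub>transport_gmodule h M\<^esub>" if "x \<in> carrier M" "h x = \<zero>\<^bsub>transport_gmodule h M\<^esub>" for x i
  proof -
    have "x = \<zero>\<^bsub>M\<^esub>" using that h by (simp add: transport_simps inj_eq)
    then show ?thesis using gcomp_grade[OF gM grade_zero[OF gM]] h by (simp add: transport_simps)
  qed
  show "graded_module R (transport_gmodule h M)"
    by (rule graded_module_surj(1)[OF gM, where f = h]) (use ker rg in \<open>auto simp: transport_simps[OF h]\<close>)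
  show "h \<in> graded_hom R M (transport_gmodule h M)"
    by (rule graded_module_surj(2)[OF gM, where f = h]) (use ker rg in \<open>auto simp: transport_simps[OF h]\<close>)
qed

locale homogeneous_submodule =
  fixes R :: "'a graded_ring" and M :: "('a, 'b) gmodule" and K :: "'b set"
  assumes gM: "graded_module R M" and K: "submodule K R M"
    and Kg: "\<And>x i. x \<in> K \<Longrightarrow> gcomp M x i \<in> K" and rg: "\<And>i. rgrade R i \<subseteq> carrier R"
begin

sublocale M: module R M using graded_module_module[OF gM] .

sublocale K: abelian_subgroup K M
proof (rule abelian_subgroupI3)
  show "additive_subgroup K M" using submodule.axioms(1)[OF K] by (rule additive_subgroupI)
qed (rule M.abelian_group_axioms)

lemma coset_zero_iff: assumes "x \<in> carrier M" shows "K +>\<^bsub>M\<^esub> x = K \<longleftrightarrow> x \<in> K"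
  using assms K.a_rcos_const[of x] M.a_coset_join1[OF _ assms K.a_subgroup] by auto

lemma coset_eq_iff: assumes "x \<in> carrier M" "y \<in> carrier M"
  shows "K +>\<^bsub>M\<^esub> x = K +>\<^bsub>M\<^esub> y \<longleftrightarrow> x \<ominus>\<^bsub>M\<^esub> y \<in> K"
  using assms coset_zero_iff[of "x \<ominus>\<^bsub>M\<^esub> y"] M.a_coset_add_inv1[OF _ assms K.a_subset] M.a_coset_add_inv2[OF _ assms K.a_subset]
  by (auto simp: M.minus_eq)

lemma smult_coset:
  assumes a: "a \<in> carrier R" and x: "x \<in> carrier M"
  shows "(\<Union>m\<in>K +>\<^bsub>M\<^esub> x. K +>\<^bsub>M\<^esub> (a \<odot>\<^bsub>M\<^esub> m)) = K +>\<^bsub>M\<^esub> (a \<odot>\<^bsub>M\<^esub> x)"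
proof -
  have "K +>\<^bsub>M\<^esub> (a \<odot>\<^bsub>M\<^esub> m) = K +>\<^bsub>M\<^esub> (a \<odot>\<^bsub>M\<^esub> x)" if "m \<in> K +>\<^bsub>M\<^esub> x" for m
  proof -
    obtain k where k: "k \<in> K" "m = k \<oplus>\<^bsub>M\<^esub> x" using \<open>m \<in> _\<close> by (auto simp: a_r_coset_def')
    have kc: "k \<in> carrier M" using k K.a_subset by auto
    have "a \<odot>\<^bsub>M\<^esub> m \<ominus>\<^bsub>M\<^esub> a \<odot>\<^bsub>M\<^esub> x = a \<odot>\<^bsub>M\<^esub> k"
      using a x kc k by (simp add: M.smult_r_distr M.minus_eq M.a_assoc M.r_neg)
    also have "\<dots> \<in> K" using submodule.smult_closed[OF K a k(1)] .
    finally show ?thesis using coset_eq_iff a x kc k by simp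
  qed
  moreover have "x \<in> K +>\<^bsub>M\<^esub> x" using K.a_rcos_self x by blast
  ultimately show ?thesis by blast
qed

lemma quot_transport_graded:
  assumes h: "inj h"
  shows "graded_module R (transport_gmodule h (quot_gmodule M K))" (is "graded_module R ?Q")
    "(\<lambda>m. h (K +>\<^bsub>M\<^esub> m)) \<in> graded_hom R M (transport_gmodule h (quot_gmodule M K))"
proof -
  let ?f = "\<lambda>m. h (K +>\<^bsub>M\<^esub> m)"
  have 1: "?f ` carrier M = carrier ?Q"
    by (auto simp: transport_simps[OF h] quot_simps A_RCOSETS_def')
  have 2: "?f \<zero>\<^bsub>M\<^esub> = \<zero>\<^bsub>?Q\<^esub>"
    by (simp add: transport_simps[OF h] quot_simps M.a_coset_add_zero[OF K.a_subset])
  have 3: "?f (x \<oplus>\<^bsub>M\<^esub> y) = ?f x \<oplus>\<^bsub>?Q\<^esub> ?f y" if "x \<in> carrier M" "y \<in> carrier M" for x y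
    using that by (simp add: transport_simps[OF h] quot_simps K.a_rcos_sum)
  have 4: "?f (a \<odot>\<^bsub>M\<^esub> x) = a \<odot>\<^bsub>?Q\<^esub> ?f x" if "a \<in> carrier R" "x \<in> carrier M" for a x
    using that by (simp add: transport_simps[OF h] quot_simps smult_coset)
  have 5: "grade ?Q i = ?f ` grade M i" for i
    by (simp add: transport_simps[OF h] quot_simps image_image)
  have 6: "?f (gcomp M x i) = \<zero>\<^bsub>?Q\<^esub>" if x: "x \<in> carrier M" "?f x = \<zero>\<^bsub>?Q\<^esub>" for x i
  proof -
    have "K +>\<^bsub>M\<^esub> x = K" using x(2) h by (simp add: transport_simps[OF h] quot_simps inj_eq)
    then have "gcomp M x i \<in> K" using coset_zero_iff[OF x(1)] Kg by blast
    then have "K +>\<^bsub>M\<^esub> gcomp M x i = K" using coset_zero_iff[OF gcomp_carrier[OF gM x(1)]] by simp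
    then show ?thesis by (simp add: transport_simps[OF h] quot_simps)
  qed
  show "graded_module R ?Q" by (rule graded_module_surj(1)[OF gM 1 2 3 4 5 6 rg])
  show "?f \<in> graded_hom R M ?Q" by (rule graded_module_surj(2)[OF gM 1 2 3 4 5 6 rg])
qed

end


section \<open>Graded free modules\<close>

text \<open>The properties of S on which the module theory rests. The symmetric algebra is shown to
  have them in \<open>Sym_graded_base\<close>.\<close>

locale graded_base =
  fixes R :: "'a graded_ring"
  assumes reg: "graded_module R (regular_gmodule R)" and rg: "\<And>i. rgrade R i \<subseteq> carrier R"
    and one_grade: "\<one>\<^bsub>R\<^esub> \<in> rgrade R 0"
begin

lemma regular_simps [simp]:
  "carrier (regular_gmodule R) = carrier R" "zero (regular_gmodule R) = \<zero>\<^bsub>R\<^esub>" "add (regular_gmodule R) = add R"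
  "smult (regular_gmodule R) = mult R" "grade (regular_gmodule R) i = rgrade R i"
  by (simp_all add: regular_gmodule_def)

sublocale R: cring R
  using graded_module_module[OF reg] by (simp add: module_def)

lemma rgrade_carrier: "a \<in> rgrade R i \<Longrightarrow> a \<in> carrier R" using rg by blast
lemma rgrade_zero: "\<zero>\<^bsub>R\<^esub> \<in> rgrade R i" using grade_zero[OF reg] by simp

abbreviation freemod :: "int list \<Rightarrow> ('a, nat \<Rightarrow> 'a) gmodule" where
  "freemod rs \<equiv> gsum {..<length rs} (\<lambda>i. gshift (rs ! i) (regular_gmodule R))"

lemma freemod_graded: "graded_module R (freemod rs)"
  by (rule gsum_graded_module[OF R.is_cring]) (auto intro: gshift_graded[OF reg])

text \<open>The degree i component of m has the same image as m, so injectivity identifies the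
  two.\<close>

lemma graded_hom_inverse:
  fixes M :: "('a, 'm) gmodule" and N :: "('a, 'n) gmodule"
  assumes gM: "graded_module R M" and gN: "graded_module R N" and f: "f \<in> graded_hom R M N"
    and inj: "inj_on f (carrier M)" and m: "m \<in> carrier M" "f m \<in> grade N i"
  shows "m \<in> grade M i"
proof -
  have "f m = gcomp N (f m) i" using gcomp_grade[OF gN m(2)] by simp
  also have "\<dots> = f (gcomp M m i)" by (rule gcomp_hom[OF f gM gN m(1)])
  finally have "m = gcomp M m i" using inj m(1) gcomp_carrier[OF gM m(1)] by (auto simp: inj_on_def)
  then show ?thesis using gcomp(1)[OF gM m(1), of i] by simp
qed

lemma free_obtain:
  assumes "graded_free R M"
  obtains rs \<phi> where "\<phi> \<in> graded_hom R M (freemod rs)" "bij_betw \<phi> (carrier M) (carrier (freemod rs))"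
  using assms unfolding graded_free_def graded_iso_def by blast

lemma free_regular:
  assumes "graded_free R M" and gM: "graded_module R M" and a: "a \<in> carrier R"
    and reg: "\<And>x. x \<in> carrier R \<Longrightarrow> a \<otimes>\<^bsub>R\<^esub> x = \<zero>\<^bsub>R\<^esub> \<Longrightarrow> x = \<zero>\<^bsub>R\<^esub>"
    and m: "m \<in> carrier M" "a \<odot>\<^bsub>M\<^esub> m = \<zero>\<^bsub>M\<^esub>"
  shows "m = \<zero>\<^bsub>M\<^esub>"
proof -
  interpret M: module R M using graded_module_module[OF gM] .
  obtain rs \<phi> where p: "\<phi> \<in> graded_hom R M (freemod rs)" "bij_betw \<phi> (carrier M) (carrier (freemod rs))"
    using free_obtain[OF assms(1)] .
  note p0 = graded_hom_zero[OF p(1) M.module_axioms graded_module_module[OF freemod_graded]]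
  have pm: "\<phi> m \<in> carrier (freemod rs)" using graded_homD(1)[OF p(1) m(1)] .
  have "a \<odot>\<^bsub>freemod rs\<^esub> \<phi> m = \<zero>\<^bsub>freemod rs\<^esub>" using graded_homD(3)[OF p(1) a m(1)] m(2) p0 by simp
  then have "a \<otimes>\<^bsub>R\<^esub> \<phi> m i = \<zero>\<^bsub>R\<^esub>" if "i < length rs" for i using that by (auto dest!: fun_cong[of _ _ i])
  then have "\<phi> m i = \<zero>\<^bsub>R\<^esub>" if "i < length rs" for i using that reg[of "\<phi> m i"] pm by auto
  then have "\<phi> m = \<zero>\<^bsub>freemod rs\<^esub>" by (intro gsum_eqI[OF pm]) (auto simp: R.zero_closed)
  then show ?thesis using p0 p(2) m(1) by (auto simp: bij_betw_def inj_on_def)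
qed

text \<open>In terms of M/aM: if b acts injectively on S/aS, then it does so on M/aM for free M, as
  one sees in each coordinate.\<close>

lemma free_coprime:
  assumes "graded_free R M" and gM: "graded_module R M" and a: "a \<in> carrier R" and b: "b \<in> carrier R"
    and cop: "\<And>x y. x \<in> carrier R \<Longrightarrow> y \<in> carrier R \<Longrightarrow> b \<otimes>\<^bsub>R\<^esub> x = a \<otimes>\<^bsub>R\<^esub> y \<Longrightarrow> \<exists>z\<in>carrier R. x = a \<otimes>\<^bsub>R\<^esub> z"
    and m: "m \<in> carrier M" and n: "n \<in> carrier M" and e: "b \<odot>\<^bsub>M\<^esub> m = a \<odot>\<^bsub>M\<^esub> n"
  shows "\<exists>k\<in>carrier M. m = a \<odot>\<^bsub>M\<^esub> k"
proof -
  interpret M: module R M using graded_module_module[OF gM] .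
  obtain rs \<phi> where p: "\<phi> \<in> graded_hom R M (freemod rs)" "bij_betw \<phi> (carrier M) (carrier (freemod rs))"
    using free_obtain[OF assms(1)] .
  have pm: "\<phi> m \<in> carrier (freemod rs)" "\<phi> n \<in> carrier (freemod rs)" using graded_homD(1)[OF p(1)] m n by auto
  have "b \<odot>\<^bsub>freemod rs\<^esub> \<phi> m = a \<odot>\<^bsub>freemod rs\<^esub> \<phi> n"
    using graded_homD(3)[OF p(1) a n] graded_homD(3)[OF p(1) b m] e by simp
  then have "b \<otimes>\<^bsub>R\<^esub> \<phi> m i = a \<otimes>\<^bsub>R\<^esub> \<phi> n i" if "i < length rs" for i using that by (auto dest!: fun_cong[of _ _ i])
  moreover have "\<phi> m i \<in> carrier R \<and> \<phi> n i \<in> carrier R" if "i < length rs" for i using pm that by auto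
  ultimately have "\<exists>z\<in>carrier R. \<phi> m i = a \<otimes>\<^bsub>R\<^esub> z" if "i < length rs" for i using cop that by blast
  then obtain z where z: "\<And>i. i < length rs \<Longrightarrow> z i \<in> carrier R \<and> \<phi> m i = a \<otimes>\<^bsub>R\<^esub> z i" by metis
  define w where "w = (\<lambda>i\<in>{..<length rs}. z i)"
  have w: "w \<in> carrier (freemod rs)" using z by (auto simp: w_def)
  then obtain k where k: "k \<in> carrier M" "\<phi> k = w" using p(2) by (metis bij_betw_imp_surj_on imageE)
  have "\<phi> m = a \<odot>\<^bsub>freemod rs\<^esub> w"
    by (rule gsum_eqI[OF pm(1)]) (use z a in \<open>auto simp: w_def\<close>)
  also have "\<dots> = \<phi> (a \<odot>\<^bsub>M\<^esub> k)" using graded_homD(3)[OF p(1) a k(1)] k by simp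
  finally have "m = a \<odot>\<^bsub>M\<^esub> k" using p(2) m a k(1) by (auto simp: bij_betw_def inj_on_def)
  then show ?thesis using k by blast
qed

text \<open>In a free module of positive rank, a vector with entries 1 is not a multiple of a
  nonunit.\<close>

lemma free_nonunit:
  assumes "graded_free R M" and gM: "graded_module R M" and a: "a \<in> carrier R"
    and nu: "\<And>x. x \<in> carrier R \<Longrightarrow> a \<otimes>\<^bsub>R\<^esub> x \<noteq> \<one>\<^bsub>R\<^esub>"
    and m: "\<And>m. m \<in> carrier M \<Longrightarrow> \<exists>n\<in>carrier M. m = a \<odot>\<^bsub>M\<^esub> n"
  shows "carrier M = {\<zero>\<^bsub>M\<^esub>}"
proof -
  interpret M: module R M using graded_module_module[OF gM] .
  obtain rs \<phi> where p: "\<phi> \<in> graded_hom R M (freemod rs)" "bij_betw \<phi> (carrier M) (carrier (freemod rs))"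
    using free_obtain[OF assms(1)] .
  have "rs = []"
  proof (rule ccontr)
    assume "rs \<noteq> []"
    then have l: "0 < length rs" by simp
    define u where "u = (\<lambda>i\<in>{..<length rs}. \<one>\<^bsub>R\<^esub>)"
    have "u \<in> carrier (freemod rs)" by (auto simp: u_def)
    then obtain m where mm: "m \<in> carrier M" "\<phi> m = u" using p(2) by (metis bij_betw_imp_surj_on imageE)
    then obtain n where n: "n \<in> carrier M" "m = a \<odot>\<^bsub>M\<^esub> n" using m by blast
    then have "u = a \<odot>\<^bsub>freemod rs\<^esub> \<phi> n" using graded_homD(3)[OF p(1) a n(1)] mm by simp
    then have "\<one>\<^bsub>R\<^esub> = a \<otimes>\<^bsub>R\<^esub> \<phi> n 0" using l by (auto simp: u_def dest!: fun_cong[of _ _ 0])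
    moreover have "\<phi> n 0 \<in> carrier R" using graded_homD(1)[OF p(1) n(1)] l by auto
    ultimately show False using nu by metis
  qed
  then have "carrier (freemod rs) = {\<lambda>x. undefined}" by simp
  then have "x = y" if "x \<in> carrier M" "y \<in> carrier M" for x y
    using p(2) that by (metis bij_betw_inv_into_left bij_betwE singletonD)
  then show ?thesis using M.zero_closed by blast
qed

definition unitvec :: "int list \<Rightarrow> nat \<Rightarrow> nat \<Rightarrow> 'a" where
  "unitvec rs k = (\<lambda>i\<in>{..<length rs}. if i = k then \<one>\<^bsub>R\<^esub> else \<zero>\<^bsub>R\<^esub>)"

text \<open>Degree i of S<r> is degree i + r of S, so the generator 1 sits in degree -r.\<close>

lemma unitvec_grade: "k < length rs \<Longrightarrow> unitvec rs k \<in> grade (freemod rs) (- (rs ! k))"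
  by (auto simp: unitvec_def one_grade rgrade_zero)

lemma unitvec_carrier: "unitvec rs k \<in> carrier (freemod rs)"
  by (auto simp: unitvec_def)

text \<open>Projectivity of free objects in the graded category: choose homogeneous preimages n of
  the images of the basis vectors e, and extend linearly.\<close>

lemma free_lift:
  fixes M :: "('a, 'm) gmodule" and N :: "('a, 'n) gmodule" and E :: "('a, 'e) gmodule"
  assumes fM: "graded_free R M" and gM: "graded_module R M" and gN: "graded_module R N" and gE: "graded_module R E"
    and g: "g \<in> graded_hom R M E" and h: "h \<in> graded_hom R N E"
    and surj: "\<And>m. m \<in> carrier M \<Longrightarrow> \<exists>n\<in>carrier N. h n = g m"
  shows "\<exists>l\<in>graded_hom R M N. \<forall>m\<in>carrier M. h (l m) = g m"
proof -
  interpret M: module R M using graded_module_module[OF gM] .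
  interpret N: module R N using graded_module_module[OF gN] .
  interpret E: module R E using graded_module_module[OF gE] .
  obtain rs \<phi> where p: "\<phi> \<in> graded_hom R M (freemod rs)" "bij_betw \<phi> (carrier M) (carrier (freemod rs))"
    using free_obtain[OF fM] .
  have inj: "inj_on \<phi> (carrier M)" using p(2) by (rule bij_betw_imp_inj_on)
  let ?I = "{..<length rs}"
  define e where "e k = inv_into (carrier M) \<phi> (unitvec rs k)" for k
  have e: "e k \<in> carrier M" "\<phi> (e k) = unitvec rs k" for k
    using unitvec_carrier[of rs k] p(2) unfolding e_def
    by (auto simp: bij_betw_def intro: inv_into_into f_inv_into_f)
  have eg: "e k \<in> grade M (- (rs ! k))" if "k < length rs" for k
    by (rule graded_hom_inverse[OF gM freemod_graded p(1) inj e(1)]) (use e(2) unitvec_grade[OF that] in simp)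
  \<comment> \<open>An arbitrary preimage may be replaced by its component of the right degree,
    because components commute with degree 0 maps and the target is homogeneous.\<close>
  have "\<exists>n. n \<in> grade N (- (rs ! k)) \<and> h n = g (e k)" if "k < length rs" for k
  proof -
    obtain n where n: "n \<in> carrier N" "h n = g (e k)" using surj[OF e(1)] by blast
    have "h (gcomp N n (- (rs ! k))) = gcomp E (g (e k)) (- (rs ! k))"
      using gcomp_hom[OF h gN gE n(1)] n(2) by simp
    also have "\<dots> = g (e k)" using gcomp_grade[OF gE graded_homD(4)[OF g eg[OF that]]] by simp
    finally show ?thesis using gcomp(1)[OF gN n(1)] by blast
  qed
  then obtain n where n: "\<And>k. k < length rs \<Longrightarrow> n k \<in> grade N (- (rs ! k)) \<and> h (n k) = g (e k)" by metis
  have nc: "n k \<in> carrier N" if "k < length rs" for k using n that grade_carrier[OF gN] by blast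
  have pc: "\<phi> m k \<in> carrier R" if "m \<in> carrier M" "k < length rs" for m k
    using graded_homD(1)[OF p(1) that(1)] that(2) by auto
  define l where "l m = finsum N (\<lambda>k. \<phi> m k \<odot>\<^bsub>N\<^esub> n k) ?I" for m
  have tc: "(\<lambda>k. \<phi> m k \<odot>\<^bsub>N\<^esub> n k) \<in> ?I \<rightarrow> carrier N" if "m \<in> carrier M" for m
    using pc[OF that] nc by auto
  have "l \<in> graded_hom R M N"
  proof (rule graded_homI)
    fix x assume "x \<in> carrier M" then show "l x \<in> carrier N" unfolding l_def using tc by auto
  next
    fix x y assume x: "x \<in> carrier M" and y: "y \<in> carrier M"
    have "l (x \<oplus>\<^bsub>M\<^esub> y) = finsum N (\<lambda>k. \<phi> x k \<odot>\<^bsub>N\<^esub> n k \<oplus>\<^bsub>N\<^esub> \<phi> y k \<odot>\<^bsub>N\<^esub> n k) ?I"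
      unfolding l_def
      by (rule N.finsum_cong') (use x y pc nc graded_homD(2)[OF p(1) x y] in \<open>auto simp: N.smult_l_distr\<close>)
    also have "\<dots> = l x \<oplus>\<^bsub>N\<^esub> l y" unfolding l_def by (rule N.finsum_addf[OF tc[OF x] tc[OF y]])
    finally show "l (x \<oplus>\<^bsub>M\<^esub> y) = l x \<oplus>\<^bsub>N\<^esub> l y" .
  next
    fix a x assume a: "a \<in> carrier R" and x: "x \<in> carrier M"
    have "l (a \<odot>\<^bsub>M\<^esub> x) = finsum N (\<lambda>k. a \<odot>\<^bsub>N\<^esub> (\<phi> x k \<odot>\<^bsub>N\<^esub> n k)) ?I"
      unfolding l_def
      by (rule N.finsum_cong') (use a x pc nc graded_homD(3)[OF p(1) a x] in \<open>auto simp: N.smult_assoc1\<close>)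
    also have "\<dots> = a \<odot>\<^bsub>N\<^esub> l x" unfolding l_def by (rule N.finsum_smult_ldistr[symmetric]) (use a tc[OF x] in auto)
    finally show "l (a \<odot>\<^bsub>M\<^esub> x) = a \<odot>\<^bsub>N\<^esub> l x" .
  next
    fix x d assume x: "x \<in> grade M d"
    have t: "\<phi> x k \<odot>\<^bsub>N\<^esub> n k \<in> grade N d" if "k < length rs" for k
    proof -
      have "\<phi> x k \<in> rgrade R (d + rs ! k)" using graded_homD(4)[OF p(1) x] that by auto
      then show ?thesis using graded_module_smult[OF gN _ conjunct1[OF n[OF that]]] by fastforce
    qed
    have "A \<subseteq> ?I \<longrightarrow> finsum N (\<lambda>k. \<phi> x k \<odot>\<^bsub>N\<^esub> n k) A \<in> grade N d" if "finite A" for A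
      using that
    proof (induction A rule: finite_induct)
      case empty
      show ?case by (simp add: grade_zero[OF gN])
    next
      case (insert k A)
      show ?case
      proof
        assume sub: "insert k A \<subseteq> ?I"
        then have "(\<lambda>k. \<phi> x k \<odot>\<^bsub>N\<^esub> n k) \<in> A \<rightarrow> carrier N" "\<phi> x k \<odot>\<^bsub>N\<^esub> n k \<in> carrier N"
          using tc[OF grade_carrier[OF gM x]] by auto
        then have "finsum N (\<lambda>k. \<phi> x k \<odot>\<^bsub>N\<^esub> n k) (insert k A) =
            \<phi> x k \<odot>\<^bsub>N\<^esub> n k \<oplus>\<^bsub>N\<^esub> finsum N (\<lambda>k. \<phi> x k \<odot>\<^bsub>N\<^esub> n k) A"
          using insert.hyps by (intro N.finsum_insert)
        then show "finsum N (\<lambda>k. \<phi> x k \<odot>\<^bsub>N\<^esub> n k) (insert k A) \<in> grade N d"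
          using insert.IH sub t by (simp add: grade_add[OF gN])
      qed
    qed
    then show "l x \<in> grade N d" unfolding l_def by simp
  qed
  moreover have "h (l m) = g m" if m: "m \<in> carrier M" for m
  proof -
    have "h (l m) = finsum E (\<lambda>k. h (\<phi> m k \<odot>\<^bsub>N\<^esub> n k)) ?I"
      unfolding l_def
      by (rule finsum_additive_map) (use tc[OF m] graded_homD[OF h] graded_hom_zero[OF h N.module_axioms E.module_axioms]
          N.abelian_monoid_axioms E.abelian_monoid_axioms in auto)
    also have "\<dots> = finsum E (\<lambda>k. g (\<phi> m k \<odot>\<^bsub>M\<^esub> e k)) ?I"
    proof (rule E.finsum_cong')
      fix k assume "k \<in> ?I"
      then have k: "k < length rs" by simp
      show "h (\<phi> m k \<odot>\<^bsub>N\<^esub> n k) = g (\<phi> m k \<odot>\<^bsub>M\<^esub> e k)"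
        using graded_homD(3)[OF h pc[OF m k] nc[OF k]] graded_homD(3)[OF g pc[OF m k] e(1)] n[OF k] by simp
    qed (use graded_homD(1)[OF g] pc[OF m] e(1) in auto)
    also have "\<dots> = g (finsum M (\<lambda>k. \<phi> m k \<odot>\<^bsub>M\<^esub> e k) ?I)"
      by (rule finsum_additive_map[symmetric]) (use pc[OF m] e(1) graded_homD[OF g] graded_hom_zero[OF g M.module_axioms E.module_axioms]
          M.abelian_monoid_axioms E.abelian_monoid_axioms in auto)
    also have "finsum M (\<lambda>k. \<phi> m k \<odot>\<^bsub>M\<^esub> e k) ?I = m"
    proof -
      interpret F: module R "freemod rs" using graded_module_module[OF freemod_graded] .
      let ?s = "finsum M (\<lambda>k. \<phi> m k \<odot>\<^bsub>M\<^esub> e k) ?I"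
      have sc: "?s \<in> carrier M" using pc[OF m] e(1) by (intro M.finsum_closed) auto
      have "\<phi> ?s = finsum (freemod rs) (\<lambda>k. \<phi> (\<phi> m k \<odot>\<^bsub>M\<^esub> e k)) ?I"
        by (rule finsum_additive_map) (use pc[OF m] e(1) graded_homD[OF p(1)] graded_hom_zero[OF p(1) M.module_axioms F.module_axioms]
          M.abelian_monoid_axioms F.abelian_monoid_axioms in \<open>auto simp del: gsum_simps\<close>)
      also have "\<dots> = \<phi> m"
      proof (rule gsum_eqI)
        have cc: "(\<lambda>k. \<phi> (\<phi> m k \<odot>\<^bsub>M\<^esub> e k)) \<in> ?I \<rightarrow> carrier (freemod rs)"
          using pc[OF m] e(1) graded_homD(1)[OF p(1)] by (auto simp del: gsum_simps)
        then show "finsum (freemod rs) (\<lambda>k. \<phi> (\<phi> m k \<odot>\<^bsub>M\<^esub> e k)) ?I \<in> carrier (freemod rs)" by (rule F.finsum_closed)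
        fix i assume "i \<in> ?I"
        then have i: "i < length rs" by simp
        have "finsum (freemod rs) (\<lambda>k. \<phi> (\<phi> m k \<odot>\<^bsub>M\<^esub> e k)) ?I i = finsum (regular_gmodule R) (\<lambda>k. \<phi> (\<phi> m k \<odot>\<^bsub>M\<^esub> e k) i) ?I"
          by (rule finsum_additive_map[where h = "\<lambda>f. f i"])
            (use cc i F.abelian_monoid_axioms module_abelian_monoid[OF graded_module_module[OF reg]] in auto)
        also have "\<dots> = finsum (regular_gmodule R) (\<lambda>k. if i = k then \<phi> m k else \<zero>\<^bsub>R\<^esub>) ?I"
        proof (rule abelian_monoid.finsum_cong'[OF module_abelian_monoid[OF graded_module_module[OF reg]]])
          fix k assume "k \<in> ?I"
          then show "\<phi> (\<phi> m k \<odot>\<^bsub>M\<^esub> e k) i = (if i = k then \<phi> m k else \<zero>\<^bsub>R\<^esub>)"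
            using graded_homD(3)[OF p(1) pc[OF m] e(1)] i e(2) pc[OF m] by (auto simp: unitvec_def)
        qed (use pc[OF m] in auto)
        also have "\<dots> = \<phi> m i"
          using abelian_monoid.finsum_singleton[OF module_abelian_monoid[OF graded_module_module[OF reg]], of i ?I "\<phi> m"] pc[OF m] i
          unfolding regular_simps by auto
        finally show "finsum (freemod rs) (\<lambda>k. \<phi> (\<phi> m k \<odot>\<^bsub>M\<^esub> e k)) ?I i = \<phi> m i" .
      qed (rule graded_homD(1)[OF p(1) m])
      finally show ?thesis using inj sc m by (auto simp: inj_on_def)
    qed
    finally show ?thesis .
  qed
  ultimately show ?thesis by blast
qed

text \<open>The section l splits the extension, so n corresponds to the pair of \<open>p n\<close>
  and the preimage under q of n - \<open>l (p n)\<close>. Joining the bases of M1 and of the shifted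
  M2 gives a basis of N.\<close>

lemma free_extension:
  fixes M1 :: "('a, 'm) gmodule" and M2 :: "('a, 'n) gmodule" and N :: "('a, 'e) gmodule"
  assumes f1: "graded_free R M1" and f2: "graded_free R M2" and g1: "graded_module R M1" and g2: "graded_module R M2"
    and gN: "graded_module R N"
    and p: "p \<in> graded_hom R N M1" and l: "l \<in> graded_hom R M1 N" and pl: "\<And>m. m \<in> carrier M1 \<Longrightarrow> p (l m) = m"
    and q: "q \<in> graded_hom R (gshift (- d) M2) N" and inj: "inj_on q (carrier M2)"
    and ker: "\<And>n. n \<in> carrier N \<Longrightarrow> p n = \<zero>\<^bsub>M1\<^esub> \<longleftrightarrow> n \<in> q ` carrier M2"
  shows "graded_free R N"
proof -
  interpret M1: module R M1 using graded_module_module[OF g1] .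
  interpret M2: module R M2 using graded_module_module[OF g2] .
  interpret N: module R N using graded_module_module[OF gN] .
  let ?M2 = "gshift (- d) M2"
  have g2': "graded_module R ?M2" by (rule gshift_graded[OF g2])
  interpret M2': module R ?M2 using graded_module_module[OF g2'] .
  obtain r1 \<phi>1 where p1: "\<phi>1 \<in> graded_hom R M1 (freemod r1)" "bij_betw \<phi>1 (carrier M1) (carrier (freemod r1))"
    using free_obtain[OF f1] .
  obtain r2 \<phi>2 where p2: "\<phi>2 \<in> graded_hom R M2 (freemod r2)" "bij_betw \<phi>2 (carrier M2) (carrier (freemod r2))"
    using free_obtain[OF f2] .
  \<comment> \<open>The projection onto the kernel of p that belongs to the splitting l, read in
    M2.\<close>
  define j where "j n = inv_into (carrier M2) q (n \<ominus>\<^bsub>N\<^esub> l (p n))" for n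
  have lp: "l (p n) \<in> carrier N" if "n \<in> carrier N" for n by (rule graded_homD(1)[OF l graded_homD(1)[OF p that]])
  have kd: "n \<ominus>\<^bsub>N\<^esub> l (p n) \<in> q ` carrier M2" if n: "n \<in> carrier N" for n
  proof -
    have "p (n \<ominus>\<^bsub>N\<^esub> l (p n)) = p n \<ominus>\<^bsub>M1\<^esub> p (l (p n))"
      by (rule graded_hom_minus[OF p N.module_axioms M1.module_axioms n lp[OF n]])
    also have "\<dots> = \<zero>\<^bsub>M1\<^esub>" using pl graded_homD(1)[OF p n] by (simp add: M1.minus_eq M1.r_neg)
    finally show ?thesis using ker n lp[OF n] by simp
  qed
  have j: "j n \<in> carrier M2" "q (j n) = n \<ominus>\<^bsub>N\<^esub> l (p n)" if "n \<in> carrier N" for n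
    using kd[OF that] unfolding j_def by (auto intro: inv_into_into f_inv_into_f)
  have qc: "q b \<in> carrier N" if "b \<in> carrier M2" for b using graded_homD(1)[OF q] that by simp
  have jI: "j n = b" if "n \<in> carrier N" "b \<in> carrier M2" "q b = n \<ominus>\<^bsub>N\<^esub> l (p n)" for n b
    using j[OF that(1)] that inj by (auto simp: inj_on_def)
  have jhom: "j \<in> graded_hom R N ?M2"
  proof (rule graded_homI)
    fix x assume "x \<in> carrier N" then show "j x \<in> carrier ?M2" using j by simp
  next
    fix x y assume x: "x \<in> carrier N" and y: "y \<in> carrier N"
    have "q (j x \<oplus>\<^bsub>M2\<^esub> j y) = q (j x) \<oplus>\<^bsub>N\<^esub> q (j y)" using graded_homD(2)[OF q, of "j x" "j y"] j x y by simp
    also have "\<dots> = (x \<oplus>\<^bsub>N\<^esub> y) \<ominus>\<^bsub>N\<^esub> (l (p x) \<oplus>\<^bsub>N\<^esub> l (p y))"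
      using j x y lp by (simp add: N.minus_eq N.minus_add N.a_ac)
    also have "l (p x) \<oplus>\<^bsub>N\<^esub> l (p y) = l (p (x \<oplus>\<^bsub>N\<^esub> y))"
      using graded_homD(2)[OF p x y] graded_homD(2)[OF l] graded_homD(1)[OF p] x y by simp
    finally show "j (x \<oplus>\<^bsub>N\<^esub> y) = j x \<oplus>\<^bsub>?M2\<^esub> j y" using x y j by (simp add: jI)
  next
    fix a x assume a: "a \<in> carrier R" and x: "x \<in> carrier N"
    have "q (a \<odot>\<^bsub>M2\<^esub> j x) = a \<odot>\<^bsub>N\<^esub> q (j x)" using graded_homD(3)[OF q a, of "j x"] j x by simp
    also have "\<dots> = a \<odot>\<^bsub>N\<^esub> x \<ominus>\<^bsub>N\<^esub> a \<odot>\<^bsub>N\<^esub> l (p x)"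
      using j x a lp by (simp add: N.minus_eq N.smult_r_distr N.smult_r_minus)
    also have "a \<odot>\<^bsub>N\<^esub> l (p x) = l (p (a \<odot>\<^bsub>N\<^esub> x))"
      using graded_homD(3)[OF p a x] graded_homD(3)[OF l a] graded_homD(1)[OF p x] by simp
    finally show "j (a \<odot>\<^bsub>N\<^esub> x) = a \<odot>\<^bsub>?M2\<^esub> j x" using a x j by (simp add: jI)
  next
    fix x i assume x: "x \<in> grade N i"
    have xc: "x \<in> carrier N" using grade_carrier[OF gN x] .
    have "q (j x) \<in> grade N i"
      using j(2)[OF xc] x graded_homD(4)[OF l graded_homD(4)[OF p x]] grade_add[OF gN] grade_neg[OF gN] by (simp add: N.minus_eq)
    then show "j x \<in> grade ?M2 i"
      using graded_hom_inverse[OF g2' gN q _ _ , of "j x" i] inj j(1)[OF xc] by simp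
  qed
  let ?n1 = "length r1" and ?n2 = "length r2"
  \<comment> \<open>The second block is lowered by d because q is homogeneous only after M2 is
    shifted by -d.\<close>
  define rs where "rs = r1 @ map (\<lambda>r. r - d) r2"
  have ln: "length rs = ?n1 + ?n2" by (simp add: rs_def)
  define \<Phi> where "\<Phi> n = (\<lambda>i\<in>{..<length rs}. if i < ?n1 then \<phi>1 (p n) i else \<phi>2 (j n) (i - ?n1))" for n
  have c1: "\<phi>1 (p n) i \<in> carrier R" if "n \<in> carrier N" "i < ?n1" for n i
    using graded_homD(1)[OF p1(1) graded_homD(1)[OF p that(1)]] that(2) by auto
  have c2: "\<phi>2 (j n) i \<in> carrier R" if "n \<in> carrier N" "i < ?n2" for n i
    using graded_homD(1)[OF p2(1) j(1)[OF that(1)]] that(2) by auto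
  have Phi: "\<Phi> \<in> graded_hom R N (freemod rs)"
  proof (rule graded_homI)
    fix x assume "x \<in> carrier N"
    then show "\<Phi> x \<in> carrier (freemod rs)" using c1 c2 by (auto simp: \<Phi>_def ln)
  next
    fix x y assume x: "x \<in> carrier N" and y: "y \<in> carrier N"
    have "\<phi>1 (p (x \<oplus>\<^bsub>N\<^esub> y)) i = \<phi>1 (p x) i \<oplus>\<^bsub>R\<^esub> \<phi>1 (p y) i" if "i < ?n1" for i
      using graded_homD(2)[OF p x y] graded_homD(2)[OF p1(1), of "p x" "p y"] graded_homD(1)[OF p] x y that by simp
    moreover have "\<phi>2 (j (x \<oplus>\<^bsub>N\<^esub> y)) i = \<phi>2 (j x) i \<oplus>\<^bsub>R\<^esub> \<phi>2 (j y) i" if "i < ?n2" for i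
      using graded_homD(2)[OF jhom x y] graded_homD(2)[OF p2(1), of "j x" "j y"] j x y that by simp
    ultimately show "\<Phi> (x \<oplus>\<^bsub>N\<^esub> y) = \<Phi> x \<oplus>\<^bsub>freemod rs\<^esub> \<Phi> y"
      by (auto simp: \<Phi>_def ln intro!: restrict_ext)
  next
    fix a x assume a: "a \<in> carrier R" and x: "x \<in> carrier N"
    have "\<phi>1 (p (a \<odot>\<^bsub>N\<^esub> x)) i = a \<otimes>\<^bsub>R\<^esub> \<phi>1 (p x) i" if "i < ?n1" for i
      using graded_homD(3)[OF p a x] graded_homD(3)[OF p1(1) a, of "p x"] graded_homD(1)[OF p] x that by simp
    moreover have "\<phi>2 (j (a \<odot>\<^bsub>N\<^esub> x)) i = a \<otimes>\<^bsub>R\<^esub> \<phi>2 (j x) i" if "i < ?n2" for i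
      using graded_homD(3)[OF jhom a x] graded_homD(3)[OF p2(1) a, of "j x"] j x that by simp
    ultimately show "\<Phi> (a \<odot>\<^bsub>N\<^esub> x) = a \<odot>\<^bsub>freemod rs\<^esub> \<Phi> x"
      by (auto simp: \<Phi>_def ln intro!: restrict_ext)
  next
    fix x i assume x: "x \<in> grade N i"
    have "\<phi>1 (p x) k \<in> rgrade R (i + rs ! k)" if "k < ?n1" for k
      using graded_homD(4)[OF p1(1) graded_homD(4)[OF p x]] that by (auto simp: rs_def nth_append)
    moreover have "j x \<in> grade M2 (i - d)" using graded_homD(4)[OF jhom x] by simp
    then have "\<phi>2 (j x) (k - ?n1) \<in> rgrade R (i + rs ! k)" if "\<not> k < ?n1" "k < length rs" for k
      using graded_homD(4)[OF p2(1), of "j x" "i - d"] that by (auto simp: rs_def nth_append PiE_iff algebra_simps)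
    ultimately show "\<Phi> x \<in> grade (freemod rs) i" by (auto simp: \<Phi>_def)
  qed
  have "inj_on \<Phi> (carrier N)"
  proof (rule inj_onI)
    fix x y assume x: "x \<in> carrier N" and y: "y \<in> carrier N" and e: "\<Phi> x = \<Phi> y"
    have "\<phi>1 (p x) i = \<phi>1 (p y) i" if "i < ?n1" for i
      using fun_cong[OF e, of i] that by (simp add: \<Phi>_def ln)
    then have "\<phi>1 (p x) = \<phi>1 (p y)"
      by (intro gsum_eqI[OF graded_homD(1)[OF p1(1) graded_homD(1)[OF p x]] graded_homD(1)[OF p1(1) graded_homD(1)[OF p y]]]) auto
    then have 1: "p x = p y" using p1(2) graded_homD(1)[OF p] x y by (auto simp: bij_betw_def inj_on_def)
    have "\<phi>2 (j x) i = \<phi>2 (j y) i" if "i < ?n2" for i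
      using fun_cong[OF e, of "?n1 + i"] that by (simp add: \<Phi>_def ln)
    then have "\<phi>2 (j x) = \<phi>2 (j y)"
      by (intro gsum_eqI[OF graded_homD(1)[OF p2(1) j(1)[OF x]] graded_homD(1)[OF p2(1) j(1)[OF y]]]) auto
    then have "j x = j y" using p2(2) j x y by (auto simp: bij_betw_def inj_on_def)
    then have "x \<ominus>\<^bsub>N\<^esub> l (p x) = y \<ominus>\<^bsub>N\<^esub> l (p x)" using j(2)[OF x] j(2)[OF y] 1 by simp
    then show "x = y" using x y lp[OF x] by (simp add: N.minus_eq)
  qed
  moreover have "\<Phi> ` carrier N = carrier (freemod rs)"
  proof
    show "\<Phi> ` carrier N \<subseteq> carrier (freemod rs)"
      by (rule image_subsetI) (rule graded_homD(1)[OF Phi])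
    show "carrier (freemod rs) \<subseteq> \<Phi> ` carrier N"
    proof
      fix v assume v: "v \<in> carrier (freemod rs)"
      define v1 where "v1 = (\<lambda>i\<in>{..<?n1}. v i)"
      define v2 where "v2 = (\<lambda>i\<in>{..<?n2}. v (?n1 + i))"
      have "v1 \<in> carrier (freemod r1)" using v by (force simp: v1_def ln PiE_iff)
      then obtain m1 where m1: "m1 \<in> carrier M1" "\<phi>1 m1 = v1"
        unfolding bij_betw_imp_surj_on[OF p1(2), symmetric] by blast
      have "v2 \<in> carrier (freemod r2)" using v by (force simp: v2_def ln PiE_iff)
      then obtain m2 where m2: "m2 \<in> carrier M2" "\<phi>2 m2 = v2"
        unfolding bij_betw_imp_surj_on[OF p2(2), symmetric] by blast
      define n where "n = l m1 \<oplus>\<^bsub>N\<^esub> q m2"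
      have lc: "l m1 \<in> carrier N" using graded_homD(1)[OF l m1(1)] .
      have n: "n \<in> carrier N" unfolding n_def using lc qc[OF m2(1)] by simp
      have pq: "p (q m2) = \<zero>\<^bsub>M1\<^esub>" using ker[OF qc[OF m2(1)]] m2(1) by simp
      have pn: "p n = m1" unfolding n_def using graded_homD(2)[OF p lc qc[OF m2(1)]] pl m1 pq by simp
      have "n \<ominus>\<^bsub>N\<^esub> l (p n) = q m2" unfolding pn unfolding n_def using lc qc[OF m2(1)] 
        by (simp add: N.minus_eq N.a_comm[of "l m1" "q m2"] N.a_assoc N.r_neg)
      then have jn: "j n = m2" using jI[OF n m2(1)] by simp
      have "\<Phi> n = v"
        by (rule gsum_eqI[OF graded_homD(1)[OF Phi n] v]) (auto simp: \<Phi>_def pn jn m1 m2 v1_def v2_def ln)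
      then show "v \<in> \<Phi> ` carrier N" using n by blast
    qed
  qed
  ultimately have "bij_betw \<Phi> (carrier N) (carrier (freemod rs))" by (simp add: bij_betw_def)
  then show ?thesis using Phi unfolding graded_free_def graded_iso_def by blast
qed

end


section \<open>Polynomials: substitution and homogeneous parts\<close>

lemma poly_mapping_sum_singles: "p = (\<Sum>m\<in>Poly_Mapping.keys p. Poly_Mapping.single m (Poly_Mapping.lookup p m))"
proof (rule poly_mapping_eqI)
  fix k
  have "(\<Sum>m\<in>Poly_Mapping.keys p. Poly_Mapping.lookup (Poly_Mapping.single m (Poly_Mapping.lookup p m)) k)
      = (\<Sum>m\<in>Poly_Mapping.keys p. if m = k then Poly_Mapping.lookup p k else 0)"
    by (rule sum.cong) (auto simp: lookup_single when_def)
  then show "Poly_Mapping.lookup p k = Poly_Mapping.lookup (\<Sum>m\<in>Poly_Mapping.keys p. Poly_Mapping.single m (Poly_Mapping.lookup p m)) k"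
    by (simp add: lookup_sum in_keys_iff)
qed

lemma lookup_single_times:
  fixes p :: "('a::cancel_comm_monoid_add, 'b::semiring_1) poly_mapping"
  shows "Poly_Mapping.lookup (Poly_Mapping.single k 1 * p) (k + m) = Poly_Mapping.lookup p m"
proof -
  have "Poly_Mapping.lookup (Poly_Mapping.single k 1 * p) (k + m) =
      (\<Sum>n\<in>Poly_Mapping.keys p. Poly_Mapping.lookup (Poly_Mapping.single (k + n) (Poly_Mapping.lookup p n)) (k + m))"
    by (subst (1) poly_mapping_sum_singles[of p]) (simp add: sum_distrib_left mult_single lookup_sum)
  also have "\<dots> = (\<Sum>n\<in>Poly_Mapping.keys p. if n = m then Poly_Mapping.lookup p m else 0)"
    by (rule sum.cong) (auto simp: lookup_single when_def)
  finally show ?thesis by (simp add: in_keys_iff)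
qed

lemma keys_single_times:
  fixes p :: "('a::cancel_comm_monoid_add, 'b::semiring_1) poly_mapping"
  assumes "n \<in> Poly_Mapping.keys (Poly_Mapping.single k 1 * p)"
  obtains m where "n = k + m" "m \<in> Poly_Mapping.keys p"
  using assms keys_mult[of "Poly_Mapping.single k 1" p] by (auto split: if_splits)

lemma single_times_cancel:
  fixes p :: "('a::cancel_comm_monoid_add, 'b::semiring_1) poly_mapping"
  assumes "Poly_Mapping.single k 1 * p = Poly_Mapping.single k 1 * q" shows "p = q"
  using assms lookup_single_times[of k p] lookup_single_times[of k q] by (intro poly_mapping_eqI) simp

lemma total_degree_add: "total_degree (m + n) = total_degree m + total_degree n"
  unfolding total_degree_def by (rule setsum_keys_plus_distrib) auto

lemma total_degree_zero [simp]: "total_degree 0 = 0"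
  by (simp add: total_degree_def)

lemma total_degree_single [simp]: "total_degree (Poly_Mapping.single v n) = n"
  by (simp add: total_degree_def)

lemma poly_const_mult: "poly_const a * poly_const b = poly_const (a * b)"
  and poly_const_add: "poly_const a + poly_const b = poly_const (a + b)"
  and poly_const_one [simp]: "poly_const 1 = 1" and poly_const_zero [simp]: "poly_const 0 = 0"
  by (simp_all add: poly_const_def mult_single single_add)

lemma poly_const_single: "poly_const c * Poly_Mapping.single m d = Poly_Mapping.single m (c * d)"
  by (simp add: poly_const_def mult_single)

text \<open>The value of the monomial m when each variable v is replaced by \<open>f v\<close>;
  \<open>subst\<close> is the resulting algebra homomorphism.\<close>

definition emon :: "('l \<Rightarrow> ('k, 'f::field) polys) \<Rightarrow> ('l, nat) poly_mapping \<Rightarrow> ('k, 'f) polys" where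
  "emon f m = (\<Prod>v\<in>Poly_Mapping.keys m. f v ^ Poly_Mapping.lookup m v)"

lemma emon_superset:
  assumes "finite A" "Poly_Mapping.keys m \<subseteq> A" shows "emon f m = (\<Prod>v\<in>A. f v ^ Poly_Mapping.lookup m v)"
  unfolding emon_def by (rule prod.mono_neutral_left) (use assms in \<open>auto simp: in_keys_iff\<close>)

lemma emon_add: "emon f (m + n) = emon f m * emon f n"
proof -
  let ?A = "Poly_Mapping.keys m \<union> Poly_Mapping.keys n"
  have "emon f (m + n) = (\<Prod>v\<in>?A. f v ^ Poly_Mapping.lookup (m + n) v)"
    by (rule emon_superset) (use keys_add[of m n] in auto)
  also have "\<dots> = (\<Prod>v\<in>?A. f v ^ Poly_Mapping.lookup m v) * (\<Prod>v\<in>?A. f v ^ Poly_Mapping.lookup n v)"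
    by (simp add: lookup_add power_add prod.distrib)
  also have "\<dots> = emon f m * emon f n" by (simp add: emon_superset[of ?A])
  finally show ?thesis .
qed

lemma emon_zero [simp]: "emon f 0 = 1" by (simp add: emon_def)
lemma emon_single: "emon f (Poly_Mapping.single v n) = f v ^ n" by (cases "n = 0") (simp_all add: emon_def)

definition subst :: "('l \<Rightarrow> ('k, 'f::field) polys) \<Rightarrow> ('l, 'f) polys \<Rightarrow> ('k, 'f) polys" where
  "subst f p = (\<Sum>m\<in>Poly_Mapping.keys p. poly_const (Poly_Mapping.lookup p m) * emon f m)"

lemma subst_add: "subst f (p + q) = subst f p + subst f q"
  unfolding subst_def by (rule setsum_keys_plus_distrib) (auto simp: poly_const_add[symmetric] distrib_right)

lemma subst_zero [simp]: "subst f 0 = 0" by (simp add: subst_def)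

lemma subst_minus: "subst f (p - q) = subst f p - subst f q"
  using subst_add[of f "p - q" q] by simp

lemma subst_sum: "subst f (\<Sum>i\<in>A. g i) = (\<Sum>i\<in>A. subst f (g i))"
  by (induction A rule: infinite_finite_induct) (auto simp: subst_add)

lemma subst_single: "subst f (Poly_Mapping.single m c) = poly_const c * emon f m"
  by (cases "c = 0") (simp_all add: subst_def)

lemma subst_mult: "subst f (p * q) = subst f p * subst f q"
proof -
  let ?s = "\<lambda>p m. Poly_Mapping.single m (Poly_Mapping.lookup p m)"
  have "p * q = (\<Sum>m\<in>Poly_Mapping.keys p. ?s p m) * (\<Sum>n\<in>Poly_Mapping.keys q. ?s q n)"
    using poly_mapping_sum_singles[of p] poly_mapping_sum_singles[of q] by simp
  also have "\<dots> = (\<Sum>m\<in>Poly_Mapping.keys p. \<Sum>n\<in>Poly_Mapping.keys q. ?s p m * ?s q n)"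
    by (rule sum_product)
  finally have "subst f (p * q) = (\<Sum>m\<in>Poly_Mapping.keys p. \<Sum>n\<in>Poly_Mapping.keys q. subst f (?s p m * ?s q n))"
    by (simp add: subst_sum)
  also have "\<dots> = (\<Sum>m\<in>Poly_Mapping.keys p. \<Sum>n\<in>Poly_Mapping.keys q. 
      (poly_const (Poly_Mapping.lookup p m) * emon f m) * (poly_const (Poly_Mapping.lookup q n) * emon f n))"
    by (simp add: mult_single subst_single emon_add poly_const_mult[symmetric] mult_ac)
  also have "\<dots> = subst f p * subst f q" unfolding subst_def by (rule sum_product[symmetric])
  finally show ?thesis .
qed

lemma subst_const [simp]: "subst f (poly_const c) = poly_const c"
  by (simp add: poly_const_def subst_single)
lemma subst_var [simp]: "subst f (poly_var v) = f v"
  by (simp add: poly_var_def subst_single emon_single)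

text \<open>Degrees are doubled as in the grading of \<open>Sym\<close>, where variables have degree
  2; odd and negative i give 0.\<close>

definition hpart :: "int \<Rightarrow> ('l, 'f::field) polys \<Rightarrow> ('l, 'f) polys" where
  "hpart i p = Poly_Mapping.mapp (\<lambda>m c. c when 2 * int (total_degree m) = i) p"

lemma lookup_hpart: "Poly_Mapping.lookup (hpart i p) m = (Poly_Mapping.lookup p m when 2 * int (total_degree m) = i)"
  by (auto simp: hpart_def lookup_mapp when_def in_keys_iff)

lemma keys_hpart: "Poly_Mapping.keys (hpart i p) = {m \<in> Poly_Mapping.keys p. 2 * int (total_degree m) = i}"
  by (auto simp: in_keys_iff lookup_hpart)

lemma hpart_add: "hpart i (p + q) = hpart i p + hpart i q"
  by (rule poly_mapping_eqI) (simp add: lookup_hpart lookup_add when_def)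
lemma hpart_zero [simp]: "hpart i 0 = 0"
  by (rule poly_mapping_eqI) (simp add: lookup_hpart)
lemma hpart_sum: "hpart i (\<Sum>j\<in>A. g j) = (\<Sum>j\<in>A. hpart i (g j))"
  by (induction A rule: infinite_finite_induct) (auto simp: hpart_add)

definition homog :: "int \<Rightarrow> ('l, 'f::field) polys \<Rightarrow> bool" where
  "homog i p \<longleftrightarrow> (\<forall>m\<in>Poly_Mapping.keys p. 2 * int (total_degree m) = i)"

lemma hpart_homog: "homog i p \<Longrightarrow> hpart j p = (if i = j then p else 0)"
  by (rule poly_mapping_eqI) (auto simp: lookup_hpart homog_def when_def in_keys_iff)

lemma homog_hpart: "homog i (hpart i p)"
  by (auto simp: homog_def keys_hpart)

lemma homog_zero [simp]: "homog i 0" by (simp add: homog_def)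
lemma homog_add: "homog i p \<Longrightarrow> homog i q \<Longrightarrow> homog i (p + q)"
  using keys_add[of p q] by (auto simp: homog_def)
lemma homog_uminus: "homog i p \<Longrightarrow> homog i (- p)"
  by (auto simp: homog_def in_keys_iff)
lemma homog_sum: "(\<And>j. j \<in> A \<Longrightarrow> homog i (g j)) \<Longrightarrow> homog i (\<Sum>j\<in>A. g j)"
  by (induction A rule: infinite_finite_induct) (auto simp: homog_add)
lemma homog_mult: "homog i p \<Longrightarrow> homog j q \<Longrightarrow> homog (i + j) (p * q)"
  using keys_mult[of p q] by (fastforce simp: homog_def total_degree_add)
lemma homog_const: "homog 0 (poly_const c)"
  by (simp add: homog_def poly_const_def)
lemma homog_one: "homog 0 1"
  using homog_const[of 1] by simp
lemma homog_var: "homog 2 (poly_var v)"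
  by (simp add: homog_def poly_var_def)
lemma homog_power: "homog i p \<Longrightarrow> homog (int n * i) (p ^ n)"
  by (induction n) (auto simp: homog_one algebra_simps dest: homog_mult)
lemma homog_prod: "finite A \<Longrightarrow> (\<And>a. a \<in> A \<Longrightarrow> homog (h a) (g a)) \<Longrightarrow> homog (sum h A) (prod g A)"
  by (induction A rule: finite_induct) (auto simp: homog_one intro!: homog_mult)

lemma homog_emon: assumes "\<And>v. homog 2 (f v)" shows "homog (2 * int (total_degree m)) (emon f m)"
proof -
  have "homog (\<Sum>v\<in>Poly_Mapping.keys m. int (Poly_Mapping.lookup m v) * 2) (emon f m)"
    unfolding emon_def by (rule homog_prod) (auto intro: homog_power assms)
  moreover have "(\<Sum>v\<in>Poly_Mapping.keys m. int (Poly_Mapping.lookup m v) * 2) = 2 * int (total_degree m)"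
    by (simp add: total_degree_def sum_distrib_left mult.commute)
  ultimately show ?thesis by simp
qed

lemma hpart_subst: assumes "\<And>v. homog 2 (f v)" shows "hpart i (subst f p) = subst f (hpart i p)"
proof -
  have h: "homog (2 * int (total_degree m)) (poly_const c * emon f m)" for c m
    using homog_mult[OF homog_const homog_emon[OF assms]] by simp
  have "hpart i (subst f p) = (\<Sum>m\<in>Poly_Mapping.keys p. if 2 * int (total_degree m) = i then poly_const (Poly_Mapping.lookup p m) * emon f m else 0)"
    unfolding subst_def[of f p] hpart_sum by (rule sum.cong) (simp_all add: hpart_homog[OF h])
  also have "\<dots> = (\<Sum>m\<in>Poly_Mapping.keys (hpart i p). poly_const (Poly_Mapping.lookup p m) * emon f m)"
    unfolding keys_hpart by (rule sum.inter_filter[symmetric]) simp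
  also have "\<dots> = subst f (hpart i p)"
    unfolding subst_def[of f "hpart i p"] by (rule sum.cong) (simp_all add: lookup_hpart keys_hpart)
  finally show ?thesis .
qed

lemma hpart_decomposition:
  assumes "finite A" "\<And>m. m \<in> Poly_Mapping.keys p \<Longrightarrow> 2 * int (total_degree m) \<in> A"
  shows "p = (\<Sum>i\<in>A. hpart i p)"
proof (rule poly_mapping_eqI)
  fix m
  have "(\<Sum>i\<in>A. Poly_Mapping.lookup (hpart i p) m) = (\<Sum>i\<in>A. if i = 2 * int (total_degree m) then Poly_Mapping.lookup p m else 0)"
    by (rule sum.cong) (auto simp: lookup_hpart when_def)
  then show "Poly_Mapping.lookup p m = Poly_Mapping.lookup (\<Sum>i\<in>A. hpart i p) m"
    using assms by (auto simp: lookup_sum in_keys_iff)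
qed

lemma poly_ring_simps [simp]:
  "carrier (poly_ring A) = {p. \<forall>m\<in>Poly_Mapping.keys p. Poly_Mapping.keys m \<subseteq> A}"
  "p \<otimes>\<^bsub>poly_ring A\<^esub> q = p * q" "p \<oplus>\<^bsub>poly_ring A\<^esub> q = p + q" "\<one>\<^bsub>poly_ring A\<^esub> = 1" "\<zero>\<^bsub>poly_ring A\<^esub> = 0"
  by (simp_all add: poly_ring_def)

abbreviation pcar :: "'l set \<Rightarrow> ('l, 'f::field) polys set" where "pcar A \<equiv> carrier (poly_ring A)"

lemma pcar_add: "p \<in> pcar A \<Longrightarrow> q \<in> pcar A \<Longrightarrow> p + q \<in> pcar A"
  using keys_add[of p q] by auto
lemma pcar_uminus: "p \<in> pcar A \<Longrightarrow> - p \<in> pcar A"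
  by (auto simp: in_keys_iff)
lemma pcar_minus: "p \<in> pcar A \<Longrightarrow> q \<in> pcar A \<Longrightarrow> p - q \<in> pcar A"
  using pcar_add[OF _ pcar_uminus, of p A q] by simp
lemma pcar_mult: assumes "p \<in> pcar A" "q \<in> pcar A" shows "p * q \<in> pcar A"
proof -
  have "Poly_Mapping.keys m \<subseteq> A" if m: "m \<in> Poly_Mapping.keys (p * q)" for m
  proof -
    obtain a b where ab: "m = a + b" "a \<in> Poly_Mapping.keys p" "b \<in> Poly_Mapping.keys q"
      using keys_mult[of p q] m by blast
    then show ?thesis using keys_add[of a b] assms by fastforce
  qed
  then show ?thesis by simp
qed
lemma pcar_const: "poly_const c \<in> pcar A" by (auto simp: poly_const_def)
lemma pcar_zero: "0 \<in> pcar A" by simp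
lemma pcar_one: "1 \<in> pcar A" by simp
lemma pcar_var: "v \<in> A \<Longrightarrow> poly_var v \<in> pcar A" by (auto simp: poly_var_def)
lemma pcar_sum: "(\<And>i. i \<in> I \<Longrightarrow> g i \<in> pcar A) \<Longrightarrow> (\<Sum>i\<in>I. g i) \<in> pcar A"
  by (induction I rule: infinite_finite_induct) (auto simp: pcar_zero intro!: pcar_add simp del: poly_ring_simps)
lemma pcar_power: "p \<in> pcar A \<Longrightarrow> p ^ n \<in> pcar A"
  by (induction n) (auto simp: pcar_one intro!: pcar_mult simp del: poly_ring_simps)
lemma pcar_prod: "(\<And>i. i \<in> I \<Longrightarrow> g i \<in> pcar A) \<Longrightarrow> (\<Prod>i\<in>I. g i) \<in> pcar A"
  by (induction I rule: infinite_finite_induct) (auto simp: pcar_one intro!: pcar_mult simp del: poly_ring_simps)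
lemma pcar_hpart: "p \<in> pcar A \<Longrightarrow> hpart i p \<in> pcar A"
  by (auto simp: keys_hpart)

lemma poly_ring_cring: "cring (poly_ring A :: ('l, 'f::field) polys ring)"
proof (rule cringI)
  show "abelian_group (poly_ring A :: ('l, 'f) polys ring)"
  proof (rule abelian_groupI)
    fix x :: "('l, 'f) polys" assume "x \<in> pcar A"
    then show "\<exists>y\<in>pcar A. y \<oplus>\<^bsub>poly_ring A\<^esub> x = \<zero>\<^bsub>poly_ring A\<^esub>" using pcar_uminus[of x A] by (intro bexI[of _ "- x"]) auto
  next
    fix x y :: "('l, 'f) polys" assume "x \<in> pcar A" "y \<in> pcar A"
    then show "x \<oplus>\<^bsub>poly_ring A\<^esub> y \<in> pcar A" using pcar_add[of x A y] by simp
  qed (auto simp: add_ac)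
  show "comm_monoid (poly_ring A :: ('l, 'f) polys ring)"
  proof (rule comm_monoidI)
    fix x y :: "('l, 'f) polys" assume "x \<in> pcar A" "y \<in> pcar A"
    then show "x \<otimes>\<^bsub>poly_ring A\<^esub> y \<in> pcar A" using pcar_mult[of x A y] by simp
  qed (auto simp: mult_ac)
qed (simp add: distrib_right)

lemma poly_ring_minus: assumes "p \<in> pcar A" "q \<in> pcar A"
  shows "p \<ominus>\<^bsub>poly_ring A\<^esub> q = p - q"
proof -
  interpret cring "poly_ring A :: ('a, 'b) polys ring" by (rule poly_ring_cring)
  have "\<ominus>\<^bsub>poly_ring A\<^esub> q = - q" by (rule minus_equality) (use assms pcar_uminus[of q A] in auto)
  then show ?thesis by (simp add: a_minus_def)
qed


section \<open>The symmetric algebra in coordinates\<close>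

text \<open>A basis B with coordinate functions c, given by just those properties that the normal
  form requires. \<open>V_induct\<close> expresses that B spans. Since different pairs of labels
  call for different bases, B and c are parameters.\<close>

locale sym_basis =
  fixes V :: "('f::field, 'l) module" and B :: "'l set" and c :: "'l \<Rightarrow> 'l \<Rightarrow> 'f"
  assumes B: "B \<subseteq> carrier V"
    and zero_V: "\<zero>\<^bsub>V\<^esub> \<in> carrier V" "\<zero>\<^bsub>V\<^esub> \<oplus>\<^bsub>V\<^esub> \<zero>\<^bsub>V\<^esub> = \<zero>\<^bsub>V\<^esub>"
    and add_V: "\<And>u v. u \<in> carrier V \<Longrightarrow> v \<in> carrier V \<Longrightarrow> u \<oplus>\<^bsub>V\<^esub> v \<in> carrier V"
    and smult_V: "\<And>a v. v \<in> carrier V \<Longrightarrow> a \<odot>\<^bsub>V\<^esub> v \<in> carrier V"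
    and c_add: "\<And>u v b. u \<in> carrier V \<Longrightarrow> v \<in> carrier V \<Longrightarrow> c (u \<oplus>\<^bsub>V\<^esub> v) b = c u b + c v b"
    and c_smult: "\<And>a v b. v \<in> carrier V \<Longrightarrow> c (a \<odot>\<^bsub>V\<^esub> v) b = a * c v b"
    and c_basis: "\<And>b d. b \<in> B \<Longrightarrow> c b d = (if b = d then 1 else 0)"
    and c_finite: "\<And>v. finite {b. c v b \<noteq> 0}" and c_support: "\<And>v b. c v b \<noteq> 0 \<Longrightarrow> b \<in> B"
    and V_induct: "\<And>P v. v \<in> carrier V \<Longrightarrow> P \<zero>\<^bsub>V\<^esub> \<Longrightarrow> (\<And>b. b \<in> B \<Longrightarrow> P b) \<Longrightarrow>
      (\<And>u v. u \<in> carrier V \<Longrightarrow> v \<in> carrier V \<Longrightarrow> P u \<Longrightarrow> P v \<Longrightarrow> P (u \<oplus>\<^bsub>V\<^esub> v)) \<Longrightarrow>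
      (\<And>a v. v \<in> carrier V \<Longrightarrow> P v \<Longrightarrow> P (a \<odot>\<^bsub>V\<^esub> v)) \<Longrightarrow> P v"
begin

abbreviation PV :: "('l, 'f) polys ring" where "PV \<equiv> poly_ring (carrier V)"
abbreviation cV :: "('l, 'f) polys set" where "cV \<equiv> carrier PV"
abbreviation cl :: "('l, 'f) polys \<Rightarrow> ('l, 'f) polys set" where "cl \<equiv> sym_class V"
abbreviation SV :: "('l, 'f) polys set graded_ring" where "SV \<equiv> Sym V"

sublocale PV: cring PV by (rule poly_ring_cring)

definition gens :: "('l, 'f) polys set" where
  "gens = {poly_var (u \<oplus>\<^bsub>V\<^esub> v) - poly_var u - poly_var v | u v. u \<in> carrier V \<and> v \<in> carrier V} \<union>
      {poly_var (a \<odot>\<^bsub>V\<^esub> v) - poly_const a * poly_var v | a v. v \<in> carrier V}"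

lemma sym_ideal_gens: "sym_ideal V = Idl\<^bsub>PV\<^esub> gens"
  by (simp add: sym_ideal_def gens_def)

lemma gens_carrier: "gens \<subseteq> cV"
  unfolding gens_def using add_V smult_V
  by (auto intro!: pcar_minus pcar_mult pcar_var pcar_const simp del: poly_ring_simps)

lemma ideal_I: "ideal (sym_ideal V) PV"
  unfolding sym_ideal_gens by (rule PV.genideal_ideal[OF gens_carrier])

sublocale I: ideal "sym_ideal V" PV by (rule ideal_I)

lemma gens_I: "g \<in> gens \<Longrightarrow> g \<in> sym_ideal V"
  unfolding sym_ideal_gens using PV.genideal_self[OF gens_carrier] by blast

lemma I_carrier: "p \<in> sym_ideal V \<Longrightarrow> p \<in> cV" using I.a_subset by blast
lemma I_add: "p \<in> sym_ideal V \<Longrightarrow> q \<in> sym_ideal V \<Longrightarrow> p + q \<in> sym_ideal V"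
  using I.a_closed[of p q] by simp
lemma I_mult: "p \<in> cV \<Longrightarrow> q \<in> sym_ideal V \<Longrightarrow> p * q \<in> sym_ideal V"
  using I.I_l_closed[of q p] by simp
lemma I_uminus: assumes "p \<in> sym_ideal V" shows "- p \<in> sym_ideal V"
proof -
  have "poly_const (-1) = (-1 :: ('l, 'f) polys)" by (simp add: poly_const_def single_uminus)
  then show ?thesis using I_mult[OF pcar_const[of "-1"] assms] by simp
qed
lemma I_minus: "p \<in> sym_ideal V \<Longrightarrow> q \<in> sym_ideal V \<Longrightarrow> p - q \<in> sym_ideal V"
  using I_add[OF _ I_uminus, of p q] by simp
lemma I_zero: "0 \<in> sym_ideal V" using I.zero_closed by simp

lemma cl_eq_iff: assumes "p \<in> cV" "q \<in> cV" shows "cl p = cl q \<longleftrightarrow> p - q \<in> sym_ideal V"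
  unfolding sym_class_def using PV.quotient_eq_iff_same_a_r_cos[OF ideal_I assms] poly_ring_minus[OF assms] by simp

lemma Sym_carrier: "carrier SV = cl ` cV"
  by (auto simp: Sym_def ring.defs FactRing_def A_RCOSETS_def' sym_class_def)
lemma Sym_add: "p \<in> cV \<Longrightarrow> q \<in> cV \<Longrightarrow> cl p \<oplus>\<^bsub>SV\<^esub> cl q = cl (p + q)"
  using I.a_rcos_sum[of p q] by (simp add: Sym_def ring.defs FactRing_def sym_class_def)
lemma Sym_mult: "p \<in> cV \<Longrightarrow> q \<in> cV \<Longrightarrow> cl p \<otimes>\<^bsub>SV\<^esub> cl q = cl (p * q)"
  using I.rcoset_mult_add[of p q] by (simp add: Sym_def ring.defs FactRing_def sym_class_def)
lemma Sym_one: "\<one>\<^bsub>SV\<^esub> = cl 1"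
  by (simp add: Sym_def ring.defs FactRing_def sym_class_def)
lemma Sym_zero: "\<zero>\<^bsub>SV\<^esub> = cl 0"
  using PV.a_coset_add_zero[OF I.a_subset] by (simp add: Sym_def ring.defs FactRing_def sym_class_def)
lemma Sym_grade: "rgrade SV i = cl ` {p \<in> cV. homog i p}"
  by (simp add: Sym_def ring.defs graded_ring.defs homog_def)

lemma Sym_cring: "cring SV"
proof -
  have Q: "cring (PV Quot sym_ideal V)" by (rule I.quotient_is_cring[OF poly_ring_cring])
  have e: "carrier SV = carrier (PV Quot sym_ideal V)" "mult SV = mult (PV Quot sym_ideal V)"
    "add SV = add (PV Quot sym_ideal V)" "one SV = one (PV Quot sym_ideal V)" "zero SV = zero (PV Quot sym_ideal V)"
    by (simp_all add: Sym_def ring.defs)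
  interpret Q: cring "PV Quot sym_ideal V" by (rule Q)
  show ?thesis
  proof (rule cringI)
    show "abelian_group SV"
      by (rule abelian_groupI, unfold e) (use Q.a_assoc Q.a_comm Q.l_neg in auto)
    show "comm_monoid SV"
      by (rule comm_monoidI, unfold e) (use Q.m_assoc Q.m_comm in auto)
  qed (unfold e, rule Q.l_distr)
qed

text \<open>The linear polynomial in the basis variables that represents v in the symmetric
  algebra.\<close>

definition L :: "'l \<Rightarrow> ('l, 'f) polys" where
  "L v = (\<Sum>b\<in>{b. c v b \<noteq> 0}. poly_const (c v b) * poly_var b)"

lemma L_superset: "finite A \<Longrightarrow> {b. c v b \<noteq> 0} \<subseteq> A \<Longrightarrow> L v = (\<Sum>b\<in>A. poly_const (c v b) * poly_var b)"
  unfolding L_def by (rule sum.mono_neutral_left) auto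

lemma L_add: assumes "u \<in> carrier V" "v \<in> carrier V" shows "L (u \<oplus>\<^bsub>V\<^esub> v) = L u + L v"
proof -
  let ?A = "{b. c u b \<noteq> 0} \<union> {b. c v b \<noteq> 0}"
  have f: "finite ?A" using c_finite by auto
  have "L (u \<oplus>\<^bsub>V\<^esub> v) = (\<Sum>b\<in>?A. poly_const (c u b + c v b) * poly_var b)"
    using assms by (subst L_superset[OF f]) (auto simp: c_add)
  also have "\<dots> = L u + L v"
    by (simp add: L_superset[OF f] poly_const_add[symmetric] distrib_right sum.distrib)
  finally show ?thesis .
qed

lemma L_smult: assumes "v \<in> carrier V" shows "L (a \<odot>\<^bsub>V\<^esub> v) = poly_const a * L v"
proof -
  have "L (a \<odot>\<^bsub>V\<^esub> v) = (\<Sum>b\<in>{b. c v b \<noteq> 0}. poly_const (a * c v b) * poly_var b)"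
    using assms by (subst L_superset[OF c_finite[of v]]) (auto simp: c_smult)
  then show ?thesis by (simp add: L_def sum_distrib_left poly_const_mult[symmetric] mult.assoc)
qed

lemma L_basis: "b \<in> B \<Longrightarrow> L b = poly_var b"
  by (subst L_superset[of "{b}"]) (auto simp: c_basis)

lemma L_carrier: "L v \<in> cV"
  unfolding L_def using c_support B
  by (intro pcar_sum pcar_mult pcar_const pcar_var) blast

lemma L_homog: "homog 2 (L v)"
  unfolding L_def using homog_mult[OF homog_const homog_var] by (intro homog_sum) simp

abbreviation \<Phi> :: "('l, 'f) polys \<Rightarrow> ('l, 'f) polys" where "\<Phi> \<equiv> subst L"

lemma \<Phi>_carrier: "\<Phi> p \<in> cV"
  unfolding subst_def emon_def by (intro pcar_sum pcar_mult pcar_const pcar_prod pcar_power L_carrier)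

text \<open>Linearity of \<open>L\<close> makes the substitution kill both kinds of generators, and
  its kernel is an ideal.\<close>

lemma \<Phi>_I: assumes "p \<in> sym_ideal V" shows "\<Phi> p = 0"
proof -
  let ?K = "{p \<in> cV. \<Phi> p = 0}"
  have "ideal ?K PV"
  proof (rule idealI)
    show "ring PV" by (rule PV.ring_axioms)
    show "subgroup ?K (add_monoid PV)"
    proof (rule group.subgroupI)
      show "Group.group (add_monoid PV)" by (rule PV.a_group)
      fix p assume p: "p \<in> ?K"
      have "inv\<^bsub>add_monoid PV\<^esub> p = \<ominus>\<^bsub>PV\<^esub> p" by (simp add: a_inv_def)
      also have "\<dots> = - p" by (rule PV.minus_equality) (use p pcar_uminus[of p "carrier V"] in auto)
      finally show "inv\<^bsub>add_monoid PV\<^esub> p \<in> ?K"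
        using p pcar_uminus[of p "carrier V"] subst_minus[of L 0 p] by auto
    next
      fix p q assume "p \<in> ?K" "q \<in> ?K"
      then show "p \<otimes>\<^bsub>add_monoid PV\<^esub> q \<in> ?K" using pcar_add[of p "carrier V" q] by (auto simp: subst_add)
    next
      have "0 \<in> ?K" by simp
      then show "?K \<noteq> {}" by blast
    qed auto
    fix a x assume "a \<in> ?K" "x \<in> cV"
    then show "x \<otimes>\<^bsub>PV\<^esub> a \<in> ?K" "a \<otimes>\<^bsub>PV\<^esub> x \<in> ?K"
      using pcar_mult[of a "carrier V" x] pcar_mult[of x "carrier V" a] by (auto simp: subst_mult)
  qed
  moreover have "gens \<subseteq> ?K"
  proof
    fix g assume g: "g \<in> gens"
    then have "\<Phi> g = 0" unfolding gens_def by (auto simp: subst_minus subst_mult L_add L_smult)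
    then show "g \<in> ?K" using g gens_carrier by blast
  qed
  ultimately have "sym_ideal V \<subseteq> ?K" unfolding sym_ideal_gens by (rule PV.genideal_minimal)
  then show ?thesis using assms by blast
qed

lemma var_L: assumes "v \<in> carrier V" shows "poly_var v - L v \<in> sym_ideal V"
  using assms
proof (rule V_induct)
  have "poly_var (\<zero>\<^bsub>V\<^esub> \<oplus>\<^bsub>V\<^esub> \<zero>\<^bsub>V\<^esub>) - poly_var \<zero>\<^bsub>V\<^esub> - poly_var \<zero>\<^bsub>V\<^esub> \<in> sym_ideal V"
    by (rule gens_I) (use zero_V in \<open>unfold gens_def, blast\<close>)
  then have "poly_var \<zero>\<^bsub>V\<^esub> \<in> sym_ideal V" using I_uminus[of "- poly_var \<zero>\<^bsub>V\<^esub>"] by (simp add: zero_V)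
  moreover have "L \<zero>\<^bsub>V\<^esub> = 0" using L_add[OF zero_V(1) zero_V(1)] by (simp add: zero_V)
  ultimately show "poly_var \<zero>\<^bsub>V\<^esub> - L \<zero>\<^bsub>V\<^esub> \<in> sym_ideal V" by simp
next
  fix b assume "b \<in> B" then show "poly_var b - L b \<in> sym_ideal V" by (simp add: L_basis I_zero)
next
  fix u v assume uv: "u \<in> carrier V" "v \<in> carrier V" "poly_var u - L u \<in> sym_ideal V" "poly_var v - L v \<in> sym_ideal V"
  have "poly_var (u \<oplus>\<^bsub>V\<^esub> v) - poly_var u - poly_var v \<in> sym_ideal V"
    by (rule gens_I) (use uv in \<open>unfold gens_def, blast\<close>)
  from I_add[OF I_add[OF uv(3,4)] this] show "poly_var (u \<oplus>\<^bsub>V\<^esub> v) - L (u \<oplus>\<^bsub>V\<^esub> v) \<in> sym_ideal V"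
    by (simp add: L_add[OF uv(1,2)] algebra_simps)
next
  fix a v assume v: "v \<in> carrier V" "poly_var v - L v \<in> sym_ideal V"
  have "poly_var (a \<odot>\<^bsub>V\<^esub> v) - poly_const a * poly_var v \<in> sym_ideal V"
    by (rule gens_I) (use v in \<open>unfold gens_def, blast\<close>)
  from I_add[OF I_mult[OF pcar_const[of a] v(2)] this]
  show "poly_var (a \<odot>\<^bsub>V\<^esub> v) - L (a \<odot>\<^bsub>V\<^esub> v) \<in> sym_ideal V"
    by (simp add: L_smult[OF v(1)] algebra_simps)
qed

text \<open>The polynomial is congruent, modulo the defining ideal, to its rewriting in basis
  variables.\<close>

definition fixedp :: "('l, 'f) polys \<Rightarrow> bool" where "fixedp p \<longleftrightarrow> p \<in> cV \<and> p - \<Phi> p \<in> sym_ideal V"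

lemma fixedp_mult: assumes "fixedp p" "fixedp q" shows "fixedp (p * q)"
proof -
  have "q * (p - \<Phi> p) + \<Phi> p * (q - \<Phi> q) \<in> sym_ideal V"
    using assms \<Phi>_carrier[of p] by (intro I_add I_mult) (auto simp: fixedp_def)
  moreover have "q * (p - \<Phi> p) + \<Phi> p * (q - \<Phi> q) = p * q - \<Phi> (p * q)"
    by (simp add: subst_mult algebra_simps)
  ultimately show ?thesis using assms pcar_mult[of p "carrier V" q] by (simp add: fixedp_def del: poly_ring_simps)
qed

lemma fixedp_add: assumes "fixedp p" "fixedp q" shows "fixedp (p + q)"
  using I_add[of "p - \<Phi> p" "q - \<Phi> q"] assms pcar_add[of p "carrier V" q]
  by (simp add: fixedp_def subst_add algebra_simps del: poly_ring_simps)

lemma fixedp_const: "fixedp (poly_const a)"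
  using pcar_const[of a "carrier V"] by (simp add: fixedp_def I_zero del: poly_ring_simps)
lemma fixedp_one: "fixedp 1" using fixedp_const[of 1] by simp
lemma fixedp_var: "v \<in> carrier V \<Longrightarrow> fixedp (poly_var v)"
  using pcar_var var_L by (simp add: fixedp_def del: poly_ring_simps)
lemma fixedp_power: "fixedp p \<Longrightarrow> fixedp (p ^ n)"
  by (induction n) (auto simp: fixedp_one fixedp_mult)
lemma fixedp_prod: "(\<And>i. i \<in> A \<Longrightarrow> fixedp (g i)) \<Longrightarrow> fixedp (prod g A)"
  by (induction A rule: infinite_finite_induct) (auto simp: fixedp_one fixedp_mult)
lemma fixedp_sum: "(\<And>i. i \<in> A \<Longrightarrow> fixedp (g i)) \<Longrightarrow> fixedp (sum g A)"
  using fixedp_const[of 0] by (induction A rule: infinite_finite_induct) (auto simp: fixedp_add)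

lemma subst_id:
  fixes p :: "('l, 'f) polys"
  shows "subst poly_var p = p"
proof -
  have e: "emon (poly_var :: 'l \<Rightarrow> ('l, 'f) polys) m = Poly_Mapping.single m 1" for m :: "('l, nat) poly_mapping"
  proof -
    have p: "(poly_var v :: ('l, 'f) polys) ^ n = Poly_Mapping.single (Poly_Mapping.single v n) 1" for v n
      by (induction n) (simp_all add: poly_var_def mult_single single_add[symmetric])
    have "(\<Prod>v\<in>A. (Poly_Mapping.single (Poly_Mapping.single v (Poly_Mapping.lookup m v)) 1 :: ('l, 'f) polys)) =
        Poly_Mapping.single (\<Sum>v\<in>A. Poly_Mapping.single v (Poly_Mapping.lookup m v)) 1" for A
      by (induction A rule: infinite_finite_induct) (simp_all add: mult_single)
    then show ?thesis unfolding emon_def p using poly_mapping_sum_singles[of m] by simp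
  qed
  show ?thesis unfolding subst_def e using poly_mapping_sum_singles[of p] by (simp add: poly_const_single)
qed

text \<open>The polynomials with this property are closed under sums and products and contain
  constants and variables; p is built from these, as \<open>subst_id\<close> shows.\<close>

lemma fixedp_all: assumes p: "p \<in> cV" shows "fixedp p"
proof -
  have "fixedp (subst poly_var p)" unfolding subst_def emon_def
    by (intro fixedp_sum fixedp_mult fixedp_const fixedp_prod fixedp_power fixedp_var) (use p in auto)
  then show ?thesis by (simp add: subst_id)
qed

text \<open>So \<open>\<Phi>\<close> is a normal form: the symmetric algebra is a polynomial ring in
  the variables from B, and a label belonging to B is a variable. Divisibility by such labels turns
  into divisibility of monomials.\<close>

lemma cl_eq_iff_\<Phi>: assumes "p \<in> cV" "q \<in> cV" shows "cl p = cl q \<longleftrightarrow> \<Phi> p = \<Phi> q"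
proof
  assume "cl p = cl q"
  then have "\<Phi> (p - q) = 0" using \<Phi>_I cl_eq_iff[OF assms] by blast
  then show "\<Phi> p = \<Phi> q" by (simp add: subst_minus)
next
  assume e: "\<Phi> p = \<Phi> q"
  have "(p - \<Phi> p) - (q - \<Phi> q) \<in> sym_ideal V"
    by (rule I_minus) (use fixedp_all[OF assms(1)] fixedp_all[OF assms(2)] in \<open>simp_all add: fixedp_def\<close>)
  then show "cl p = cl q" using cl_eq_iff[OF assms] e by simp
qed

lemma cl_\<Phi>: "p \<in> cV \<Longrightarrow> cl (\<Phi> p) = cl p"
  using cl_eq_iff[OF _ \<Phi>_carrier, of p] fixedp_all[of p] by (auto simp: fixedp_def)

lemma \<Phi>_\<Phi>: "p \<in> cV \<Longrightarrow> \<Phi> (\<Phi> p) = \<Phi> p"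
  using cl_\<Phi> cl_eq_iff_\<Phi>[OF \<Phi>_carrier, of p p] by blast

lemma sym_of_cl: "sym_of V v = cl (poly_var v)" by (simp add: sym_of_def)

lemma sym_of_grade: "v \<in> carrier V \<Longrightarrow> sym_of V v \<in> rgrade SV 2"
  unfolding Sym_grade sym_of_cl by (intro imageI CollectI conjI pcar_var homog_var)

lemma sym_of_add: assumes "u \<in> carrier V" "v \<in> carrier V" 
  shows "sym_of V (u \<oplus>\<^bsub>V\<^esub> v) = sym_of V u \<oplus>\<^bsub>SV\<^esub> sym_of V v"
proof -
  have "\<Phi> (poly_var (u \<oplus>\<^bsub>V\<^esub> v)) = \<Phi> (poly_var u + poly_var v)" by (simp add: subst_add L_add assms)
  then have "cl (poly_var (u \<oplus>\<^bsub>V\<^esub> v)) = cl (poly_var u + poly_var v)"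
    using cl_eq_iff_\<Phi>[OF pcar_var[OF add_V[OF assms]] pcar_add[OF pcar_var pcar_var, OF assms]] by blast
  then show ?thesis unfolding sym_of_cl using Sym_add[OF pcar_var pcar_var, OF assms] by simp
qed

lemma half: assumes "(2::'f) \<noteq> 0"
  shows "\<exists>h\<in>carrier SV. h \<otimes>\<^bsub>SV\<^esub> (\<one>\<^bsub>SV\<^esub> \<oplus>\<^bsub>SV\<^esub> \<one>\<^bsub>SV\<^esub>) = \<one>\<^bsub>SV\<^esub>"
proof (rule bexI)
  have "(1::('l, 'f) polys) + 1 = poly_const (1 + 1)" by (simp only: poly_const_add[symmetric] poly_const_one)
  moreover have "(1/2) * (1 + 1) = (1::'f)" using assms by simp
  ultimately have "poly_const (1/2) * ((1::('l, 'f) polys) + 1) = 1" by (simp only: poly_const_mult poly_const_one)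
  then show "cl (poly_const (1/2)) \<otimes>\<^bsub>SV\<^esub> (\<one>\<^bsub>SV\<^esub> \<oplus>\<^bsub>SV\<^esub> \<one>\<^bsub>SV\<^esub>) = \<one>\<^bsub>SV\<^esub>"
    by (simp only: Sym_one Sym_add[OF pcar_one pcar_one] Sym_mult[OF pcar_const pcar_add[OF pcar_one pcar_one]])
  show "cl (poly_const (1/2)) \<in> carrier SV" using Sym_carrier pcar_const by blast
qed

lemma sym_of_regular:
  assumes b: "b \<in> B" and x: "x \<in> carrier SV" "sym_of V b \<otimes>\<^bsub>SV\<^esub> x = \<zero>\<^bsub>SV\<^esub>"
  shows "x = \<zero>\<^bsub>SV\<^esub>"
proof -
  obtain p where p: "p \<in> cV" "x = cl p" using x(1) Sym_carrier by blast
  have bc: "b \<in> carrier V" using b B by blast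
  have "\<Phi> (poly_var b * p) = \<Phi> 0"
    using x(2) p Sym_mult[OF pcar_var[OF bc] p(1)] cl_eq_iff_\<Phi>[OF pcar_mult[OF pcar_var[OF bc] p(1)] pcar_zero]
    by (simp add: sym_of_cl Sym_zero del: poly_ring_simps)
  then have "poly_var b * \<Phi> p = poly_var b * 0" by (simp add: subst_mult L_basis[OF b])
  then have "\<Phi> p = 0" unfolding poly_var_def by (rule single_times_cancel)
  then have "\<Phi> p = \<Phi> 0" by simp
  then show ?thesis using p cl_eq_iff_\<Phi>[OF p(1) pcar_zero] by (simp add: Sym_zero)
qed

lemma sym_of_nonunit:
  assumes b: "b \<in> B" and x: "x \<in> carrier SV"
  shows "sym_of V b \<otimes>\<^bsub>SV\<^esub> x \<noteq> \<one>\<^bsub>SV\<^esub>"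
proof
  assume e: "sym_of V b \<otimes>\<^bsub>SV\<^esub> x = \<one>\<^bsub>SV\<^esub>"
  obtain p where p: "p \<in> cV" "x = cl p" using x(1) Sym_carrier by blast
  have bc: "b \<in> carrier V" using b B by blast
  have "\<Phi> (poly_var b * p) = \<Phi> 1"
    using e p Sym_mult[OF pcar_var[OF bc] p(1)] cl_eq_iff_\<Phi>[OF pcar_mult[OF pcar_var[OF bc] p(1)] pcar_one]
    by (simp add: sym_of_cl Sym_one del: poly_ring_simps)
  then have "poly_var b * \<Phi> p = 1"
    using subst_const[of L 1] by (simp add: subst_mult L_basis[OF b])
  then have "0 \<in> Poly_Mapping.keys (poly_var b * \<Phi> p)" by simp
  then obtain m where m: "0 = Poly_Mapping.single b (1::nat) + m" unfolding poly_var_def by (rule keys_single_times)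
  show False using arg_cong[OF m, of "\<lambda>n. Poly_Mapping.lookup n b"] by (simp add: lookup_add)
qed

text \<open>Two distinct variables of a polynomial ring: if a divides b p, then a occurs in every
  monomial of b p, hence, being different from b, in every monomial of p. The quotient z collects
  the monomials with one factor a removed.\<close>

lemma sym_of_coprime:
  assumes a: "a \<in> B" and b: "b \<in> B" and ne: "a \<noteq> b" and x: "x \<in> carrier SV" and y: "y \<in> carrier SV"
    and e: "sym_of V b \<otimes>\<^bsub>SV\<^esub> x = sym_of V a \<otimes>\<^bsub>SV\<^esub> y"
  shows "\<exists>z\<in>carrier SV. x = sym_of V a \<otimes>\<^bsub>SV\<^esub> z"
proof -
  obtain p where p: "p \<in> cV" "x = cl p" using x unfolding Sym_carrier by blast
  obtain q where q: "q \<in> cV" "y = cl q" using y unfolding Sym_carrier by blast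
  have bc: "b \<in> carrier V" "a \<in> carrier V" using a b B by auto
  let ?a = "Poly_Mapping.single a (1::nat)" and ?b = "Poly_Mapping.single b (1::nat)"
  have "\<Phi> (poly_var b * p) = \<Phi> (poly_var a * q)"
    using e p q Sym_mult[OF pcar_var[OF bc(1)] p(1)] Sym_mult[OF pcar_var[OF bc(2)] q(1)]
      cl_eq_iff_\<Phi>[OF pcar_mult[OF pcar_var[OF bc(1)] p(1)] pcar_mult[OF pcar_var[OF bc(2)] q(1)]]
    by (simp add: sym_of_cl del: poly_ring_simps)
  then have "poly_var b * \<Phi> p = poly_var a * \<Phi> q" by (simp add: subst_mult L_basis[OF b] L_basis[OF a])
  then have eq: "Poly_Mapping.single ?b 1 * \<Phi> p = Poly_Mapping.single ?a 1 * \<Phi> q" unfolding poly_var_def .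
  have "\<exists>m. n = ?a + m" if n: "n \<in> Poly_Mapping.keys (\<Phi> p)" for n
  proof -
    have "?b + n \<in> Poly_Mapping.keys (Poly_Mapping.single ?b 1 * \<Phi> p)"
      using n by (simp add: in_keys_iff lookup_single_times)
    then obtain m where m: "?b + n = ?a + m" unfolding eq by (rule keys_single_times)
    have "Poly_Mapping.lookup (?b + n) a = Poly_Mapping.lookup (?a + m) a" by (simp only: m)
    then have "Poly_Mapping.lookup n a \<ge> 1" using ne by (simp add: lookup_add lookup_single)
    then have "n = ?a + (n - ?a)" by (intro poly_mapping_eqI) (auto simp: lookup_add lookup_minus lookup_single when_def)
    then show ?thesis by blast
  qed
  then obtain g where g: "\<And>n. n \<in> Poly_Mapping.keys (\<Phi> p) \<Longrightarrow> n = ?a + g n" by metis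
  define z where "z = (\<Sum>n\<in>Poly_Mapping.keys (\<Phi> p). Poly_Mapping.single (g n) (Poly_Mapping.lookup (\<Phi> p) n))"
  have zc: "z \<in> cV" unfolding z_def
  proof (rule pcar_sum)
    fix n assume n: "n \<in> Poly_Mapping.keys (\<Phi> p)"
    have "Poly_Mapping.keys (g n) \<subseteq> Poly_Mapping.keys n"
    proof
      fix k assume "k \<in> Poly_Mapping.keys (g n)"
      then show "k \<in> Poly_Mapping.keys n" by (subst g[OF n]) (simp add: in_keys_iff lookup_add)
    qed
    then have "Poly_Mapping.keys (g n) \<subseteq> carrier V" using n \<Phi>_carrier[of p] by fastforce
    then show "Poly_Mapping.single (g n) (Poly_Mapping.lookup (\<Phi> p) n) \<in> cV" by simp
  qed
  have "poly_var a * z = (\<Sum>n\<in>Poly_Mapping.keys (\<Phi> p). Poly_Mapping.single n (Poly_Mapping.lookup (\<Phi> p) n))"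
    unfolding z_def poly_var_def sum_distrib_left using g by (intro sum.cong) (simp_all add: mult_single)
  also have "\<dots> = \<Phi> p" by (rule poly_mapping_sum_singles[symmetric])
  finally have "x = sym_of V a \<otimes>\<^bsub>SV\<^esub> cl z"
    using p cl_\<Phi>[OF p(1)] Sym_mult[OF pcar_var[OF bc(2)] zc] by (simp add: sym_of_cl)
  then show ?thesis using Sym_carrier zc by blast
qed

lemma rgrade_subset: "rgrade SV i \<subseteq> carrier SV"
  unfolding Sym_grade Sym_carrier by blast

definition rep :: "('l, 'f) polys set \<Rightarrow> ('l, 'f) polys" where "rep x = (SOME p. p \<in> cV \<and> cl p = x)"

lemma rep: assumes "x \<in> carrier SV" shows "rep x \<in> cV" "cl (rep x) = x"
proof -
  have "\<exists>p. p \<in> cV \<and> cl p = x" using assms unfolding Sym_carrier image_iff by metis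
  then have r: "rep x \<in> cV \<and> cl (rep x) = x" unfolding rep_def by (rule someI_ex)
  show "rep x \<in> cV" by (rule conjunct1[OF r])
  show "cl (rep x) = x" by (rule conjunct2[OF r])
qed

text \<open>The defining ideal is homogeneous, here because \<open>\<Phi>\<close> replaces variables
  by polynomials of the same degree and so commutes with homogeneous parts.\<close>

lemma cl_hpart: assumes "p \<in> cV" "q \<in> cV" "cl p = cl q" shows "cl (hpart i p) = cl (hpart i q)"
proof -
  have "\<Phi> p = \<Phi> q" using assms(3) cl_eq_iff_\<Phi>[OF assms(1,2)] by blast
  then have "\<Phi> (hpart i p) = \<Phi> (hpart i q)" by (simp only: hpart_subst[OF L_homog, symmetric])
  then show ?thesis using cl_eq_iff_\<Phi>[OF pcar_hpart pcar_hpart, OF assms(1,2)] by blast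
qed

lemma cl_sum: "finite A \<Longrightarrow> (\<And>i. i \<in> A \<Longrightarrow> g i \<in> cV) \<Longrightarrow> finsum SV (\<lambda>i. cl (g i)) A = cl (\<Sum>i\<in>A. g i)"
proof (induction A rule: finite_induct)
  interpret S: cring SV by (rule Sym_cring)
  case empty then show ?case by (simp add: Sym_zero)
next
  interpret S: cring SV by (rule Sym_cring)
  case (insert a A)
  have "cl (g i) \<in> carrier SV" if "i \<in> insert a A" for i using insert.prems[OF that] Sym_carrier by blast
  then show ?case using insert pcar_sum[of A g "carrier V"] 
    by (subst S.finsum_insert) (auto simp: Sym_add simp del: poly_ring_simps)
qed

text \<open>Homogeneous components of a class are computed from a representative;
  \<open>cl_hpart\<close> removes the dependence on the choice.\<close>

lemma Sym_regular_graded: "graded_module SV (regular_gmodule SV)"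
proof -
  interpret S: cring SV by (rule Sym_cring)
  let ?M = "regular_gmodule SV"
  have [simp]: "carrier ?M = carrier SV" "zero ?M = \<zero>\<^bsub>SV\<^esub>" "add ?M = add SV" "smult ?M = mult SV" "grade ?M i = rgrade SV i" for i
    by (simp_all add: regular_gmodule_def)
  have clc: "p \<in> cV \<Longrightarrow> cl p \<in> carrier SV" for p using Sym_carrier by blast
  have S: "module SV ?M"
    by (rule moduleI[OF Sym_cring], rule abelian_groupI)
      (use S.l_neg in \<open>auto simp: S.a_ac S.m_ac S.l_distr S.r_distr\<close>)
  interpret M: module SV ?M by (rule S)
  have fs: "finsum ?M h A = finsum SV h A" if "h \<in> A \<rightarrow> carrier SV" for h and A :: "int set"
    using finsum_additive_map[OF M.abelian_monoid_axioms S.abelian_monoid_axioms, of h A "\<lambda>x. x"] that by auto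
  have hp: "cl (hpart i (rep (cl p))) = cl (hpart i p)" if "p \<in> cV" for i p
    by (rule cl_hpart) (use that rep[OF clc[OF that]] in auto)
  show ?thesis
  proof (rule graded_moduleI[where \<pi> = "\<lambda>i x. cl (hpart i (rep x))", OF S])
    fix i
    show "additive_subgroup (grade ?M i) ?M"
    proof (rule additive_subgroupI, rule group.subgroupI)
      show "Group.group (add_monoid ?M)" by (rule M.a_group)
      show "grade ?M i \<subseteq> carrier (add_monoid ?M)" using rgrade_subset by simp
      have "cl 0 \<in> rgrade SV i" unfolding Sym_grade using pcar_zero homog_zero by blast
      then show "grade ?M i \<noteq> {}" by auto
    next
      fix x assume "x \<in> grade ?M i"
      then obtain p where p: "p \<in> cV" "homog i p" "x = cl p" unfolding \<open>grade ?M i = _\<close> Sym_grade by blast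
      have "cl (- p) \<oplus>\<^bsub>SV\<^esub> x = \<zero>\<^bsub>SV\<^esub>" using p Sym_add[OF pcar_uminus[OF p(1)] p(1)] by (simp add: Sym_zero)
      then have "\<ominus>\<^bsub>?M\<^esub> x = cl (- p)" using p clc pcar_uminus[OF p(1)] by (intro M.minus_equality) auto
      moreover have "cl (- p) \<in> rgrade SV i" unfolding Sym_grade using pcar_uminus[OF p(1)] homog_uminus[OF p(2)] by blast
      ultimately show "inv\<^bsub>add_monoid ?M\<^esub> x \<in> grade ?M i" by (simp add: a_inv_def)
    next
      fix x y assume "x \<in> grade ?M i" "y \<in> grade ?M i"
      then obtain p q where p: "p \<in> cV" "homog i p" "x = cl p" and q: "q \<in> cV" "homog i q" "y = cl q"
        unfolding \<open>grade ?M i = _\<close> Sym_grade by blast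
      have "cl (p + q) \<in> rgrade SV i" unfolding Sym_grade using pcar_add[OF p(1) q(1)] homog_add[OF p(2) q(2)] by blast
      then show "x \<otimes>\<^bsub>add_monoid ?M\<^esub> y \<in> grade ?M i" using p q Sym_add[OF p(1) q(1)] by simp
    qed
  next
    fix i j x y assume "x \<in> rgrade SV i" "y \<in> grade ?M j"
    then obtain p q where p: "p \<in> cV" "homog i p" "x = cl p" and q: "q \<in> cV" "homog j q" "y = cl q"
      unfolding \<open>grade ?M j = _\<close> Sym_grade by blast
    have "cl (p * q) \<in> rgrade SV (i + j)" unfolding Sym_grade using pcar_mult[OF p(1) q(1)] homog_mult[OF p(2) q(2)] by blast
    then show "x \<odot>\<^bsub>?M\<^esub> y \<in> grade ?M (i + j)" using p q Sym_mult[OF p(1) q(1)] by simp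
  next
    fix i x assume "x \<in> carrier ?M"
    then show "cl (hpart i (rep x)) \<in> grade ?M i"
      unfolding \<open>grade ?M i = _\<close> Sym_grade
      by (intro imageI CollectI conjI pcar_hpart homog_hpart rep(1)) simp
  next
    fix i x y assume "x \<in> carrier ?M" "y \<in> carrier ?M"
    then obtain p q where p: "p \<in> cV" "x = cl p" and q: "q \<in> cV" "y = cl q" using Sym_carrier by auto
    show "cl (hpart i (rep (x \<oplus>\<^bsub>?M\<^esub> y))) = cl (hpart i (rep x)) \<oplus>\<^bsub>?M\<^esub> cl (hpart i (rep y))"
      using p q hp[OF p(1)] hp[OF q(1)] hp[OF pcar_add[OF p(1) q(1)]] Sym_add[OF p(1) q(1)] Sym_add[OF pcar_hpart[OF p(1)] pcar_hpart[OF q(1)]]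
      by (simp add: hpart_add del: poly_ring_simps)
  next
    fix i j x assume "x \<in> grade ?M i"
    then obtain p where p: "p \<in> cV" "homog i p" "x = cl p" unfolding \<open>grade ?M i = _\<close> Sym_grade by blast
    then show "cl (hpart j (rep x)) = (if j = i then x else \<zero>\<^bsub>?M\<^esub>)"
      using hp[OF p(1)] hpart_homog[OF p(2)] by (simp add: Sym_zero)
  next
    fix x assume "x \<in> carrier ?M"
    then have "x \<in> carrier SV" by simp
    note p = rep[OF this]
    let ?A = "{i. cl (hpart i (rep x)) \<noteq> \<zero>\<^bsub>?M\<^esub>}"
    let ?B = "(\<lambda>m. 2 * int (total_degree m)) ` Poly_Mapping.keys (rep x)"
    have AB: "?A \<subseteq> ?B"
    proof
      fix i assume "i \<in> ?A"
      then have "cl (hpart i (rep x)) \<noteq> cl 0" by (simp only: mem_Collect_eq \<open>zero ?M = \<zero>\<^bsub>SV\<^esub>\<close> Sym_zero not_False_eq_True)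
      then have "hpart i (rep x) \<noteq> 0" by metis
      then have "Poly_Mapping.keys (hpart i (rep x)) \<noteq> {}" by simp
      then show "i \<in> ?B" unfolding keys_hpart by blast
    qed
    then show "finite ?A" by (rule finite_subset) simp
    have d: "rep x = (\<Sum>i\<in>?B. hpart i (rep x))" by (rule hpart_decomposition) auto
    have "x = cl (\<Sum>i\<in>?B. hpart i (rep x))" by (rule trans[OF p(2)[symmetric] arg_cong[OF d, of cl]])
    also have "\<dots> = finsum SV (\<lambda>i. cl (hpart i (rep x))) ?B"
      by (rule cl_sum[symmetric]) (use pcar_hpart[OF p(1)] in auto)
    also have "\<dots> = finsum SV (\<lambda>i. cl (hpart i (rep x))) ?A"
      by (rule S.finsum_superset[symmetric]) (use AB clc pcar_hpart[OF p(1)] in auto)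
    finally show "x = finsum ?M (\<lambda>i. cl (hpart i (rep x))) ?A"
      using clc pcar_hpart[OF p(1)] by (subst fs) auto
  qed
qed

lemma Sym_graded_base: "graded_base SV"
proof
  show "graded_module SV (regular_gmodule SV)" by (rule Sym_regular_graded)
  show "\<one>\<^bsub>SV\<^esub> \<in> rgrade SV 0" unfolding Sym_one Sym_grade using pcar_one homog_one by blast
qed (rule rgrade_subset)

end


section \<open>Base change of a lattice and its bases\<close>

lemma fscale_conv: "fscale c p = Poly_Mapping.single 0 c * (p :: ('x::ab_group_add, 'f::field) poly_mapping)"
  unfolding fscale_def by (rule mult_map_scale_conv_mult)

lemma lookup_fscale: "Poly_Mapping.lookup (fscale c p) k = c * Poly_Mapping.lookup p k"
  by (simp add: fscale_def Poly_Mapping.map.rep_eq when_def)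

interpretation FS: vector_space "fscale :: 'f::field \<Rightarrow> ('x, 'f) poly_mapping \<Rightarrow> _"
  by unfold_locales (rule poly_mapping_eqI; simp add: lookup_fscale lookup_add algebra_simps)+

lemma keys_fscale: "Poly_Mapping.keys (fscale c p) \<subseteq> Poly_Mapping.keys p"
  by (auto simp: in_keys_iff lookup_fscale)

locale lattice_base_change =
  fixes X :: "'x::ab_group_add set" and V :: "('f::field, ('x, 'f) poly_mapping set) module"
  assumes X_zero: "0 \<in> X" and X_add: "\<And>x y. x \<in> X \<Longrightarrow> y \<in> X \<Longrightarrow> x + y \<in> X"
    and V_def: "V = base_change X"
begin

definition U :: "('x, 'f) poly_mapping set" where "U = {p. Poly_Mapping.keys p \<subseteq> X}"
definition Rel :: "('x, 'f) poly_mapping set" where "Rel = additivity_relations X"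
text \<open>The quotient map from the free vector space on X to the base change, with classes as
  explicit translates of the relations; \<open>U\<close>, the span of the symbols from X, is the
  domain on which it is used.\<close>

definition q :: "('x, 'f) poly_mapping \<Rightarrow> ('x, 'f) poly_mapping set" where "q p = {r + p | r. r \<in> Rel}"

abbreviation bco :: "'x \<Rightarrow> ('x, 'f) poly_mapping set" where "bco \<equiv> base_change_of X"

lemma U_subspace: "FS.subspace U"
proof (rule FS.subspaceI)
  show "x + y \<in> U" if "x \<in> U" "y \<in> U" for x y using that keys_add[of x y] by (auto simp: U_def)
  show "fscale c x \<in> U" if "x \<in> U" for c x using that keys_fscale[of c x] by (auto simp: U_def)
qed (simp add: U_def)

lemma Rel_subspace: "FS.subspace Rel"
  unfolding Rel_def additivity_relations_def by (rule FS.subspace_span)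

lemma Rel_U: "Rel \<subseteq> U"
proof -
  have "Poly_Mapping.single (x + y) 1 - Poly_Mapping.single x 1 - Poly_Mapping.single y 1 \<in> U" if "x \<in> X" "y \<in> X" for x y
  proof -
    have "Poly_Mapping.single z 1 \<in> U" if "z \<in> X" for z using that by (auto simp: U_def)
    then show ?thesis using X_add that by (intro FS.subspace_diff[OF U_subspace]) auto
  qed
  then show ?thesis unfolding Rel_def additivity_relations_def by (intro FS.span_minimal[OF _ U_subspace]) auto
qed

lemma q_coset: "Rel +>\<^bsub>free_vector_space X\<^esub> p = q p"
  by (auto simp: a_r_coset_def' free_vector_space_def q_def)

lemma q_eq_iff: "q p = q p' \<longleftrightarrow> p - p' \<in> Rel"
proof
  assume "q p = q p'"
  moreover have "p \<in> q p" unfolding q_def using FS.subspace_0[OF Rel_subspace] by force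
  ultimately obtain r where "r \<in> Rel" "p = r + p'" unfolding q_def by auto
  then show "p - p' \<in> Rel" by simp
next
  assume d: "p - p' \<in> Rel"
  have "q a \<subseteq> q b" if "a - b \<in> Rel" for a b
  proof
    fix x assume "x \<in> q a"
    then obtain r where r: "r \<in> Rel" "x = r + a" unfolding q_def by blast
    then have "x = (r + (a - b)) + b" "r + (a - b) \<in> Rel" using FS.subspace_add[OF Rel_subspace r(1) that] by auto
    then show "x \<in> q b" unfolding q_def by blast
  qed
  moreover have "p' - p \<in> Rel" using FS.subspace_neg[OF Rel_subspace d] by simp
  ultimately show "q p = q p'" using d by blast
qed

lemma V_carrier: "carrier V = q ` U"
proof -
  have "carrier (free_vector_space X :: ('f, ('x, 'f) poly_mapping) module) = U" by (simp add: free_vector_space_def U_def)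
  then show ?thesis by (auto simp: V_def base_change_def quot_module_def A_RCOSETS_def' Rel_def[symmetric] q_coset)
qed

lemma V_zero: "\<zero>\<^bsub>V\<^esub> = q 0"
  by (simp add: V_def base_change_def quot_module_def Rel_def[symmetric] q_def)

lemma V_add: "q p \<oplus>\<^bsub>V\<^esub> q p' = q (p + p')"
proof -
  have "q p \<oplus>\<^bsub>V\<^esub> q p' = {a + b | a b. a \<in> q p \<and> b \<in> q p'}"
    by (auto simp: V_def base_change_def quot_module_def set_add_def' free_vector_space_def)
  also have "\<dots> = q (p + p')"
  proof (intro equalityI subsetI)
    fix x assume "x \<in> {a + b | a b. a \<in> q p \<and> b \<in> q p'}"
    then obtain r r' where r: "r \<in> Rel" "r' \<in> Rel" "x = (r + p) + (r' + p')" unfolding q_def by blast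
    then have "x = (r + r') + (p + p')" by (simp add: algebra_simps)
    then show "x \<in> q (p + p')" using FS.subspace_add[OF Rel_subspace r(1,2)] unfolding q_def by blast
  next
    fix x assume "x \<in> q (p + p')"
    then obtain r where r: "r \<in> Rel" "x = (r + p) + (0 + p')" unfolding q_def by (auto simp: algebra_simps)
    moreover have "r + p \<in> q p" "0 + p' \<in> q p'" using r FS.subspace_0[OF Rel_subspace] unfolding q_def by blast+
    ultimately show "x \<in> {a + b | a b. a \<in> q p \<and> b \<in> q p'}" by blast
  qed
  finally show ?thesis .
qed

lemma V_smult: "c \<odot>\<^bsub>V\<^esub> q p = q (fscale c p)"
proof -
  have "c \<odot>\<^bsub>V\<^esub> q p = (\<Union>m\<in>q p. q (fscale c m))"
    by (simp add: V_def base_change_def quot_module_def Rel_def[symmetric] q_coset) (simp add: free_vector_space_def)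
  moreover have "q (fscale c m) = q (fscale c p)" if m: "m \<in> q p" for m
  proof -
    obtain r where r: "r \<in> Rel" "m = r + p" using m unfolding q_def by blast
    have "fscale c m - fscale c p = fscale c r" using r by (simp add: FS.scale_right_distrib)
    then show ?thesis using q_eq_iff FS.subspace_scale[OF Rel_subspace r(1)] by metis
  qed
  moreover have "p \<in> q p" unfolding q_def using FS.subspace_0[OF Rel_subspace] by force
  ultimately show ?thesis by blast
qed

lemma bco_q: "bco x = q (Poly_Mapping.single x 1)"
  by (simp add: base_change_of_def Rel_def[symmetric] q_coset)

lemma single_U: "x \<in> X \<Longrightarrow> Poly_Mapping.single x 1 \<in> U" by (auto simp: U_def)

lemma bco_carrier: "x \<in> X \<Longrightarrow> bco x \<in> carrier V"
  unfolding bco_q V_carrier using single_U by blast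

lemma bco_add: assumes "x \<in> X" "y \<in> X" shows "bco (x + y) = bco x \<oplus>\<^bsub>V\<^esub> bco y"
proof -
  have "Poly_Mapping.single (x + y) 1 - Poly_Mapping.single x 1 - Poly_Mapping.single y (1::'f) \<in> Rel"
    unfolding Rel_def additivity_relations_def by (rule FS.span_base) (use assms in blast)
  then have "Poly_Mapping.single (x + y) 1 - (Poly_Mapping.single x 1 + Poly_Mapping.single y (1::'f)) \<in> Rel"
    by (simp add: algebra_simps)
  then show ?thesis unfolding bco_q V_add using q_eq_iff by blast
qed

text \<open>Take a basis C of the space of relations and extend C together with T to a basis D of
  the free vector space on X. The classes of D - C then form a basis of the quotient that contains
  the classes of T, with the coefficients at D - C as coordinates.\<close>

lemma sym_basis_extends:
  assumes T: "T \<subseteq> U" "\<And>C. FS.independent C \<Longrightarrow> FS.span C = Rel \<Longrightarrow> FS.independent (C \<union> T) \<and> C \<inter> T = {}"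
  shows "\<exists>B c. sym_basis V B c \<and> q ` T \<subseteq> B"
proof -
  obtain C where C: "C \<subseteq> Rel" "FS.independent C" "Rel \<subseteq> FS.span C"
    using FS.maximal_independent_subset_extend[of "{}" Rel] FS.independent_empty by (metis empty_subsetI)
  have sC: "FS.span C = Rel" using C FS.span_minimal[OF C(1) Rel_subspace] by blast
  have CT: "FS.independent (C \<union> T)" "C \<inter> T = {}" using T(2)[OF C(2) sC] by auto
  obtain D where D: "C \<union> T \<subseteq> D" "D \<subseteq> U" "FS.independent D" "U \<subseteq> FS.span D"
    using FS.maximal_independent_subset_extend[of "C \<union> T" U] CT(1) T(1) C(1) Rel_U by (metis Un_least subset_trans)
  let ?r = "FS.representation D"
  define B where "B = q ` (D - C)"
  \<comment> \<open>A relation is a combination of C alone. So the coefficients off C depend only on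
    the class of a vector.\<close>
  have rel: "?r p d = 0" if "p \<in> Rel" "d \<notin> C" for p d
  proof -
    have "?r p = FS.representation C p" using FS.representation_extend[OF D(3)] that(1) sC D(1) by (metis Un_subset_iff)
    then show ?thesis using FS.representation_ne_zero[of C p d] that(2) by metis
  qed
  have UD: "p \<in> FS.span D" if "p \<in> U" for p using that D by blast
  have wd: "?r p d = ?r p' d" if "p \<in> U" "p' \<in> U" "q p = q p'" "d \<notin> C" for p p' d
    using rel[of "p - p'" d] that q_eq_iff FS.representation_diff[OF D(3) UD UD, of p' p] by simp
  define rp where "rp v = (SOME p. p \<in> U \<and> q p = v)" for v
  have rp: "rp v \<in> U \<and> q (rp v) = v" if "v \<in> carrier V" for v
  proof -
    have "\<exists>p. p \<in> U \<and> q p = v" using that unfolding V_carrier by blast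
    then show ?thesis unfolding rp_def by (rule someI_ex)
  qed
  have dU: "d \<in> U" if "d \<in> D" for d using D that by blast
  have rd: "?r d = (\<lambda>e. if e = d then 1 else 0)" if "d \<in> D" for d by (rule FS.representation_basis[OF D(3) that])
  have inj: "d = e" if de: "d \<in> D - C" "e \<in> D - C" "q d = q e" for d e
  proof -
    have "?r d d = ?r e d" using wd[OF dU dU de(3)] de by blast
    then show ?thesis using rd[of d] rd[of e] de by (simp split: if_splits)
  qed
  define db where "db b = (SOME d. d \<in> D - C \<and> q d = b)" for b
  have db: "db (q d) = d" if "d \<in> D - C" for d
  proof -
    have "\<exists>e. e \<in> D - C \<and> q e = q d" using that by blast
    then have "db (q d) \<in> D - C \<and> q (db (q d)) = q d" unfolding db_def by (rule someI_ex)
    then show ?thesis using inj that by blast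
  qed
  define c where "c v b = (if v \<in> carrier V \<and> b \<in> B then ?r (rp v) (db b) else 0)" for v b
  have c: "c (q p) (q d) = ?r p d" if "p \<in> U" "d \<in> D - C" for p d
  proof -
    have v: "q p \<in> carrier V" using that V_carrier by blast
    moreover have "q d \<in> B" using that B_def by blast
    ultimately show ?thesis using wd[of "rp (q p)" p d] rp[OF v] that db[OF that(2)] by (simp add: c_def)
  qed
  have c0: "b \<notin> B \<Longrightarrow> c v b = 0" for v b by (simp add: c_def)
  have "sym_basis V B c"
  proof
    show "B \<subseteq> carrier V" unfolding B_def V_carrier using dU by blast
    have "0 \<in> U" by (rule FS.subspace_0[OF U_subspace])
    then show "\<zero>\<^bsub>V\<^esub> \<in> carrier V" unfolding V_zero V_carrier by blast
    show "\<zero>\<^bsub>V\<^esub> \<oplus>\<^bsub>V\<^esub> \<zero>\<^bsub>V\<^esub> = \<zero>\<^bsub>V\<^esub>" unfolding V_zero V_add by simp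
  next
    fix u v b assume "u \<in> carrier V" "v \<in> carrier V"
    then obtain p p' where p: "p \<in> U" "u = q p" "p' \<in> U" "v = q p'" unfolding V_carrier by blast
    have pp: "p + p' \<in> U" using FS.subspace_add[OF U_subspace] p by blast
    then show "u \<oplus>\<^bsub>V\<^esub> v \<in> carrier V" unfolding p(2,4) V_add V_carrier by blast
    show "c (u \<oplus>\<^bsub>V\<^esub> v) b = c u b + c v b"
    proof (cases "b \<in> B")
      case True
      then obtain d where d: "d \<in> D - C" "b = q d" unfolding B_def by blast
      show ?thesis unfolding p(2,4) V_add d(2) c[OF pp d(1)] c[OF p(1) d(1)] c[OF p(3) d(1)]
        using FS.representation_add[OF D(3) UD UD] p by simp
    qed (simp add: c0)
  next
    fix a v assume "v \<in> carrier V"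
    then obtain p where p: "p \<in> U" "v = q p" unfolding V_carrier by blast
    then show "a \<odot>\<^bsub>V\<^esub> v \<in> carrier V" unfolding p(2) V_smult V_carrier using FS.subspace_scale[OF U_subspace] by blast
  next
    fix a v b assume "v \<in> carrier V"
    then obtain p where p: "p \<in> U" "v = q p" unfolding V_carrier by blast
    have ap: "fscale a p \<in> U" using FS.subspace_scale[OF U_subspace p(1)] .
    show "c (a \<odot>\<^bsub>V\<^esub> v) b = a * c v b"
    proof (cases "b \<in> B")
      case True
      then obtain d where d: "d \<in> D - C" "b = q d" unfolding B_def by blast
      show ?thesis unfolding p(2) V_smult d(2) c[OF ap d(1)] c[OF p(1) d(1)]
        using FS.representation_scale[OF D(3) UD] p by simp
    qed (simp add: c0)
  next
    fix b e assume "b \<in> B"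
    then obtain d where d: "d \<in> D - C" "b = q d" unfolding B_def by blast
    show "c b e = (if b = e then 1 else 0)"
    proof (cases "e \<in> B")
      case True
      then obtain d' where d': "d' \<in> D - C" "e = q d'" unfolding B_def by blast
      have "c b e = (if d' = d then 1 else 0)" unfolding d(2) d'(2) using c[OF dU d'(1), of d] rd[of d] d by simp
      then show ?thesis using inj[OF d'(1) d(1)] d d' by auto
    next
      case False then show ?thesis using \<open>b \<in> B\<close> by (auto simp: c0)
    qed
  next
    fix v
    have "{b. c v b \<noteq> 0} \<subseteq> q ` {d. ?r (rp v) d \<noteq> 0}"
    proof
      fix b assume "b \<in> {b. c v b \<noteq> 0}"
      then have b: "b \<in> B" "?r (rp v) (db b) \<noteq> 0" by (auto simp: c_def split: if_splits)
      then obtain d where d: "d \<in> D - C" "b = q d" unfolding B_def by blast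
      then show "b \<in> q ` {d. ?r (rp v) d \<noteq> 0}" using b db by auto
    qed
    then show "finite {b. c v b \<noteq> 0}" using FS.finite_representation by (rule finite_subset[OF _ finite_imageI])
  next
    fix v b show "c v b \<noteq> 0 \<Longrightarrow> b \<in> B" using c0 by blast
  next
    fix P v assume v: "v \<in> carrier V" and P0: "P \<zero>\<^bsub>V\<^esub>" and PB: "\<And>b. b \<in> B \<Longrightarrow> P b"
      and Pa: "\<And>u v. u \<in> carrier V \<Longrightarrow> v \<in> carrier V \<Longrightarrow> P u \<Longrightarrow> P v \<Longrightarrow> P (u \<oplus>\<^bsub>V\<^esub> v)"
      and Ps: "\<And>a v. v \<in> carrier V \<Longrightarrow> P v \<Longrightarrow> P (a \<odot>\<^bsub>V\<^esub> v)"
    have sU: "FS.span D \<subseteq> U" by (rule FS.span_minimal[OF D(2) U_subspace])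
    have "p \<in> U \<and> P (q p)" if "p \<in> FS.span D" for p
      using that
    proof (induction rule: FS.span_induct_alt)
      case base then show ?case using P0 V_zero FS.subspace_0[OF U_subspace] by simp
    next
      case (step a d p)
      have "P (q d)"
      proof (cases "d \<in> C")
        case True
        then have "q d = q 0" using q_eq_iff[of d 0] C(1) by auto
        then show ?thesis using P0 V_zero by simp
      next
        case False then show ?thesis using PB step(1) B_def by blast
      qed
      moreover have "q d \<in> carrier V" using dU[OF step(1)] V_carrier by blast
      ultimately have 1: "P (a \<odot>\<^bsub>V\<^esub> q d)" using Ps by blast
      have ad: "fscale a d \<in> U" using FS.subspace_scale[OF U_subspace dU[OF step(1)]] .
      then have "a \<odot>\<^bsub>V\<^esub> q d \<in> carrier V" unfolding V_smult V_carrier by (rule imageI)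
      moreover have "q p \<in> carrier V" unfolding V_carrier using step(2) by (intro imageI) simp
      ultimately have "P (a \<odot>\<^bsub>V\<^esub> q d \<oplus>\<^bsub>V\<^esub> q p)" by (rule Pa) (use 1 step in simp_all)
      then show ?case using FS.subspace_add[OF U_subspace ad] step(2) by (simp add: V_smult V_add)
    qed
    moreover obtain p where "p \<in> U" "v = q p" using v unfolding V_carrier by blast
    ultimately show "P v" using UD by blast
  qed
  moreover have "q ` T \<subseteq> B" using D(1) CT(2) unfolding B_def by blast
  ultimately show ?thesis by blast
qed

lemma sym_basis_exists: "\<exists>B c. sym_basis V B c"
  using sym_basis_extends[of "{}"] by auto

lemma sym_basis_one:
  assumes x: "x \<in> X" and nz: "Poly_Mapping.single x 1 \<notin> Rel"
  shows "\<exists>B c. sym_basis V B c \<and> bco x \<in> B"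
proof -
  let ?s = "Poly_Mapping.single x (1::'f)"
  have "FS.independent (C \<union> {?s}) \<and> C \<inter> {?s} = {}" if "FS.independent C" "FS.span C = Rel" for C
    using that nz FS.span_base[of ?s C] by (auto simp: FS.independent_insert)
  then show ?thesis using sym_basis_extends[of "{?s}"] single_U[OF x] unfolding bco_q by fastforce
qed

text \<open>Non-proportional means that no nontrivial combination of the two symbols is a relation,
  which is independence of the symbols over the relations.\<close>

lemma sym_basis_two:
  assumes x: "x \<in> X" and y: "y \<in> X" and np: "\<not> proportional V (bco x) (bco y)"
  shows "\<exists>B c. sym_basis V B c \<and> bco x \<in> B \<and> bco y \<in> B \<and> bco x \<noteq> bco y"
proof -
  let ?s = "Poly_Mapping.single x (1::'f)" and ?t = "Poly_Mapping.single y (1::'f)"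
  have *: "fscale a ?s - fscale b ?t \<notin> Rel" if "(a, b) \<noteq> (0, 0)" for a b
    using np that q_eq_iff[of "fscale a ?s" "fscale b ?t"] unfolding proportional_def bco_q V_smult by blast
  have sR: "?s \<notin> Rel" using *[of 1 0] by simp
  have "FS.independent (C \<union> {?s, ?t}) \<and> C \<inter> {?s, ?t} = {}" if C: "FS.independent C" "FS.span C = Rel" for C
  proof -
    have s: "?s \<notin> FS.span C" using sR C by simp
    have t: "?t \<notin> FS.span (insert ?s C)"
    proof
      assume "?t \<in> FS.span (insert ?s C)"
      then obtain k where "?t - fscale k ?s \<in> Rel" using FS.span_breakdown_eq C by metis
      then have "fscale k ?s - fscale 1 ?t \<in> Rel" using FS.subspace_neg[OF Rel_subspace] by fastforce
      then show False using *[of k 1] by simp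
    qed
    have "FS.independent (insert ?t (insert ?s C))" using s t C(1) by (intro FS.independent_insertI)
    moreover have "?s \<notin> C" "?t \<notin> C" using s t FS.span_base by blast+
    moreover have "C \<union> {?s, ?t} = insert ?t (insert ?s C)" by blast
    ultimately show ?thesis by simp
  qed
  then obtain B c where "sym_basis V B c" "q ` {?s, ?t} \<subseteq> B" using sym_basis_extends[of "{?s, ?t}"] single_U x y by auto
  moreover have "bco x \<noteq> bco y"
    using *[of 1 1] q_eq_iff unfolding bco_q by simp
  ultimately show ?thesis unfolding bco_q by blast
qed

text \<open>An additive functional on \<open>X\<close> which does not vanish at \<open>x\<close> in \<open>'f\<close> shows that \<open>x \<otimes> 1\<close> is nonzero.\<close>

lemma single_not_Rel:
  assumes l: "\<And>x y. x \<in> X \<Longrightarrow> y \<in> X \<Longrightarrow> l (x + y) = l x + (l y :: 'f)" and x: "l x \<noteq> 0"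
  shows "Poly_Mapping.single x 1 \<notin> Rel"
proof
  define f where "f p = (\<Sum>k\<in>Poly_Mapping.keys p. Poly_Mapping.lookup p k * l k)" for p :: "('x, 'f) poly_mapping"
  have f_add: "f (p + p') = f p + f p'" for p p'
    unfolding f_def by (rule setsum_keys_plus_distrib) (auto simp: distrib_right)
  have f_single: "f (Poly_Mapping.single z a) = a * l z" for z a by (simp add: f_def)
  have f_diff: "f (p - p') = f p - f p'" for p p' using f_add[of "p - p'" p'] by simp
  have f_scale: "f (fscale a p) = a * f p" for a p
  proof (cases "a = 0")
    case False
    then have "Poly_Mapping.keys (fscale a p) = Poly_Mapping.keys p" by (auto simp: in_keys_iff lookup_fscale)
    then show ?thesis by (simp add: f_def lookup_fscale sum_distrib_left mult.assoc)
  qed (simp add: f_def)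
  assume "Poly_Mapping.single x 1 \<in> Rel"
  then have "Poly_Mapping.single x (1::'f) \<in> FS.span {Poly_Mapping.single (x + y) 1 - Poly_Mapping.single x 1 - Poly_Mapping.single y 1 | x y.
        x \<in> X \<and> y \<in> X}" by (simp add: Rel_def additivity_relations_def)
  then have "f (Poly_Mapping.single x 1) = 0"
  proof (induction rule: FS.span_induct_alt)
    case base then show ?case by (simp add: f_def)
  next
    case (step c u v)
    then have "f u = 0" using l by (auto simp: f_diff f_single)
    then show ?case using step by (simp add: f_add f_scale)
  qed
  then show False using x by (simp add: f_single)
qed

end


section \<open>Labels in the symmetric algebra and functions that multiply sections\<close>

locale projective_setup = affine_wall \<Delta> s for \<Delta> :: "'v::ab_group_add root_data" and s +
  fixes P :: "('v affine_trans, 'v affine_edge, ('v, 'f::field) weight_sym, 'm, 'n) msheaf"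
  assumes char: "CHAR('f) \<noteq> 2"
    and proj: "projective_sheaf (label_space \<Delta>) (affine_graph \<Delta>) P"
    and gkm: "GKM (label_space \<Delta> :: ('f, ('v, 'f) weight_space) module)
      (full_subgraph (affine_graph \<Delta>)
        (msupp (affine_graph \<Delta> :: ('v affine_trans, 'v affine_edge, ('v, 'f) weight_space) moment_graph) P \<union>
          (\<lambda>x. x \<otimes>\<^bsub>affine_weyl \<Delta>\<^esub> s) `
            msupp (affine_graph \<Delta> :: ('v affine_trans, 'v affine_edge, ('v, 'f) weight_space) moment_graph) P))"
begin

abbreviation V :: "('f, ('v, 'f) weight_space) module" where "V \<equiv> label_space \<Delta>"
abbreviation SV :: "('v, 'f) weight_sym graded_ring" where "SV \<equiv> Sym V"
abbreviation G :: "('v affine_trans, 'v affine_edge, ('v, 'f) weight_space) moment_graph" where "G \<equiv> affine_graph \<Delta>"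
abbreviation Gs :: "('v affine_trans set, 'v affine_coset_edge, ('v, 'f) weight_space) moment_graph"
  where "Gs \<equiv> coset_graph \<Delta> s"
abbreviation WC :: "'v affine_trans set" where "WC \<equiv> carrier W"
abbreviation aw :: "('v \<times> int) set" where "aw \<equiv> affine_weights \<Delta>"
abbreviation rl :: "'v \<times> int \<Rightarrow> ('v, 'f) weight_space" where "rl \<equiv> root_label \<Delta>"
definition lb :: "'v \<times> int \<Rightarrow> ('v, 'f) weight_sym" where "lb \<beta> = sym_of V (rl \<beta>)"

lemma two_nz: "(2::'f) \<noteq> 0"
proof
  assume "(2::'f) = 0"
  then have "CHAR('f) dvd 2" using of_nat_eq_0_iff_char_dvd[where 'a = 'f, of 2] by simp
  then have "CHAR('f) \<le> 2" by (rule dvd_imp_le) simp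
  moreover have "CHAR('f) \<noteq> 0" using \<open>CHAR('f) dvd 2\<close> by (metis dvd_0_left zero_neq_numeral)
  ultimately show False using char CHAR_not_1[where 'a = 'f] by simp
qed

lemma aw_iff: "\<beta> \<in> aw \<longleftrightarrow> (\<forall>\<alpha>\<in>Rt. cr \<alpha> (fst \<beta>) \<in> \<int>)"
  by (cases \<beta>) (simp add: affine_weights_def)

lemma aw_add: "x \<in> aw \<Longrightarrow> y \<in> aw \<Longrightarrow> x + y \<in> aw"
  by (simp add: aw_iff coroot_simps)
lemma aw_zero: "0 \<in> aw"
  by (simp add: aw_iff coroot_simps)
lemma aw_neg: "x \<in> aw \<Longrightarrow> - x \<in> aw"
  by (simp add: aw_iff coroot_simps)
lemma AR_aw: "\<beta> \<in> AR \<Longrightarrow> \<beta> \<in> aw"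
  by (simp add: aw_iff AR_iff coroot_Ints)

sublocale LB: lattice_base_change aw V
  by unfold_locales (auto simp: aw_zero aw_add label_space_def)

lemma rl_bco: "rl \<beta> = LB.bco \<beta>" by (simp add: root_label_def)

sublocale GB: graded_base SV
  using LB.sym_basis_exists sym_basis.Sym_graded_base by blast

lemma rl_add: "x \<in> aw \<Longrightarrow> y \<in> aw \<Longrightarrow> rl (x + y) = rl x \<oplus>\<^bsub>V\<^esub> rl y"
  unfolding rl_bco by (rule LB.bco_add)
lemma rl_carrier: "x \<in> aw \<Longrightarrow> rl x \<in> carrier V"
  unfolding rl_bco by (rule LB.bco_carrier)

lemma lb_add: assumes "x \<in> aw" "y \<in> aw" shows "lb (x + y) = lb x \<oplus>\<^bsub>SV\<^esub> lb y"
proof -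
  obtain B c where "sym_basis V B c" using LB.sym_basis_exists by metis
  then show ?thesis unfolding lb_def rl_add[OF assms] by (rule sym_basis.sym_of_add) (use rl_carrier assms in auto)
qed

lemma lb_grade: assumes "x \<in> aw" shows "lb x \<in> rgrade SV 2"
proof -
  obtain B c where "sym_basis V B c" using LB.sym_basis_exists by metis
  then show ?thesis unfolding lb_def by (rule sym_basis.sym_of_grade) (rule rl_carrier[OF assms])
qed

lemma lb_carrier: "x \<in> aw \<Longrightarrow> lb x \<in> carrier SV"
  using GB.rgrade_carrier lb_grade by blast
lemma lb_AR [simp]: "\<beta> \<in> AR \<Longrightarrow> lb \<beta> \<in> carrier SV"
  using lb_carrier AR_aw by blast
lemma lb_PR [simp]: "\<beta> \<in> PR \<Longrightarrow> lb \<beta> \<in> carrier SV"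
  using lb_AR PR_AR by blast

lemma lb_zero: "lb 0 = \<zero>\<^bsub>SV\<^esub>"
proof -
  have "lb 0 \<oplus>\<^bsub>SV\<^esub> lb 0 = lb 0" using lb_add[OF aw_zero aw_zero] by simp
  then show ?thesis using lb_carrier[OF aw_zero] GB.R.add.r_cancel_one by auto
qed

lemma lb_neg: assumes "x \<in> aw" shows "lb (- x) = \<ominus>\<^bsub>SV\<^esub> lb x"
proof -
  have "lb (- x) \<oplus>\<^bsub>SV\<^esub> lb x = \<zero>\<^bsub>SV\<^esub>" using lb_add[OF aw_neg[OF assms] assms] lb_zero by simp
  then show ?thesis using lb_carrier[OF assms] lb_carrier[OF aw_neg[OF assms]] by (simp add: GB.R.minus_equality)
qed

definition smul :: "int \<Rightarrow> 'v \<times> int \<Rightarrow> 'v \<times> int" where "smul k \<alpha> = (rat_of_int k *q fst \<alpha>, k * snd \<alpha>)"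

lemma smul_aw: "\<alpha> \<in> AR \<Longrightarrow> smul k \<alpha> \<in> aw"
  by (auto simp: aw_iff smul_def coroot_simps AR_iff coroot_Ints)

lemma lb_smul: assumes a: "\<alpha> \<in> AR" shows "\<exists>x\<in>carrier SV. lb (smul k \<alpha>) = x \<otimes>\<^bsub>SV\<^esub> lb \<alpha>"
proof -
  have nat: "\<exists>x\<in>carrier SV. lb (smul (int n) \<alpha>) = x \<otimes>\<^bsub>SV\<^esub> lb \<alpha>" for n
  proof (induction n)
    case 0
    have "smul 0 \<alpha> = 0" by (simp add: smul_def zero_prod_def)
    then show ?case using lb_zero a by (intro bexI[of _ "\<zero>\<^bsub>SV\<^esub>"]) auto
  next
    case (Suc n)
    then obtain x where x: "x \<in> carrier SV" "lb (smul (int n) \<alpha>) = x \<otimes>\<^bsub>SV\<^esub> lb \<alpha>" by blast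
    have "smul (int (Suc n)) \<alpha> = smul (int n) \<alpha> + \<alpha>" by (simp add: smul_def prod_eq_iff algebra_simps)
    then have "lb (smul (int (Suc n)) \<alpha>) = (x \<oplus>\<^bsub>SV\<^esub> \<one>\<^bsub>SV\<^esub>) \<otimes>\<^bsub>SV\<^esub> lb \<alpha>"
      using lb_add[OF smul_aw[OF a] AR_aw[OF a]] x a by (simp add: GB.R.l_distr)
    then show ?case using x by blast
  qed
  show ?thesis
  proof (cases "k \<ge> 0")
    case True then show ?thesis using nat[of "nat k"] by simp
  next
    case False
    then obtain x where x: "x \<in> carrier SV" "lb (smul (- k) \<alpha>) = x \<otimes>\<^bsub>SV\<^esub> lb \<alpha>" using nat[of "nat (- k)"] by auto
    have "smul k \<alpha> = - smul (- k) \<alpha>" by (simp add: smul_def prod_eq_iff)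
    then have "lb (smul k \<alpha>) = (\<ominus>\<^bsub>SV\<^esub> x) \<otimes>\<^bsub>SV\<^esub> lb \<alpha>"
      using lb_neg[OF smul_aw[OF a], of "- k"] x a by (simp add: GB.R.l_minus)
    then show ?thesis using x by blast
  qed
qed

lemma lb_arfl: assumes a: "\<alpha> \<in> AR" and b: "\<beta> \<in> AR"
  shows "\<exists>x\<in>carrier SV. lb (arfl \<alpha> \<beta>) = lb \<beta> \<oplus>\<^bsub>SV\<^esub> x \<otimes>\<^bsub>SV\<^esub> lb \<alpha>"
proof -
  have "rat_of_int (ci (fst \<alpha>) (fst \<beta>)) = cr (fst \<alpha>) (fst \<beta>)" using a b of_int_ci by (simp add: AR_iff)
  then have "arfl \<alpha> \<beta> = \<beta> + smul (- ci (fst \<alpha>) (fst \<beta>)) \<alpha>"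
    by (simp add: arfl_def rfl_def smul_def prod_eq_iff)
  then have "lb (arfl \<alpha> \<beta>) = lb \<beta> \<oplus>\<^bsub>SV\<^esub> lb (smul (- ci (fst \<alpha>) (fst \<beta>)) \<alpha>)"
    using lb_add[OF AR_aw[OF b] smul_aw[OF a]] by simp
  then show ?thesis using lb_smul[OF a, of "- ci (fst \<alpha>) (fst \<beta>)"] by metis
qed

text \<open>The pairing with the coroot of \<alpha> is integral on weights, so the floor only
  changes the type, and it takes the value 2 at \<alpha>. In characteristic other than 2 this is
  nonzero, so labels are nonzero.\<close>

lemma single_not_Rel: assumes a: "\<alpha> \<in> AR" shows "Poly_Mapping.single \<alpha> (1::'f) \<notin> LB.Rel"
proof (rule LB.single_not_Rel)
  let ?l = "\<lambda>\<beta> :: 'v \<times> int. of_int \<lfloor>cr (fst \<alpha>) (fst \<beta>)\<rfloor> :: 'f"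
  have aR: "fst \<alpha> \<in> Rt" using a by (simp add: AR_iff)
  show "?l (x + y) = ?l x + ?l y" if xy: "x \<in> aw" "y \<in> aw" for x y
  proof -
    have "cr (fst \<alpha>) (fst x) \<in> \<int>" "cr (fst \<alpha>) (fst y) \<in> \<int>" using xy aR unfolding aw_iff by auto
    then obtain i j where "cr (fst \<alpha>) (fst x) = of_int i" "cr (fst \<alpha>) (fst y) = of_int j" by (elim Ints_cases)
    then have "\<lfloor>cr (fst \<alpha>) (fst (x + y))\<rfloor> = i + j" "\<lfloor>cr (fst \<alpha>) (fst x)\<rfloor> = i" "\<lfloor>cr (fst \<alpha>) (fst y)\<rfloor> = j"
      using aR by (simp_all add: coroot_simps flip: of_int_add)
    then show ?thesis by simp
  qed
  show "?l \<alpha> \<noteq> 0" using two_nz aR by (simp add: coroot_self)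
qed

lemma lb_regular: assumes "\<alpha> \<in> AR" "x \<in> carrier SV" "lb \<alpha> \<otimes>\<^bsub>SV\<^esub> x = \<zero>\<^bsub>SV\<^esub>" shows "x = \<zero>\<^bsub>SV\<^esub>"
proof -
  obtain B c where B: "sym_basis V B c" "rl \<alpha> \<in> B"
    using LB.sym_basis_one[OF AR_aw[OF assms(1)] single_not_Rel[OF assms(1)]] unfolding rl_bco by metis
  show ?thesis by (rule sym_basis.sym_of_regular[OF B assms(2) assms(3)[unfolded lb_def]])
qed

lemma lb_nonunit: assumes "\<alpha> \<in> AR" "x \<in> carrier SV" shows "lb \<alpha> \<otimes>\<^bsub>SV\<^esub> x \<noteq> \<one>\<^bsub>SV\<^esub>"
proof -
  obtain B c where B: "sym_basis V B c" "rl \<alpha> \<in> B"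
    using LB.sym_basis_one[OF AR_aw[OF assms(1)] single_not_Rel[OF assms(1)]] unfolding rl_bco by metis
  show ?thesis unfolding lb_def by (rule sym_basis.sym_of_nonunit[OF B assms(2)])
qed

text \<open>The two labels belong to a common basis of the label space, so they are distinct
  variables of S.\<close>

lemma lb_coprime:
  assumes "\<alpha> \<in> AR" "\<beta> \<in> AR" "\<not> proportional V (rl \<alpha>) (rl \<beta>)" "x \<in> carrier SV" "y \<in> carrier SV"
    "lb \<beta> \<otimes>\<^bsub>SV\<^esub> x = lb \<alpha> \<otimes>\<^bsub>SV\<^esub> y"
  shows "\<exists>z\<in>carrier SV. x = lb \<alpha> \<otimes>\<^bsub>SV\<^esub> z"
proof -
  obtain B c where B: "sym_basis V B c" "rl \<alpha> \<in> B" "rl \<beta> \<in> B" "rl \<alpha> \<noteq> rl \<beta>"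
    using LB.sym_basis_two[OF AR_aw[OF assms(1)] AR_aw[OF assms(2)]] assms(3) unfolding rl_bco by metis
  show ?thesis unfolding lb_def by (rule sym_basis.sym_of_coprime[OF B assms(4,5) assms(6)[unfolded lb_def]])
qed

text \<open>One half in S; there is no relation to the height \<open>hf\<close>.\<close>

definition hf2 :: "('v, 'f) weight_sym" where
  "hf2 = (SOME h. h \<in> carrier SV \<and> h \<otimes>\<^bsub>SV\<^esub> (\<one>\<^bsub>SV\<^esub> \<oplus>\<^bsub>SV\<^esub> \<one>\<^bsub>SV\<^esub>) = \<one>\<^bsub>SV\<^esub>)"

lemma hf2: "hf2 \<in> carrier SV" "hf2 \<otimes>\<^bsub>SV\<^esub> (\<one>\<^bsub>SV\<^esub> \<oplus>\<^bsub>SV\<^esub> \<one>\<^bsub>SV\<^esub>) = \<one>\<^bsub>SV\<^esub>"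
proof -
  obtain B c where "sym_basis V B c" using LB.sym_basis_exists by metis
  from sym_basis.half[OF this two_nz] have "hf2 \<in> carrier SV \<and> hf2 \<otimes>\<^bsub>SV\<^esub> (\<one>\<^bsub>SV\<^esub> \<oplus>\<^bsub>SV\<^esub> \<one>\<^bsub>SV\<^esub>) = \<one>\<^bsub>SV\<^esub>"
    unfolding hf2_def Bex_def by (rule someI_ex)
  then show "hf2 \<in> carrier SV" "hf2 \<otimes>\<^bsub>SV\<^esub> (\<one>\<^bsub>SV\<^esub> \<oplus>\<^bsub>SV\<^esub> \<one>\<^bsub>SV\<^esub>) = \<one>\<^bsub>SV\<^esub>" by auto
qed

lemma G_simps [simp]: "verts G = WC" "less G = weyl_less \<Delta>" "edges G = affine_edges \<Delta>" "ends G = fst" "label G E = rl (snd E)"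
  by (simp_all add: affine_graph_def)
lemma Gs_simps [simp]: "verts Gs = cosets \<Delta> s" "less Gs = coset_less \<Delta>" "edges Gs = coset_edges \<Delta> s" "ends Gs = fst"
  "label Gs B = rl (snd B)"
  by (simp_all add: coset_graph_def)

lemma joins_G: "joins G E x y \<longleftrightarrow> x \<in> WC \<and> snd E \<in> PR \<and> y = rr (snd E) \<cdot> x \<and> E = edg x (snd E)"
  unfolding joins_def using joins_iff[of E x y] by auto

lemma sections_iff:
  fixes Q :: "('v affine_trans, 'v affine_edge, ('v, 'f) weight_sym, 'a, 'b) msheaf"
  assumes I: "I \<subseteq> WC"
  shows "m \<in> sections G I Q \<longleftrightarrow> m \<in> (\<Pi>\<^sub>E x\<in>I. carrier (vstalk Q x)) \<and>
    (\<forall>x\<in>I. \<forall>\<alpha>\<in>PR. rr \<alpha> \<cdot> x \<in> I \<longrightarrow> rho Q x (edg x \<alpha>) (m x) = rho Q (rr \<alpha> \<cdot> x) (edg x \<alpha>) (m (rr \<alpha> \<cdot> x)))"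
proof -
  have "(\<forall>E. \<forall>x\<in>I. \<forall>y\<in>I. joins G E x y \<longrightarrow> rho Q x E (m x) = rho Q y E (m y)) \<longleftrightarrow>
    (\<forall>x\<in>I. \<forall>\<alpha>\<in>PR. rr \<alpha> \<cdot> x \<in> I \<longrightarrow> rho Q x (edg x \<alpha>) (m x) = rho Q (rr \<alpha> \<cdot> x) (edg x \<alpha>) (m (rr \<alpha> \<cdot> x)))"
    (is "?L = ?R")
  proof
    assume L: ?L
    show ?R
    proof (intro ballI impI)
      fix x \<alpha> assume x: "x \<in> I" "\<alpha> \<in> PR" "rr \<alpha> \<cdot> x \<in> I"
      have "joins G (edg x \<alpha>) x (rr \<alpha> \<cdot> x)" using x I by (auto simp: joins_G)
      then show "rho Q x (edg x \<alpha>) (m x) = rho Q (rr \<alpha> \<cdot> x) (edg x \<alpha>) (m (rr \<alpha> \<cdot> x))" using L x by blast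
    qed
  next
    assume R: ?R
    show ?L
    proof (intro allI ballI impI)
      fix E x y assume xy: "x \<in> I" "y \<in> I" "joins G E x y"
      then have "snd E \<in> PR" "y = rr (snd E) \<cdot> x" "E = edg x (snd E)" by (auto simp: joins_G)
      then show "rho Q x E (m x) = rho Q y E (m y)" using R xy by metis
    qed
  qed
  then show ?thesis unfolding sections_def by simp
qed

lemma sheafD:
  fixes Q :: "('v affine_trans, 'v affine_edge, ('v, 'f) weight_sym, 'a, 'b) msheaf"
  assumes "is_sheaf V G Q"
  shows "x \<in> WC \<Longrightarrow> graded_module SV (vstalk Q x)"
    "x \<in> WC \<Longrightarrow> \<alpha> \<in> PR \<Longrightarrow> graded_module SV (estalk Q (edg x \<alpha>))"
    "x \<in> WC \<Longrightarrow> \<alpha> \<in> PR \<Longrightarrow> e \<in> carrier (estalk Q (edg x \<alpha>)) \<Longrightarrow> lb \<alpha> \<odot>\<^bsub>estalk Q (edg x \<alpha>)\<^esub> e = \<zero>\<^bsub>estalk Q (edg x \<alpha>)\<^esub>"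
    "x \<in> WC \<Longrightarrow> \<alpha> \<in> PR \<Longrightarrow> rho Q x (edg x \<alpha>) \<in> graded_hom SV (vstalk Q x) (estalk Q (edg x \<alpha>))"
    "x \<in> WC \<Longrightarrow> \<alpha> \<in> PR \<Longrightarrow> rho Q (rr \<alpha> \<cdot> x) (edg x \<alpha>) \<in> graded_hom SV (vstalk Q (rr \<alpha> \<cdot> x)) (estalk Q (edg x \<alpha>))"
proof -
  show "x \<in> WC \<Longrightarrow> graded_module SV (vstalk Q x)" using assms unfolding is_sheaf_def by simp
  assume x: "x \<in> WC" and a: "\<alpha> \<in> PR"
  note E = edg_edge[OF x a]
  show "graded_module SV (estalk Q (edg x \<alpha>))" using assms E unfolding is_sheaf_def by simp
  show "e \<in> carrier (estalk Q (edg x \<alpha>)) \<Longrightarrow> lb \<alpha> \<odot>\<^bsub>estalk Q (edg x \<alpha>)\<^esub> e = \<zero>\<^bsub>estalk Q (edg x \<alpha>)\<^esub>"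
    using assms E unfolding is_sheaf_def lb_def by (metis G_simps(3,5) snd_edg)
  show "rho Q x (edg x \<alpha>) \<in> graded_hom SV (vstalk Q x) (estalk Q (edg x \<alpha>))"
    "rho Q (rr \<alpha> \<cdot> x) (edg x \<alpha>) \<in> graded_hom SV (vstalk Q (rr \<alpha> \<cdot> x)) (estalk Q (edg x \<alpha>))"
    using assms E unfolding is_sheaf_def by auto
qed

lemma sections_add:
  fixes Q :: "('v affine_trans, 'v affine_edge, ('v, 'f) weight_sym, 'a, 'b) msheaf"
  assumes Q: "is_sheaf V G Q" and I: "I \<subseteq> WC" and m: "m \<in> sections G I Q" and n: "n \<in> sections G I Q"
  shows "(\<lambda>x\<in>I. m x \<oplus>\<^bsub>vstalk Q x\<^esub> n x) \<in> sections G I Q"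
proof -
  have mc: "m x \<in> carrier (vstalk Q x)" "n x \<in> carrier (vstalk Q x)" if "x \<in> I" for x
    using m n that unfolding sections_iff[OF I] by auto
  show ?thesis unfolding sections_iff[OF I]
  proof (intro conjI ballI impI)
    show "(\<lambda>x\<in>I. m x \<oplus>\<^bsub>vstalk Q x\<^esub> n x) \<in> (\<Pi>\<^sub>E x\<in>I. carrier (vstalk Q x))"
      using mc by (auto intro: abelian_monoid.a_closed[OF module_abelian_monoid[OF graded_module_module[OF sheafD(1)[OF Q subsetD[OF I]]]]])
    fix x \<alpha> assume x: "x \<in> I" and a: "\<alpha> \<in> PR" and y: "rr \<alpha> \<cdot> x \<in> I"
    have xW: "x \<in> WC" using x I by blast
    have "rho Q x (edg x \<alpha>) (m x) = rho Q (rr \<alpha> \<cdot> x) (edg x \<alpha>) (m (rr \<alpha> \<cdot> x))"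
      "rho Q x (edg x \<alpha>) (n x) = rho Q (rr \<alpha> \<cdot> x) (edg x \<alpha>) (n (rr \<alpha> \<cdot> x))"
      using m n x a y unfolding sections_iff[OF I] by blast+
    then show "rho Q x (edg x \<alpha>) ((\<lambda>x\<in>I. m x \<oplus>\<^bsub>vstalk Q x\<^esub> n x) x) =
        rho Q (rr \<alpha> \<cdot> x) (edg x \<alpha>) ((\<lambda>x\<in>I. m x \<oplus>\<^bsub>vstalk Q x\<^esub> n x) (rr \<alpha> \<cdot> x))"
      using x y graded_homD(2)[OF sheafD(4)[OF Q xW a] mc[OF x]] graded_homD(2)[OF sheafD(5)[OF Q xW a] mc[OF y]] by simp
  qed
qed

text \<open>The structure algebra of the moment graph: S-valued functions on the vertices that are
  congruent along each edge modulo its label.\<close>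

definition admissible :: "('v affine_trans \<Rightarrow> ('v, 'f) weight_sym) \<Rightarrow> bool" where
  "admissible d \<longleftrightarrow> (\<forall>x\<in>WC. d x \<in> carrier SV) \<and>
    (\<forall>x\<in>WC. \<forall>\<alpha>\<in>PR. \<exists>a\<in>carrier SV. d (rr \<alpha> \<cdot> x) = d x \<oplus>\<^bsub>SV\<^esub> a \<otimes>\<^bsub>SV\<^esub> lb \<alpha>)"

text \<open>The antisymmetric element c of the structure algebra: up to sign its value at x is the
  label of the edge from x to xs, and it changes sign under right multiplication by s.\<close>

definition cf :: "'v affine_trans \<Rightarrow> ('v, 'f) weight_sym" where "cf x = lb (wall x)"

lemma cf_carrier [simp]: "x \<in> WC \<Longrightarrow> cf x \<in> carrier SV"
  unfolding cf_def using wall_AR lb_AR by blast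

lemma cf_s: "x \<in> WC \<Longrightarrow> cf (x \<cdot> s) = \<ominus>\<^bsub>SV\<^esub> cf x"
  unfolding cf_def using wall_s lb_neg[OF AR_aw[OF wall_AR]] by simp

lemma cf_lab: assumes "x \<in> WC" shows "cf x = lb (lab x) \<or> cf x = \<ominus>\<^bsub>SV\<^esub> lb (lab x)"
proof -
  have "lab x = wall x \<or> lab x = - wall x" using lab(3)[OF assms] .
  then show ?thesis using lb_neg[OF AR_aw[OF wall_AR[OF assms]]] lb_AR[OF wall_AR[OF assms]] by (auto simp: cf_def)
qed

text \<open>Reflecting the affine root at x in \<alpha> changes it by an integral multiple of
  \<alpha>.\<close>

lemma admissible_cf: "admissible cf"
  unfolding admissible_def
proof (intro conjI ballI)
  fix x \<alpha> assume "x \<in> WC" "\<alpha> \<in> PR"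
  then show "\<exists>a\<in>carrier SV. cf (rr \<alpha> \<cdot> x) = cf x \<oplus>\<^bsub>SV\<^esub> a \<otimes>\<^bsub>SV\<^esub> lb \<alpha>"
    unfolding cf_def using wall_rr lb_arfl[OF PR_AR wall_AR] by simp
qed simp

lemma admissible_affine: assumes d: "admissible d" and k: "k \<in> carrier SV" "l \<in> carrier SV"
  shows "admissible (\<lambda>x. l \<otimes>\<^bsub>SV\<^esub> (d x \<oplus>\<^bsub>SV\<^esub> k))"
  unfolding admissible_def
proof (intro conjI ballI)
  show "l \<otimes>\<^bsub>SV\<^esub> (d x \<oplus>\<^bsub>SV\<^esub> k) \<in> carrier SV" if "x \<in> WC" for x using d k that by (simp add: admissible_def)
  fix x \<alpha> assume x: "x \<in> WC" and a: "\<alpha> \<in> PR"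
  obtain b where b: "b \<in> carrier SV" "d (rr \<alpha> \<cdot> x) = d x \<oplus>\<^bsub>SV\<^esub> b \<otimes>\<^bsub>SV\<^esub> lb \<alpha>"
    using d x a unfolding admissible_def by blast
  have dx: "d x \<in> carrier SV" using d x by (simp add: admissible_def)
  have "l \<otimes>\<^bsub>SV\<^esub> (d (rr \<alpha> \<cdot> x) \<oplus>\<^bsub>SV\<^esub> k) = l \<otimes>\<^bsub>SV\<^esub> (d x \<oplus>\<^bsub>SV\<^esub> k) \<oplus>\<^bsub>SV\<^esub> (l \<otimes>\<^bsub>SV\<^esub> b) \<otimes>\<^bsub>SV\<^esub> lb \<alpha>"
    using b dx k a by (simp add: GB.R.r_distr GB.R.m_assoc GB.R.a_ac)
  then show "\<exists>a\<in>carrier SV. l \<otimes>\<^bsub>SV\<^esub> (d (rr \<alpha> \<cdot> x) \<oplus>\<^bsub>SV\<^esub> k) = l \<otimes>\<^bsub>SV\<^esub> (d x \<oplus>\<^bsub>SV\<^esub> k) \<oplus>\<^bsub>SV\<^esub> a \<otimes>\<^bsub>SV\<^esub> lb \<alpha>"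
    using k b by blast
qed

lemma admissible_const: "k \<in> carrier SV \<Longrightarrow> admissible (\<lambda>x. k)"
  unfolding admissible_def by (auto intro!: bexI[of _ "\<zero>\<^bsub>SV\<^esub>"])

lemma scale_killed:
  assumes E: "module SV E" and "a \<in> carrier SV" "k \<in> carrier SV" "b \<in> carrier SV" "e \<in> carrier E"
    and "b \<odot>\<^bsub>E\<^esub> e = \<zero>\<^bsub>E\<^esub>"
  shows "(k \<oplus>\<^bsub>SV\<^esub> a \<otimes>\<^bsub>SV\<^esub> b) \<odot>\<^bsub>E\<^esub> e = k \<odot>\<^bsub>E\<^esub> e"
proof -
  interpret E: module SV E by (rule E)
  show ?thesis using assms by (simp add: E.smult_l_distr E.smult_assoc1)
qed

text \<open>On an edge stalk, which its label kills, the values of d at the two ends act in the same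
  way.\<close>

lemma sections_scale:
  fixes Q :: "('v affine_trans, 'v affine_edge, ('v, 'f) weight_sym, 'a, 'b) msheaf"
  assumes Q: "is_sheaf V G Q" and I: "I \<subseteq> WC" and m: "m \<in> sections G I Q" and d: "admissible d"
  shows "(\<lambda>x\<in>I. d x \<odot>\<^bsub>vstalk Q x\<^esub> m x) \<in> sections G I Q"
proof -
  have mc: "m x \<in> carrier (vstalk Q x)" if "x \<in> I" for x
    using m that unfolding sections_iff[OF I] by auto
  have dc: "d x \<in> carrier SV" if "x \<in> I" for x using d that I by (auto simp: admissible_def)
  show ?thesis unfolding sections_iff[OF I]
  proof (intro conjI ballI impI)
    show "(\<lambda>x\<in>I. d x \<odot>\<^bsub>vstalk Q x\<^esub> m x) \<in> (\<Pi>\<^sub>E x\<in>I. carrier (vstalk Q x))"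
      using mc dc by (auto intro: module.smult_closed[OF graded_module_module[OF sheafD(1)[OF Q subsetD[OF I]]]])
    fix x \<alpha> assume x: "x \<in> I" and a: "\<alpha> \<in> PR" and y: "rr \<alpha> \<cdot> x \<in> I"
    have xW: "x \<in> WC" using x I by blast
    let ?E = "estalk Q (edg x \<alpha>)" and ?y = "rr \<alpha> \<cdot> x"
    note E = graded_module_module[OF sheafD(2)[OF Q xW a]]
    have e: "rho Q x (edg x \<alpha>) (m x) = rho Q ?y (edg x \<alpha>) (m ?y)"
      using m x a y unfolding sections_iff[OF I] by blast
    obtain b where b: "b \<in> carrier SV" "d ?y = d x \<oplus>\<^bsub>SV\<^esub> b \<otimes>\<^bsub>SV\<^esub> lb \<alpha>"
      using d xW a unfolding admissible_def by blast
    have ec: "rho Q ?y (edg x \<alpha>) (m ?y) \<in> carrier ?E" using graded_homD(1)[OF sheafD(5)[OF Q xW a] mc[OF y]] .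
    have "rho Q ?y (edg x \<alpha>) (d ?y \<odot>\<^bsub>vstalk Q ?y\<^esub> m ?y) = d ?y \<odot>\<^bsub>?E\<^esub> rho Q ?y (edg x \<alpha>) (m ?y)"
      by (rule graded_homD(3)[OF sheafD(5)[OF Q xW a] dc[OF y] mc[OF y]])
    also have "\<dots> = d x \<odot>\<^bsub>?E\<^esub> rho Q ?y (edg x \<alpha>) (m ?y)"
      unfolding b(2) by (rule scale_killed[OF E b(1) dc[OF x] lb_PR[OF a] ec sheafD(3)[OF Q xW a ec]])
    also have "\<dots> = rho Q x (edg x \<alpha>) (d x \<odot>\<^bsub>vstalk Q x\<^esub> m x)"
      using graded_homD(3)[OF sheafD(4)[OF Q xW a] dc[OF x] mc[OF x]] e by simp
    finally show "rho Q x (edg x \<alpha>) ((\<lambda>x\<in>I. d x \<odot>\<^bsub>vstalk Q x\<^esub> m x) x) =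
        rho Q ?y (edg x \<alpha>) ((\<lambda>x\<in>I. d x \<odot>\<^bsub>vstalk Q x\<^esub> m x) ?y)" using x y by simp
  qed
qed

end


section \<open>Vertex stalks of the sheaf on cosets\<close>

lemma graded_module_image:
  fixes M :: "('a, 'b) gmodule" and L :: "('a, 'c) gmodule"
  assumes gM: "graded_module R M" and gL: "graded_module R L" and f: "f \<in> graded_hom R M L"
    and rg: "\<And>i. rgrade R i \<subseteq> carrier R"
  shows "graded_module R (gsubmodule L (f ` carrier M))" "f \<in> graded_hom R M (gsubmodule L (f ` carrier M))"
proof -
  let ?Q = "gsubmodule L (f ` carrier M)"
  have [simp]: "carrier ?Q = f ` carrier M" "zero ?Q = \<zero>\<^bsub>L\<^esub>" "add ?Q = add L" "smult ?Q = smult L" "grade ?Q i = grade L i \<inter> f ` carrier M" for i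
    by (simp_all add: gsubmodule_def)
  have gr: "grade ?Q i = f ` grade M i" for i
  proof (intro equalityI subsetI)
    fix y assume "y \<in> grade ?Q i"
    then obtain x where x: "x \<in> carrier M" "y = f x" "y \<in> grade L i" by auto
    have "y = gcomp L (f x) i" using gcomp_grade[OF gL x(3)] x(2) by simp
    also have "\<dots> = f (gcomp M x i)" by (rule gcomp_hom[OF f gM gL x(1)])
    finally show "y \<in> f ` grade M i" using gcomp(1)[OF gM x(1)] by blast
  next
    fix y assume "y \<in> f ` grade M i"
    then show "y \<in> grade ?Q i" using graded_homD(4)[OF f] grade_carrier[OF gM] by auto
  qed
  have 0: "f \<zero>\<^bsub>M\<^esub> = \<zero>\<^bsub>?Q\<^esub>" using graded_hom_zero[OF f graded_module_module[OF gM] graded_module_module[OF gL]] by simp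
  have ker: "f (gcomp M x i) = \<zero>\<^bsub>?Q\<^esub>" if "x \<in> carrier M" "f x = \<zero>\<^bsub>?Q\<^esub>" for x i
  proof -
    have "f (gcomp M x i) = gcomp L (f x) i" by (rule gcomp_hom[OF f gM gL that(1), symmetric])
    also have "\<dots> = \<zero>\<^bsub>L\<^esub>" using that(2) gcomp_grade[OF gL grade_zero[OF gL, of i]] by simp
    finally show ?thesis by simp
  qed
  show "graded_module R ?Q"
    by (rule graded_module_surj(1)[OF gM _ 0 _ _ gr ker rg]) (use graded_homD[OF f] in auto)
  show "f \<in> graded_hom R M ?Q"
    by (rule graded_module_surj(2)[OF gM _ 0 _ _ gr ker rg]) (use graded_homD[OF f] in auto)
qed

lemma proportional_sym: "proportional V u v \<Longrightarrow> proportional V v u"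
  unfolding proportional_def by (metis prod.inject)

context projective_setup begin

lemma sheafP: "is_sheaf V G P" and finite_supp: "finite (msupp G P)"
  and freeP: "x \<in> WC \<Longrightarrow> graded_free SV (vstalk P x)"
  and P4a: "x \<in> WC \<Longrightarrow> p \<in> carrier (vstalk P x) \<Longrightarrow> \<exists>m\<in>sections G WC P. m x = p"
  and P4b: "open_verts G I \<Longrightarrow> open_verts G I' \<Longrightarrow> I' \<subseteq> I \<Longrightarrow> (\<lambda>m. restrict m I') ` sections G I P = sections G I' P"
  using proj unfolding projective_sheaf_def by auto

abbreviation pv :: "'v affine_trans \<Rightarrow> (('v, 'f) weight_sym, 'm) gmodule" where "pv \<equiv> vstalk P"
abbreviation pe :: "'v affine_edge \<Rightarrow> (('v, 'f) weight_sym, 'n) gmodule" where "pe \<equiv> estalk P"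

lemmas gpv = sheafD(1)[OF sheafP] and gpe = sheafD(2)[OF sheafP] and pe_killed = sheafD(3)[OF sheafP]
  and rhoP = sheafD(4)[OF sheafP] and rhoP' = sheafD(5)[OF sheafP]
lemmas mpv = graded_module_module[OF gpv] and mpe = graded_module_module[OF gpe]

lemma directed_edg: "x \<in> WC \<Longrightarrow> \<alpha> \<in> PR \<Longrightarrow> weyl_less \<Delta> x (rr \<alpha> \<cdot> x) \<Longrightarrow> directed_edge G (edg x \<alpha>) x (rr \<alpha> \<cdot> x)"
  unfolding directed_edge_def by (simp add: joins_G)

lemma P3:
  assumes "directed_edge G E x y"
  shows "rho P y E ` carrier (pv y) = carrier (pe E)" "a_kernel (pv y) (pe E) (rho P y E) = smult_image V (label G E) (pv y)"
proof -
  have "\<forall>E x y. directed_edge G E x y \<longrightarrow> rho P y E ` carrier (pv y) = carrier (pe E) \<and>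
      a_kernel (pv y) (pe E) (rho P y E) = smult_image V (label G E) (pv y)"
    using proj unfolding projective_sheaf_def by (elim conjE) assumption
  note this[rule_format, OF assms]
  then show "rho P y E ` carrier (pv y) = carrier (pe E)" "a_kernel (pv y) (pe E) (rho P y E) = smult_image V (label G E) (pv y)"
    by (rule conjunct1, rule conjunct2)
qed

lemma rho_surj:
  assumes "x \<in> WC" "\<alpha> \<in> PR" "weyl_less \<Delta> x (rr \<alpha> \<cdot> x)"
  shows "rho P (rr \<alpha> \<cdot> x) (edg x \<alpha>) ` carrier (pv (rr \<alpha> \<cdot> x)) = carrier (pe (edg x \<alpha>))"
  by (rule P3(1)[OF directed_edg[OF assms]])

lemma rho_ker:
  assumes "x \<in> WC" "\<alpha> \<in> PR" "weyl_less \<Delta> x (rr \<alpha> \<cdot> x)" "n \<in> carrier (pv (rr \<alpha> \<cdot> x))"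
  shows "rho P (rr \<alpha> \<cdot> x) (edg x \<alpha>) n = \<zero>\<^bsub>pe (edg x \<alpha>)\<^esub> \<longleftrightarrow> (\<exists>k\<in>carrier (pv (rr \<alpha> \<cdot> x)). n = lb \<alpha> \<odot>\<^bsub>pv (rr \<alpha> \<cdot> x)\<^esub> k)"
proof -
  note k = P3(2)[OF directed_edg[OF assms(1-3)]]
  show ?thesis using assms(4) set_eq_iff[THEN iffD1, OF k, rule_format, of n]
    unfolding a_kernel_def' smult_image_def lb_def image_iff by (simp add: snd_edg)
qed

lemma coset_lower: assumes "X \<in> cosets \<Delta> s"
  obtains u where "u \<in> WC" "X = cs u" "weyl_less \<Delta> u (u \<cdot> s)"
proof -
  obtain x where x: "x \<in> WC" "X = cs x" using assms by (auto simp: cosets_def)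
  have "weyl_less \<Delta> x (x \<cdot> s) \<or> weyl_less \<Delta> (x \<cdot> s) x"
    using weyl_less_refl_total[OF x(1) lab(1)[OF x(1)]] lab(2)[OF x(1)] by simp
  then show ?thesis using that[of x] that[of "x \<cdot> s"] x by auto
qed

lemma lab_less: "u \<in> WC \<Longrightarrow> weyl_less \<Delta> u (u \<cdot> s) \<Longrightarrow> weyl_less \<Delta> u (rr (lab u) \<cdot> u)"
  using lab(2) by simp

text \<open>A reflection is determined by one of its effects x -> xs, so the coset spans a single
  edge, labelled \<open>lab u\<close>.\<close>

lemma sections_coset_iff:
  assumes u: "u \<in> WC"
  shows "m \<in> sections G (cs u) P \<longleftrightarrow> m \<in> (\<Pi>\<^sub>E x\<in>cs u. carrier (pv x)) \<and>
    rho P u (edg u (lab u)) (m u) = rho P (u \<cdot> s) (edg u (lab u)) (m (u \<cdot> s))"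
proof -
  have cW: "cs u \<subseteq> WC" using cs_W[OF u] by blast
  note l = lab[OF u]
  have e: "edg (u \<cdot> s) (lab u) = edg u (lab u)" using edg_rr[OF u l(1)] l(2) by simp
  have "(\<forall>x\<in>cs u. \<forall>\<alpha>\<in>PR. rr \<alpha> \<cdot> x \<in> cs u \<longrightarrow> rho P x (edg x \<alpha>) (m x) = rho P (rr \<alpha> \<cdot> x) (edg x \<alpha>) (m (rr \<alpha> \<cdot> x)))
    \<longleftrightarrow> rho P u (edg u (lab u)) (m u) = rho P (u \<cdot> s) (edg u (lab u)) (m (u \<cdot> s))" (is "?L \<longleftrightarrow> ?R")
  proof
    assume ?L
    moreover have "u \<in> cs u" "rr (lab u) \<cdot> u \<in> cs u" using l(2) by (auto simp: cs_def')
    ultimately show ?R using l(1,2) by metis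
  next
    assume R: ?R
    show ?L
    proof (intro ballI impI)
      fix x \<alpha> assume x: "x \<in> cs u" and a: "\<alpha> \<in> PR" and y: "rr \<alpha> \<cdot> x \<in> cs u"
      have xW: "x \<in> WC" using x cW by blast
      have "cs (rr \<alpha> \<cdot> x) = cs x" using cs_eq[OF u x] cs_eq[OF u y] by simp
      then have ys: "rr \<alpha> \<cdot> x = x \<cdot> s" using rr_not_s[OF a xW] by simp
      have al: "\<alpha> = lab x" by (rule lab_unique[OF xW a ys])
      have "x = u \<or> x = u \<cdot> s" using x by (simp add: cs_def')
      then show "rho P x (edg x \<alpha>) (m x) = rho P (rr \<alpha> \<cdot> x) (edg x \<alpha>) (m (rr \<alpha> \<cdot> x))"
      proof
        assume "x = u" then show ?thesis using R ys al by simp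
      next
        assume xu: "x = u \<cdot> s"
        then have "\<alpha> = lab u" "rr \<alpha> \<cdot> x = u" using al ys lab_s[OF u] u by simp_all
        then show ?thesis using R xu e by simp
      qed
    qed
  qed
  then show ?thesis unfolding sections_iff[OF cW] by simp
qed

text \<open>Extend the value at the lower element u to a global section m1. At us it differs from m
  by an element that vanishes on the edge, hence by a multiple c(u) d. A global section through d,
  multiplied by a function that is 0 at u and c(u) at us, makes up for the difference.\<close>

lemma section_extends:
  assumes X: "X \<in> cosets \<Delta> s" and m: "m \<in> sections G X P"
  shows "\<exists>n\<in>sections G WC P. \<forall>x\<in>X. n x = m x"
proof -
  obtain u where u: "u \<in> WC" "X = cs u" "weyl_less \<Delta> u (u \<cdot> s)" using coset_lower[OF X] .
  let ?y = "u \<cdot> s" and ?E = "edg u (lab u)"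
  have y: "?y \<in> WC" using u by simp
  note l = lab[OF u(1)]
  interpret Y: module SV "pv ?y" by (rule mpv[OF y])
  interpret U: module SV "pv u" by (rule mpv[OF u(1)])
  interpret E: module SV "pe ?E" by (rule mpe[OF u(1) l(1)])
  have ry: "rho P ?y ?E \<in> graded_hom SV (pv ?y) (pe ?E)" using rhoP'[OF u(1) l(1)] l(2) by simp
  have mm: "m u \<in> carrier (pv u)" "m ?y \<in> carrier (pv ?y)" "rho P u ?E (m u) = rho P ?y ?E (m ?y)"
    using m unfolding u(2) sections_coset_iff[OF u(1)] by (auto simp: cs_def')
  obtain m1 where m1: "m1 \<in> sections G WC P" "m1 u = m u" using P4a[OF u(1) mm(1)] by blast
  have m1c: "m1 x \<in> carrier (pv x)" if "x \<in> WC" for x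
    using m1(1) that unfolding sections_iff[OF order_refl] by auto
  have "rho P u ?E (m1 u) = rho P ?y ?E (m1 ?y)"
    using m1(1) u(1) l(1,2) y unfolding sections_iff[OF order_refl] by metis
  then have eq: "rho P ?y ?E (m1 ?y) = rho P ?y ?E (m ?y)" using m1(2) mm(3) by simp
  have dc: "m ?y \<ominus>\<^bsub>pv ?y\<^esub> m1 ?y \<in> carrier (pv ?y)" using mm m1c[OF y] by simp
  have "rho P ?y ?E (m ?y \<ominus>\<^bsub>pv ?y\<^esub> m1 ?y) = rho P ?y ?E (m ?y) \<ominus>\<^bsub>pe ?E\<^esub> rho P ?y ?E (m1 ?y)"
    by (rule graded_hom_minus[OF ry Y.module_axioms E.module_axioms mm(2) m1c[OF y]])
  also have "\<dots> = \<zero>\<^bsub>pe ?E\<^esub>" unfolding eq using graded_homD(1)[OF ry mm(2)] by (simp add: E.minus_eq E.r_neg)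
  finally obtain k where k: "k \<in> carrier (pv ?y)" "m ?y \<ominus>\<^bsub>pv ?y\<^esub> m1 ?y = lb (lab u) \<odot>\<^bsub>pv ?y\<^esub> k"
    using rho_ker[OF u(1) l(1) lab_less[OF u(1,3)]] l(2) dc by auto
  \<comment> \<open>The kernel is given by the positive label; the sign of \<open>cf u\<close> is
    absorbed into the other factor.\<close>
  have "\<exists>d\<in>carrier (pv ?y). lb (lab u) \<odot>\<^bsub>pv ?y\<^esub> k = cf u \<odot>\<^bsub>pv ?y\<^esub> d"
    using cf_lab[OF u(1)]
  proof
    assume "cf u = lb (lab u)" then show ?thesis using k(1) by auto
  next
    assume c: "cf u = \<ominus>\<^bsub>SV\<^esub> lb (lab u)"
    have "cf u \<odot>\<^bsub>pv ?y\<^esub> (\<ominus>\<^bsub>pv ?y\<^esub> k) = lb (lab u) \<odot>\<^bsub>pv ?y\<^esub> k"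
      unfolding c using k(1) l(1) by (simp add: Y.smult_l_minus Y.smult_r_minus)
    then show ?thesis using k(1) Y.a_inv_closed by metis
  qed
  then obtain d where d: "d \<in> carrier (pv ?y)" "m ?y \<ominus>\<^bsub>pv ?y\<^esub> m1 ?y = cf u \<odot>\<^bsub>pv ?y\<^esub> d" using k by auto
  obtain n1 where n1: "n1 \<in> sections G WC P" "n1 ?y = d" using P4a[OF y d(1)] by blast
  have n1c: "n1 x \<in> carrier (pv x)" if "x \<in> WC" for x
    using n1(1) that unfolding sections_iff[OF order_refl] by auto
  \<comment> \<open>This is (c(u) - c(x))/2. It is 0 at u, and at us, where c takes the value -c(u),
    it is c(u).\<close>
  define a where "a x = (\<ominus>\<^bsub>SV\<^esub> hf2) \<otimes>\<^bsub>SV\<^esub> (cf x \<oplus>\<^bsub>SV\<^esub> (\<ominus>\<^bsub>SV\<^esub> cf u))" for x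
  have adm: "admissible a" unfolding a_def by (rule admissible_affine[OF admissible_cf]) (use hf2 u in auto)
  have au: "a u = \<zero>\<^bsub>SV\<^esub>" unfolding a_def using u(1) hf2(1) by (simp add: GB.R.r_neg)
  have ay: "a ?y = cf u"
  proof -
    have "a ?y = hf2 \<otimes>\<^bsub>SV\<^esub> (cf u \<oplus>\<^bsub>SV\<^esub> cf u)"
      unfolding a_def cf_s[OF u(1)] using u(1) hf2(1) by (simp add: GB.R.l_minus GB.R.r_minus GB.R.minus_add[symmetric])
    also have "\<dots> = hf2 \<otimes>\<^bsub>SV\<^esub> (\<one>\<^bsub>SV\<^esub> \<oplus>\<^bsub>SV\<^esub> \<one>\<^bsub>SV\<^esub>) \<otimes>\<^bsub>SV\<^esub> cf u"
      using u(1) hf2(1) by (simp add: GB.R.m_assoc GB.R.l_distr)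
    also have "\<dots> = cf u" using u(1) hf2(2) by simp
    finally show ?thesis .
  qed
  define n where "n = (\<lambda>x\<in>WC. m1 x \<oplus>\<^bsub>pv x\<^esub> (\<lambda>x\<in>WC. a x \<odot>\<^bsub>pv x\<^esub> n1 x) x)"
  have "n \<in> sections G WC P" unfolding n_def
    by (rule sections_add[OF sheafP order_refl m1(1) sections_scale[OF sheafP order_refl n1(1) adm]])
  moreover have "n u = m u" unfolding n_def using u(1) au m1(2) n1c[OF u(1)] mm(1) by simp
  moreover have "n ?y = m ?y"
  proof -
    have "n ?y = m1 ?y \<oplus>\<^bsub>pv ?y\<^esub> (m ?y \<ominus>\<^bsub>pv ?y\<^esub> m1 ?y)" unfolding n_def d(2) using y ay n1(2) by simp
    also have "\<dots> = m ?y" using mm(2) m1c[OF y] by (simp add: Y.minus_eq Y.a_lcomm Y.r_neg)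
    finally show ?thesis .
  qed
  ultimately show ?thesis unfolding u(2) by (intro bexI[of _ n]) (auto simp: cs_def')
qed

abbreviation NN :: "('v affine_trans set, 'v affine_coset_edge, ('v, 'f) weight_sym, 'v affine_trans \<Rightarrow> 'm, 'v affine_edge \<Rightarrow> 'n) msheaf"
  where "NN \<equiv> theta_on \<Delta> s P"
abbreviation nv :: "'v affine_trans set \<Rightarrow> (('v, 'f) weight_sym, 'v affine_trans \<Rightarrow> 'm) gmodule" where "nv \<equiv> vstalk NN"

lemma nv_def: "nv X = gsubmodule (gsum X pv) (sections G X P)"
  by (simp add: theta_on_def Let_def)
lemma rho_NN: "rho NN = coset_rho \<Delta> s P"
  by (simp add: theta_on_def Let_def)
lemma estalk_NN: "estalk NN B = gsubmodule (gsum (inducing_edges \<Delta> s B) pe)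
            (coset_rho \<Delta> s P (upper_coset \<Delta> B) B ` carrier (nv (upper_coset \<Delta> B)))"
  by (simp add: theta_on_def Let_def)

lemma nv_simps [simp]:
  "carrier (nv X) = sections G X P" "\<zero>\<^bsub>nv X\<^esub> = (\<lambda>x\<in>X. \<zero>\<^bsub>pv x\<^esub>)" "f \<oplus>\<^bsub>nv X\<^esub> g = (\<lambda>x\<in>X. f x \<oplus>\<^bsub>pv x\<^esub> g x)"
  "a \<odot>\<^bsub>nv X\<^esub> f = (\<lambda>x\<in>X. a \<odot>\<^bsub>pv x\<^esub> f x)" "grade (nv X) i = (\<Pi>\<^sub>E x\<in>X. grade (pv x) i) \<inter> sections G X P"
  by (simp_all add: nv_def gsubmodule_def gsum_def)

lemma coset_WC: "X \<in> cosets \<Delta> s \<Longrightarrow> X \<subseteq> WC" using cosets_W by blast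

lemma sections_carrier: "m \<in> sections G X P \<Longrightarrow> x \<in> X \<Longrightarrow> m x \<in> carrier (pv x)"
  unfolding sections_def by auto

lemma zero_section:
  assumes "I \<subseteq> WC" shows "(\<lambda>x\<in>I. \<zero>\<^bsub>pv x\<^esub>) \<in> sections G I P"
  unfolding sections_iff[OF assms]
proof (intro conjI ballI impI)
  show "(\<lambda>x\<in>I. \<zero>\<^bsub>pv x\<^esub>) \<in> (\<Pi>\<^sub>E x\<in>I. carrier (pv x))"
    using abelian_monoid.zero_closed[OF module_abelian_monoid[OF mpv[OF subsetD[OF assms]]]] by auto
  fix x \<alpha> assume x: "x \<in> I" and a: "\<alpha> \<in> PR" and y: "rr \<alpha> \<cdot> x \<in> I"
  have xW: "x \<in> WC" and yW: "rr \<alpha> \<cdot> x \<in> WC" using x y assms by auto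
  show "rho P x (edg x \<alpha>) ((\<lambda>x\<in>I. \<zero>\<^bsub>pv x\<^esub>) x) = rho P (rr \<alpha> \<cdot> x) (edg x \<alpha>) ((\<lambda>x\<in>I. \<zero>\<^bsub>pv x\<^esub>) (rr \<alpha> \<cdot> x))"
    using x y graded_hom_zero[OF rhoP[OF xW a] mpv[OF xW] mpe[OF xW a]] graded_hom_zero[OF rhoP'[OF xW a] mpv[OF yW] mpe[OF xW a]]
    by simp
qed

lemma gcomp_section:
  assumes I: "I \<subseteq> WC" and m: "m \<in> sections G I P"
  shows "(\<lambda>x\<in>I. gcomp (pv x) (m x) i) \<in> sections G I P"
  unfolding sections_iff[OF I]
proof (intro conjI ballI impI)
  note mc = sections_carrier[OF m]
  show "(\<lambda>x\<in>I. gcomp (pv x) (m x) i) \<in> (\<Pi>\<^sub>E x\<in>I. carrier (pv x))"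
    using gcomp_carrier[OF gpv[OF subsetD[OF I]] mc] by auto
  fix x \<alpha> assume x: "x \<in> I" and a: "\<alpha> \<in> PR" and y: "rr \<alpha> \<cdot> x \<in> I"
  have xW: "x \<in> WC" and yW: "rr \<alpha> \<cdot> x \<in> WC" using x y I by auto
  have "rho P x (edg x \<alpha>) (m x) = rho P (rr \<alpha> \<cdot> x) (edg x \<alpha>) (m (rr \<alpha> \<cdot> x))"
    using m x a y unfolding sections_iff[OF I] by blast
  then show "rho P x (edg x \<alpha>) ((\<lambda>x\<in>I. gcomp (pv x) (m x) i) x) = rho P (rr \<alpha> \<cdot> x) (edg x \<alpha>) ((\<lambda>x\<in>I. gcomp (pv x) (m x) i) (rr \<alpha> \<cdot> x))"
    using x y gcomp_hom[OF rhoP[OF xW a] gpv[OF xW] gpe[OF xW a] mc[OF x], of i]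
      gcomp_hom[OF rhoP'[OF xW a] gpv[OF yW] gpe[OF xW a] mc[OF y], of i] by simp
qed

lemma gsum_pv_graded: "X \<in> cosets \<Delta> s \<Longrightarrow> graded_module SV (gsum X pv)"
  by (rule gsum_graded_module[OF GB.R.is_cring finite_coset gpv[OF subsetD[OF coset_WC]]])

lemma nv_graded: assumes X: "X \<in> cosets \<Delta> s" shows "graded_module SV (nv X)"
  unfolding nv_def
proof (rule graded_module_gsubmodule[OF gsum_pv_graded[OF X]])
  note XW = coset_WC[OF X]
  show "sections G X P \<subseteq> carrier (gsum X pv)" by (auto simp: sections_def)
  show "\<zero>\<^bsub>gsum X pv\<^esub> \<in> sections G X P" using zero_section[OF XW] by simp
  fix m n assume m: "m \<in> sections G X P" and n: "n \<in> sections G X P"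
  show "m \<oplus>\<^bsub>gsum X pv\<^esub> n \<in> sections G X P" using sections_add[OF sheafP XW m n] by simp
next
  note XW = coset_WC[OF X]
  fix a m assume a: "a \<in> carrier SV" and m: "m \<in> sections G X P"
  show "a \<odot>\<^bsub>gsum X pv\<^esub> m \<in> sections G X P" using sections_scale[OF sheafP XW m admissible_const[OF a]] by simp
next
  note XW = coset_WC[OF X]
  fix m i assume m: "m \<in> sections G X P"
  have mc: "m \<in> carrier (gsum X pv)" using m by (auto simp: sections_def)
  have "gcomp (gsum X pv) m i = (\<lambda>x\<in>X. gcomp (pv x) (m x) i)"
  proof (rule gsum_eqI[OF gcomp_carrier[OF gsum_pv_graded[OF X] mc]])
    show "(\<lambda>x\<in>X. gcomp (pv x) (m x) i) \<in> carrier (gsum X pv)" using gcomp_section[OF XW m, of i] by (auto simp: sections_def)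
    fix x assume x: "x \<in> X"
    show "gcomp (gsum X pv) m i x = (\<lambda>x\<in>X. gcomp (pv x) (m x) i) x"
      using gcomp_gsum[OF GB.R.is_cring finite_coset[OF X] gpv[OF subsetD[OF XW]] mc x] x by simp
  qed
  then show "gcomp (gsum X pv) m i \<in> sections G X P" using gcomp_section[OF XW m] by simp
qed (rule GB.rg)

text \<open>The value at the lower element u is arbitrary, since the upper stalk maps onto the edge;
  pairs with value 0 at u have a multiple of the label at us. So the stalk is an extension of a free
  module by a shifted free module.\<close>

lemma nv_free: assumes X: "X \<in> cosets \<Delta> s" shows "graded_free SV (nv X)"
proof -
  obtain u where u: "u \<in> WC" "X = cs u" "weyl_less \<Delta> u (u \<cdot> s)" using coset_lower[OF X] .
  let ?y = "u \<cdot> s" and ?E = "edg u (lab u)"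
  have y: "?y \<in> WC" and uy: "?y \<noteq> u" using u xs_ne by auto
  note l = lab[OF u(1)]
  interpret Y: module SV "pv ?y" by (rule mpv[OF y])
  interpret U: module SV "pv u" by (rule mpv[OF u(1)])
  interpret E: module SV "pe ?E" by (rule mpe[OF u(1) l(1)])
  have ry: "rho P ?y ?E \<in> graded_hom SV (pv ?y) (pe ?E)" using rhoP'[OF u(1) l(1)] l(2) by simp
  have ru: "rho P u ?E \<in> graded_hom SV (pv u) (pe ?E)" by (rule rhoP[OF u(1) l(1)])
  have sur: "\<exists>n\<in>carrier (pv ?y). rho P ?y ?E n = rho P u ?E m" if "m \<in> carrier (pv u)" for m
    using rho_surj[OF u(1) l(1) lab_less[OF u(1,3)]] graded_homD(1)[OF ru that] l(2) by (metis (no_types, lifting) image_iff)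
  have ker: "rho P ?y ?E n = \<zero>\<^bsub>pe ?E\<^esub> \<longleftrightarrow> (\<exists>k\<in>carrier (pv ?y). n = lb (lab u) \<odot>\<^bsub>pv ?y\<^esub> k)" if "n \<in> carrier (pv ?y)" for n
    using rho_ker[OF u(1) l(1) lab_less[OF u(1,3)], of n] that l(2) by simp
  \<comment> \<open>Lifts the map from the lower stalk to the edge through the surjection from the
    upper stalk. Then m is sent to the compatible pair (m, L m).\<close>
  obtain L where L: "L \<in> graded_hom SV (pv u) (pv ?y)" "\<And>m. m \<in> carrier (pv u) \<Longrightarrow> rho P ?y ?E (L m) = rho P u ?E m"
    using GB.free_lift[OF freeP[OF u(1)] gpv[OF u(1)] gpv[OF y] gpe[OF u(1) l(1)] ru ry sur] by blast
  have uX: "u \<in> X" "?y \<in> X" unfolding u(2) by (auto simp: cs_def')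
  have Xc: "x \<in> X \<Longrightarrow> x = u \<or> x = ?y" for x unfolding u(2) by (auto simp: cs_def')
  have mkI: "(\<lambda>x\<in>X. if x = u then a else b) \<in> sections G X P"
    if "a \<in> carrier (pv u)" "b \<in> carrier (pv ?y)" "rho P u ?E a = rho P ?y ?E b" for a b
    unfolding u(2) sections_coset_iff[OF u(1)] using that uy by (auto simp: cs_def')
  have sD: "m u \<in> carrier (pv u)" "m ?y \<in> carrier (pv ?y)" "rho P u ?E (m u) = rho P ?y ?E (m ?y)" if "m \<in> sections G X P" for m
    using that unfolding u(2) sections_coset_iff[OF u(1)] by (auto simp: cs_def')
  have sEq: "m = n" if "m \<in> sections G X P" "n \<in> sections G X P" "m u = n u" "m ?y = n ?y" for m n
  proof (rule gsum_eqI[where I = X and N = pv])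
    fix x assume "x \<in> X" then show "m x = n x" using Xc[of x] that by auto
  qed (use that in \<open>auto simp: sections_def\<close>)
  \<comment> \<open>\<open>l'\<close> splits the evaluation at u, and \<open>q\<close> embeds the
    upper stalk as its kernel. Multiplication by a label raises degrees by 2, whence d = 2
    below.\<close>
  define l' where "l' m = (\<lambda>x\<in>X. if x = u then m else L m)" for m
  define q where "q b = (\<lambda>x\<in>X. if x = u then \<zero>\<^bsub>pv u\<^esub> else lb (lab u) \<odot>\<^bsub>pv ?y\<^esub> b)" for b
  note Lh = graded_homD[OF L(1)]
  have q_sec: "q b \<in> sections G X P" if "b \<in> carrier (pv ?y)" for b
  proof -
    have c: "lb (lab u) \<odot>\<^bsub>pv ?y\<^esub> b \<in> carrier (pv ?y)" using that l(1) by simp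
    have "rho P u ?E \<zero>\<^bsub>pv u\<^esub> = rho P ?y ?E (lb (lab u) \<odot>\<^bsub>pv ?y\<^esub> b)"
      using graded_hom_zero[OF ru U.module_axioms E.module_axioms] ker[OF c] that by auto
    then show ?thesis unfolding q_def using c by (intro mkI) auto
  qed
  have l_sec: "l' m \<in> sections G X P" if "m \<in> carrier (pv u)" for m
    unfolding l'_def using that Lh(1)[OF that] L(2)[OF that] by (intro mkI) auto
  show ?thesis
  proof (rule GB.free_extension[OF freeP[OF u(1)] freeP[OF y] gpv[OF u(1)] gpv[OF y] nv_graded[OF X], where p = "\<lambda>m. m u" and l = l' and q = q and d = 2])
    show "(\<lambda>m. m u) \<in> graded_hom SV (nv X) (pv u)"
      by (rule graded_homI) (use uX sD in auto)
    show "l' \<in> graded_hom SV (pv u) (nv X)"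
    proof (rule graded_homI)
      fix m assume "m \<in> carrier (pv u)" then show "l' m \<in> carrier (nv X)" using l_sec by simp
    next
      fix m n assume "m \<in> carrier (pv u)" "n \<in> carrier (pv u)"
      then show "l' (m \<oplus>\<^bsub>pv u\<^esub> n) = l' m \<oplus>\<^bsub>nv X\<^esub> l' n"
        unfolding nv_simps l'_def by (intro restrict_ext) (use Xc Lh uy in auto)
    next
      fix a m assume "a \<in> carrier SV" "m \<in> carrier (pv u)"
      then show "l' (a \<odot>\<^bsub>pv u\<^esub> m) = a \<odot>\<^bsub>nv X\<^esub> l' m"
        unfolding nv_simps l'_def by (intro restrict_ext) (use Xc Lh uy in auto)
    next
      fix m i assume m: "m \<in> grade (pv u) i"
      have "l' m \<in> sections G X P" by (rule l_sec[OF grade_carrier[OF gpv[OF u(1)] m]])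
      moreover have "l' m x \<in> grade (pv x) i" if "x \<in> X" for x
        using Xc[OF that] that m Lh(4)[OF m] by (auto simp: l'_def)
      ultimately show "l' m \<in> grade (nv X) i" unfolding nv_simps by (auto simp: l'_def)
    qed
    show "l' m u = m" if "m \<in> carrier (pv u)" for m using uX by (simp add: l'_def)
    show "q \<in> graded_hom SV (gshift (- 2) (pv ?y)) (nv X)"
    proof (rule graded_homI)
      fix m assume "m \<in> carrier (gshift (- 2) (pv ?y))" then show "q m \<in> carrier (nv X)" using q_sec by simp
    next
      fix m n assume "m \<in> carrier (gshift (- 2) (pv ?y))" "n \<in> carrier (gshift (- 2) (pv ?y))"
      then show "q (m \<oplus>\<^bsub>gshift (- 2) (pv ?y)\<^esub> n) = q m \<oplus>\<^bsub>nv X\<^esub> q n"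
        unfolding nv_simps q_def by (intro restrict_ext) (use Xc uy l(1) in \<open>auto simp: Y.smult_r_distr\<close>)
    next
      fix a m assume "a \<in> carrier SV" "m \<in> carrier (gshift (- 2) (pv ?y))"
      then have am: "a \<in> carrier SV" "m \<in> carrier (pv ?y)" by simp_all
      have *: "q (a \<odot>\<^bsub>pv ?y\<^esub> m) x = a \<odot>\<^bsub>pv x\<^esub> q m x" if x: "x \<in> X" for x
      proof (cases "x = u")
        case True
        then show ?thesis using x am by (simp add: q_def)
      next
        case False
        then have xy: "x = ?y" using Xc[OF x] by simp
        have "lb (lab u) \<odot>\<^bsub>pv ?y\<^esub> (a \<odot>\<^bsub>pv ?y\<^esub> m) = a \<odot>\<^bsub>pv ?y\<^esub> (lb (lab u) \<odot>\<^bsub>pv ?y\<^esub> m)"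
          using am l(1) Y.smult_assoc1[of a "lb (lab u)" m] Y.smult_assoc1[of "lb (lab u)" a m] GB.R.m_comm[of a "lb (lab u)"] by simp
        then show ?thesis unfolding q_def xy using uX uy by simp
      qed
      show "q (a \<odot>\<^bsub>gshift (- 2) (pv ?y)\<^esub> m) = a \<odot>\<^bsub>nv X\<^esub> q m"
      proof (rule ext)
        fix x show "q (a \<odot>\<^bsub>gshift (- 2) (pv ?y)\<^esub> m) x = (a \<odot>\<^bsub>nv X\<^esub> q m) x"
          using * by (cases "x \<in> X") (simp_all add: q_def)
      qed
    next
      fix m i assume m: "m \<in> grade (gshift (- 2) (pv ?y)) i"
      then have m': "m \<in> grade (pv ?y) (i - 2)" by simp
      have "q m \<in> sections G X P" by (rule q_sec[OF grade_carrier[OF gpv[OF y] m']])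
      moreover have "lb (lab u) \<odot>\<^bsub>pv ?y\<^esub> m \<in> grade (pv ?y) i"
        using graded_module_smult[OF gpv[OF y] lb_grade[OF AR_aw[OF PR_AR[OF l(1)]]] m'] by simp
      ultimately have "q m x \<in> grade (pv x) i" if "x \<in> X" for x
        using Xc[OF that] that grade_zero[OF gpv[OF u(1)]] by (auto simp: q_def)
      with q_sec[OF grade_carrier[OF gpv[OF y] m']] show "q m \<in> grade (nv X) i" unfolding nv_simps by (auto simp: q_def)
    qed
    show "inj_on q (carrier (pv ?y))"
    proof (rule inj_onI)
      fix a b assume ab: "a \<in> carrier (pv ?y)" "b \<in> carrier (pv ?y)" "q a = q b"
      have "lb (lab u) \<odot>\<^bsub>pv ?y\<^esub> a = lb (lab u) \<odot>\<^bsub>pv ?y\<^esub> b" using fun_cong[OF ab(3), of ?y] uX uy by (simp add: q_def)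
      then have *: "lb (lab u) \<odot>\<^bsub>pv ?y\<^esub> (a \<ominus>\<^bsub>pv ?y\<^esub> b) = \<zero>\<^bsub>pv ?y\<^esub>"
        using ab(1,2) lb_PR[OF l(1)] by (simp add: Y.minus_eq Y.smult_r_distr Y.smult_r_minus Y.r_neg)
      have "a \<ominus>\<^bsub>pv ?y\<^esub> b = \<zero>\<^bsub>pv ?y\<^esub>"
        by (rule GB.free_regular[OF freeP[OF y] gpv[OF y] lb_PR[OF l(1)] lb_regular[OF PR_AR[OF l(1)]] Y.minus_closed[OF ab(1,2)] *])
      moreover have "a = (a \<ominus>\<^bsub>pv ?y\<^esub> b) \<oplus>\<^bsub>pv ?y\<^esub> b"
        using ab(1,2) by (simp add: Y.minus_eq Y.a_assoc Y.l_neg)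
      ultimately show "a = b" using ab(2) Y.l_zero by metis
    qed
    fix n assume n: "n \<in> carrier (nv X)"
    then have n': "n \<in> sections G X P" by simp
    show "n u = \<zero>\<^bsub>pv u\<^esub> \<longleftrightarrow> n \<in> q ` carrier (pv ?y)"
    proof
      assume z: "n u = \<zero>\<^bsub>pv u\<^esub>"
      have "rho P ?y ?E (n ?y) = \<zero>\<^bsub>pe ?E\<^esub>" using sD(3)[OF n'] z graded_hom_zero[OF ru U.module_axioms E.module_axioms] by simp
      then obtain k where k: "k \<in> carrier (pv ?y)" "n ?y = lb (lab u) \<odot>\<^bsub>pv ?y\<^esub> k" using ker[OF sD(2)[OF n']] by blast
      have "n = q k" by (rule sEq[OF n' q_sec[OF k(1)]]) (use z k uX uy in \<open>auto simp: q_def\<close>)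
      then show "n \<in> q ` carrier (pv ?y)" using k(1) by blast
    next
      assume "n \<in> q ` carrier (pv ?y)"
      then show "n u = \<zero>\<^bsub>pv u\<^esub>" using uX by (auto simp: q_def)
    qed
  qed
qed

end


section \<open>Edge stalks of the sheaf on cosets and the GKM-property\<close>

lemma graded_hom_gsumI:
  assumes "\<And>i. i \<in> I \<Longrightarrow> (\<lambda>m. f m i) \<in> graded_hom R M (N i)" "\<And>m. f m \<in> extensional I"
  shows "f \<in> graded_hom R M (gsum I N)"
proof (rule graded_homI)
  note h = graded_homD[OF assms(1)]
  note ext = extensional_arb[OF assms(2)]
  fix x assume x: "x \<in> carrier M"
  then show "f x \<in> carrier (gsum I N)" using h(1) assms(2) by (auto simp: PiE_def)
  fix y assume y: "y \<in> carrier M"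
  show "f (x \<oplus>\<^bsub>M\<^esub> y) = f x \<oplus>\<^bsub>gsum I N\<^esub> f y"
  proof (rule HOL.ext)
    fix i show "f (x \<oplus>\<^bsub>M\<^esub> y) i = (f x \<oplus>\<^bsub>gsum I N\<^esub> f y) i"
      using h(2)[OF _ x y, of i] ext[of i] by (cases "i \<in> I") auto
  qed
next
  note h = graded_homD[OF assms(1)]
  note ext = extensional_arb[OF assms(2)]
  fix a x assume a: "a \<in> carrier R" and x: "x \<in> carrier M"
  show "f (a \<odot>\<^bsub>M\<^esub> x) = a \<odot>\<^bsub>gsum I N\<^esub> f x"
  proof (rule HOL.ext)
    fix i show "f (a \<odot>\<^bsub>M\<^esub> x) i = (a \<odot>\<^bsub>gsum I N\<^esub> f x) i"
      using h(3)[OF _ a x, of i] ext[of i] by (cases "i \<in> I") auto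
  qed
next
  note h = graded_homD[OF assms(1)]
  fix x d assume "x \<in> grade M d"
  then show "f x \<in> grade (gsum I N) d" using h(4) assms(2) by (auto simp: PiE_def)
qed

lemma graded_hom_comp:
  assumes "f \<in> graded_hom R L M" "g \<in> graded_hom R M N" shows "(\<lambda>x. g (f x)) \<in> graded_hom R L N"
  by (rule graded_homI) (simp_all add: graded_homD[OF assms(1)] graded_homD[OF assms(2)])

lemma graded_hom_gsubmodule:
  assumes "f \<in> graded_hom R M N" "graded_module R M" "f ` carrier M \<subseteq> C"
  shows "f \<in> graded_hom R M (gsubmodule N C)"
proof (rule graded_homI)
  fix x i assume x: "x \<in> grade M i"
  then have "f x \<in> C" using grade_carrier[OF assms(2) x] assms(3) by blast
  then show "f x \<in> grade (gsubmodule N C) i" using graded_homD(4)[OF assms(1) x] by (simp add: gsubmodule_def)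
next
  fix x assume "x \<in> carrier M"
  then show "f x \<in> carrier (gsubmodule N C)" using assms(3) by (auto simp: gsubmodule_def)
qed (simp_all add: graded_homD[OF assms(1)] gsubmodule_def)

lemma sections_restrict: "m \<in> sections H I M \<Longrightarrow> J \<subseteq> I \<Longrightarrow> restrict m J \<in> sections H J M"
  unfolding sections_def by (auto simp: subset_iff)

context projective_setup begin

abbreviation cr_rho where "cr_rho \<equiv> coset_rho \<Delta> s P"
abbreviation ie where "ie \<equiv> inducing_edges \<Delta> s"

lemma rr_in_cs: "\<alpha> \<in> PR \<Longrightarrow> x \<in> WC \<Longrightarrow> u \<in> cs x \<Longrightarrow> rr \<alpha> \<cdot> u \<in> cs (rr \<alpha> \<cdot> x)"
  by (drule (1) rr_cs) (erule subst, rule imageI)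

lemma cs_rr: "\<alpha> \<in> PR \<Longrightarrow> x \<in> WC \<Longrightarrow> u \<in> cs x \<Longrightarrow> cs (rr \<alpha> \<cdot> u) = cs (rr \<alpha> \<cdot> x)"
  by (rule cs_eq[OF _ rr_in_cs]) simp_all

lemma rr_ne_swap: "x \<in> WC \<Longrightarrow> \<alpha> \<in> PR \<Longrightarrow> cs (rr \<alpha> \<cdot> x) \<noteq> cs x \<Longrightarrow> cs (rr \<alpha> \<cdot> (rr \<alpha> \<cdot> x)) \<noteq> cs (rr \<alpha> \<cdot> x)"
  by simp

lemma coset_rho_app:
  assumes "x \<in> WC" "\<alpha> \<in> PR" "cs (rr \<alpha> \<cdot> x) \<noteq> cs x" "u \<in> cs x"
  shows "cr_rho (cs x) (cedg x \<alpha>) m (edg u \<alpha>) = rho P u (edg u \<alpha>) (m u)"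
  unfolding coset_rho_def Let_def inducing_edges_cedg[OF assms(1-3)] using the_end[OF assms] assms(4) by simp

lemma coset_rho_app':
  assumes x: "x \<in> WC" and a: "\<alpha> \<in> PR" and ne: "cs (rr \<alpha> \<cdot> x) \<noteq> cs x" and u: "u \<in> cs x"
  shows "cr_rho (cs (rr \<alpha> \<cdot> x)) (cedg x \<alpha>) m (edg u \<alpha>) = rho P (rr \<alpha> \<cdot> u) (edg u \<alpha>) (m (rr \<alpha> \<cdot> u))"
proof -
  have "rr \<alpha> \<cdot> x \<in> WC" using x a by simp
  from coset_rho_app[OF this a rr_ne_swap[OF x a ne] rr_in_cs[OF a x u], of m]
  show ?thesis using cedg_rr[OF x a] edg_rr[OF cs_W[OF x u] a] by simp
qed

lemma coset_rho_ext: "x \<in> WC \<Longrightarrow> \<alpha> \<in> PR \<Longrightarrow> cs (rr \<alpha> \<cdot> x) \<noteq> cs x \<Longrightarrow>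
    cr_rho X (cedg x \<alpha>) m = n \<longleftrightarrow> n \<in> extensional (ie (cedg x \<alpha>)) \<and> (\<forall>u\<in>cs x. cr_rho X (cedg x \<alpha>) m (edg u \<alpha>) = n (edg u \<alpha>))"
proof -
  assume a: "x \<in> WC" "\<alpha> \<in> PR" "cs (rr \<alpha> \<cdot> x) \<noteq> cs x"
  have e: "cr_rho X (cedg x \<alpha>) m \<in> extensional (ie (cedg x \<alpha>))" by (simp add: coset_rho_def)
  show ?thesis
  proof
    assume "n \<in> extensional (ie (cedg x \<alpha>)) \<and> (\<forall>u\<in>cs x. cr_rho X (cedg x \<alpha>) m (edg u \<alpha>) = n (edg u \<alpha>))"
    then show "cr_rho X (cedg x \<alpha>) m = n"
      by (intro extensionalityI[OF e]) (auto simp: inducing_edges_cedg[OF a])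
  qed (use e in auto)
qed

lemma coset_rho_eq_iff:
  assumes "x \<in> WC" "\<alpha> \<in> PR" "cs (rr \<alpha> \<cdot> x) \<noteq> cs x"
  shows "cr_rho (cs x) (cedg x \<alpha>) m = cr_rho (cs (rr \<alpha> \<cdot> x)) (cedg x \<alpha>) n \<longleftrightarrow>
    (\<forall>u\<in>cs x. rho P u (edg u \<alpha>) (m u) = rho P (rr \<alpha> \<cdot> u) (edg u \<alpha>) (n (rr \<alpha> \<cdot> u)))"
proof -
  have e: "cr_rho (cs (rr \<alpha> \<cdot> x)) (cedg x \<alpha>) n \<in> extensional (ie (cedg x \<alpha>))" by (simp add: coset_rho_def)
  show ?thesis unfolding coset_rho_ext[OF assms] using e coset_rho_app[OF assms] coset_rho_app'[OF assms] by simp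
qed

lemma nv_proj: "x \<in> X \<Longrightarrow> (\<lambda>m. m x) \<in> graded_hom SV (nv X) (pv x)"
  by (rule graded_homI) (auto dest: sections_carrier)

lemma ie_graded:
  assumes "x \<in> WC" "\<alpha> \<in> PR" "cs (rr \<alpha> \<cdot> x) \<noteq> cs x"
  shows "graded_module SV (gsum (ie (cedg x \<alpha>)) pe)"
proof (rule gsum_graded_module[OF GB.R.is_cring])
  show "finite (ie (cedg x \<alpha>))" unfolding inducing_edges_cedg[OF assms] using finite_coset[OF cosets_cs[OF assms(1)]] by simp
  fix E assume "E \<in> ie (cedg x \<alpha>)"
  then obtain u where "u \<in> cs x" "E = edg u \<alpha>" unfolding inducing_edges_cedg[OF assms] by blast
  then show "graded_module SV (pe E)" using gpe[OF cs_W[OF assms(1)] assms(2)] by blast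
qed

lemma coset_rho_hom:
  assumes "x \<in> WC" "\<alpha> \<in> PR" "cs (rr \<alpha> \<cdot> x) \<noteq> cs x"
  shows "cr_rho (cs x) (cedg x \<alpha>) \<in> graded_hom SV (nv (cs x)) (gsum (ie (cedg x \<alpha>)) pe)"
proof (rule graded_hom_gsumI)
  fix E assume "E \<in> ie (cedg x \<alpha>)"
  then obtain u where u: "u \<in> cs x" "E = edg u \<alpha>" unfolding inducing_edges_cedg[OF assms] by blast
  have "(\<lambda>m. rho P u E (m u)) \<in> graded_hom SV (nv (cs x)) (pe E)"
    unfolding u(2) by (rule graded_hom_comp[OF nv_proj[OF u(1)] rhoP[OF cs_W[OF assms(1) u(1)] assms(2)]])
  then show "(\<lambda>m. cr_rho (cs x) (cedg x \<alpha>) m E) \<in> graded_hom SV (nv (cs x)) (pe E)"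
    unfolding u(2) coset_rho_app[OF assms u(1)] .
qed (simp add: coset_rho_def)

lemma coset_rho_hom':
  assumes x: "x \<in> WC" and a: "\<alpha> \<in> PR" and ne: "cs (rr \<alpha> \<cdot> x) \<noteq> cs x"
  shows "cr_rho (cs (rr \<alpha> \<cdot> x)) (cedg x \<alpha>) \<in> graded_hom SV (nv (cs (rr \<alpha> \<cdot> x))) (gsum (ie (cedg x \<alpha>)) pe)"
proof -
  have "rr \<alpha> \<cdot> x \<in> WC" using x a by simp
  from coset_rho_hom[OF this a rr_ne_swap[OF x a ne]] show ?thesis using cedg_rr[OF x a] by simp
qed

text \<open>The standard presentation of an edge between cosets: x is any element of the lower
  coset, and by \<open>coset_edge_up\<close> every edge is \<open>cedg x \<alpha>\<close> for such a
  pair.\<close>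

definition up :: "'v affine_trans \<Rightarrow> 'v \<times> int \<Rightarrow> bool" where
  "up x \<alpha> \<longleftrightarrow> x \<in> WC \<and> \<alpha> \<in> PR \<and> coset_less \<Delta> (cs x) (cs (rr \<alpha> \<cdot> x))"

lemma upD: assumes "up x \<alpha>"
  shows "x \<in> WC" "\<alpha> \<in> PR" "cs (rr \<alpha> \<cdot> x) \<noteq> cs x" "coset_less \<Delta> (cs x) (cs (rr \<alpha> \<cdot> x))" "rr \<alpha> \<cdot> x \<in> WC"
    "cs x \<in> cosets \<Delta> s" "cs (rr \<alpha> \<cdot> x) \<in> cosets \<Delta> s"
  using assms cosets_cs unfolding up_def by (auto simp: coset_less_def)

lemma up_cs: assumes "up x \<alpha>" "u \<in> cs x" shows "up u \<alpha>"
  using assms cs_W[of x u] cs_eq[of x u] cs_rr[of \<alpha> x u] unfolding up_def by auto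

lemma up_less: assumes "up x \<alpha>" shows "weyl_less \<Delta> x (rr \<alpha> \<cdot> x)"
  using assms coset_less_edge unfolding up_def by blast

lemma coset_edge_up:
  assumes "B \<in> coset_edges \<Delta> s" obtains x \<alpha> where "up x \<alpha>" "B = cedg x \<alpha>"
proof -
  obtain X Y where "fst B = {X, Y}" using assms by (auto simp: coset_edges_def)
  then have "fst B = {X, Y} \<and> B \<in> coset_edges \<Delta> s" using assms by blast
  from coset_joins_iff[THEN iffD1, OF this]
  obtain x where x: "x \<in> WC" "snd B \<in> PR" "cs (rr (snd B) \<cdot> x) \<noteq> cs x" "B = cedg x (snd B)"
    by (elim bexE conjE) (rule that; assumption)
  from coset_less_total[OF x(1-3)] show ?thesis
  proof
    assume "coset_less \<Delta> (cs x) (cs (rr (snd B) \<cdot> x))"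
    then have "up x (snd B)" using x(1,2) by (simp add: up_def)
    then show ?thesis using x(4) by (rule that)
  next
    assume "coset_less \<Delta> (cs (rr (snd B) \<cdot> x)) (cs x)"
    then have u: "up (rr (snd B) \<cdot> x) (snd B)" using x(1,2) by (simp add: up_def)
    have "B = cedg (rr (snd B) \<cdot> x) (snd B)" unfolding cedg_rr[OF x(1,2)] by (rule x(4))
    with u show ?thesis by (rule that)
  qed
qed

lemma directed_Gs:
  assumes "directed_edge Gs B X Y" obtains x \<alpha> where "up x \<alpha>" "B = cedg x \<alpha>" "X = cs x" "Y = cs (rr \<alpha> \<cdot> x)"
proof -
  have j: "fst B = {X, Y} \<and> B \<in> coset_edges \<Delta> s" and l: "coset_less \<Delta> X Y"
    using assms by (auto simp: directed_edge_def joins_def)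
  from coset_joins_iff[THEN iffD1, OF j]
  obtain x where x: "x \<in> WC" "snd B \<in> PR" "X = cs x" "Y = cs (rr (snd B) \<cdot> x)" "B = cedg x (snd B)"
    by (elim bexE conjE) (rule that; assumption)
  have "up x (snd B)" using x(1,2) l unfolding x(3,4) by (simp add: up_def)
  then show ?thesis using x(5,3,4) by (rule that)
qed

abbreviation ne :: "'v affine_coset_edge \<Rightarrow> (('v, 'f) weight_sym, 'v affine_edge \<Rightarrow> 'n) gmodule" where "ne \<equiv> estalk NN"

lemma ne_def: "up x \<alpha> \<Longrightarrow> ne (cedg x \<alpha>) = gsubmodule (gsum (ie (cedg x \<alpha>)) pe) (cr_rho (cs (rr \<alpha> \<cdot> x)) (cedg x \<alpha>) ` carrier (nv (cs (rr \<alpha> \<cdot> x))))"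
  unfolding estalk_NN by (simp add: upper_coset_cedg upD)

lemma coset_rho_surj: "up x \<alpha> \<Longrightarrow> cr_rho (cs (rr \<alpha> \<cdot> x)) (cedg x \<alpha>) ` carrier (nv (cs (rr \<alpha> \<cdot> x))) = carrier (ne (cedg x \<alpha>))"
  by (simp add: ne_def gsubmodule_def)

lemma ne_smult: "up x \<alpha> \<Longrightarrow> a \<odot>\<^bsub>ne (cedg x \<alpha>)\<^esub> e = (\<lambda>E\<in>ie (cedg x \<alpha>). a \<odot>\<^bsub>pe E\<^esub> e E)"
  and ne_zero: "up x \<alpha> \<Longrightarrow> \<zero>\<^bsub>ne (cedg x \<alpha>)\<^esub> = (\<lambda>E\<in>ie (cedg x \<alpha>). \<zero>\<^bsub>pe E\<^esub>)"
  by (simp_all add: ne_def gsubmodule_def)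

lemma ne_graded:
  assumes "up x \<alpha>"
  shows "graded_module SV (ne (cedg x \<alpha>))" "cr_rho (cs (rr \<alpha> \<cdot> x)) (cedg x \<alpha>) \<in> graded_hom SV (nv (cs (rr \<alpha> \<cdot> x))) (ne (cedg x \<alpha>))"
  unfolding ne_def[OF assms]
  by (rule graded_module_image[OF nv_graded[OF upD(7)[OF assms]] ie_graded[OF upD(1-3)[OF assms]] coset_rho_hom'[OF upD(1-3)[OF assms]] GB.rg])+

text \<open>Extend m to a global section of P and restrict it to the upper coset: the two values
  agree on both edges that join the cosets. So the lower vertex maps into the edge stalk, which is
  defined by the upper one.\<close>

lemma coset_rho_lower:
  assumes up: "up x \<alpha>" and m: "m \<in> carrier (nv (cs x))"
  shows "\<exists>n\<in>carrier (nv (cs (rr \<alpha> \<cdot> x))). cr_rho (cs x) (cedg x \<alpha>) m = cr_rho (cs (rr \<alpha> \<cdot> x)) (cedg x \<alpha>) n"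
proof -
  note U = upD[OF up]
  obtain g where g: "g \<in> sections G WC P" "\<And>u. u \<in> cs x \<Longrightarrow> g u = m u" using section_extends[OF U(6), of m] m by auto
  have "restrict g (cs (rr \<alpha> \<cdot> x)) \<in> carrier (nv (cs (rr \<alpha> \<cdot> x)))"
    using sections_restrict[OF g(1) coset_WC[OF U(7)]] by simp
  moreover have "cr_rho (cs x) (cedg x \<alpha>) m = cr_rho (cs (rr \<alpha> \<cdot> x)) (cedg x \<alpha>) (restrict g (cs (rr \<alpha> \<cdot> x)))"
    unfolding coset_rho_eq_iff[OF U(1-3)]
  proof
    fix u assume u: "u \<in> cs x"
    have uW: "u \<in> WC" using cs_W[OF U(1) u] .
    have "rho P u (edg u \<alpha>) (g u) = rho P (rr \<alpha> \<cdot> u) (edg u \<alpha>) (g (rr \<alpha> \<cdot> u))"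
      using g(1) uW U(2) unfolding sections_iff[OF order_refl] by simp
    then show "rho P u (edg u \<alpha>) (m u) = rho P (rr \<alpha> \<cdot> u) (edg u \<alpha>) (restrict g (cs (rr \<alpha> \<cdot> x)) (rr \<alpha> \<cdot> u))"
      using g(2)[OF u] rr_in_cs[OF U(2,1) u] by simp
  qed
  ultimately show ?thesis by blast
qed

lemma coset_rho_lower_hom:
  assumes up: "up x \<alpha>" shows "cr_rho (cs x) (cedg x \<alpha>) \<in> graded_hom SV (nv (cs x)) (ne (cedg x \<alpha>))"
  unfolding ne_def[OF up]
proof (rule graded_hom_gsubmodule[OF coset_rho_hom[OF upD(1-3)[OF up]] nv_graded[OF upD(6)[OF up]]])
  show "cr_rho (cs x) (cedg x \<alpha>) ` carrier (nv (cs x)) \<subseteq> cr_rho (cs (rr \<alpha> \<cdot> x)) (cedg x \<alpha>) ` carrier (nv (cs (rr \<alpha> \<cdot> x)))"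
    using coset_rho_lower[OF up] by (metis (no_types, lifting) image_eqI image_subsetI)
qed

lemma ne_killed:
  assumes up: "up x \<alpha>" and e: "e \<in> carrier (ne (cedg x \<alpha>))"
  shows "lb \<alpha> \<odot>\<^bsub>ne (cedg x \<alpha>)\<^esub> e = \<zero>\<^bsub>ne (cedg x \<alpha>)\<^esub>"
proof -
  note U = upD[OF up]
  obtain n where n: "n \<in> carrier (nv (cs (rr \<alpha> \<cdot> x)))" "e = cr_rho (cs (rr \<alpha> \<cdot> x)) (cedg x \<alpha>) n"
    using e coset_rho_surj[OF up] by (metis (no_types, lifting) imageE)
  have eE: "e E \<in> carrier (pe E)" if "E \<in> ie (cedg x \<alpha>)" for E
    using graded_homD(1)[OF coset_rho_hom'[OF U(1-3)] n(1)] that unfolding n(2) by auto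
  show ?thesis unfolding ne_smult[OF up] ne_zero[OF up]
  proof (intro restrict_ext)
    fix E assume E: "E \<in> ie (cedg x \<alpha>)"
    then obtain u where u: "u \<in> cs x" "E = edg u \<alpha>" unfolding inducing_edges_cedg[OF U(1-3)] by blast
    show "lb \<alpha> \<odot>\<^bsub>pe E\<^esub> e E = \<zero>\<^bsub>pe E\<^esub>"
      using pe_killed[OF cs_W[OF U(1) u(1)] U(2)] eE[OF E] unfolding u(2) by blast
  qed
qed

lemma NN_sheaf: "is_sheaf V Gs NN"
  unfolding is_sheaf_def
proof (intro conjI ballI)
  fix X assume "X \<in> verts Gs" then show "graded_module SV (nv X)" using nv_graded by simp
next
  fix B assume "B \<in> edges Gs"
  then have "B \<in> coset_edges \<Delta> s" by simp
  from coset_edge_up[OF this] obtain x \<alpha> where U: "up x \<alpha>" "B = cedg x \<alpha>" .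
  show "graded_module SV (ne B)" unfolding U(2) by (rule ne_graded(1)[OF U(1)])
  show "sym_of V (label Gs B) \<odot>\<^bsub>ne B\<^esub> e = \<zero>\<^bsub>ne B\<^esub>" if "e \<in> carrier (ne B)" for e
    using ne_killed[OF U(1)] that unfolding U(2) lb_def by simp
  fix X assume "X \<in> ends Gs B"
  then have "X = cs x \<or> X = cs (rr \<alpha> \<cdot> x)" unfolding U(2) by simp
  then show "rho NN X B \<in> graded_hom SV (nv X) (ne B)"
    unfolding rho_NN U(2) using coset_rho_lower_hom[OF U(1)] ne_graded(2)[OF U(1)] by blast
qed

text \<open>With a zero stalk at x, global sections have value 0 on the edge. As they fill the stalk
  at the upper end, that whole stalk lies in the kernel, so it equals its multiple by a nonunit, and
  a free module with this property is zero.\<close>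

lemma supp_down:
  assumes x: "x \<in> WC" and a: "\<alpha> \<in> PR" and l: "weyl_less \<Delta> x (rr \<alpha> \<cdot> x)" and z: "carrier (pv x) = {\<zero>\<^bsub>pv x\<^esub>}"
  shows "carrier (pv (rr \<alpha> \<cdot> x)) = {\<zero>\<^bsub>pv (rr \<alpha> \<cdot> x)\<^esub>}"
proof -
  have y: "rr \<alpha> \<cdot> x \<in> WC" using x a by simp
  have "\<exists>k\<in>carrier (pv (rr \<alpha> \<cdot> x)). n = lb \<alpha> \<odot>\<^bsub>pv (rr \<alpha> \<cdot> x)\<^esub> k" if n: "n \<in> carrier (pv (rr \<alpha> \<cdot> x))" for n
  proof -
    obtain g where g: "g \<in> sections G WC P" "g (rr \<alpha> \<cdot> x) = n" using P4a[OF y n] by blast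
    have "g x = \<zero>\<^bsub>pv x\<^esub>" using sections_carrier[OF g(1) x] z by blast
    moreover have "rho P x (edg x \<alpha>) (g x) = rho P (rr \<alpha> \<cdot> x) (edg x \<alpha>) (g (rr \<alpha> \<cdot> x))"
      using g(1) x a unfolding sections_iff[OF order_refl] by simp
    ultimately have "rho P (rr \<alpha> \<cdot> x) (edg x \<alpha>) n = \<zero>\<^bsub>pe (edg x \<alpha>)\<^esub>"
      using graded_hom_zero[OF rhoP[OF x a] mpv[OF x] mpe[OF x a]] g(2) by simp
    then show ?thesis using rho_ker[OF x a l n] by blast
  qed
  then show ?thesis using GB.free_nonunit[OF freeP[OF y] gpv[OF y] lb_PR[OF a] lb_nonunit[OF PR_AR[OF a]]] by blast
qed

text \<open>If P is nonzero at some v in the upper coset, then by \<open>supp_down\<close> it is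
  nonzero at the neighbour of v in the lower one. The two cosets then lie in the set where the
  GKM-property holds, and at every element w of them the edges with labels \<alpha> and
  \<open>lab w\<close> are distinct and meet.\<close>

lemma gkm_cases:
  assumes up: "up x \<alpha>"
  shows "(\<forall>v\<in>cs (rr \<alpha> \<cdot> x). carrier (pv v) = {\<zero>\<^bsub>pv v\<^esub>}) \<or>
    (\<forall>u\<in>cs x \<union> cs (rr \<alpha> \<cdot> x). \<not> proportional V (rl (lab u)) (rl \<alpha>))"
proof (cases "\<forall>v\<in>cs (rr \<alpha> \<cdot> x). carrier (pv v) = {\<zero>\<^bsub>pv v\<^esub>}")
  case False
  note U = upD[OF up]
  let ?\<Omega> = "msupp G P \<union> (\<lambda>x. x \<cdot> s) ` msupp G P"
  obtain v where v: "v \<in> cs (rr \<alpha> \<cdot> x)" "carrier (pv v) \<noteq> {\<zero>\<^bsub>pv v\<^esub>}" using False by blast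
  have vW: "v \<in> WC" using cs_W[OF U(5) v(1)] .
  define u where "u = rr \<alpha> \<cdot> v"
  have u: "u \<in> cs x" "rr \<alpha> \<cdot> u = v" "u \<in> WC" using rr_in_cs[OF U(2,5) v(1)] U vW by (auto simp: u_def)
  have "carrier (pv u) \<noteq> {\<zero>\<^bsub>pv u\<^esub>}" using supp_down[OF u(3) U(2) up_less[OF up_cs[OF up u(1)]]] u(2) v(2) by auto
  then have supp: "u \<in> msupp G P" "v \<in> msupp G P" using v(2) vW u(3) by (simp_all add: msupp_def)
  have sub: "cs x \<subseteq> ?\<Omega>" "cs (rr \<alpha> \<cdot> x) \<subseteq> ?\<Omega>"
    using supp cs_eq[OF U(1) u(1)] cs_eq[OF U(5) v(1)] by (auto simp: cs_def')
  have "\<not> proportional V (rl (lab w)) (rl \<alpha>)" if w: "w \<in> cs x \<union> cs (rr \<alpha> \<cdot> x)" for w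
  proof -
    have wW: "w \<in> WC" using w cs_W[OF U(1)] cs_W[OF U(5)] by blast
    have rrx: "rr \<alpha> \<cdot> (rr \<alpha> \<cdot> x) = x" by (rule rr_rr[OF U(2,1)])
    have wr: "cs (rr \<alpha> \<cdot> w) \<noteq> cs w \<and> rr \<alpha> \<cdot> w \<in> cs x \<union> cs (rr \<alpha> \<cdot> x)"
      using w
    proof
      assume w: "w \<in> cs x"
      show ?thesis unfolding cs_rr[OF U(2,1) w] cs_eq[OF U(1) w] using U(3) rr_in_cs[OF U(2,1) w] by blast
    next
      assume w: "w \<in> cs (rr \<alpha> \<cdot> x)"
      show ?thesis unfolding cs_rr[OF U(2,5) w] cs_eq[OF U(5) w] rrx using U(3) rr_in_cs[OF U(2,5) w] unfolding rrx by blast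
    qed
    note wn = conjunct1[OF wr] and rw = conjunct2[OF wr]
    have ws: "w \<cdot> s \<in> cs x \<union> cs (rr \<alpha> \<cdot> x)" using w U(1,5) by (auto simp: cs_def')
    note l = lab[OF wW]
    have "fst (edg w \<alpha>) \<subseteq> ?\<Omega>" "fst (edg w (lab w)) \<subseteq> ?\<Omega>"
      unfolding fst_edg l(2) using w rw ws sub by blast+
    then have e: "edg w \<alpha> \<in> edges (full_subgraph G ?\<Omega>)" "edg w (lab w) \<in> edges (full_subgraph G ?\<Omega>)"
      using edg_edge[OF wW U(2)] edg_edge[OF wW l(1)] unfolding full_subgraph_def by simp_all
    have d: "edg w (lab w) \<noteq> edg w \<alpha>" using rr_not_s'(2)[OF U(2) wW wn] snd_edg by metis
    have c: "ends (full_subgraph G ?\<Omega>) (edg w (lab w)) \<inter> ends (full_subgraph G ?\<Omega>) (edg w \<alpha>) \<noteq> {}"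
      by (auto simp: full_subgraph_def)
    have "\<not> proportional V (label (full_subgraph G ?\<Omega>) (edg w (lab w))) (label (full_subgraph G ?\<Omega>) (edg w \<alpha>))"
      by (rule gkm[unfolded GKM_def, THEN bspec, OF e(2), THEN bspec, OF e(1), THEN mp, OF conjI[OF d c]])
    then show ?thesis by (simp add: full_subgraph_def)
  qed
  then show ?thesis by blast
qed blast

text \<open>In each component an element of the kernel is \<alpha> times some k. It remains to see
  that the k agree on the inner edge. Their difference there is killed by \<alpha>, and \<alpha>
  acts injectively on the inner edge stalk, which is the upper stalk modulo a label not proportional
  to \<alpha>.\<close>

lemma NN_ker:
  assumes up: "up x \<alpha>" and n: "n \<in> carrier (nv (cs (rr \<alpha> \<cdot> x)))"
  shows "cr_rho (cs (rr \<alpha> \<cdot> x)) (cedg x \<alpha>) n = \<zero>\<^bsub>ne (cedg x \<alpha>)\<^esub> \<longleftrightarrow>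
    (\<exists>k\<in>carrier (nv (cs (rr \<alpha> \<cdot> x))). n = lb \<alpha> \<odot>\<^bsub>nv (cs (rr \<alpha> \<cdot> x))\<^esub> k)"
proof
  note U = upD[OF up]
  let ?Y = "cs (rr \<alpha> \<cdot> x)" and ?B = "cedg x \<alpha>"
  assume "\<exists>k\<in>carrier (nv ?Y). n = lb \<alpha> \<odot>\<^bsub>nv ?Y\<^esub> k"
  then obtain k where k: "k \<in> carrier (nv ?Y)" "n = lb \<alpha> \<odot>\<^bsub>nv ?Y\<^esub> k" by blast
  note h = graded_homD[OF ne_graded(2)[OF up]]
  show "cr_rho ?Y ?B n = \<zero>\<^bsub>ne ?B\<^esub>"
    unfolding k(2) h(3)[OF lb_PR[OF U(2)] k(1)] by (rule ne_killed[OF up h(1)[OF k(1)]])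
next
  note U = upD[OF up]
  let ?Y = "cs (rr \<alpha> \<cdot> x)" and ?B = "cedg x \<alpha>"
  assume z: "cr_rho ?Y ?B n = \<zero>\<^bsub>ne ?B\<^esub>"
  have n': "n \<in> sections G ?Y P" using n by simp
  note nc = sections_carrier[OF n']
  show "\<exists>k\<in>carrier (nv ?Y). n = lb \<alpha> \<odot>\<^bsub>nv ?Y\<^esub> k"
  proof (cases "\<forall>v\<in>?Y. carrier (pv v) = {\<zero>\<^bsub>pv v\<^esub>}")
    case True
    \<comment> \<open>Over this coset all stalks vanish, so n is zero and is its own
      quotient.\<close>
    have "n = lb \<alpha> \<odot>\<^bsub>nv ?Y\<^esub> n"
    proof (rule gsum_eqI[where I = ?Y and N = pv])
      show "n \<in> carrier (gsum ?Y pv)" using n' by (auto simp: sections_def)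
      have c: "lb \<alpha> \<odot>\<^bsub>pv v\<^esub> n v \<in> carrier (pv v)" if "v \<in> ?Y" for v
        using module.smult_closed[OF mpv[OF cs_W[OF U(5) that]] lb_PR[OF U(2)] nc[OF that]] .
      then show "lb \<alpha> \<odot>\<^bsub>nv ?Y\<^esub> n \<in> carrier (gsum ?Y pv)" by simp
      fix v assume v: "v \<in> ?Y"
      then have "n v = \<zero>\<^bsub>pv v\<^esub>" "lb \<alpha> \<odot>\<^bsub>pv v\<^esub> n v = \<zero>\<^bsub>pv v\<^esub>" using True nc[OF v] c[OF v] by blast+
      then show "n v = (lb \<alpha> \<odot>\<^bsub>nv ?Y\<^esub> n) v" using v by simp
    qed
    then show ?thesis using n by blast
  next
    case False
    then have np: "\<And>u. u \<in> ?Y \<Longrightarrow> \<not> proportional V (rl (lab u)) (rl \<alpha>)" using gkm_cases[OF up] by blast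
    have "\<exists>k\<in>carrier (pv v). n v = lb \<alpha> \<odot>\<^bsub>pv v\<^esub> k" if v: "v \<in> ?Y" for v
    proof -
      have vW: "v \<in> WC" using cs_W[OF U(5) v] .
      define u where "u = rr \<alpha> \<cdot> v"
      have u: "u \<in> cs x" "rr \<alpha> \<cdot> u = v" "u \<in> WC" using rr_in_cs[OF U(2,5) v] U vW by (auto simp: u_def)
      have e: "edg u \<alpha> \<in> ie ?B" using u(1) unfolding inducing_edges_cedg[OF U(1-3)] by blast
      have "rho P v (edg u \<alpha>) (n v) = \<zero>\<^bsub>pe (edg u \<alpha>)\<^esub>"
        using coset_rho_app'[OF U(1-3) u(1), of n] e u(2) unfolding z ne_zero[OF up] by simp
      then show ?thesis using rho_ker[OF u(3) U(2) up_less[OF up_cs[OF up u(1)]], of "n v"] nc[OF v] u(2) by simp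
    qed
    then obtain k where k: "\<And>v. v \<in> ?Y \<Longrightarrow> k v \<in> carrier (pv v)" "\<And>v. v \<in> ?Y \<Longrightarrow> n v = lb \<alpha> \<odot>\<^bsub>pv v\<^esub> k v" by metis
    obtain v where v: "v \<in> WC" "?Y = cs v" "weyl_less \<Delta> v (v \<cdot> s)" using coset_lower[OF U(7)] .
    let ?y = "v \<cdot> s" and ?E = "edg v (lab v)"
    have y: "?y \<in> WC" using v by simp
    have vY: "v \<in> ?Y" "?y \<in> ?Y" unfolding v(2) by (auto simp: cs_def')
    note l = lab[OF v(1)]
    interpret Y: module SV "pv ?y" by (rule mpv[OF y])
    interpret X: module SV "pv v" by (rule mpv[OF v(1)])
    interpret E: module SV "pe ?E" by (rule mpe[OF v(1) l(1)])
    have ry: "rho P ?y ?E \<in> graded_hom SV (pv ?y) (pe ?E)" using rhoP'[OF v(1) l(1)] l(2) by simp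
    have rv: "rho P v ?E \<in> graded_hom SV (pv v) (pe ?E)" by (rule rhoP[OF v(1) l(1)])
    note hy = graded_homD[OF ry] and hv = graded_homD[OF rv]
    have sur: "\<exists>w\<in>carrier (pv ?y). rho P ?y ?E w = e" if "e \<in> carrier (pe ?E)" for e
      using rho_surj[OF v(1) l(1) lab_less[OF v(1,3)]] that l(2) by (metis (no_types, lifting) image_iff)
    have ker: "rho P ?y ?E w = \<zero>\<^bsub>pe ?E\<^esub> \<longleftrightarrow> (\<exists>k\<in>carrier (pv ?y). w = lb (lab v) \<odot>\<^bsub>pv ?y\<^esub> k)" if "w \<in> carrier (pv ?y)" for w
      using rho_ker[OF v(1) l(1) lab_less[OF v(1,3)], of w] that l(2) by simp
    note kv = k(1)[OF vY(1)] and ky = k(1)[OF vY(2)]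
    note la = lb_PR[OF U(2)] and ll = lb_PR[OF l(1)]
    have rk: "rho P v ?E (k v) \<in> carrier (pe ?E)" "rho P ?y ?E (k ?y) \<in> carrier (pe ?E)" using hv(1)[OF kv] hy(1)[OF ky] .
    \<comment> \<open>A lift to the upper stalk of the discrepancy of the k on the inner edge. Since
      n itself is a section, \<alpha> w vanishes on that edge, so it is a multiple of the inner
      label; coprimality then makes w such a multiple.\<close>
    obtain w where w: "w \<in> carrier (pv ?y)" "rho P ?y ?E w = rho P v ?E (k v) \<ominus>\<^bsub>pe ?E\<^esub> rho P ?y ?E (k ?y)"
      using sur[OF E.minus_closed[OF rk]] by blast
    have eq: "lb \<alpha> \<odot>\<^bsub>pe ?E\<^esub> rho P v ?E (k v) = lb \<alpha> \<odot>\<^bsub>pe ?E\<^esub> rho P ?y ?E (k ?y)"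
      using n' k(2)[OF vY(1)] k(2)[OF vY(2)] hv(3)[OF la kv] hy(3)[OF la ky]
      unfolding v(2) sections_coset_iff[OF v(1)] by simp
    have wc: "lb \<alpha> \<odot>\<^bsub>pv ?y\<^esub> w \<in> carrier (pv ?y)" using la w(1) by simp
    have "rho P ?y ?E (lb \<alpha> \<odot>\<^bsub>pv ?y\<^esub> w) = lb \<alpha> \<odot>\<^bsub>pe ?E\<^esub> (rho P v ?E (k v) \<ominus>\<^bsub>pe ?E\<^esub> rho P ?y ?E (k ?y))"
      unfolding hy(3)[OF la w(1)] w(2) ..
    also have "\<dots> = \<zero>\<^bsub>pe ?E\<^esub>"
      using eq la rk by (simp add: E.minus_eq E.smult_r_distr E.smult_r_minus E.r_neg)
    finally obtain k' where k': "k' \<in> carrier (pv ?y)" "lb \<alpha> \<odot>\<^bsub>pv ?y\<^esub> w = lb (lab v) \<odot>\<^bsub>pv ?y\<^esub> k'" using ker[OF wc] by blast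
    have "\<exists>k\<in>carrier (pv ?y). w = lb (lab v) \<odot>\<^bsub>pv ?y\<^esub> k"
      by (rule GB.free_coprime[OF freeP[OF y] gpv[OF y] ll la lb_coprime[OF PR_AR[OF l(1)] PR_AR[OF U(2)] np[OF vY(1)]] w(1) k'])
    then have "rho P v ?E (k v) \<ominus>\<^bsub>pe ?E\<^esub> rho P ?y ?E (k ?y) = \<zero>\<^bsub>pe ?E\<^esub>" using ker[OF w(1)] w(2) by simp
    moreover have "rho P v ?E (k v) = (rho P v ?E (k v) \<ominus>\<^bsub>pe ?E\<^esub> rho P ?y ?E (k ?y)) \<oplus>\<^bsub>pe ?E\<^esub> rho P ?y ?E (k ?y)"
      using rk by (simp add: E.minus_eq E.a_assoc E.l_neg)
    ultimately have re: "rho P v ?E (k v) = rho P ?y ?E (k ?y)" using rk(2) E.l_zero by metis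
    have "restrict k ?Y \<in> sections G ?Y P" unfolding v(2) sections_coset_iff[OF v(1)]
      using k(1) vY re unfolding v(2) by simp
    moreover have "n = lb \<alpha> \<odot>\<^bsub>nv ?Y\<^esub> restrict k ?Y"
    proof (rule ext)
      have e: "n \<in> extensional ?Y" using n' by (auto simp: sections_def PiE_def)
      fix v show "n v = (lb \<alpha> \<odot>\<^bsub>nv ?Y\<^esub> restrict k ?Y) v"
      proof (cases "v \<in> ?Y")
        case True then show ?thesis using k(2)[OF True] by simp
      next
        case False then show ?thesis using extensional_arb[OF e False] by simp
      qed
    qed
    ultimately show ?thesis unfolding nv_simps(1) by (intro bexI)
  qed
qed

end


section \<open>Sections of the sheaf on cosets and its projectivity\<close>

context projective_setup begin

lemma sections_NN_iff:
  assumes J: "J \<subseteq> cosets \<Delta> s"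
  shows "m \<in> sections Gs J NN \<longleftrightarrow> m \<in> (\<Pi>\<^sub>E X\<in>J. sections G X P) \<and>
    (\<forall>X\<in>J. \<forall>u\<in>X. \<forall>\<alpha>\<in>PR. cs (rr \<alpha> \<cdot> u) \<in> J \<and> cs (rr \<alpha> \<cdot> u) \<noteq> X \<longrightarrow>
      rho P u (edg u \<alpha>) (m X u) = rho P (rr \<alpha> \<cdot> u) (edg u \<alpha>) (m (cs (rr \<alpha> \<cdot> u)) (rr \<alpha> \<cdot> u)))"
proof -
  have "(\<forall>B. \<forall>X\<in>J. \<forall>Y\<in>J. joins Gs B X Y \<longrightarrow> cr_rho X B (m X) = cr_rho Y B (m Y)) \<longleftrightarrow>
    (\<forall>X\<in>J. \<forall>u\<in>X. \<forall>\<alpha>\<in>PR. cs (rr \<alpha> \<cdot> u) \<in> J \<and> cs (rr \<alpha> \<cdot> u) \<noteq> X \<longrightarrow>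
      rho P u (edg u \<alpha>) (m X u) = rho P (rr \<alpha> \<cdot> u) (edg u \<alpha>) (m (cs (rr \<alpha> \<cdot> u)) (rr \<alpha> \<cdot> u)))" (is "?L = ?R")
  proof
    assume L: ?L
    show ?R
    proof (intro ballI impI, elim conjE)
      fix X u \<alpha> assume X: "X \<in> J" "u \<in> X" "\<alpha> \<in> PR" "cs (rr \<alpha> \<cdot> u) \<in> J" "cs (rr \<alpha> \<cdot> u) \<noteq> X"
      have u: "u \<in> WC" "X = cs u" using X J cosets_W cosets_eq by blast+
      have ne: "cs (rr \<alpha> \<cdot> u) \<noteq> cs u" using X(5) u(2) by simp
      have "joins Gs (cedg u \<alpha>) (cs u) (cs (rr \<alpha> \<cdot> u))" using cedg_edge[OF u(1) X(3) ne] by (simp add: joins_def)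
      then have "cr_rho (cs u) (cedg u \<alpha>) (m (cs u)) = cr_rho (cs (rr \<alpha> \<cdot> u)) (cedg u \<alpha>) (m (cs (rr \<alpha> \<cdot> u)))"
        using L X(1,4) unfolding u(2) by blast
      then show "rho P u (edg u \<alpha>) (m X u) = rho P (rr \<alpha> \<cdot> u) (edg u \<alpha>) (m (cs (rr \<alpha> \<cdot> u)) (rr \<alpha> \<cdot> u))"
        unfolding coset_rho_eq_iff[OF u(1) X(3) ne] using u(2) cs_self by blast
    qed
  next
    assume R: ?R
    show ?L
    proof (intro allI ballI impI)
      fix B X Y assume J2: "X \<in> J" "Y \<in> J" and "joins Gs B X Y"
      then have "fst B = {X, Y} \<and> B \<in> coset_edges \<Delta> s" by (simp add: joins_def)
      from coset_joins_iff[THEN iffD1, OF this]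
      obtain x where x: "x \<in> WC" "snd B \<in> PR" "cs (rr (snd B) \<cdot> x) \<noteq> cs x" "X = cs x" "Y = cs (rr (snd B) \<cdot> x)" "B = cedg x (snd B)"
        by (elim bexE conjE) (rule that; assumption)
      have "cr_rho (cs x) (cedg x (snd B)) (m (cs x)) = cr_rho (cs (rr (snd B) \<cdot> x)) (cedg x (snd B)) (m (cs (rr (snd B) \<cdot> x)))"
        unfolding coset_rho_eq_iff[OF x(1-3)]
      proof
        fix u assume u: "u \<in> cs x"
        show "rho P u (edg u (snd B)) (m (cs x) u) = rho P (rr (snd B) \<cdot> u) (edg u (snd B)) (m (cs (rr (snd B) \<cdot> x)) (rr (snd B) \<cdot> u))"
          using R[rule_format, of "cs x" u "snd B"] u x(1-3) J2 unfolding x(4,5) cs_rr[OF x(2,1) u] by blast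
      qed
      then show "cr_rho X B (m X) = cr_rho Y B (m Y)" using x(4-6) by simp
    qed
  qed
  then show ?thesis unfolding sections_def[of Gs] rho_NN nv_simps mem_Collect_eq by blast
qed

text \<open>An edge of the union lies either inside a coset, where agreement is part of the
  definition of the vertex stalk, or over an edge between cosets, where it is a component of the
  agreement there. Together with \<open>unflatten\<close> this identifies the two kinds of
  sections.\<close>

lemma flatten:
  assumes J: "J \<subseteq> cosets \<Delta> s" and m: "m \<in> sections Gs J NN"
  shows "(\<lambda>u\<in>\<Union>J. m (cs u) u) \<in> sections G (\<Union>J) P"
proof -
  have JW: "\<Union>J \<subseteq> WC" using J cosets_W by blast
  have cJ: "cs u \<in> J" "u \<in> WC" if "u \<in> \<Union>J" for u
    using that J cosets_eq cosets_W by blast+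
  have ms: "X \<in> J \<Longrightarrow> m X \<in> sections G X P" for X using m unfolding sections_NN_iff[OF J] by auto
  show ?thesis unfolding sections_iff[OF JW]
  proof (intro conjI ballI impI)
    show "(\<lambda>u\<in>\<Union>J. m (cs u) u) \<in> (\<Pi>\<^sub>E x\<in>\<Union>J. carrier (pv x))"
    proof (rule restrict_PiE_iff[THEN iffD2], rule ballI)
      fix u assume "u \<in> \<Union>J"
      then show "m (cs u) u \<in> carrier (pv u)" using sections_carrier[OF ms[OF cJ(1)] cs_self] by blast
    qed
    fix x \<alpha> assume x: "x \<in> \<Union>J" and a: "\<alpha> \<in> PR" and y: "rr \<alpha> \<cdot> x \<in> \<Union>J"
    have "rho P x (edg x \<alpha>) (m (cs x) x) = rho P (rr \<alpha> \<cdot> x) (edg x \<alpha>) (m (cs (rr \<alpha> \<cdot> x)) (rr \<alpha> \<cdot> x))"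
    proof (cases "cs (rr \<alpha> \<cdot> x) = cs x")
      case False
      then show ?thesis using m cJ(1)[OF x] cJ(1)[OF y] a cs_self unfolding sections_NN_iff[OF J] by blast
    next
      case True
      have "rr \<alpha> \<cdot> x \<in> cs x" using True cs_self by metis
      then show ?thesis using ms[OF cJ(1)[OF x]] a cs_self
        unfolding True sections_iff[OF coset_WC[OF cosets_cs[OF cJ(2)[OF x]]]] by blast
    qed
    then show "rho P x (edg x \<alpha>) ((\<lambda>u\<in>\<Union>J. m (cs u) u) x) = rho P (rr \<alpha> \<cdot> x) (edg x \<alpha>) ((\<lambda>u\<in>\<Union>J. m (cs u) u) (rr \<alpha> \<cdot> x))"
      using x y by simp
  qed
qed

text \<open>The restriction to each coset is an element of the stalk, and agreement along both
  inducing edges is agreement in the edge stalk of the coset edge.\<close>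

lemma unflatten:
  assumes J: "J \<subseteq> cosets \<Delta> s" and g: "g \<in> sections G (\<Union>J) P"
  shows "(\<lambda>X\<in>J. restrict g X) \<in> sections Gs J NN"
  unfolding sections_NN_iff[OF J]
proof (intro conjI ballI impI)
  have JW: "\<Union>J \<subseteq> WC" using J cosets_W by blast
  show "(\<lambda>X\<in>J. restrict g X) \<in> (\<Pi>\<^sub>E X\<in>J. sections G X P)"
    using sections_restrict[OF g] by (auto simp: Sup_upper)
  fix X u \<alpha> assume X: "X \<in> J" and u: "u \<in> X" and a: "\<alpha> \<in> PR" and Y: "cs (rr \<alpha> \<cdot> u) \<in> J \<and> cs (rr \<alpha> \<cdot> u) \<noteq> X"
  have "u \<in> \<Union>J" "rr \<alpha> \<cdot> u \<in> \<Union>J" using X u Y cs_self by blast+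
  then have "rho P u (edg u \<alpha>) (g u) = rho P (rr \<alpha> \<cdot> u) (edg u \<alpha>) (g (rr \<alpha> \<cdot> u))"
    using g a unfolding sections_iff[OF JW] by blast
  then show "rho P u (edg u \<alpha>) ((\<lambda>X\<in>J. restrict g X) X u) =
      rho P (rr \<alpha> \<cdot> u) (edg u \<alpha>) ((\<lambda>X\<in>J. restrict g X) (cs (rr \<alpha> \<cdot> u)) (rr \<alpha> \<cdot> u))"
    using X u Y by simp
qed

text \<open>A relation x < y between elements of different cosets gives the relation between the
  cosets by definition.\<close>

lemma open_Union:
  assumes "open_verts Gs J" shows "open_verts G (\<Union>J)"
  unfolding open_verts_def
proof (intro conjI ballI impI)
  have J: "J \<subseteq> cosets \<Delta> s" using assms by (simp add: open_verts_def)
  then show "\<Union>J \<subseteq> verts G" using cosets_W by auto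
  fix x y assume x: "x \<in> \<Union>J" and y: "y \<in> verts G" and l: "less G x y"
  have cx: "cs x \<in> J" using x J cosets_eq by blast
  have cy: "cs y \<in> cosets \<Delta> s" using y cosets_cs by simp
  have "cs y \<in> J"
  proof (cases "cs x = cs y")
    case False
    then have "coset_less \<Delta> (cs x) (cs y)" using edge_coset_less l by simp
    then show ?thesis using assms cx cy unfolding open_verts_def by simp
  qed (use cx in simp)
  then show "y \<in> \<Union>J" using cs_self by blast
qed

lemma NN_supp_sub: "msupp Gs NN \<subseteq> cs ` msupp G P"
proof
  fix X assume "X \<in> msupp Gs NN"
  then have X: "X \<in> cosets \<Delta> s" "carrier (nv X) \<noteq> {\<zero>\<^bsub>nv X\<^esub>}" unfolding msupp_def by simp_all
  have "\<exists>u\<in>X. carrier (pv u) \<noteq> {\<zero>\<^bsub>pv u\<^esub>}"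
  proof (rule ccontr)
    assume "\<not> ?thesis"
    then have z: "carrier (pv u) = {\<zero>\<^bsub>pv u\<^esub>}" if "u \<in> X" for u using that by blast
    have "m = \<zero>\<^bsub>nv X\<^esub>" if m: "m \<in> sections G X P" for m
    proof (rule gsum_eqI[where I = X and N = pv])
      show "m \<in> carrier (gsum X pv)" using m by (auto simp: sections_def)
      show "\<zero>\<^bsub>nv X\<^esub> \<in> carrier (gsum X pv)" using z by simp
      show "m u = \<zero>\<^bsub>nv X\<^esub> u" if "u \<in> X" for u using sections_carrier[OF m that] z[OF that] that by simp
    qed
    moreover have "\<zero>\<^bsub>nv X\<^esub> \<in> sections G X P" using zero_section[OF coset_WC[OF X(1)]] by simp
    ultimately have "carrier (nv X) = {\<zero>\<^bsub>nv X\<^esub>}" unfolding nv_simps(1) by blast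
    then show False using X(2) by contradiction
  qed
  then obtain u where u: "u \<in> X" "carrier (pv u) \<noteq> {\<zero>\<^bsub>pv u\<^esub>}" by blast
  then have "u \<in> msupp G P" using cosets_W[OF X(1) u(1)] by (simp add: msupp_def)
  then have "cs u \<in> cs ` msupp G P" by (rule imageI)
  then show "X \<in> cs ` msupp G P" by (rule subst[OF cosets_eq[OF X(1) u(1), symmetric], where P = "\<lambda>Z. Z \<in> cs ` msupp G P"])
qed

lemma NN_supp: "finite (msupp Gs NN)"
  by (rule finite_subset[OF NN_supp_sub finite_imageI[OF finite_supp]])

text \<open>An element of a stalk is a section of P on the coset; extend it by
  \<open>section_extends\<close> and regard the result as a family over all cosets.\<close>

lemma NN_extend: assumes X: "X \<in> cosets \<Delta> s" and p: "p \<in> carrier (nv X)"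
  shows "\<exists>m\<in>sections Gs (cosets \<Delta> s) NN. m X = p"
proof -
  have p': "p \<in> sections G X P" using p by simp
  obtain g where g: "g \<in> sections G WC P" "\<And>u. u \<in> X \<Longrightarrow> g u = p u" using section_extends[OF X p'] by blast
  have "\<Union>(cosets \<Delta> s) \<subseteq> WC" using cosets_W by blast
  from unflatten[OF order_refl sections_restrict[OF g(1) this]]
  have m: "(\<lambda>X\<in>cosets \<Delta> s. restrict (restrict g (\<Union>(cosets \<Delta> s))) X) \<in> sections Gs (cosets \<Delta> s) NN" .
  have e: "p \<in> extensional X" using p' by (auto simp: sections_def PiE_def)
  have "restrict (restrict g (\<Union>(cosets \<Delta> s))) X = p"
    by (rule extensionalityI[OF restrict_extensional e]) (use X g(2) in auto)
  then show ?thesis using m X by (intro bexI[OF _ m]) simp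
qed

text \<open>Flatten, extend with the corresponding property of P over the union, which is open, and
  unflatten.\<close>

lemma NN_restrict_surj:
  assumes I: "open_verts Gs I" and I': "open_verts Gs I'" and sub: "I' \<subseteq> I"
  shows "(\<lambda>m. restrict m I') ` sections Gs I NN = sections Gs I' NN"
proof (intro equalityI subsetI)
  fix m assume "m \<in> (\<lambda>m. restrict m I') ` sections Gs I NN"
  then show "m \<in> sections Gs I' NN" using sections_restrict sub by blast
next
  fix m assume m: "m \<in> sections Gs I' NN"
  have J: "I \<subseteq> cosets \<Delta> s" "I' \<subseteq> cosets \<Delta> s" using I I' by (simp_all add: open_verts_def)
  have "\<Union>I' \<subseteq> \<Union>I" using sub by blast
  from P4b[OF open_Union[OF I] open_Union[OF I'] this] flatten[OF J(2) m]
  obtain g where g: "g \<in> sections G (\<Union>I) P" "restrict g (\<Union>I') = (\<lambda>u\<in>\<Union>I'. m (cs u) u)"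
    by (metis (no_types, lifting) imageE)
  have gm: "g u = m X u" if "X \<in> I'" "u \<in> X" for X u
  proof -
    have "u \<in> \<Union>I'" "X = cs u" using that cosets_eq J(2) by blast+
    then show ?thesis using fun_cong[OF g(2), of u] by simp
  qed
  have mX: "m X \<in> extensional X" if "X \<in> I'" for X
    using m that unfolding sections_NN_iff[OF J(2)] by (auto simp: sections_def PiE_def)
  have "m = restrict (\<lambda>X\<in>I. restrict g X) I'"
  proof (rule extensionalityI[of _ I'])
    show "m \<in> extensional I'" using m unfolding sections_NN_iff[OF J(2)] by (auto simp: PiE_def)
    fix X assume X: "X \<in> I'"
    have "m X = restrict g X" by (rule extensionalityI[OF mX[OF X] restrict_extensional]) (use gm[OF X] in simp)
    then show "m X = restrict (\<lambda>X\<in>I. restrict g X) I' X" using X sub by auto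
  qed (rule restrict_extensional)
  then show "m \<in> (\<lambda>m. restrict m I') ` sections Gs I NN" using unflatten[OF J(1) g(1)] by blast
qed

lemma smult_image_iff: "n \<in> smult_image V (rl \<alpha>) M \<longleftrightarrow> (\<exists>k\<in>carrier M. n = lb \<alpha> \<odot>\<^bsub>M\<^esub> k)"
  unfolding smult_image_def lb_def by blast

theorem NN_projective: "projective_sheaf V Gs NN"
  unfolding projective_sheaf_def
proof (intro conjI allI impI ballI)
  fix B X Y assume "directed_edge Gs B X Y"
  then obtain x \<alpha> where U: "up x \<alpha>" "B = cedg x \<alpha>" "X = cs x" "Y = cs (rr \<alpha> \<cdot> x)" using directed_Gs by blast
  show "rho NN Y B ` carrier (nv Y) = carrier (ne B)" unfolding rho_NN U(2,4) by (rule coset_rho_surj[OF U(1)])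
  have z: "\<zero>\<^bsub>nv (cs (rr \<alpha> \<cdot> x))\<^esub> \<in> carrier (nv (cs (rr \<alpha> \<cdot> x)))"
    using zero_section[OF coset_WC[OF upD(7)[OF U(1)]]] by simp
  have sm: "lb \<alpha> \<odot>\<^bsub>nv (cs (rr \<alpha> \<cdot> x))\<^esub> k \<in> carrier (nv (cs (rr \<alpha> \<cdot> x)))" if "k \<in> carrier (nv (cs (rr \<alpha> \<cdot> x)))" for k
    by (rule module.smult_closed[OF graded_module_module[OF nv_graded[OF upD(7)[OF U(1)]]] lb_PR[OF upD(2)[OF U(1)]] that])
  show "a_kernel (nv Y) (ne B) (rho NN Y B) = smult_image V (label Gs B) (nv Y)"
    unfolding rho_NN U(2,4) Gs_simps snd_cedg
  proof (intro equalityI subsetI)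
    fix n assume "n \<in> a_kernel (nv (cs (rr \<alpha> \<cdot> x))) (ne (cedg x \<alpha>)) (cr_rho (cs (rr \<alpha> \<cdot> x)) (cedg x \<alpha>))"
    then have n: "n \<in> carrier (nv (cs (rr \<alpha> \<cdot> x)))" "cr_rho (cs (rr \<alpha> \<cdot> x)) (cedg x \<alpha>) n = \<zero>\<^bsub>ne (cedg x \<alpha>)\<^esub>"
      unfolding a_kernel_def' by blast+
    show "n \<in> smult_image V (rl \<alpha>) (nv (cs (rr \<alpha> \<cdot> x)))" unfolding smult_image_iff using NN_ker[OF U(1) n(1)] n(2) by blast
  next
    fix n assume "n \<in> smult_image V (rl \<alpha>) (nv (cs (rr \<alpha> \<cdot> x)))"
    then obtain k where k: "k \<in> carrier (nv (cs (rr \<alpha> \<cdot> x)))" "n = lb \<alpha> \<odot>\<^bsub>nv (cs (rr \<alpha> \<cdot> x))\<^esub> k" unfolding smult_image_iff by blast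
    have n: "n \<in> carrier (nv (cs (rr \<alpha> \<cdot> x)))" unfolding k(2) by (rule sm[OF k(1)])
    show "n \<in> a_kernel (nv (cs (rr \<alpha> \<cdot> x))) (ne (cedg x \<alpha>)) (cr_rho (cs (rr \<alpha> \<cdot> x)) (cedg x \<alpha>))"
      unfolding a_kernel_def' using NN_ker[OF U(1) n] k n by blast
  qed
next
  fix I I' assume "open_verts Gs I \<and> open_verts Gs I' \<and> I' \<subseteq> I"
  then show "(\<lambda>m. restrict m I') ` sections Gs I NN = sections Gs I' NN" using NN_restrict_surj by blast
next
  fix X p assume "X \<in> verts Gs" "p \<in> carrier (nv X)"
  then show "\<exists>m\<in>sections Gs (verts Gs) NN. m X = p" using NN_extend[of X p] unfolding Gs_simps by blast
next
  show "is_sheaf V Gs NN" by (rule NN_sheaf)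
  show "finite (msupp Gs NN)" by (rule NN_supp)
  show "graded_free SV (nv X)" if "X \<in> verts Gs" for X using nv_free that unfolding Gs_simps by blast
qed

end


section \<open>The sheaf \<open>theta\<close> and the extension of its sections\<close>

context module begin

lemma add_minus_smult_cancel:
  assumes "x \<in> carrier M" "n \<in> carrier M" "h \<in> carrier R" "f \<in> carrier R"
  shows "(x \<oplus>\<^bsub>M\<^esub> ((\<ominus> h) \<otimes> f) \<odot>\<^bsub>M\<^esub> n) \<oplus>\<^bsub>M\<^esub> (h \<otimes> f) \<odot>\<^bsub>M\<^esub> n = x"
proof -
  have "((\<ominus> h) \<otimes> f) \<odot>\<^bsub>M\<^esub> n = \<ominus>\<^bsub>M\<^esub> ((h \<otimes> f) \<odot>\<^bsub>M\<^esub> n)" using assms by (simp add: R.l_minus smult_l_minus)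
  then show ?thesis using assms by (simp add: M.a_assoc M.l_neg)
qed

text \<open>Both sides are the average of x and y, as h is one half and f n is their
  difference.\<close>

lemma half_difference:
  assumes c: "x \<in> carrier M" "y \<in> carrier M" "n \<in> carrier M" "h \<in> carrier R" "f \<in> carrier R"
    and h: "h \<otimes> (\<one> \<oplus> \<one>) = \<one>" and d: "x \<ominus>\<^bsub>M\<^esub> y = f \<odot>\<^bsub>M\<^esub> n"
  shows "x \<oplus>\<^bsub>M\<^esub> ((\<ominus> h) \<otimes> f) \<odot>\<^bsub>M\<^esub> n = y \<oplus>\<^bsub>M\<^esub> ((\<ominus> h) \<otimes> (\<ominus> f)) \<odot>\<^bsub>M\<^esub> n"
proof -
  let ?e = "(h \<otimes> f) \<odot>\<^bsub>M\<^esub> n"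
  have e: "?e \<in> carrier M" using c by simp
  have "f = h \<otimes> (\<one> \<oplus> \<one>) \<otimes> f" using c unfolding h by simp
  also have "\<dots> = h \<otimes> f \<oplus> h \<otimes> f" using c by (simp add: R.r_distr R.l_distr)
  finally have "f \<odot>\<^bsub>M\<^esub> n = ?e \<oplus>\<^bsub>M\<^esub> ?e" using c smult_l_distr[of "h \<otimes> f" "h \<otimes> f" n] by simp
  moreover have "x = y \<oplus>\<^bsub>M\<^esub> (x \<ominus>\<^bsub>M\<^esub> y)" using c by (simp add: M.minus_eq M.a_lcomm M.r_neg)
  ultimately have x: "x = y \<oplus>\<^bsub>M\<^esub> (?e \<oplus>\<^bsub>M\<^esub> ?e)" using d by simp
  have n: "((\<ominus> h) \<otimes> f) \<odot>\<^bsub>M\<^esub> n = \<ominus>\<^bsub>M\<^esub> ?e" "((\<ominus> h) \<otimes> (\<ominus> f)) \<odot>\<^bsub>M\<^esub> n = ?e"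
    using c by (simp_all add: R.l_minus R.r_minus smult_l_minus)
  show ?thesis unfolding n by (subst x) (use c e in \<open>simp add: M.a_assoc M.r_neg\<close>)
qed

end

context homogeneous_submodule begin

lemma quot_transport_facts:
  assumes h: "inj h"
  shows "carrier (transport_gmodule h (quot_gmodule M K)) = (\<lambda>m. h (K +>\<^bsub>M\<^esub> m)) ` carrier M"
    "x \<in> carrier M \<Longrightarrow> h (K +>\<^bsub>M\<^esub> x) = \<zero>\<^bsub>transport_gmodule h (quot_gmodule M K)\<^esub> \<longleftrightarrow> x \<in> K"
    "x \<in> carrier M \<Longrightarrow> y \<in> carrier M \<Longrightarrow> h (K +>\<^bsub>M\<^esub> x) = h (K +>\<^bsub>M\<^esub> y) \<longleftrightarrow> x \<ominus>\<^bsub>M\<^esub> y \<in> K"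
proof -
  show "carrier (transport_gmodule h (quot_gmodule M K)) = (\<lambda>m. h (K +>\<^bsub>M\<^esub> m)) ` carrier M"
    unfolding transport_simps(1)[OF h] quot_simps(1) A_RCOSETS_def' by blast
  show "x \<in> carrier M \<Longrightarrow> h (K +>\<^bsub>M\<^esub> x) = \<zero>\<^bsub>transport_gmodule h (quot_gmodule M K)\<^esub> \<longleftrightarrow> x \<in> K"
    unfolding transport_simps(2)[OF h] quot_simps(2) inj_eq[OF h] by (rule coset_zero_iff)
  show "x \<in> carrier M \<Longrightarrow> y \<in> carrier M \<Longrightarrow> h (K +>\<^bsub>M\<^esub> x) = h (K +>\<^bsub>M\<^esub> y) \<longleftrightarrow> x \<ominus>\<^bsub>M\<^esub> y \<in> K"
    unfolding inj_eq[OF h] by (rule coset_eq_iff)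
qed

end

context projective_setup begin

declare nv_simps [simp del]

abbreviation TH :: "('v affine_trans, 'v affine_edge, ('v, 'f) weight_sym, 'v affine_trans \<Rightarrow> 'm,
    ('v affine_trans \<Rightarrow> 'm) set + ('v affine_edge \<Rightarrow> 'n)) msheaf"
  where "TH \<equiv> theta \<Delta> s P"
abbreviation Kr :: "'v \<times> int \<Rightarrow> 'v affine_trans set \<Rightarrow> ('v affine_trans \<Rightarrow> 'm) set" where
  "Kr \<alpha> X \<equiv> smult_image V (rl \<alpha>) (nv X)"

lemma sections_carrier_gen: "m \<in> sections H I M \<Longrightarrow> x \<in> I \<Longrightarrow> m x \<in> carrier (vstalk M x)"
  unfolding sections_def by auto

lemma TH_vstalk: "vstalk TH x = nv (cs x)"
  by (simp add: theta_def theta_out_def Let_def)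

lemma edg_in: assumes "x \<in> WC" "\<alpha> \<in> PR" "cs (rr \<alpha> \<cdot> x) = cs x" shows "fst (edg x \<alpha>) = cs x"
  using assms(3) unfolding rr_not_s[OF assms(2,1)] fst_edg by (simp add: cs_def')

lemma TH_in:
  assumes "x \<in> WC" "\<alpha> \<in> PR" "cs (rr \<alpha> \<cdot> x) = cs x"
  shows "estalk TH (edg x \<alpha>) = transport_gmodule Inl (quot_gmodule (nv (cs x)) (Kr \<alpha> (cs x)))"
    "rho TH z (edg x \<alpha>) = (\<lambda>m. Inl (Kr \<alpha> (cs x) +>\<^bsub>nv (cs x)\<^esub> m))"
  using edg_in[OF assms] cosets_cs[OF assms(1)] by (simp_all add: theta_def theta_out_def Let_def del: fst_edg)

lemma TH_out:
  assumes "x \<in> WC" "\<alpha> \<in> PR" "cs (rr \<alpha> \<cdot> x) \<noteq> cs x"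
  shows "estalk TH (edg x \<alpha>) = transport_gmodule Inr (ne (cedg x \<alpha>))"
    "rho TH z (edg x \<alpha>) = (\<lambda>m. Inr (cr_rho (cs z) (cedg x \<alpha>) m))"
proof -
  have "fst (edg x \<alpha>) \<notin> cosets \<Delta> s" using edge_in_coset[OF assms(1,2)] assms(3) by blast
  then show "estalk TH (edg x \<alpha>) = transport_gmodule Inr (ne (cedg x \<alpha>))"
    "rho TH z (edg x \<alpha>) = (\<lambda>m. Inr (cr_rho (cs z) (cedg x \<alpha>) m))"
    by (simp_all add: theta_def theta_out_def Let_def rho_NN del: fst_edg)
qed

lemma nv_module: "X \<in> cosets \<Delta> s \<Longrightarrow> module SV (nv X)"
  by (rule graded_module_module[OF nv_graded])

text \<open>The label is homogeneous of degree 2, so components of a multiple of it are again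
  multiples of it.\<close>

lemma Kr_homogeneous:
  assumes X: "X \<in> cosets \<Delta> s" and a: "\<alpha> \<in> PR"
  shows "homogeneous_submodule SV (nv X) (Kr \<alpha> X)"
proof -
  interpret N: module SV "nv X" by (rule nv_module[OF X])
  note la = lb_PR[OF a]
  show ?thesis
  proof (rule homogeneous_submodule.intro)
    show "graded_module SV (nv X)" by (rule nv_graded[OF X])
    show "rgrade SV i \<subseteq> carrier SV" for i by (rule GB.rg)
    show "submodule (Kr \<alpha> X) SV (nv X)"
    proof (rule N.submoduleI)
      show "Kr \<alpha> X \<subseteq> carrier (nv X)" unfolding smult_image_def lb_def[symmetric] using la by auto
      show "\<zero>\<^bsub>nv X\<^esub> \<in> Kr \<alpha> X" unfolding smult_image_iff using la by (intro bexI[of _ "\<zero>\<^bsub>nv X\<^esub>"]) auto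
    next
      fix m assume "m \<in> Kr \<alpha> X"
      then obtain k where k: "k \<in> carrier (nv X)" "m = lb \<alpha> \<odot>\<^bsub>nv X\<^esub> k" unfolding smult_image_iff by blast
      show "\<ominus>\<^bsub>nv X\<^esub> m \<in> Kr \<alpha> X" unfolding smult_image_iff k(2)
        using la k(1) by (intro bexI[of _ "\<ominus>\<^bsub>nv X\<^esub> k"]) (simp_all add: N.smult_r_minus)
      fix c assume c: "c \<in> carrier SV"
      show "c \<odot>\<^bsub>nv X\<^esub> m \<in> Kr \<alpha> X" unfolding smult_image_iff k(2)
        using la k(1) c N.smult_assoc1[of c "lb \<alpha>" k] N.smult_assoc1[of "lb \<alpha>" c k] GB.R.m_comm[of c "lb \<alpha>"]
        by (intro bexI[of _ "c \<odot>\<^bsub>nv X\<^esub> k"]) simp_all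
    next
      fix m n assume "m \<in> Kr \<alpha> X" "n \<in> Kr \<alpha> X"
      then obtain k l where k: "k \<in> carrier (nv X)" "m = lb \<alpha> \<odot>\<^bsub>nv X\<^esub> k" "l \<in> carrier (nv X)" "n = lb \<alpha> \<odot>\<^bsub>nv X\<^esub> l"
        unfolding smult_image_iff by blast
      show "m \<oplus>\<^bsub>nv X\<^esub> n \<in> Kr \<alpha> X" unfolding smult_image_iff k(2,4)
        using la k(1,3) by (intro bexI[of _ "k \<oplus>\<^bsub>nv X\<^esub> l"]) (simp_all add: N.smult_r_distr)
    qed
    fix m and i :: int assume m: "m \<in> Kr \<alpha> X"
    obtain k where k: "k \<in> carrier (nv X)" "m = lb \<alpha> \<odot>\<^bsub>nv X\<^esub> k"
      using m[unfolded smult_image_iff] by (rule bexE) (rule that; assumption)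
    \<comment> \<open>The component of degree i of the label times k comes from the component of
      degree i - 2 of k.\<close>
    have i: "2 + (i - 2) = i" by simp
    have "gcomp (nv X) m i = lb \<alpha> \<odot>\<^bsub>nv X\<^esub> gcomp (nv X) k (i - 2)"
      unfolding k(2) by (rule gcomp_smult[OF nv_graded[OF X] k(1) lb_grade[OF AR_aw[OF PR_AR[OF a]]] la, of "i - 2", unfolded i])
    then show "gcomp (nv X) m i \<in> Kr \<alpha> X" unfolding smult_image_iff
      by (rule bexI[OF _ gcomp_carrier[OF nv_graded[OF X] k(1)]])
  qed
qed

text \<open>The orientation-free form of the facts about edge stalks, read off from
  \<open>NN_sheaf\<close>: here x may lie in the lower or in the upper coset.\<close>

lemma ne_facts:
  assumes x: "x \<in> WC" and a: "\<alpha> \<in> PR" and ne: "cs (rr \<alpha> \<cdot> x) \<noteq> cs x"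
  shows "graded_module SV (ne (cedg x \<alpha>))" "cr_rho (cs x) (cedg x \<alpha>) \<in> graded_hom SV (nv (cs x)) (ne (cedg x \<alpha>))"
    "cr_rho (cs (rr \<alpha> \<cdot> x)) (cedg x \<alpha>) \<in> graded_hom SV (nv (cs (rr \<alpha> \<cdot> x))) (ne (cedg x \<alpha>))"
    "e \<in> carrier (ne (cedg x \<alpha>)) \<Longrightarrow> lb \<alpha> \<odot>\<^bsub>ne (cedg x \<alpha>)\<^esub> e = \<zero>\<^bsub>ne (cedg x \<alpha>)\<^esub>"
proof -
  have B: "cedg x \<alpha> \<in> edges Gs" using cedg_edge[OF x a ne] unfolding Gs_simps .
  note S = NN_sheaf[unfolded is_sheaf_def]
  note S1 = conjunct1[OF conjunct2[OF S], THEN bspec, OF B] and S2 = conjunct2[OF conjunct2[OF S], THEN bspec, OF B]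
  show "graded_module SV (ne (cedg x \<alpha>))" by (rule conjunct1[OF S1])
  show "e \<in> carrier (ne (cedg x \<alpha>)) \<Longrightarrow> lb \<alpha> \<odot>\<^bsub>ne (cedg x \<alpha>)\<^esub> e = \<zero>\<^bsub>ne (cedg x \<alpha>)\<^esub>"
    using conjunct2[OF S1, THEN bspec, of e] unfolding lb_def Gs_simps snd_cedg .
  show "cr_rho (cs x) (cedg x \<alpha>) \<in> graded_hom SV (nv (cs x)) (ne (cedg x \<alpha>))"
    "cr_rho (cs (rr \<alpha> \<cdot> x)) (cedg x \<alpha>) \<in> graded_hom SV (nv (cs (rr \<alpha> \<cdot> x))) (ne (cedg x \<alpha>))"
    by (rule S2[THEN bspec, unfolded rho_NN], simp)+
qed

lemma TH_sheaf: "is_sheaf V G TH"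
  unfolding is_sheaf_def
proof (intro conjI ballI)
  fix x assume "x \<in> verts G" 
  then show "graded_module SV (vstalk TH x)" unfolding TH_vstalk G_simps by (rule nv_graded[OF cosets_cs])
next
  fix E assume "E \<in> edges G"
  then have "E \<in> affine_edges \<Delta>" by simp
  from affine_edges_iff[THEN iffD1, OF this]
  obtain x \<alpha> where x: "x \<in> WC" and a: "\<alpha> \<in> PR" and E: "E = edg x \<alpha>" by (elim bexE conjE) (rule that; assumption)
  have "graded_module SV (estalk TH E) \<and> (\<forall>e\<in>carrier (estalk TH E). lb \<alpha> \<odot>\<^bsub>estalk TH E\<^esub> e = \<zero>\<^bsub>estalk TH E\<^esub>) \<and>
    (\<forall>z\<in>{x, rr \<alpha> \<cdot> x}. rho TH z E \<in> graded_hom SV (vstalk TH z) (estalk TH E))"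
  proof (cases "cs (rr \<alpha> \<cdot> x) = cs x")
    case True
    interpret H: homogeneous_submodule SV "nv (cs x)" "Kr \<alpha> (cs x)" by (rule Kr_homogeneous[OF cosets_cs[OF x] a])
    note Q = H.quot_transport_graded[OF inj_Inl] H.quot_transport_facts[OF inj_Inl]
    note hQ = graded_homD[OF Q(2)]
    show ?thesis unfolding E TH_in[OF x a True] TH_vstalk
    proof (intro conjI ballI)
      show "graded_module SV (transport_gmodule Inl (quot_gmodule (nv (cs x)) (Kr \<alpha> (cs x))))" by (rule Q(1))
    next
      fix e assume "e \<in> carrier (transport_gmodule Inl (quot_gmodule (nv (cs x)) (Kr \<alpha> (cs x))))"
      then obtain m where m: "m \<in> carrier (nv (cs x))" "e = Inl (Kr \<alpha> (cs x) +>\<^bsub>nv (cs x)\<^esub> m)" unfolding Q(3) by blast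
      have "lb \<alpha> \<odot>\<^bsub>nv (cs x)\<^esub> m \<in> Kr \<alpha> (cs x)" unfolding smult_image_iff using m(1) by blast
      then show "lb \<alpha> \<odot>\<^bsub>transport_gmodule Inl (quot_gmodule (nv (cs x)) (Kr \<alpha> (cs x)))\<^esub> e = \<zero>\<^bsub>transport_gmodule Inl (quot_gmodule (nv (cs x)) (Kr \<alpha> (cs x)))\<^esub>"
        unfolding m(2) hQ(3)[OF lb_PR[OF a] m(1), symmetric] Q(4)[OF H.M.smult_closed[OF lb_PR[OF a] m(1)]] .
    next
      fix z assume "z \<in> {x, rr \<alpha> \<cdot> x}"
      then have z: "cs z = cs x" using True by blast
      show "(\<lambda>m. Inl (Kr \<alpha> (cs x) +>\<^bsub>nv (cs x)\<^esub> m)) \<in> graded_hom SV (nv (cs z)) (transport_gmodule Inl (quot_gmodule (nv (cs x)) (Kr \<alpha> (cs x))))"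
        unfolding z by (rule Q(2))
    qed
  next
    case False
    note N = ne_facts[OF x a False]
    note T = transport_graded[OF N(1) inj_Inr GB.rg]
    show ?thesis unfolding E TH_out[OF x a False] TH_vstalk
    proof (intro conjI ballI)
      show "graded_module SV (transport_gmodule Inr (ne (cedg x \<alpha>)))" by (rule T(1))
    next
      fix e assume "e \<in> carrier (transport_gmodule Inr (ne (cedg x \<alpha>)))"
      then obtain f where f: "f \<in> carrier (ne (cedg x \<alpha>))" "e = Inr f" unfolding transport_simps(1)[OF inj_Inr] by blast
      show "lb \<alpha> \<odot>\<^bsub>transport_gmodule Inr (ne (cedg x \<alpha>))\<^esub> e = \<zero>\<^bsub>transport_gmodule Inr (ne (cedg x \<alpha>))\<^esub>"
        unfolding f(2) transport_simps[OF inj_Inr] N(4)[OF f(1)] ..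
    next
      fix z assume "z \<in> {x, rr \<alpha> \<cdot> x}"
      then have "cr_rho (cs z) (cedg x \<alpha>) \<in> graded_hom SV (nv (cs z)) (ne (cedg x \<alpha>))" using N(2,3) by blast
      from graded_hom_comp[OF this T(2)]
      show "(\<lambda>m. Inr (cr_rho (cs z) (cedg x \<alpha>) m)) \<in> graded_hom SV (nv (cs z)) (transport_gmodule Inr (ne (cedg x \<alpha>)))" .
    qed
  qed
  note R = this
  show "graded_module SV (estalk TH E)" by (rule conjunct1[OF R])
  show "sym_of V (label G E) \<odot>\<^bsub>estalk TH E\<^esub> e = \<zero>\<^bsub>estalk TH E\<^esub>" if "e \<in> carrier (estalk TH E)" for e
    using conjunct1[OF conjunct2[OF R], THEN bspec, OF that] unfolding lb_def G_simps E snd_edg .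
  show "rho TH z E \<in> graded_hom SV (vstalk TH z) (estalk TH E)" if "z \<in> ends G E" for z
    using conjunct2[OF conjunct2[OF R], THEN bspec, of z] that unfolding G_simps E fst_edg .
qed

text \<open>On an inner edge the map is the projection modulo the label, so image and kernel are
  right by construction. On any other edge it is the map of the sheaf on cosets, and
  \<open>NN_ker\<close> applies.\<close>

lemma TH_P3:
  assumes "directed_edge G E x y"
  shows "rho TH y E ` carrier (vstalk TH y) = carrier (estalk TH E)"
    "a_kernel (vstalk TH y) (estalk TH E) (rho TH y E) = smult_image V (label G E) (vstalk TH y)"
proof -
  define \<alpha> where "\<alpha> = snd E"
  note jj = conjunct1[OF assms[unfolded directed_edge_def], unfolded joins_G, folded \<alpha>_def]
  note j = jj[THEN conjunct1] jj[THEN conjunct2, THEN conjunct1] jj[THEN conjunct2, THEN conjunct2, THEN conjunct1]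
    jj[THEN conjunct2, THEN conjunct2, THEN conjunct2]
  note l = conjunct2[OF assms[unfolded directed_edge_def], unfolded G_simps]
  have "rho TH y E ` carrier (vstalk TH y) = carrier (estalk TH E) \<and>
    (\<forall>n\<in>carrier (vstalk TH y). rho TH y E n = \<zero>\<^bsub>estalk TH E\<^esub> \<longleftrightarrow> n \<in> smult_image V (rl \<alpha>) (vstalk TH y))"
  proof (cases "cs y = cs x")
    case True
    have T: "cs (rr \<alpha> \<cdot> x) = cs x" using True j(3) by simp
    interpret H: homogeneous_submodule SV "nv (cs x)" "Kr \<alpha> (cs x)" by (rule Kr_homogeneous[OF cosets_cs[OF j(1)] j(2)])
    note Q = H.quot_transport_facts[OF inj_Inl]
    show ?thesis unfolding TH_vstalk True j(4) TH_in[OF j(1,2) T] Q(1)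
      by (intro conjI ballI Q(2)) simp
  next
    case False
    have "up x \<alpha>" unfolding up_def using edge_coset_less[OF l] False j(1-3) by auto
    note U = this
    note ne = upD(3)[OF U]
    show ?thesis unfolding TH_vstalk j(3,4) TH_out[OF j(1,2) ne] transport_simps[OF inj_Inr] coset_rho_surj[OF U, symmetric] inj_eq[OF inj_Inr] smult_image_iff
      by (intro conjI ballI NN_ker[OF U]) (simp_all add: image_image)
  qed
  note R = this
  show "rho TH y E ` carrier (vstalk TH y) = carrier (estalk TH E)" by (rule conjunct1[OF R])
  have cy: "cs y \<in> cosets \<Delta> s" unfolding j(3) using j(1,2) by (intro cosets_cs) simp
  interpret N: module SV "nv (cs y)" by (rule nv_module[OF cy])
  have sub: "smult_image V (rl \<alpha>) (vstalk TH y) \<subseteq> carrier (vstalk TH y)"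
    unfolding TH_vstalk smult_image_def lb_def[symmetric] using lb_PR[OF j(2)] by auto
  show "a_kernel (vstalk TH y) (estalk TH E) (rho TH y E) = smult_image V (label G E) (vstalk TH y)"
    unfolding a_kernel_def' G_simps \<alpha>_def[symmetric] using conjunct2[OF R] sub by blast
qed

text \<open>The sections constant on cosets: on inner edges both ends carry the same element, and on
  the other edges the agreement is that of the sheaf on cosets.\<close>

lemma pullback_section:
  assumes I: "I \<subseteq> WC" and J: "J \<subseteq> cosets \<Delta> s" and IJ: "\<And>x. x \<in> I \<Longrightarrow> cs x \<in> J" and m: "m \<in> sections Gs J NN"
  shows "(\<lambda>x\<in>I. m (cs x)) \<in> sections G I TH"
  unfolding sections_iff[OF I]
proof (intro conjI ballI impI)
  show "(\<lambda>x\<in>I. m (cs x)) \<in> (\<Pi>\<^sub>E x\<in>I. carrier (vstalk TH x))"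
    unfolding TH_vstalk restrict_PiE_iff using m IJ unfolding sections_def by blast
  fix x \<alpha> assume x: "x \<in> I" and a: "\<alpha> \<in> PR" and y: "rr \<alpha> \<cdot> x \<in> I"
  have xW: "x \<in> WC" using x I by blast
  have "rho TH x (edg x \<alpha>) (m (cs x)) = rho TH (rr \<alpha> \<cdot> x) (edg x \<alpha>) (m (cs (rr \<alpha> \<cdot> x)))"
  proof (cases "cs (rr \<alpha> \<cdot> x) = cs x")
    case True show ?thesis unfolding TH_in[OF xW a True] True ..
  next
    case False
    have "joins Gs (cedg x \<alpha>) (cs x) (cs (rr \<alpha> \<cdot> x))" using cedg_edge[OF xW a False] by (simp add: joins_def)
    then have "rho NN (cs x) (cedg x \<alpha>) (m (cs x)) = rho NN (cs (rr \<alpha> \<cdot> x)) (cedg x \<alpha>) (m (cs (rr \<alpha> \<cdot> x)))"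
      using m IJ[OF x] IJ[OF y] unfolding sections_def by blast
    then show ?thesis unfolding TH_out[OF xW a False] rho_NN by simp
  qed
  then show "rho TH x (edg x \<alpha>) ((\<lambda>x\<in>I. m (cs x)) x) = rho TH (rr \<alpha> \<cdot> x) (edg x \<alpha>) ((\<lambda>x\<in>I. m (cs x)) (rr \<alpha> \<cdot> x))"
    using x y by simp
qed

lemma sections_NN_upI:
  assumes m: "\<And>X. X \<in> J \<Longrightarrow> m X \<in> carrier (nv X)" and e: "m \<in> extensional J"
    and up: "\<And>x \<alpha>. up x \<alpha> \<Longrightarrow> cs x \<in> J \<Longrightarrow> cs (rr \<alpha> \<cdot> x) \<in> J \<Longrightarrow>
      cr_rho (cs x) (cedg x \<alpha>) (m (cs x)) = cr_rho (cs (rr \<alpha> \<cdot> x)) (cedg x \<alpha>) (m (cs (rr \<alpha> \<cdot> x)))"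
  shows "m \<in> sections Gs J NN"
  unfolding sections_def mem_Collect_eq
proof (intro conjI allI ballI impI)
  show "m \<in> (\<Pi>\<^sub>E x\<in>J. carrier (nv x))" using m e unfolding PiE_def Pi_def by blast
  fix B X Y assume X: "X \<in> J" and Y: "Y \<in> J" and j: "joins Gs B X Y"
  have B: "B \<in> coset_edges \<Delta> s" "fst B = {X, Y}" using j by (simp_all add: joins_def)
  obtain x \<alpha> where U: "up x \<alpha>" "B = cedg x \<alpha>" by (rule coset_edge_up[OF B(1)])
  have "{X, Y} = {cs x, cs (rr \<alpha> \<cdot> x)}" using B(2) unfolding U(2) fst_cedg ..
  then have "X = cs x \<and> Y = cs (rr \<alpha> \<cdot> x) \<or> X = cs (rr \<alpha> \<cdot> x) \<and> Y = cs x" by (simp add: doubleton_eq_iff)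
  then show "rho NN X B (m X) = rho NN Y B (m Y)"
  proof (elim disjE conjE)
    assume h: "X = cs x" "Y = cs (rr \<alpha> \<cdot> x)"
    show ?thesis using up[OF U(1)] X Y unfolding h U(2) rho_NN by blast
  next
    assume h: "X = cs (rr \<alpha> \<cdot> x)" "Y = cs x"
    show ?thesis using up[OF U(1)] X Y unfolding h U(2) rho_NN by (simp del: coset_edge_edg)
  qed
qed

text \<open>The edge stalk is the free upper stalk modulo \<alpha>, and \<open>cf x\<close> is, up
  to sign, an inner label that is coprime to \<alpha> by the GKM-property; so it acts injectively.
  In the other case of \<open>gkm_cases\<close> the upper stalk is zero.\<close>

lemma ne_coprime:
  assumes up: "up x \<alpha>" and d: "d \<in> carrier (ne (cedg x \<alpha>))" and z: "cf x \<odot>\<^bsub>ne (cedg x \<alpha>)\<^esub> d = \<zero>\<^bsub>ne (cedg x \<alpha>)\<^esub>"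
  shows "d = \<zero>\<^bsub>ne (cedg x \<alpha>)\<^esub>"
proof -
  note U = upD[OF up]
  let ?Y = "cs (rr \<alpha> \<cdot> x)" and ?B = "cedg x \<alpha>"
  interpret Y: module SV "nv ?Y" by (rule nv_module[OF U(7)])
  interpret E: module SV "ne ?B" by (rule graded_module_module[OF ne_graded(1)[OF up]])
  note r = ne_graded(2)[OF up] and h = graded_homD[OF ne_graded(2)[OF up]]
  have "d \<in> cr_rho ?Y ?B ` carrier (nv ?Y)" using d unfolding coset_rho_surj[OF up] .
  then obtain w where w: "d = cr_rho ?Y ?B w" "w \<in> carrier (nv ?Y)" by (rule imageE)
  note l = lab[OF U(1)]
  have "\<exists>k\<in>carrier (nv ?Y). w = lb \<alpha> \<odot>\<^bsub>nv ?Y\<^esub> k"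
    using gkm_cases[OF up]
  proof
    assume z: "\<forall>v\<in>?Y. carrier (pv v) = {\<zero>\<^bsub>pv v\<^esub>}"
    \<comment> \<open>The stalk has only one element, so w is its own multiple.\<close>
    have "carrier (nv ?Y) \<subseteq> {w}"
    proof
      fix n assume n: "n \<in> carrier (nv ?Y)"
      have s: "n \<in> sections G ?Y P" "w \<in> sections G ?Y P" using n w(2) unfolding nv_simps .
      have "n = w"
      proof (rule gsum_eqI[where I = ?Y and N = pv])
        fix v assume v: "v \<in> ?Y" 
        have "n v = \<zero>\<^bsub>pv v\<^esub>" "w v = \<zero>\<^bsub>pv v\<^esub>"
          using sections_carrier[OF s(1) v] sections_carrier[OF s(2) v] unfolding z[THEN bspec, OF v] singleton_iff .
        then show "n v = w v" by (rule trans[OF _ sym])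
      qed (use s in \<open>simp_all add: sections_def\<close>)
      then show "n \<in> {w}" by simp
    qed
    from subsetD[OF this Y.smult_closed[OF lb_PR[OF U(2)] w(2)]]
    have "lb \<alpha> \<odot>\<^bsub>nv ?Y\<^esub> w = w" by (rule singletonD)
    from this[symmetric] show ?thesis by (rule bexI[OF _ w(2)])
  next
    assume np: "\<forall>u\<in>cs x \<union> ?Y. \<not> proportional V (rl (lab u)) (rl \<alpha>)"
    have "\<not> proportional V (rl (lab x)) (rl \<alpha>)" by (rule np[THEN bspec]) simp
    then have np: "\<not> proportional V (rl \<alpha>) (rl (lab x))" by (rule contrapos_nn) (rule proportional_sym)
    have ll: "lb (lab x) \<in> carrier SV" by (rule lb_PR[OF l(1)])
    have "lb (lab x) \<odot>\<^bsub>ne ?B\<^esub> d = \<zero>\<^bsub>ne ?B\<^esub>"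
      using cf_lab[OF U(1)]
    proof
      assume "cf x = lb (lab x)" then show ?thesis using z by simp
    next
      assume c: "cf x = \<ominus>\<^bsub>SV\<^esub> lb (lab x)"
      have "lb (lab x) = \<ominus>\<^bsub>SV\<^esub> cf x" unfolding c using ll by simp
      then show ?thesis using E.smult_l_minus[OF cf_carrier[OF U(1)] d] z by simp
    qed
    then have "cr_rho ?Y ?B (lb (lab x) \<odot>\<^bsub>nv ?Y\<^esub> w) = \<zero>\<^bsub>ne ?B\<^esub>" unfolding h(3)[OF ll w(2)] w(1) .
    from NN_ker[OF up Y.smult_closed[OF ll w(2)], THEN iffD1, OF this]
    obtain k where k: "k \<in> carrier (nv ?Y)" "lb (lab x) \<odot>\<^bsub>nv ?Y\<^esub> w = lb \<alpha> \<odot>\<^bsub>nv ?Y\<^esub> k" by blast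
    show ?thesis
      by (rule GB.free_coprime[OF nv_free[OF U(7)] nv_graded[OF U(7)] lb_PR[OF U(2)] ll
          lb_coprime[OF PR_AR[OF U(2)] PR_AR[OF l(1)] np] w(2) k])
  qed
  then show ?thesis unfolding w(1) by (rule NN_ker[OF up w(2), THEN iffD2])
qed

lemma TH_edge:
  assumes I: "I \<subseteq> WC" and m: "m \<in> sections G I TH" and up: "up x \<alpha>" and u: "u \<in> cs x" "u \<in> I" "rr \<alpha> \<cdot> u \<in> I"
  shows "cr_rho (cs x) (cedg x \<alpha>) (m u) = cr_rho (cs (rr \<alpha> \<cdot> x)) (cedg x \<alpha>) (m (rr \<alpha> \<cdot> u))"
proof -
  note U = upD[OF up] and U' = upD[OF up_cs[OF up u(1)]]
  have e: "cs u = cs x" "cs (rr \<alpha> \<cdot> u) = cs (rr \<alpha> \<cdot> x)" "cedg u \<alpha> = cedg x \<alpha>"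
    unfolding cedg_def cs_eq[OF U(1) u(1)] cs_rr[OF U(2,1) u(1)] by (rule refl)+
  have "rho TH u (edg u \<alpha>) (m u) = rho TH (rr \<alpha> \<cdot> u) (edg u \<alpha>) (m (rr \<alpha> \<cdot> u))"
    using m u(2,3) U(2) unfolding sections_iff[OF I] by blast
  then show ?thesis unfolding TH_out[OF U'(1-3)] inj_eq[OF inj_Inr] e .
qed

lemma TH_supp: "msupp G TH \<subseteq> msupp G P \<union> (\<lambda>x. x \<cdot> s) ` msupp G P"
proof
  fix x assume "x \<in> msupp G TH"
  then have x: "x \<in> WC" and ne: "carrier (nv (cs x)) \<noteq> {\<zero>\<^bsub>nv (cs x)\<^esub>}" unfolding msupp_def TH_vstalk by simp_all
  have "cs x \<in> msupp Gs NN" using ne cosets_cs[OF x] unfolding msupp_def by simp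
  then have "cs x \<in> cs ` msupp G P" using NN_supp_sub by blast
  then obtain u where u: "cs x = cs u" "u \<in> msupp G P" by (rule imageE)
  have uW: "u \<in> WC" using u(2) unfolding msupp_def by simp
  have "x = u \<or> x = u \<cdot> s" using cs_eq_iff[OF uW x] u(1) by blast
  then show "x \<in> msupp G P \<union> (\<lambda>x. x \<cdot> s) ` msupp G P" using u(2) by blast
qed

text \<open>Agreement on the inner edge says that the difference is a multiple of the inner label.
  Written with the signed label \<open>cf\<close>, one quotient n serves both elements of the coset,
  since the difference and \<open>cf\<close> change sign together.\<close>

lemma TH_difference:
  assumes I: "I \<subseteq> WC" and m: "m \<in> sections G I TH" and X: "X \<in> cosets \<Delta> s" "X \<subseteq> I"
  shows "\<exists>n\<in>carrier (nv X). \<forall>u\<in>X. m u \<ominus>\<^bsub>nv X\<^esub> m (u \<cdot> s) = cf u \<odot>\<^bsub>nv X\<^esub> n"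
proof -
  obtain u where u: "u \<in> X" using cosets_ne[OF X(1)] by blast
  have uW: "u \<in> WC" and Xu: "X = cs u" using cosets_W[OF X(1) u] cosets_eq[OF X(1) u] .
  have us: "u \<cdot> s \<in> X" unfolding Xu by (simp add: cs_def')
  note l = lab[OF uW]
  interpret H: homogeneous_submodule SV "nv X" "Kr (lab u) X" by (rule Kr_homogeneous[OF X(1) l(1)])
  have T: "cs (rr (lab u) \<cdot> u) = cs u" unfolding l(2) by (rule cs_s[OF uW])
  have mc: "m v \<in> carrier (nv X)" if "v \<in> X" for v
    using sections_carrier_gen[OF m subsetD[OF X(2) that]] unfolding TH_vstalk cosets_eq[OF X(1) that, symmetric] .
  have "rho TH u (edg u (lab u)) (m u) = rho TH (u \<cdot> s) (edg u (lab u)) (m (u \<cdot> s))"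
    using m u us X(2) l(1) unfolding sections_iff[OF I] l(2)[symmetric] by blast
  then have "m u \<ominus>\<^bsub>nv X\<^esub> m (u \<cdot> s) \<in> Kr (lab u) X"
    unfolding TH_in[OF uW l(1) T] Xu[symmetric] H.quot_transport_facts(3)[OF inj_Inl mc[OF u] mc[OF us]] .
  then obtain k where k: "k \<in> carrier (nv X)" "m u \<ominus>\<^bsub>nv X\<^esub> m (u \<cdot> s) = lb (lab u) \<odot>\<^bsub>nv X\<^esub> k"
    unfolding smult_image_iff by (rule bexE) (rule that; assumption)
  have ll: "lb (lab u) \<in> carrier SV" by (rule lb_PR[OF l(1)])
  have "\<exists>n\<in>carrier (nv X). m u \<ominus>\<^bsub>nv X\<^esub> m (u \<cdot> s) = cf u \<odot>\<^bsub>nv X\<^esub> n"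
    using cf_lab[OF uW]
  proof
    assume "cf u = lb (lab u)" then show ?thesis unfolding k(2) using k(1) by (intro bexI[of _ k]) simp_all
  next
    assume c: "cf u = \<ominus>\<^bsub>SV\<^esub> lb (lab u)"
    have "cf u \<odot>\<^bsub>nv X\<^esub> (\<ominus>\<^bsub>nv X\<^esub> k) = lb (lab u) \<odot>\<^bsub>nv X\<^esub> k"
      unfolding c using k(1) ll by (simp add: H.M.smult_l_minus H.M.smult_r_minus)
    then show ?thesis unfolding k(2) by (intro bexI[OF _ H.M.a_inv_closed[OF k(1)]]) (rule sym)
  qed
  then obtain n where n: "n \<in> carrier (nv X)" "m u \<ominus>\<^bsub>nv X\<^esub> m (u \<cdot> s) = cf u \<odot>\<^bsub>nv X\<^esub> n" by (rule bexE) (rule that; assumption)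
  have "m (u \<cdot> s) \<ominus>\<^bsub>nv X\<^esub> m u = \<ominus>\<^bsub>nv X\<^esub> (m u \<ominus>\<^bsub>nv X\<^esub> m (u \<cdot> s))"
    using mc[OF u] mc[OF us] by (simp add: H.M.minus_eq H.M.minus_add H.M.a_comm)
  also have "\<dots> = cf (u \<cdot> s) \<odot>\<^bsub>nv X\<^esub> n"
    unfolding n(2) cf_s[OF uW] by (rule H.M.smult_l_minus[OF cf_carrier[OF uW] n(1), symmetric])
  finally have n': "m (u \<cdot> s) \<ominus>\<^bsub>nv X\<^esub> m u = cf (u \<cdot> s) \<odot>\<^bsub>nv X\<^esub> n" .
  show ?thesis
  proof (rule bexI[OF _ n(1)], rule ballI)
    fix v assume "v \<in> X"
    then have "v = u \<or> v = u \<cdot> s" unfolding Xu by (simp add: cs_def')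
    then show "m v \<ominus>\<^bsub>nv X\<^esub> m (v \<cdot> s) = cf v \<odot>\<^bsub>nv X\<^esub> n"
    proof
      assume v: "v = u" show ?thesis unfolding v by (rule n(2))
    next
      assume v: "v = u \<cdot> s" show ?thesis unfolding v xss[OF uW] by (rule n')
    qed
  qed
qed

text \<open>The two differences of m have the same image on the edge, namely c(x) times the image of
  n and c(s_\<alpha> x) times the image of n'. The two values of c agree modulo \<alpha>, which acts
  as 0 there, and c(x) may be cancelled by \<open>ne_coprime\<close>.\<close>

lemma TH_difference_edge:
  assumes I: "I \<subseteq> WC" and m: "m \<in> sections G I TH" and up: "up x \<alpha>" and XI: "cs x \<subseteq> I" "cs (rr \<alpha> \<cdot> x) \<subseteq> I"
    and n: "n \<in> carrier (nv (cs x))" "\<And>u. u \<in> cs x \<Longrightarrow> m u \<ominus>\<^bsub>nv (cs x)\<^esub> m (u \<cdot> s) = cf u \<odot>\<^bsub>nv (cs x)\<^esub> n"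
    and n': "n' \<in> carrier (nv (cs (rr \<alpha> \<cdot> x)))"
      "\<And>u. u \<in> cs (rr \<alpha> \<cdot> x) \<Longrightarrow> m u \<ominus>\<^bsub>nv (cs (rr \<alpha> \<cdot> x))\<^esub> m (u \<cdot> s) = cf u \<odot>\<^bsub>nv (cs (rr \<alpha> \<cdot> x))\<^esub> n'"
  shows "cr_rho (cs x) (cedg x \<alpha>) n = cr_rho (cs (rr \<alpha> \<cdot> x)) (cedg x \<alpha>) n'"
proof -
  note U = upD[OF up]
  let ?X = "cs x" and ?y = "rr \<alpha> \<cdot> x" and ?B = "cedg x \<alpha>"
  let ?Y = "cs ?y"
  let ?r = "cr_rho ?X ?B" and ?t = "cr_rho ?Y ?B"
  interpret X: module SV "nv ?X" by (rule nv_module[OF U(6)])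
  interpret Y: module SV "nv ?Y" by (rule nv_module[OF U(7)])
  interpret E: module SV "ne ?B" by (rule graded_module_module[OF ne_graded(1)[OF up]])
  note r = coset_rho_lower_hom[OF up] and t = ne_graded(2)[OF up]
  note hr = graded_homD[OF r] and ht = graded_homD[OF t]
  have xs: "x \<in> ?X" "x \<cdot> s \<in> ?X" "?y \<in> ?Y" "?y \<cdot> s \<in> ?Y" by (simp_all add: cs_def')
  have mX: "m v \<in> carrier (nv ?X)" if "v \<in> ?X" for v
    using sections_carrier_gen[OF m subsetD[OF XI(1) that]] unfolding TH_vstalk cosets_eq[OF U(6) that, symmetric] .
  have mY: "m v \<in> carrier (nv ?Y)" if "v \<in> ?Y" for v
    using sections_carrier_gen[OF m subsetD[OF XI(2) that]] unfolding TH_vstalk cosets_eq[OF U(7) that, symmetric] .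
  have e1: "?r (m x) = ?t (m ?y)"
    by (rule TH_edge[OF I m up xs(1) subsetD[OF XI(1) xs(1)] subsetD[OF XI(2) xs(3)]])
  have ys: "rr \<alpha> \<cdot> (x \<cdot> s) = ?y \<cdot> s" by (rule rr_s[OF U(2,1)])
  have e2: "?r (m (x \<cdot> s)) = ?t (m (?y \<cdot> s))"
    by (rule TH_edge[OF I m up xs(2) subsetD[OF XI(1) xs(2)], unfolded ys, OF subsetD[OF XI(2) xs(4)]])
  have cx: "cf x \<in> carrier SV" and cy: "cf ?y \<in> carrier SV" using U(1,5) by simp_all
  have rn: "?r n \<in> carrier (ne ?B)" and tn: "?t n' \<in> carrier (ne ?B)" by (rule hr(1)[OF n(1)], rule ht(1)[OF n'(1)])
  have "cf x \<odot>\<^bsub>ne ?B\<^esub> ?r n = ?r (m x \<ominus>\<^bsub>nv ?X\<^esub> m (x \<cdot> s))" unfolding n(2)[OF xs(1)] hr(3)[OF cx n(1)] ..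
  also have "\<dots> = ?t (m ?y) \<ominus>\<^bsub>ne ?B\<^esub> ?t (m (?y \<cdot> s))"
    unfolding graded_hom_minus[OF r X.module_axioms E.module_axioms mX[OF xs(1)] mX[OF xs(2)]] e1 e2 ..
  also have "\<dots> = ?t (cf ?y \<odot>\<^bsub>nv ?Y\<^esub> n')"
    unfolding graded_hom_minus[OF t Y.module_axioms E.module_axioms mY[OF xs(3)] mY[OF xs(4)], symmetric] n'(2)[OF xs(3)] ..
  also have "\<dots> = cf ?y \<odot>\<^bsub>ne ?B\<^esub> ?t n'" by (rule ht(3)[OF cy n'(1)])
  also have "\<dots> = cf x \<odot>\<^bsub>ne ?B\<^esub> ?t n'"
  proof -
    obtain b where b: "b \<in> carrier SV" "cf ?y = cf x \<oplus>\<^bsub>SV\<^esub> b \<otimes>\<^bsub>SV\<^esub> lb \<alpha>"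
      using admissible_cf U(1,2) unfolding admissible_def by blast
    show ?thesis unfolding b(2) by (rule scale_killed[OF E.module_axioms b(1) cx lb_PR[OF U(2)] tn ne_killed[OF up tn]])
  qed
  finally have e: "cf x \<odot>\<^bsub>ne ?B\<^esub> ?r n = cf x \<odot>\<^bsub>ne ?B\<^esub> ?t n'" .
  have d: "?r n \<ominus>\<^bsub>ne ?B\<^esub> ?t n' \<in> carrier (ne ?B)" by (rule E.minus_closed[OF rn tn])
  have "cf x \<odot>\<^bsub>ne ?B\<^esub> (?r n \<ominus>\<^bsub>ne ?B\<^esub> ?t n') = \<zero>\<^bsub>ne ?B\<^esub>"
    using e cx rn tn by (simp add: E.minus_eq E.smult_r_distr E.smult_r_minus E.r_neg)
  then have z: "?r n \<ominus>\<^bsub>ne ?B\<^esub> ?t n' = \<zero>\<^bsub>ne ?B\<^esub>" by (rule ne_coprime[OF up d])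
  have "?r n = (?r n \<ominus>\<^bsub>ne ?B\<^esub> ?t n') \<oplus>\<^bsub>ne ?B\<^esub> ?t n'"
    using rn tn by (simp add: E.minus_eq E.a_assoc E.l_neg)
  then show ?thesis unfolding z E.l_zero[OF tn] .
qed

lemma wle_open:
  assumes "open_verts G I" "x \<in> I" "wle x y" shows "y \<in> I"
  using assms(3) unfolding wle_def
proof
  assume "x = y" then show ?thesis using assms(2) by simp
next
  assume l: "weyl_less \<Delta> x y"
  have "y \<in> verts G" using weyl_less_W[OF l] by simp
  then show ?thesis using assms(1,2) l unfolding open_verts_def by simp
qed

text \<open>Every element of a larger coset lies above some element of the smaller one.\<close>

lemma open_inner: assumes I: "open_verts G I" shows "open_verts Gs {X \<in> cosets \<Delta> s. X \<subseteq> I}"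
  unfolding open_verts_def Gs_simps
proof (intro conjI ballI impI)
  fix X Y assume X: "X \<in> {X \<in> cosets \<Delta> s. X \<subseteq> I}" and Y: "Y \<in> cosets \<Delta> s" and l: "coset_less \<Delta> X Y"
  have X': "X \<in> cosets \<Delta> s" "X \<subseteq> I" using X by blast+
  have "Y \<subseteq> I"
  proof
    fix v assume "v \<in> Y"
    then obtain u where "u \<in> X" "wle u v" using coset_less_wle(2)[OF X'(1) Y l] by blast
    then show "v \<in> I" using wle_open[OF I] X'(2) by blast
  qed
  then show "Y \<in> {X \<in> cosets \<Delta> s. X \<subseteq> I}" using Y by blast
qed blast

text \<open>Every element of a smaller coset lies below some element of the larger one.\<close>

lemma open_outer: assumes I: "open_verts G I" shows "open_verts Gs {X \<in> cosets \<Delta> s. X \<inter> I \<noteq> {}}"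
  unfolding open_verts_def Gs_simps
proof (intro conjI ballI impI)
  fix X Y assume X: "X \<in> {X \<in> cosets \<Delta> s. X \<inter> I \<noteq> {}}" and Y: "Y \<in> cosets \<Delta> s" and l: "coset_less \<Delta> X Y"
  obtain u where u: "X \<in> cosets \<Delta> s" "u \<in> X" "u \<in> I" using X by blast
  then obtain v where "v \<in> Y" "wle u v" using coset_less_wle(1)[OF u(1) Y l] by blast
  then have "v \<in> Y \<inter> I" using wle_open[OF I u(3)] by blast
  then show "Y \<in> {X \<in> cosets \<Delta> s. X \<inter> I \<noteq> {}}" using Y by blast
qed blast

lemma NN_extend_open:
  assumes J: "open_verts Gs J" and m: "m \<in> sections Gs J NN"
  shows "\<exists>g\<in>sections Gs (cosets \<Delta> s) NN. \<forall>X\<in>J. g X = m X"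
proof -
  have all: "open_verts Gs (cosets \<Delta> s)" unfolding open_verts_def Gs_simps by blast
  have sub: "J \<subseteq> cosets \<Delta> s" using J unfolding open_verts_def Gs_simps by blast
  have "m \<in> (\<lambda>g. restrict g J) ` sections Gs (cosets \<Delta> s) NN" using m unfolding NN_restrict_surj[OF all J sub] .
  then obtain g where g: "m = restrict g J" "g \<in> sections Gs (cosets \<Delta> s) NN" by (rule imageE)
  show ?thesis by (rule bexI[OF _ g(2)]) (simp add: g(1))
qed

text \<open>Split m into a part constant on cosets and c times a part constant on cosets, and extend
  both parts with the projectivity of the sheaf on cosets. The second part is determined on cosets
  inside I. Once it has been extended and subtracted, the rest is determined on all cosets that meet
  I.\<close>

lemma TH_extend:
  assumes I: "open_verts G I" and m: "m \<in> sections G I TH"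
  shows "\<exists>g\<in>sections G WC TH. restrict g I = m"
proof -
  have IW: "I \<subseteq> WC" using I unfolding open_verts_def G_simps by blast
  have mc: "m x \<in> carrier (nv (cs x))" if "x \<in> I" for x
    using sections_carrier_gen[OF m that] unfolding TH_vstalk .
  have cW: "cs x \<in> cosets \<Delta> s" if "x \<in> I" for x using cosets_cs IW that by blast
  let ?A = "{X \<in> cosets \<Delta> s. X \<subseteq> I}" and ?B = "{X \<in> cosets \<Delta> s. X \<inter> I \<noteq> {}}"
  \<comment> \<open>The difference quotient of m; it makes sense only on cosets contained in
    I.\<close>
  define n0 where "n0 = (\<lambda>X\<in>?A. SOME n. n \<in> carrier (nv X) \<and> (\<forall>u\<in>X. m u \<ominus>\<^bsub>nv X\<^esub> m (u \<cdot> s) = cf u \<odot>\<^bsub>nv X\<^esub> n))"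
  have n0: "n0 X \<in> carrier (nv X) \<and> (\<forall>u\<in>X. m u \<ominus>\<^bsub>nv X\<^esub> m (u \<cdot> s) = cf u \<odot>\<^bsub>nv X\<^esub> n0 X)" if X: "X \<in> ?A" for X
  proof -
    have ex: "\<exists>n. n \<in> carrier (nv X) \<and> (\<forall>u\<in>X. m u \<ominus>\<^bsub>nv X\<^esub> m (u \<cdot> s) = cf u \<odot>\<^bsub>nv X\<^esub> n)"
      using TH_difference[OF IW m, of X] X unfolding Bex_def by blast
    have e: "n0 X = (SOME n. n \<in> carrier (nv X) \<and> (\<forall>u\<in>X. m u \<ominus>\<^bsub>nv X\<^esub> m (u \<cdot> s) = cf u \<odot>\<^bsub>nv X\<^esub> n))"
      unfolding n0_def by (rule restrict_apply'[OF X])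
    show ?thesis unfolding e by (rule someI_ex[OF ex])
  qed
  have "n0 \<in> sections Gs ?A NN"
  proof (rule sections_NN_upI)
    show "n0 X \<in> carrier (nv X)" if "X \<in> ?A" for X using n0[OF that] by (rule conjunct1)
    show "n0 \<in> extensional ?A" unfolding n0_def by (rule restrict_extensional)
    fix x \<alpha> assume up: "up x \<alpha>" and X: "cs x \<in> ?A" and Y: "cs (rr \<alpha> \<cdot> x) \<in> ?A"
    have sub: "cs x \<subseteq> I" "cs (rr \<alpha> \<cdot> x) \<subseteq> I" using X Y by blast+
    show "cr_rho (cs x) (cedg x \<alpha>) (n0 (cs x)) = cr_rho (cs (rr \<alpha> \<cdot> x)) (cedg x \<alpha>) (n0 (cs (rr \<alpha> \<cdot> x)))"
      by (rule TH_difference_edge[OF IW m up sub conjunct1[OF n0[OF X]] conjunct2[OF n0[OF X], THEN bspec]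
            conjunct1[OF n0[OF Y]] conjunct2[OF n0[OF Y], THEN bspec]])
  qed
  from NN_extend_open[OF open_inner[OF I] this]
  obtain n where n': "n \<in> sections Gs (cosets \<Delta> s) NN" "\<forall>X\<in>?A. n X = n0 X" by (rule bexE) (rule that; assumption)
  note n = n'(1) n'(2)[THEN bspec]
  have nc: "n X \<in> carrier (nv X)" if "X \<in> cosets \<Delta> s" for X
    using sections_carrier_gen[OF n(1) that] .
  \<comment> \<open>The added zero only brings the function into the shape of
    \<open>admissible_affine\<close>; the value is h times \<open>cf x\<close>.\<close>
  define c where "c h x = h \<otimes>\<^bsub>SV\<^esub> (cf x \<oplus>\<^bsub>SV\<^esub> \<zero>\<^bsub>SV\<^esub>)" for h x
  have adm: "admissible (c h)" if "h \<in> carrier SV" for h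
    unfolding c_def by (rule admissible_affine[OF admissible_cf GB.R.zero_closed that])
  have c: "c h x = h \<otimes>\<^bsub>SV\<^esub> cf x" if "x \<in> WC" for h x unfolding c_def using that by simp
  have mh: "\<ominus>\<^bsub>SV\<^esub> hf2 \<in> carrier SV" using hf2(1) by simp
  \<comment> \<open>Here n has been extended beyond the cosets inside I, so half of c n can be
    subtracted everywhere on I.\<close>
  define m' where "m' = (\<lambda>x\<in>I. m x \<oplus>\<^bsub>vstalk TH x\<^esub> (\<lambda>x\<in>I. c (\<ominus>\<^bsub>SV\<^esub> hf2) x \<odot>\<^bsub>vstalk TH x\<^esub> (\<lambda>x\<in>I. n (cs x)) x) x)"
  have m': "m' \<in> sections G I TH" unfolding m'_def
    by (rule sections_add[OF TH_sheaf IW m sections_scale[OF TH_sheaf IW pullback_section[OF IW order_refl cW n(1)] adm[OF mh]]])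
  have m'_val: "m' x = m x \<oplus>\<^bsub>nv (cs x)\<^esub> ((\<ominus>\<^bsub>SV\<^esub> hf2) \<otimes>\<^bsub>SV\<^esub> cf x) \<odot>\<^bsub>nv (cs x)\<^esub> n (cs x)" if "x \<in> I" for x
    unfolding m'_def TH_vstalk using that c[OF subsetD[OF IW that]] by simp
  \<comment> \<open>Where both elements of a coset belong to I, both values are the average of m at
    x and at xs.\<close>
  have inv: "m' (x \<cdot> s) = m' x" if x: "x \<in> I" and xs: "x \<cdot> s \<in> I" for x
  proof -
    have xW: "x \<in> WC" using x IW by blast
    have X: "cs x \<in> ?A" using x xs cosets_cs[OF xW] by (simp add: cs_def')
    interpret N: module SV "nv (cs x)" by (rule nv_module[OF cosets_cs[OF xW]])
    have mxs: "m (x \<cdot> s) \<in> carrier (nv (cs x))" using mc[OF xs] unfolding cs_s[OF xW] .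
    have "m x \<ominus>\<^bsub>nv (cs x)\<^esub> m (x \<cdot> s) = cf x \<odot>\<^bsub>nv (cs x)\<^esub> n (cs x)"
      unfolding n(2)[OF X] by (rule conjunct2[OF n0[OF X], THEN bspec, OF cs_self])
    from N.half_difference[OF mc[OF x] mxs nc[OF cosets_cs[OF xW]] hf2(1) cf_carrier[OF xW] hf2(2) this]
    show ?thesis unfolding m'_val[OF x] m'_val[OF xs] cs_s[OF xW] cf_s[OF xW] by (rule sym)
  qed
  \<comment> \<open>By invariance the chosen element of the coset in I does not affect the value; on
    a coset with only one element in I there is no choice.\<close>
  define a where "a = (\<lambda>X\<in>?B. m' (SOME u. u \<in> X \<inter> I))"
  have a_val: "a X = m' u" if X: "X \<in> ?B" and u: "u \<in> X \<inter> I" for X u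
  proof -
    define v where "v = (SOME u. u \<in> X \<inter> I)"
    have v: "v \<in> X \<inter> I" unfolding v_def by (rule someI[of "\<lambda>u. u \<in> X \<inter> I", OF u])
    have vW: "v \<in> WC" using v IW by blast
    have "X = cs v" using cosets_eq[of X v] X v by blast
    then have "u = v \<or> u = v \<cdot> s" using u by (simp add: cs_def')
    then have "m' u = m' v"
    proof
      assume "u = v" then show ?thesis by simp
    next
      assume uv: "u = v \<cdot> s"
      show ?thesis unfolding uv by (rule inv) (use u v uv in blast)+
    qed
    then show ?thesis unfolding a_def v_def using X by simp
  qed
  have "a \<in> sections Gs ?B NN"
  proof (rule sections_NN_upI)
    fix X assume X: "X \<in> ?B"
    then obtain u where u: "u \<in> X \<inter> I" by blast
    have "X = cs u" using cosets_eq[of X u] X u by blast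
    then show "a X \<in> carrier (nv X)"
      using sections_carrier_gen[OF m', of u] u unfolding a_val[OF X u] TH_vstalk by blast
  next
    show "a \<in> extensional ?B" unfolding a_def by (rule restrict_extensional)
    fix x \<alpha> assume up: "up x \<alpha>" and X: "cs x \<in> ?B" and Y: "cs (rr \<alpha> \<cdot> x) \<in> ?B"
    note U = upD[OF up]
    obtain u where u: "u \<in> cs x" "u \<in> I" using X by blast
    \<comment> \<open>The neighbour lies above u, so openness of I provides an edge inside I over
      every edge between cosets that meet I.\<close>
    have "rr \<alpha> \<cdot> u \<in> I" by (rule wle_open[OF I u(2)]) (simp add: wle_def up_less[OF up_cs[OF up u(1)]])
    then have y: "rr \<alpha> \<cdot> u \<in> cs (rr \<alpha> \<cdot> x) \<inter> I" using rr_in_cs[OF U(2,1) u(1)] by blast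
    have u': "u \<in> cs x \<inter> I" using u by blast
    show "cr_rho (cs x) (cedg x \<alpha>) (a (cs x)) = cr_rho (cs (rr \<alpha> \<cdot> x)) (cedg x \<alpha>) (a (cs (rr \<alpha> \<cdot> x)))"
      unfolding a_val[OF X u'] a_val[OF Y y] by (rule TH_edge[OF IW m' up u IntD2[OF y]])
  qed
  from NN_extend_open[OF open_outer[OF I] this]
  obtain b where b': "b \<in> sections Gs (cosets \<Delta> s) NN" "\<forall>X\<in>?B. b X = a X" by (rule bexE) (rule that; assumption)
  note b = b'(1) b'(2)[THEN bspec]
  \<comment> \<open>The invariant part b plus the half of c n that was subtracted before, now on all
    vertices.\<close>
  define g where "g = (\<lambda>x\<in>WC. (\<lambda>x\<in>WC. b (cs x)) x \<oplus>\<^bsub>vstalk TH x\<^esub> (\<lambda>x\<in>WC. c hf2 x \<odot>\<^bsub>vstalk TH x\<^esub> (\<lambda>x\<in>WC. n (cs x)) x) x)"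
  have g: "g \<in> sections G WC TH" unfolding g_def
    by (rule sections_add[OF TH_sheaf order_refl pullback_section[OF order_refl order_refl cosets_cs b(1)]
          sections_scale[OF TH_sheaf order_refl pullback_section[OF order_refl order_refl cosets_cs n(1)] adm[OF hf2(1)]]])
  have gm: "g x = m x" if x: "x \<in> I" for x
  proof -
    have xW: "x \<in> WC" using x IW by blast
    interpret N: module SV "nv (cs x)" by (rule nv_module[OF cosets_cs[OF xW]])
    have u: "x \<in> cs x \<inter> I" using x by simp
    then have X: "cs x \<in> ?B" using cosets_cs[OF xW] by blast
    have "g x = b (cs x) \<oplus>\<^bsub>nv (cs x)\<^esub> (hf2 \<otimes>\<^bsub>SV\<^esub> cf x) \<odot>\<^bsub>nv (cs x)\<^esub> n (cs x)"
      unfolding g_def TH_vstalk using xW c[OF xW] by simp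
    also have "\<dots> = m x" unfolding b(2)[OF X] a_val[OF X u] m'_val[OF x]
      by (rule N.add_minus_smult_cancel[OF mc[OF x] nc[OF cosets_cs[OF xW]] hf2(1) cf_carrier[OF xW]])
    finally show ?thesis .
  qed
  have "restrict g I = m"
  proof (rule extensionalityI[OF restrict_extensional])
    show "m \<in> extensional I" using m unfolding sections_def by (simp add: PiE_def)
    show "restrict g I x = m x" if "x \<in> I" for x using gm[OF that] that by simp
  qed
  then show ?thesis by (rule bexI[OF _ g])
qed

text \<open>For the restriction property it is enough that sections over an open set extend to all
  vertices: restricting such an extension to I gives the preimage.\<close>

theorem TH_projective: "projective_sheaf V G TH"
  unfolding projective_sheaf_def
proof (intro conjI allI impI ballI)
  show "is_sheaf V G TH" by (rule TH_sheaf)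
  show "finite (msupp G TH)" by (rule finite_subset[OF TH_supp]) (simp add: finite_supp)
  show "graded_free SV (vstalk TH x)" if "x \<in> verts G" for x
    unfolding TH_vstalk using that[unfolded G_simps] by (intro nv_free cosets_cs)
  show "rho TH y E ` carrier (vstalk TH y) = carrier (estalk TH E)"
    "a_kernel (vstalk TH y) (estalk TH E) (rho TH y E) = smult_image V (label G E) (vstalk TH y)"
    if "directed_edge G E x y" for E x y by (rule TH_P3[OF that])+
  show "\<exists>m\<in>sections G (verts G) TH. m x = p" if x: "x \<in> verts G" and p: "p \<in> carrier (vstalk TH x)" for x p
  proof -
    have xW: "x \<in> WC" using x unfolding G_simps .
    from NN_extend[OF cosets_cs[OF xW] p[unfolded TH_vstalk]]
    obtain m where m: "m \<in> sections Gs (cosets \<Delta> s) NN" "m (cs x) = p" by (rule bexE) (rule that; assumption)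
    have "(\<lambda>x\<in>WC. m (cs x)) \<in> sections G WC TH" by (rule pullback_section[OF order_refl order_refl cosets_cs m(1)])
    moreover have "(\<lambda>x\<in>WC. m (cs x)) x = p" using xW m(2) by simp
    ultimately show ?thesis unfolding G_simps by (intro bexI)
  qed
  fix I I' assume h: "open_verts G I \<and> open_verts G I' \<and> I' \<subseteq> I"
  then have o: "open_verts G I" "open_verts G I'" and sub: "I' \<subseteq> I" by blast+
  have IW: "I \<subseteq> WC" using o(1) unfolding open_verts_def G_simps by blast
  show "(\<lambda>m. restrict m I') ` sections G I TH = sections G I' TH"
  proof (intro equalityI subsetI)
    fix m assume "m \<in> (\<lambda>m. restrict m I') ` sections G I TH"
    then obtain g where "m = restrict g I'" "g \<in> sections G I TH" by (rule imageE)
    then show "m \<in> sections G I' TH" using sections_restrict[OF _ sub] by simp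
  next
    fix m assume "m \<in> sections G I' TH"
    from TH_extend[OF o(2) this] obtain g where g: "g \<in> sections G WC TH" "restrict g I' = m" by (rule bexE) (rule that; assumption)
    have "m = restrict (restrict g I) I'" unfolding g(2)[symmetric] restrict_restrict using sub by (simp add: Int_absorb1)
    then show "m \<in> (\<lambda>m. restrict m I') ` sections G I TH" by (rule image_eqI[OF _ sections_restrict[OF g(1) IW]])
  qed
qed

end

theorem theorem3p9p1:
  fixes \<Delta> :: "'v::ab_group_add root_data"
    and s :: "'v affine_trans"
    and P :: "('v affine_trans, 'v affine_edge, ('v, 'f::field) weight_sym, 'm, 'n) msheaf"
  defines "W \<equiv> affine_weyl \<Delta>"
    and "G \<equiv> affine_graph \<Delta> :: ('v affine_trans, 'v affine_edge, ('v, 'f) weight_space) moment_graph"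
    and "Gs \<equiv> coset_graph \<Delta> s ::
      ('v affine_trans set, 'v affine_coset_edge, ('v, 'f) weight_space) moment_graph"
    and "V \<equiv> label_space \<Delta> :: ('f, ('v, 'f) weight_space) module"
  defines "\<Omega> \<equiv> msupp G P \<union> (\<lambda>x. x \<otimes>\<^bsub>W\<^esub> s) ` msupp G P"
  assumes "root_system \<Delta>" and "reduced_roots \<Delta>" and "irreducible_roots \<Delta>"
    and "simple_system \<Delta>"
    and "CHAR('f) \<noteq> 2"
    and "s \<in> simple_refls \<Delta>"
    and "projective_sheaf V G P"
    and "GKM V (full_subgraph G \<Omega>)"
  shows "projective_sheaf V Gs (theta_on \<Delta> s P) \<and>
    projective_sheaf V G (theta \<Delta> s P) \<and>
    msupp G (theta \<Delta> s P) \<subseteq> \<Omega>"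
proof -
  interpret projective_setup \<Delta> s P
    by unfold_locales (use assms in \<open>simp_all add: W_def G_def V_def \<Omega>_def\<close>)
  show ?thesis unfolding G_def Gs_def V_def \<Omega>_def W_def
    by (intro conjI NN_projective TH_projective TH_supp)
qed

end
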